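(* Let $p\in(1,\infty)$. Suppose that $(K,d,\{K_w\}_{w\in T},m)$ satisfies the basic geometric framework, that $m$ is Ahlfors regular with respect to $d$, that $K$ is $p$-conductively homogeneous, and that there exists $C_0\in(0,\infty)$ such that for any $(x,s)\in K\times(0,1]$, $$\inf\bigl\{\mathcal{N}_p(f)^p\bigm| f\in\mathcal{W}^p\cap C(K),\ f|_{B_d(x,s)}=1,\ \operatorname{supp}_K[f]\subseteq B_d(x,2s)\bigr\}\le C_0\,s^{d_{\mathrm f}-d_{\mathrm{w},p}}.$$ Then $s_p=d_{\mathrm{w},p}/p$, $\mathcal{W}^p=\mathrm{KS}^{1,p}$, $\mathcal{W}^p\cap C(K)$ is dense in $\mathcal{W}^p$, and $(\mathrm{WM})_{p,\boldsymbol{k}}$ holds for $\boldsymbol{k}=\boldsymbol{k}^{s_p}$. Moreover, there exists $C\in[1,\infty)$ such that $$C^{-1}\sup_{r>0}J_{p,r}^{\boldsymbol{k}}(f)\le\mathcal{N}_p(f)^p\le C\liminf_{r\downarrow0}J_{p,r}^{\boldsymbol{k}}(f)\quad\text{for any }f\in L^p(K,m).$$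
   Context: Tree. $(T,E_T)$ is a locally finite infinite undirected tree with root $\phi\in T$, every vertex having at least two neighbours. For $w\ne\phi$, $\pi(w)$ is the vertex preceding $w$ on the unique simple path from $\phi$ to $w$; $\pi(\phi)=\phi$. $S(w)=\{v:\pi(v)=w\}\setminus\{w\}$, $S^0(w)=\{w\}$, $S^1=S$, $S^{k+1}(w)=\bigcup_{v\in S(w)}S^k(v)$, $S^k(A)=\bigcup_{w\in A}S^k(w)$. $|w|=\min\{n\ge0:\pi^n(w)=\phi\}$, $T_n=\{w:|w|=n\}$. Partition. $K$ is a compact metrizable space without isolated points. A family $\{K_w\}_{w\in T}$ of non-empty compact subsets is a partition of $K$ parametrized by the tree if $K_\phi=K$; $\#K_w\ge2$ and $K_w=\bigcup_{v\in S(w)}K_v$ for all $w$; and $\bigcap_{n\ge0}K_{\omega_n}$ is a single point whenever $\omega_n\in T_n$ and $\omega_n=\pi(\omega_{n+1})$ for all $n\ge0$. For $A\subseteq T_n$: $E_n^*=\{\{v,w\}:v,w\in T_n,v\ne w,K_v\cap K_w\ne\emptyset\}$, $E_n^*(A)=\{\{v,w\}\in E_n^*:v,w\in A\}$; $d_n$ is the graph distance of $(T_n,E_n^* )$; for $w\in T_n$, $\Gamma_M(w)=\{v\in T_n:d_n(v,w)\le M\}$; $U_M(x;n)=\bigcup_{w\in T_n,x\in K_w}\bigcup_{v\in\Gamma_M(w)}K_v$. The partition is minimal if $K_w\setminus\bigcup_{v\in T_{|w|}\setminus\{w\}}K_v\ne\emptyset$ for all $w$, and uniformly finite if $\sup_w\#\Gamma_1(w)<\infty$.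 $B_d(x,r)=\{y:d(x,y)<r\}$. Basic geometric framework. $K$ is connected, $\{K_w\}_{w\in T}$ is a partition of $K$ parametrized by the tree $(T,E_T)$ with root $\phi$, $d$ is a metric giving the topology of $K$ with $\operatorname{diam}(K,d)=1$, $m$ is a Borel probability measure on $K$, and there are $M_*\in\mathbb{N}$, $r_*\in(0,1)$ such that: (1) each $K_w$ is connected, $\{K_w\}$ is minimal and uniformly finite, and $\#S(w)\ge2$ for all $w\in T$. (2) There are $c_1,\dots,c_5>0$ with: $c_1r_*^{|w|}\le\operatorname{diam}(K_w,d)\le c_2r_*^{|w|}$ for $w\in T$; $B_d(x,c_3r_*^n)\subseteq U_{M_*}(x;n)\subseteq B_d(x,c_4r_*^n)$ for $n\in\mathbb{N}$, $x\in K$; for $n\in\mathbb{N}$, $w\in T_n$ there is $x\in K_w$ with $K_w\supseteq B_d(x,c_5r_*^n)$. (3) There are $m_1\in\mathbb{N}$, $\gamma_1,\gamma\in(0,1)$ with $m(K_w)\ge\gamma m(K_{\pi(w)})$ for $w\in T$ and $m(K_v)\le\gamma_1m(K_w)$ for $w\in T$, $v\in S^{m_1}(w)$; $m$ is volume doubling ($m(B_d(x,2s))\le C_{\mathrm D}m(B_d(x,s))<\infty$ for all $x\in K,s>0$, some constant $C_{\mathrm D}$); and $m(K_w)=\sum_{v\in S(w)}m(K_v)$ for $w\in T$. (4) There is $M_0\ge M_*$ such that for $w\in T$, $k\ge1$, $v\in S^k(w)$ and $v'\in\Gamma_{M_*}(v)\cap S^k(w)$ there are $l\le M_0$ and $(v_0,\dots,v_l)\in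 S^k(w)^{l+1}$ with $v_0=v$, $v_l=v'$ and $\{v_{j-1},v_j\}\in E^*_{|v|}$ for $1\le j\le l$. (5) $\pi(\Gamma_{M_*+1}(w))\subseteq\Gamma_{M_*}(\pi(w))$ for $w\in T$. Ahlfors regular: for some $Q>0$, $C\ge1$, $C^{-1}s^Q\le m(B_d(x,s))\le Cs^Q$ for $x\in K$, $s\in(0,2\operatorname{diam}(K,d))$. $p$-conductive homogeneity. For $A\subseteq T_n$, $f\in\mathbb{R}^A$: $\mathcal{E}_{p,A}^n(f)=\sum_{\{u,v\}\in E_n^*(A)}|f(u)-f(v)|^p$, $\mathcal{E}_p^n=\mathcal{E}_{p,T_n}^n$. For $A_0,A_1\subseteq A$, $\mathrm{cap}_p^n(A_0,A_1;A)=\inf\{\mathcal{E}_{p,A}^n(f):f\in\mathbb{R}^A,f|_{A_i}=i,\ i=0,1\}$. $\mathcal{E}_{M,p,k}=\sup_{w\in T}\mathrm{cap}_p^{|w|+k}(S^k(w),S^k(T_{|w|}\setminus\Gamma_M(w));T_{|w|+k})$. For $f\colon S^k(A)\to\mathbb{R}$ and $w\in A$, $P_{n,k}f(w)=\frac{1}{\sum_{v\in S^k(w)}m(K_v)}\sum_{v\in S^k(w)}f(v)m(K_v)$; $\sigma_{p,k}(A)=\sup_{f\colon S^k(A)\to\mathbb{R}}\mathcal{E}_{p,A}^n(P_{n,k}f)/\mathcal{E}_{p,S^k(A)}^{n+k}(f)$ (with $0/0=0$). A collection $\{G_i\}_{i=1}^k$, $G_i\subseteq T_n$, is a covering of $(A,E_n^*(A))$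 with covering numbers $(N_T,N_E)\in\mathbb{N}^2$ if $A=\bigcup_iG_i$, $\max_{x\in A}\#\{i:x\in G_i\}\le N_T$, and for every $\{u,v\}\in E_n^*(A)$ there are $l\le N_E$ and $w(1),\dots,w(l+1)\in A$ with $w(1)=u$, $w(l+1)=v$, $\{w(i),w(i+1)\}\in\bigcup_jE_n^*(G_j)$ for $1\le i\le l$. A family $\mathscr{J}$ of sets each contained in some $T_n$ is a covering system if for some $(N_T,N_E)$: $\sup_{A\in\mathscr{J}}\#A<\infty$; for all $w\in T$, $k\in\mathbb{N}$ there is a finite $\mathscr{N}\subseteq\{A\in\mathscr{J}:A\subseteq T_{|w|+k}\}$ that is a covering of $(S^k(w),E^*_{|w|+k}(S^k(w)))$ with covering numbers $(N_T,N_E)$; and for all $G\in\mathscr{J}$ with $G\subseteq T_n$ and $k\ge0$ there is a finite $\mathscr{N}\subseteq\{A\in\mathscr{J}:A\subseteq T_{n+k}\}$ that is a covering of $(S^k(G),E^*_{n+k}(S^k(G)))$ with these covering numbers. Put $\sigma_{p,k}^{\mathscr{J}}=\sup_{n\ge0}\max\{\sigma_{p,k}(A):A\in\mathscr{J},A\subseteq T_n\}$. $K$ is $p$-conductively homogeneous if $\sup_{k\ge0}\sigma_{p,k}^{\mathscr{J}}\mathcal{E}_{M_*,p,k}<\infty$ for some covering system $\mathscr{J}$. In that case (a known theorem of Kigami) there is a unique $\sigma_p\in(0,\infty)$ such that for some $c_1',c_2'>0$ and covering system $\mathscr{J}$: $c_1'\sigma_p^{-k}\le\mathcal{E}_{M_*,p,k}\le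 c_2'\sigma_p^{-k}$ and $c_1'\sigma_p^k\le\sigma_{p,k}^{\mathscr{J}}\le c_2'\sigma_p^k$ for all $k\ge0$. Sobolev space. $P_nf(w)=\frac{1}{m(K_w)}\int_{K_w}f\,dm$ for $w\in T_n$; $\mathcal{N}_p(f)=(\sup_{n\ge0}\sigma_p^n\mathcal{E}_p^n(P_nf))^{1/p}$ for $f\in L^p(K,m)$; $\mathcal{W}^p=\{f\in L^p(K,m):\mathcal{N}_p(f)<\infty\}$ with norm $\|f\|_{\mathcal{W}^p}=(\|f\|_{L^p}^p+\mathcal{N}_p(f)^p)^{1/p}$. $d_{\mathrm f}$ is the Hausdorff dimension of $(K,d)$ and $d_{\mathrm{w},p}=d_{\mathrm f}+\log\sigma_p/\log r_*^{-1}$. $\operatorname{supp}_K[f]$ is the closure of $\{f\neq0\}$; continuous functions are identified with their $m$-classes. Korevaar--Schoen space. For $s>0$, $\boldsymbol{k}^s=\{k_r^s\}_{r>0}$, $k_r^s(x,y)=\frac{\mathbf{1}_{B_d(x,r)}(y)}{r^{ps}m(B_d(x,r))}$. For kernels $\boldsymbol{k}=\{k_r\}$, $J_{p,r}^{\boldsymbol{k}}(f)=\int_K\int_K|f(x)-f(y)|^pk_r(x,y)\,m(dy)m(dx)$ and $B_{p,\infty}^{\boldsymbol{k}}=\{f\in L^p(K,m):\sup_{r>0}J_{p,r}^{\boldsymbol{k}}(f)<\infty\}$. $s_p=\sup\{s>0:B_{p,\infty}^{\boldsymbol{k}^s}\text{ contains a non-constant function}\}$, $\mathrm{KS}^{1,p}=B_{p,\infty}^{\boldsymbol{k}^{s_p}}$.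 $(\mathrm{WM})_{p,\boldsymbol{k}}$: there is $C\in[1,\infty)$ with $\sup_{r>0}J_{p,r}^{\boldsymbol{k}}(f)\le C\liminf_{r\downarrow0}J_{p,r}^{\boldsymbol{k}}(f)$ for all $f\in B_{p,\infty}^{\boldsymbol{k}}$. *)

theory Defs
  imports "HOL-Probability.Probability"
begin

text \<open>
  The compact space K is the whole of a type of class metric_space, with d = dist; the vertex
  set T of the tree is the whole of a type. The cell attached to a vertex w is K w. The set N of
  natural numbers does not contain 0, so indices ranging over N are bounded below by 1.
\<close>

text \<open>Only used for positive exponents.\<close>
definition epowr :: "ennreal \<Rightarrow> real \<Rightarrow> ennreal" where
  "epowr x a = (if x = \<top> then \<top> else ennreal (enn2real x powr a))"

text \<open>
  Elements of the Lebesgue space are represented by functions rather than by equivalence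
  classes; all spaces of functions below are closed under almost everywhere equality.
\<close>
definition lp_space :: "'a measure \<Rightarrow> real \<Rightarrow> ('a \<Rightarrow> real) set" where
  "lp_space m p = {f \<in> borel_measurable m. integrable m (\<lambda>x. \<bar>f x\<bar> powr p)}"

definition lp_norm :: "'a measure \<Rightarrow> real \<Rightarrow> ('a \<Rightarrow> real) \<Rightarrow> ennreal" where
  "lp_norm m p f = epowr (\<integral>\<^sup>+x. ennreal (\<bar>f x\<bar> powr p) \<partial>m) (1 / p)"

definition hausdorff_premeasure :: "real \<Rightarrow> real \<Rightarrow> 'a::metric_space set \<Rightarrow> ennreal" where
  "hausdorff_premeasure s \<delta> A =
     (INF U \<in> {U :: nat \<Rightarrow> 'a set. A \<subseteq> (\<Union>i. U i) \<and> (\<forall>i. bounded (U i) \<and> diameter (U i) \<le> \<delta>)}.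
        \<Sum>i. ennreal (diameter (U i) powr s))"

definition hausdorff_measure :: "real \<Rightarrow> 'a::metric_space set \<Rightarrow> ennreal" where
  "hausdorff_measure s A = (SUP \<delta> \<in> {0<..}. hausdorff_premeasure s \<delta> A)"

text \<open>The exponent 0 is left out because 0 powr 0 = 0; this does not affect the infimum.\<close>
definition hausdorff_dim :: "'a::metric_space set \<Rightarrow> ereal" where
  "hausdorff_dim A = (INF s \<in> {s :: real. 0 < s \<and> hausdorff_measure s A = 0}. ereal s)"

definition volume_doubling :: "'a::metric_space measure \<Rightarrow> bool" where
  "volume_doubling m \<longleftrightarrow>
     (\<exists>C>0. \<forall>x. \<forall>s>0. emeasure m (ball x (2 * s)) \<le> ennreal C * emeasure m (ball x s) \<and>
        ennreal C * emeasure m (ball x s) < \<infinity>)"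

definition ahlfors_regular :: "'a::metric_space measure \<Rightarrow> bool" where
  "ahlfors_regular m \<longleftrightarrow>
     (\<exists>Q>0. \<exists>C\<ge>1. \<forall>x. \<forall>s. 0 < s \<and> s < 2 * diameter (UNIV :: 'a set) \<longrightarrow>
        s powr Q / C \<le> measure m (ball x s) \<and> measure m (ball x s) \<le> C * s powr Q)"

definition walk :: "'t set set \<Rightarrow> 't \<Rightarrow> 't \<Rightarrow> 't list \<Rightarrow> bool" where
  "walk E u v xs \<longleftrightarrow> xs \<noteq> [] \<and> hd xs = u \<and> last xs = v \<and> successively (\<lambda>a b. {a, b} \<in> E) xs"

definition simple_path :: "'t set set \<Rightarrow> 't \<Rightarrow> 't \<Rightarrow> 't list \<Rightarrow> bool" where
  "simple_path E u v xs \<longleftrightarrow> walk E u v xs \<and> distinct xs"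

definition graph_dist :: "'t set set \<Rightarrow> 't \<Rightarrow> 't \<Rightarrow> enat" where
  "graph_dist E u v = (INF xs \<in> {xs. walk E u v xs}. enat (length xs - 1))"

definition is_tree :: "'t set set \<Rightarrow> bool" where
  "is_tree E \<longleftrightarrow> (\<forall>e\<in>E. \<exists>u v. u \<noteq> v \<and> e = {u, v}) \<and> (\<forall>u v. \<exists>!xs. simple_path E u v xs)"

definition infinite_tree :: "'t set set \<Rightarrow> bool" where
  "infinite_tree E \<longleftrightarrow> infinite (UNIV :: 't set) \<and> is_tree E \<and>
     (\<forall>w. finite {v. {v, w} \<in> E} \<and> card {v. {v, w} \<in> E} \<ge> 2)"

context
  fixes E :: "'t set set" and root :: 't
begin

definition parent :: "'t \<Rightarrow> 't" where
  "parent w = (if w = root then root else last (butlast (THE xs. simple_path E root w xs)))"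

definition children :: "'t \<Rightarrow> 't set" where
  "children w = {v. parent v = w} - {w}"

primrec desc :: "nat \<Rightarrow> 't \<Rightarrow> 't set" where
  "desc 0 w = {w}"
| "desc (Suc k) w = (\<Union>v\<in>children w. desc k v)"

definition desc_set :: "nat \<Rightarrow> 't set \<Rightarrow> 't set" where
  "desc_set k A = (\<Union>w\<in>A. desc k w)"

definition height :: "'t \<Rightarrow> nat" where
  "height w = (LEAST n. (parent ^^ n) w = root)"

definition level :: "nat \<Rightarrow> 't set" where
  "level n = {w. height w = n}"

end

context
  fixes E :: "'t set set" and root :: 't and K :: "'t \<Rightarrow> 'a::metric_space set"
begin

definition is_partition :: bool where
  "is_partition \<longleftrightarrow>
     compact (UNIV :: 'a set) \<and> (\<forall>x::'a. x islimpt UNIV) \<and>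
     infinite_tree E \<and>
     (\<forall>w. compact (K w) \<and> K w \<noteq> {}) \<and>
     K root = UNIV \<and>
     (\<forall>w. (\<exists>x\<in>K w. \<exists>y\<in>K w. x \<noteq> y) \<and> K w = (\<Union>v\<in>children E root w. K v)) \<and>
     (\<forall>\<omega> :: nat \<Rightarrow> 't.
        (\<forall>n. \<omega> n \<in> level E root n \<and> \<omega> n = parent E root (\<omega> (Suc n))) \<longrightarrow>
        (\<exists>x. (\<Inter>n. K (\<omega> n)) = {x}))"

definition cell_edges :: "nat \<Rightarrow> 't set set" where
  "cell_edges n = {{v, w} |v w. v \<in> level E root n \<and> w \<in> level E root n \<and> v \<noteq> w \<and> K v \<inter> K w \<noteq> {}}"

definition cell_edges_on :: "nat \<Rightarrow> 't set \<Rightarrow> 't set set" where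
  "cell_edges_on n A = {{v, w} |v w. {v, w} \<in> cell_edges n \<and> v \<in> A \<and> w \<in> A}"

definition cell_nbhd :: "nat \<Rightarrow> 't \<Rightarrow> 't set" where
  "cell_nbhd M w =
     {v \<in> level E root (height E root w). graph_dist (cell_edges (height E root w)) v w \<le> enat M}"

definition point_nbhd :: "nat \<Rightarrow> 'a \<Rightarrow> nat \<Rightarrow> 'a set" where
  "point_nbhd M x n = (\<Union>w\<in>{w \<in> level E root n. x \<in> K w}. \<Union>v\<in>cell_nbhd M w. K v)"

definition minimal_partition :: bool where
  "minimal_partition \<longleftrightarrow> (\<forall>w. K w - (\<Union>v\<in>level E root (height E root w) - {w}. K v) \<noteq> {})"

definition uniformly_finite :: bool where
  "uniformly_finite \<longleftrightarrow> (\<exists>N. \<forall>w. finite (cell_nbhd 1 w) \<and> card (cell_nbhd 1 w) \<le> N)"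

definition basic_framework :: "'a measure \<Rightarrow> nat \<Rightarrow> real \<Rightarrow> bool" where
  "basic_framework m Mst rst \<longleftrightarrow>
     connected (UNIV :: 'a set) \<and> is_partition \<and> diameter (UNIV :: 'a set) = 1 \<and>
     prob_space m \<and> sets m = sets borel \<and>
     Mst \<ge> 1 \<and> 0 < rst \<and> rst < 1 \<and>
     (\<forall>w. connected (K w)) \<and> minimal_partition \<and> uniformly_finite \<and>
     (\<forall>w. card (children E root w) \<ge> 2) \<and>
     (\<exists>c1>0. \<exists>c2>0. \<exists>c3>0. \<exists>c4>0. \<exists>c5>0.
        (\<forall>w. c1 * rst ^ height E root w \<le> diameter (K w) \<and>
             diameter (K w) \<le> c2 * rst ^ height E root w) \<and>
        (\<forall>n\<ge>1. \<forall>x. ball x (c3 * rst ^ n) \<subseteq> point_nbhd Mst x n \<and>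
                    point_nbhd Mst x n \<subseteq> ball x (c4 * rst ^ n)) \<and>
        (\<forall>n\<ge>1. \<forall>w\<in>level E root n. \<exists>x\<in>K w. ball x (c5 * rst ^ n) \<subseteq> K w)) \<and>
     (\<exists>m1\<ge>1. \<exists>\<gamma>1 \<gamma> :: real. 0 < \<gamma>1 \<and> \<gamma>1 < 1 \<and> 0 < \<gamma> \<and> \<gamma> < 1 \<and>
        (\<forall>w. measure m (K w) \<ge> \<gamma> * measure m (K (parent E root w))) \<and>
        (\<forall>w. \<forall>v\<in>desc E root m1 w. measure m (K v) \<le> \<gamma>1 * measure m (K w))) \<and>
     volume_doubling m \<and>
     (\<forall>w. measure m (K w) = (\<Sum>v\<in>children E root w. measure m (K v))) \<and>
     (\<exists>M0\<ge>Mst. \<forall>w. \<forall>k\<ge>1. \<forall>v\<in>desc E root k w. \<forall>v'\<in>cell_nbhd Mst v \<inter> desc E root k w.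
        \<exists>xs. walk (cell_edges (height E root v)) v v' xs \<and> set xs \<subseteq> desc E root k w \<and>
             length xs \<le> M0 + 1) \<and>
     (\<forall>w. parent E root ` cell_nbhd (Mst + 1) w \<subseteq> cell_nbhd Mst (parent E root w))"

end

context
  fixes E :: "'t set set" and root :: 't and K :: "'t \<Rightarrow> 'a::metric_space set"
begin

text \<open>Every unordered edge occurs as two ordered pairs, whence the factor 1/2.\<close>
definition energy :: "real \<Rightarrow> nat \<Rightarrow> 't set \<Rightarrow> ('t \<Rightarrow> real) \<Rightarrow> real" where
  "energy p n A f =
     (\<Sum>(u, v)\<in>{(u, v). {u, v} \<in> cell_edges_on E root K n A}. \<bar>f u - f v\<bar> powr p) / 2"

definition capacity :: "real \<Rightarrow> nat \<Rightarrow> 't set \<Rightarrow> 't set \<Rightarrow> 't set \<Rightarrow> ennreal" where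
  "capacity p n A0 A1 A =
     (INF f \<in> {f. (\<forall>w\<in>A0. f w = 0) \<and> (\<forall>w\<in>A1. f w = 1)}. ennreal (energy p n A f))"

definition nbhd_capacity :: "nat \<Rightarrow> real \<Rightarrow> nat \<Rightarrow> ennreal" where
  "nbhd_capacity M p k =
     (SUP w. capacity p (height E root w + k) (desc E root k w)
        (desc_set E root k (level E root (height E root w) - cell_nbhd E root K M w))
        (level E root (height E root w + k)))"

definition is_covering :: "nat \<Rightarrow> 't set \<Rightarrow> nat \<Rightarrow> nat \<Rightarrow> 't set set \<Rightarrow> bool" where
  "is_covering n A NT NE G \<longleftrightarrow>
     finite G \<and> A = \<Union>G \<and>
     (\<forall>x\<in>A. card {B \<in> G. x \<in> B} \<le> NT) \<and>
     (\<forall>u v. {u, v} \<in> cell_edges_on E root K n A \<longrightarrow>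
        (\<exists>xs. walk (\<Union>B\<in>G. cell_edges_on E root K n B) u v xs \<and> set xs \<subseteq> A \<and> length xs \<le> NE + 1))"

definition covering_system :: "'t set set \<Rightarrow> bool" where
  "covering_system J \<longleftrightarrow>
     (\<forall>A\<in>J. \<exists>n. A \<subseteq> level E root n) \<and>
     (\<exists>NT\<ge>1. \<exists>NE\<ge>1.
        (\<exists>N. \<forall>A\<in>J. finite A \<and> card A \<le> N) \<and>
        (\<forall>w. \<forall>k\<ge>1. \<exists>G \<subseteq> {A \<in> J. A \<subseteq> level E root (height E root w + k)}.
           is_covering (height E root w + k) (desc E root k w) NT NE G) \<and>
        (\<forall>B\<in>J. \<forall>n. B \<subseteq> level E root n \<longrightarrow>
           (\<forall>k. \<exists>G \<subseteq> {A \<in> J. A \<subseteq> level E root (n + k)}.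
              is_covering (n + k) (desc_set E root k B) NT NE G)))"

context
  fixes m :: "'a measure"
begin

definition discrete_avg :: "nat \<Rightarrow> ('t \<Rightarrow> real) \<Rightarrow> 't \<Rightarrow> real" where
  "discrete_avg k f w =
     (\<Sum>v\<in>desc E root k w. f v * measure m (K v)) / (\<Sum>v\<in>desc E root k w. measure m (K v))"

text \<open>Division on \<^typ>\<open>ennreal\<close> satisfies 0/0 = 0 and a/0 = \<open>\<infinity>\<close> for a > 0.\<close>
definition poincare_const :: "real \<Rightarrow> nat \<Rightarrow> nat \<Rightarrow> 't set \<Rightarrow> ennreal" where
  "poincare_const p k n A =
     (SUP f. ennreal (energy p n A (discrete_avg k f)) /
        ennreal (energy p (n + k) (desc_set E root k A) f))"

definition system_const :: "'t set set \<Rightarrow> real \<Rightarrow> nat \<Rightarrow> ennreal" where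
  "system_const J p k = (SUP n. SUP A \<in> {A \<in> J. A \<subseteq> level E root n}. poincare_const p k n A)"

definition conductively_homogeneous :: "nat \<Rightarrow> real \<Rightarrow> bool" where
  "conductively_homogeneous Mst p \<longleftrightarrow>
     (\<exists>J. covering_system J \<and> (SUP k. system_const J p k * nbhd_capacity Mst p k) < \<infinity>)"

definition scaling_factor :: "nat \<Rightarrow> real \<Rightarrow> real" where
  "scaling_factor Mst p = (THE \<sigma>. 0 < \<sigma> \<and>
     (\<exists>c1>0. \<exists>c2>0. \<exists>J. covering_system J \<and>
        (\<forall>k. ennreal (c1 / \<sigma> ^ k) \<le> nbhd_capacity Mst p k \<and>
             nbhd_capacity Mst p k \<le> ennreal (c2 / \<sigma> ^ k) \<and>
             ennreal (c1 * \<sigma> ^ k) \<le> system_const J p k \<and>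
             system_const J p k \<le> ennreal (c2 * \<sigma> ^ k))))"

definition cell_avg :: "('a \<Rightarrow> real) \<Rightarrow> 't \<Rightarrow> real" where
  "cell_avg f w = (LINT x:K w|m. f x) / measure m (K w)"

definition sobolev_seminorm :: "nat \<Rightarrow> real \<Rightarrow> ('a \<Rightarrow> real) \<Rightarrow> ennreal" where
  "sobolev_seminorm Mst p f =
     epowr (SUP n. ennreal (scaling_factor Mst p ^ n * energy p n (level E root n) (cell_avg f))) (1 / p)"

definition sobolev_space :: "nat \<Rightarrow> real \<Rightarrow> ('a \<Rightarrow> real) set" where
  "sobolev_space Mst p = {f \<in> lp_space m p. sobolev_seminorm Mst p f < \<infinity>}"

definition sobolev_norm :: "nat \<Rightarrow> real \<Rightarrow> ('a \<Rightarrow> real) \<Rightarrow> ennreal" where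
  "sobolev_norm Mst p f =
     epowr (epowr (lp_norm m p f) p + epowr (sobolev_seminorm Mst p f) p) (1 / p)"

definition walk_dim :: "nat \<Rightarrow> real \<Rightarrow> real \<Rightarrow> real" where
  "walk_dim Mst rst p =
     real_of_ereal (hausdorff_dim (UNIV :: 'a set)) +
       ln (scaling_factor Mst p) / ln (1 / rst)"

end

end

definition ks_kernel :: "'a::metric_space measure \<Rightarrow> real \<Rightarrow> real \<Rightarrow> real \<Rightarrow> 'a \<Rightarrow> 'a \<Rightarrow> real" where
  "ks_kernel m p s r x y = indicator (ball x r) y / (r powr (p * s) * measure m (ball x r))"

definition kernel_energy ::
    "'a measure \<Rightarrow> real \<Rightarrow> (real \<Rightarrow> 'a \<Rightarrow> 'a \<Rightarrow> real) \<Rightarrow> real \<Rightarrow> ('a \<Rightarrow> real) \<Rightarrow> ennreal" where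
  "kernel_energy m p k r f =
     (\<integral>\<^sup>+x. (\<integral>\<^sup>+y. ennreal (\<bar>f x - f y\<bar> powr p * k r x y) \<partial>m) \<partial>m)"

definition besov_space :: "'a measure \<Rightarrow> real \<Rightarrow> (real \<Rightarrow> 'a \<Rightarrow> 'a \<Rightarrow> real) \<Rightarrow> ('a \<Rightarrow> real) set" where
  "besov_space m p k = {f \<in> lp_space m p. (SUP r\<in>{0<..}. kernel_energy m p k r f) < \<infinity>}"

text \<open>Non-constancy refers to classes of functions, so it means not almost everywhere constant.\<close>
definition ks_exponent :: "'a::metric_space measure \<Rightarrow> real \<Rightarrow> ereal" where
  "ks_exponent m p =
     (SUP s \<in> {s :: real. 0 < s \<and>
        (\<exists>f \<in> besov_space m p (ks_kernel m p s). \<not> (\<exists>c. AE x in m. f x = c))}. ereal s)"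

definition critical_kernel :: "'a::metric_space measure \<Rightarrow> real \<Rightarrow> real \<Rightarrow> 'a \<Rightarrow> 'a \<Rightarrow> real" where
  "critical_kernel m p = ks_kernel m p (real_of_ereal (ks_exponent m p))"

definition ks_space :: "'a::metric_space measure \<Rightarrow> real \<Rightarrow> ('a \<Rightarrow> real) set" where
  "ks_space m p = besov_space m p (critical_kernel m p)"

definition weak_monotonicity :: "'a measure \<Rightarrow> real \<Rightarrow> (real \<Rightarrow> 'a \<Rightarrow> 'a \<Rightarrow> real) \<Rightarrow> bool" where
  "weak_monotonicity m p k \<longleftrightarrow>
     (\<exists>C::real. C \<ge> 1 \<and> (\<forall>f\<in>besov_space m p k.
        (SUP r\<in>{0<..}. kernel_energy m p k r f) \<le>
          ennreal C * Liminf (at_right 0) (\<lambda>r. kernel_energy m p k r f)))"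

end

theory Submission
  imports Defs
begin

text \<open>
  Write \<sigma> for the scaling factor, \<theta> for the number rst powr Q, where Q is the
  exponent of Ahlfors regularity, E_n(u) for the energy of a function u on the n-th level of
  cells, and P_n f for the cell averages of f. Covering the space by cells, and the mass
  distribution principle, identify Q with the Hausdorff dimension, so the walk dimension dw
  satisfies rst powr dw = \<theta> / \<sigma>. Everything then comes down to comparing the
  renormalized discrete energies \<sigma>^n E_n(P_n f) with the integrals J_r(f) of |f x - f y|^p
  over pairs of points at distance less than r, normalized with the exponent dw / p, when r is
  comparable to rst^n.

  That \<sigma> exists at all is \<open>scaling_exists\<close>. Let s_k be the Poincare constants
  of a covering system and e_k the capacities. Coverings give s_(k+l) \<le> C s_k s_l. Gluing test
  functions with the partition of unity made of capacity functions gives e_(j+k+l) \<le> C e_k e_l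
  for a fixed j (\<open>cap_submultiplicative\<close>); here the condition that parents of
  (M+1)-neighbours are M-neighbours absorbs the growth of neighbourhoods. The products s_k e_k are
  bounded above by hypothesis, and below because averages of a test function still separate two
  distant vertices (\<open>cap_system_lower\<close>). So the second inequality turns into the
  reverse of the first, and ln s_k is additive in k up to a bounded error, therefore linear up to
  a bounded error. Its slope is ln \<sigma>.

  Lower bound for J (\<open>Np_le_Liminf\<close>). The Poincare constants give \<sigma>^n E_n(P_n
  f) \<le> C \<sigma>^(n+k) E_(n+k)(P_(n+k) f) for all k (\<open>weak_monotone_energy\<close>),
  while Jensen's inequality applied to pairs of touching cells bounds \<sigma>^n E_n(P_n f) by C
  J_r(f) for r comparable to rst^n. Hence every renormalized energy, and with them the p-th power
  N(f) of the Sobolev seminorm, is at most C liminf J_r(f) as r tends to 0.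

  Upper bound for J (\<open>kernel_le_Np\<close>). The function f is the limit of its step
  functions, with value P_n f on the cells of level n, and consecutive step functions differ by
  increments of E_(n+1). Summing these gives the p-th power of the L^p distance from f to its n-th
  step function the bound C rst^(n dw) N(f) (\<open>step_approx\<close>), provided dw > 0. Two
  points at distance less than a multiple of rst^n lie in cells joined by a short chain, so J_r(f)
  \<le> C N(f) for all r. The positivity of dw is a consequence of the lower bound: for an
  exponent s > dw / p, a function with bounded Korevaar-Schoen energies has vanishing discrete
  energies and is constant, and distance functions have bounded energies for the exponent 1, so dw
  / p \<ge> 1.

  These two bounds give the equality of the two spaces, the comparison of the seminorms and the
  weak monotonicity. The critical exponent is dw / p, because the exponents above it admit only
  constants while a cutoff function is a nonconstant function of finite energy at dw / p.

  Density (\<open>density\<close>). Cutoff functions attached to the cells of level n form, after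
  normalization, a continuous partition of unity. Averaging P_n f against it produces continuous
  functions that converge to f in L^p and have energies bounded by C N(f)
  (\<open>smoothing\<close>). Strong convergence is obtained by passing to iterated midpoints of
  these functions: by uniform convexity of t^p, midpoints that nearly minimize the energy are
  close to each other in energy, and lower semicontinuity of the energy under L^p convergence
  carries this closeness over to f.
\<close>

section \<open>Elementary inequalities\<close>

text \<open>
  Each x with positive g x is charged to one related y that dominates it; every y is charged by at
  most k of the x. This is the way overlaps of neighbourhoods are counted below.
\<close>

lemma sum_le_fibres:
  fixes g :: "'x \<Rightarrow> real" and h :: "'y \<Rightarrow> real" and k :: nat
  assumes "finite X" "finite Y"
    and dom: "\<And>x. x \<in> X \<Longrightarrow> 0 < g x \<Longrightarrow> \<exists>y\<in>Y. rel x y \<and> g x \<le> c * h y"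
    and card: "\<And>y. y \<in> Y \<Longrightarrow> card {x \<in> X. rel x y} \<le> k"
    and nn: "\<And>y. y \<in> Y \<Longrightarrow> 0 \<le> h y" "0 \<le> c"
  shows "sum g X \<le> real k * c * sum h Y"
proof -
  have "sum g X \<le> (\<Sum>x\<in>X. \<Sum>y\<in>{y \<in> Y. rel x y}. c * h y)"
  proof (rule sum_mono)
    fix x assume x: "x \<in> X"
    have nn': "0 \<le> (\<Sum>y\<in>{y \<in> Y. rel x y}. c * h y)"
      by (rule sum_nonneg) (use nn in auto)
    show "g x \<le> (\<Sum>y\<in>{y \<in> Y. rel x y}. c * h y)"
    proof (cases "0 < g x")
      case True
      then obtain y where y: "y \<in> Y" "rel x y" "g x \<le> c * h y" using dom x by blast
      have "c * h y \<le> (\<Sum>y\<in>{y \<in> Y. rel x y}. c * h y)"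
        by (rule member_le_sum) (use y nn \<open>finite Y\<close> in auto)
      with y show ?thesis by linarith
    qed (use nn' in linarith)
  qed
  also have "\<dots> = (\<Sum>y\<in>Y. \<Sum>x\<in>{x \<in> X. rel x y}. c * h y)"
    by (rule sum.swap_restrict) fact+
  also have "\<dots> \<le> (\<Sum>y\<in>Y. real k * (c * h y))"
    unfolding sum_constant
    by (intro sum_mono mult_right_mono) (use card nn in auto)
  also have "\<dots> = real k * c * sum h Y"
    by (simp add: sum_distrib_left mult.assoc)
  finally show ?thesis .
qed

text \<open>
  Of i increments adding up to f u - f v, one carries at least the share 1/i. The index j records
  how far from u that step lies, so that steps can be traced back to the endpoints that use them.
\<close>

lemma relpow_large_step:
  fixes f :: "'x \<Rightarrow> real"
  assumes "(u, v) \<in> S ^^ i" "f u \<noteq> f v"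
  shows "\<exists>a b j. j < i \<and> (u, a) \<in> S ^^ j \<and> (a, b) \<in> S \<and> \<bar>f u - f v\<bar> \<le> real i * \<bar>f a - f b\<bar>"
  using assms
proof (induction i arbitrary: v)
  case 0
  then show ?case by simp
next
  case (Suc i)
  then obtain w where w: "(u, w) \<in> S ^^ i" "(w, v) \<in> S" by auto
  show ?case
  proof (cases "\<bar>f u - f v\<bar> \<le> real (Suc i) * \<bar>f w - f v\<bar>")
    case True
    then show ?thesis using w by blast
  next
    case False
    have tri: "\<bar>f u - f v\<bar> \<le> \<bar>f u - f w\<bar> + \<bar>f w - f v\<bar>" by linarith
    have "f u \<noteq> f w"
    proof
      assume "f u = f w"
      have "1 * \<bar>f w - f v\<bar> \<le> real (Suc i) * \<bar>f w - f v\<bar>" by (intro mult_right_mono) auto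
      with False \<open>f u = f w\<close> show False by simp
    qed
    from Suc.IH[OF w(1) this] obtain a b j where ab: "j < i" "(u, a) \<in> S ^^ j" "(a, b) \<in> S"
      "\<bar>f u - f w\<bar> \<le> real i * \<bar>f a - f b\<bar>" by blast
    then have i0: "0 < real i" by simp
    have "real i * \<bar>f u - f v\<bar> \<le> real (Suc i) * \<bar>f u - f w\<bar>"
      using False mult_left_mono[OF tri, of "real (Suc i)"] by (simp add: algebra_simps)
    also have "\<dots> \<le> real i * (real (Suc i) * \<bar>f a - f b\<bar>)"
      using mult_left_mono[OF ab(4), of "real (Suc i)"] by (simp add: algebra_simps)
    finally have "\<bar>f u - f v\<bar> \<le> real (Suc i) * \<bar>f a - f b\<bar>"
      using i0 by (metis mult_le_cancel_left_pos)
    with ab show ?thesis by (meson less_SucI)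
  qed
qed

text \<open>
  The sum is at most n times its largest term. The factor is not the best one, but it serves all p
  > 0 and all index sets of at most n elements.
\<close>

lemma powr_sum_le:
  fixes x :: "'i \<Rightarrow> real"
  assumes "finite I" "card I \<le> n" "0 < p" "\<And>i. i \<in> I \<Longrightarrow> 0 \<le> x i"
  shows "(\<Sum>i\<in>I. x i) powr p \<le> real n powr p * (\<Sum>i\<in>I. x i powr p)"
proof (cases "I = {}")
  case False
  define M where "M = Max (x ` I)"
  have M: "M \<in> x ` I" unfolding M_def using assms False by (intro Max_in) auto
  then obtain i0 where i0: "i0 \<in> I" "M = x i0" by auto
  have le: "x i \<le> M" if "i \<in> I" for i unfolding M_def using that assms by simp
  have M0: "0 \<le> M" using i0 assms by simp
  have "(\<Sum>i\<in>I. x i) \<le> real (card I) * M"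
    using sum_bounded_above[of I x M] le by simp
  also have "\<dots> \<le> real n * M" using assms M0 by (intro mult_right_mono) auto
  finally have "(\<Sum>i\<in>I. x i) powr p \<le> (real n * M) powr p"
    using assms by (intro powr_mono2) (auto intro: sum_nonneg)
  also have "\<dots> = real n powr p * M powr p" using M0 by (simp add: powr_mult)
  also have "\<dots> \<le> real n powr p * (\<Sum>i\<in>I. x i powr p)"
    using member_le_sum[of i0 I "\<lambda>i. x i powr p"] i0 assms by (intro mult_left_mono) auto
  finally show ?thesis .
qed (use assms in auto)

lemma powr_add_le:
  fixes a b p :: real
  assumes "0 < p" "0 \<le> a" "0 \<le> b"
  shows "(a + b) powr p \<le> 2 powr p * (a powr p + b powr p)"
  using powr_sum_le[of "UNIV :: bool set" 2 p "\<lambda>i. if i then a else b"] assms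
  by (simp add: UNIV_bool algebra_simps)

lemma powr_add3_le:
  fixes a b c p :: real
  assumes "0 < p" "0 \<le> a" "0 \<le> b" "0 \<le> c"
  shows "(a + b + c) powr p \<le> 3 powr p * (a powr p + b powr p + c powr p)"
proof -
  have "(\<Sum>i<3. [a, b, c] ! i) powr p \<le> real 3 powr p * (\<Sum>i<3. ([a, b, c] ! i) powr p)"
    using assms by (intro powr_sum_le) (auto simp: less_Suc_eq numeral_3_eq_3)
  then show ?thesis by (simp add: numeral_3_eq_3 algebra_simps)
qed

text \<open>
  Comparing x (k l) computed as l copies of k and as k copies of l shows that every quotient (x k
  - B) / k lies below every (x l + B) / l; any number between the two families is a slope, for
  instance the supremum of the lower one.
\<close>

lemma quasi_additive_linear:
  fixes x :: "nat \<Rightarrow> real"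
  assumes B: "\<And>k l. \<bar>x (k + l) - x k - x l\<bar> \<le> B"
  shows "\<exists>a. \<forall>k. \<bar>x k - real k * a\<bar> \<le> B"
proof -
  have B0: "\<bar>x 0\<bar> \<le> B" using B[of 0 0] by simp
  have mult: "\<bar>x (Suc n * k) - real (Suc n) * x k\<bar> \<le> real n * B" for n k
  proof (induction n)
    case (Suc n)
    have "x (Suc (Suc n) * k) = x (Suc n * k + k)" by (simp add: algebra_simps)
    then show ?case using Suc B[of "Suc n * k" k] by (simp add: algebra_simps)
  qed simp
  have cross: "(x k - B) / real k \<le> (x l + B) / real l" if "1 \<le> k" "1 \<le> l" for k l
  proof -
    obtain k' where k': "k = Suc k'" using \<open>1 \<le> k\<close> by (cases k) auto
    obtain l' where l': "l = Suc l'" using \<open>1 \<le> l\<close> by (cases l) auto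
    note kl = k' l'
    have BB: "0 \<le> B" using B0 by linarith
    have "real l * x k - real l * B \<le> x (l * k)"
      using mult[of l' k] BB unfolding kl by (simp add: algebra_simps)
    moreover have "x (k * l) \<le> real k * x l + real k * B"
      using mult[of k' l] BB unfolding kl by (simp add: algebra_simps)
    ultimately have "real l * (x k - B) \<le> real k * (x l + B)"
      by (simp add: algebra_simps)
    then show ?thesis using that by (simp add: field_simps)
  qed
  define a where "a = (SUP k\<in>{1..}. (x k - B) / real k)"
  have "\<bar>x k - real k * a\<bar> \<le> B" for k
  proof (cases "k = 0")
    case False
    then have k: "1 \<le> k" by simp
    have "(x k - B) / real k \<le> a"
      unfolding a_def
    proof (rule cSUP_upper)
      show "bdd_above ((\<lambda>k. (x k - B) / real k) ` {1..})"
        using cross[of _ 1] by (intro bdd_aboveI2[of _ _ "(x 1 + B) / real 1"]) auto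
    qed (use k in simp)
    moreover have "a \<le> (x k + B) / real k"
      unfolding a_def by (rule cSUP_least) (use k cross in auto)
    ultimately show ?thesis using k by (simp add: field_simps abs_le_iff)
  qed (use B0 in simp)
  then show ?thesis by blast
qed

text \<open>
  The mean value theorem on the two halves of the interval from s to t, together with the strict
  monotonicity of the derivative, makes the second increment the larger one.
\<close>

lemma powr_midpoint_less:
  fixes s t p :: real
  assumes "1 < p" "0 \<le> s" "s < t"
  shows "((s + t) / 2) powr p < (s powr p + t powr p) / 2"
proof -
  define c where "c = (s + t) / 2"
  have c: "s < c" "c < t" "0 < c" using assms by (auto simp: c_def)
  have cont: "continuous_on A (\<lambda>x. x powr p)" if "A \<subseteq> {0..}" for A :: "real set"
    using that assms by (intro continuous_on_powr') (auto intro: continuous_intros)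
  have d: "((\<lambda>x. x powr p) has_real_derivative p * x powr (p - 1)) (at x)" if "0 < x" for x
    using that by (auto intro!: derivative_eq_intros)
  have mvt: "\<exists>z. a < z \<and> z < b \<and> b powr p - a powr p = (b - a) * (p * z powr (p - 1))"
    if ab: "0 \<le> a" "a < b" for a b
  proof -
    have "\<exists>l z. a < z \<and> z < b \<and> ((\<lambda>x. x powr p) has_real_derivative l) (at z)
        \<and> b powr p - a powr p = (b - a) * l"
    proof (rule MVT[OF ab(2)])
      show "continuous_on {a..b} (\<lambda>x. x powr p)" by (rule cont) (use ab in auto)
      show "(\<lambda>x. x powr p) differentiable at x" if "a < x" "x < b" for x
        using d[of x] that ab by (auto simp: real_differentiable_def)
    qed
    then obtain l z where lz: "a < z" "z < b" "((\<lambda>x. x powr p) has_real_derivative l) (at z)"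
      "b powr p - a powr p = (b - a) * l" by blast
    have "l = p * z powr (p - 1)" by (rule DERIV_unique[OF lz(3) d]) (use lz ab in auto)
    with lz show ?thesis by blast
  qed
  obtain y z where y: "s < y" "y < c" "c powr p - s powr p = (c - s) * (p * y powr (p - 1))"
    and z: "c < z" "z < t" "t powr p - c powr p = (t - c) * (p * z powr (p - 1))"
    using mvt[of s c] mvt[of c t] c assms by auto
  have "y powr (p - 1) < z powr (p - 1)"
    using y z assms c by (intro powr_less_mono2) auto
  moreover have "t - c = c - s" by (simp add: c_def field_simps)
  moreover have "0 < c - s" "0 < p" using c assms by auto
  ultimately have "c powr p - s powr p < t powr p - c powr p"
    using y z by simp
  then show ?thesis unfolding c_def by (simp add: field_simps)
qed

lemma powr_abs_midpoint_less:
  fixes a b p :: real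
  assumes "1 < p" "a \<noteq> b"
  shows "\<bar>(a + b) / 2\<bar> powr p < (\<bar>a\<bar> powr p + \<bar>b\<bar> powr p) / 2"
proof (cases "\<bar>a\<bar> = \<bar>b\<bar>")
  case True
  with assms(2) have "b = - a" "a \<noteq> 0" by (auto simp: abs_eq_iff)
  then show ?thesis by simp
next
  case False
  have "\<bar>(a + b) / 2\<bar> powr p \<le> ((\<bar>a\<bar> + \<bar>b\<bar>) / 2) powr p"
    using assms by (intro powr_mono2) (auto simp: divide_simps)
  also have "\<dots> < (\<bar>a\<bar> powr p + \<bar>b\<bar> powr p) / 2"
  proof (cases "\<bar>a\<bar> < \<bar>b\<bar>")
    case True
    then show ?thesis using powr_midpoint_less[of p "\<bar>a\<bar>" "\<bar>b\<bar>"] assms by simp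
  next
    case False2: False
    then show ?thesis using powr_midpoint_less[of p "\<bar>b\<bar>" "\<bar>a\<bar>"] assms False
      by (simp add: add.commute)
  qed
  finally show ?thesis .
qed

text \<open>
  A single inequality expressing uniform convexity for all p > 1, in place of the two Clarkson
  inequalities. Both sides are homogeneous of degree p, so it suffices to look at max |a| |b| = 1.
  There, either |a - b|^p < \<epsilon>, and the first term suffices, or (a, b) lies in a compact
  set on which the midpoint defect is continuous and positive by strict convexity, and the second
  term does.
\<close>

lemma powr_uniformly_convex:
  fixes p \<epsilon> :: real
  assumes p: "1 < p" and "0 < \<epsilon>"
  shows "\<exists>C\<ge>0. \<forall>a b. \<bar>a - b\<bar> powr p \<le> \<epsilon> * (\<bar>a\<bar> powr p + \<bar>b\<bar> powr p)
           + C * ((\<bar>a\<bar> powr p + \<bar>b\<bar> powr p) / 2 - \<bar>(a + b) / 2\<bar> powr p)"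
proof -
  define D where "D = (\<lambda>(a::real, b::real). (\<bar>a\<bar> powr p + \<bar>b\<bar> powr p) / 2 - \<bar>(a + b) / 2\<bar> powr p)"
  define G where "G = (\<lambda>(a::real, b::real). \<bar>a - b\<bar> powr p)"
  define S where "S = {x. max \<bar>fst x\<bar> \<bar>snd x\<bar> = 1 \<and> \<epsilon> \<le> G x}"
  have powr_cont: "continuous_on UNIV (\<lambda>x. \<bar>g x\<bar> powr p)"
    if "continuous_on UNIV g" for g :: "real \<times> real \<Rightarrow> real"
    using that p by (intro continuous_on_powr') (auto intro!: continuous_intros)
  have contD: "continuous_on UNIV D" unfolding D_def case_prod_unfold
    by (intro continuous_intros powr_cont) auto
  have contG: "continuous_on UNIV G" unfolding G_def case_prod_unfold
    by (intro continuous_intros powr_cont)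
  have "closed S" unfolding S_def
    by (intro closed_Collect_conj closed_Collect_eq closed_Collect_le contG) (auto intro!: continuous_intros)
  moreover have "bounded S"
  proof (rule bounded_subset)
    show "bounded (cbox (-1, -1) (1::real, 1::real))" by simp
    show "S \<subseteq> cbox (-1, -1) (1, 1)"
      by (auto simp: S_def mem_box Basis_prod_def max_def abs_le_iff split: if_splits)
  qed
  ultimately have cS: "compact S" by (simp add: compact_eq_bounded_closed)
  have Dnn: "0 \<le> D x" for x
    using powr_abs_midpoint_less[OF p, of "fst x" "snd x"]
    by (cases "fst x = snd x") (auto simp: D_def case_prod_unfold abs_mult)
  have Dpos: "0 < D x" if "x \<in> S" for x
  proof -
    have "fst x \<noteq> snd x" using that \<open>0 < \<epsilon>\<close> by (auto simp: S_def G_def case_prod_unfold)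
    then show ?thesis using powr_abs_midpoint_less[OF p, of "fst x" "snd x"]
      by (auto simp: D_def case_prod_unfold)
  qed
  have "\<exists>C\<ge>0. \<forall>x\<in>S. G x \<le> C * D x"
  proof (cases "S = {}")
    case False
    obtain x0 where x0: "x0 \<in> S" "\<And>x. x \<in> S \<Longrightarrow> D x0 \<le> D x"
      using continuous_attains_inf[OF cS False continuous_on_subset[OF contD]] by auto
    obtain x1 where x1: "x1 \<in> S" "\<And>x. x \<in> S \<Longrightarrow> G x \<le> G x1"
      using continuous_attains_sup[OF cS False continuous_on_subset[OF contG]] by auto
    have "G x \<le> (G x1 / D x0) * D x" if "x \<in> S" for x
    proof -
      have "G x1 * D x0 \<le> G x1 * D x"
        using x0(2)[OF that] by (intro mult_left_mono) (auto simp: G_def case_prod_unfold)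
      then have "G x1 \<le> (G x1 / D x0) * D x" using Dpos[OF x0(1)] by (simp add: field_simps)
      with x1(2)[OF that] show ?thesis by linarith
    qed
    moreover have "0 \<le> G x1 / D x0" using Dpos[OF x0(1)] by (auto simp: G_def case_prod_unfold)
    ultimately show ?thesis by blast
  qed auto
  then obtain C where C: "0 \<le> C" "\<And>x. x \<in> S \<Longrightarrow> G x \<le> C * D x" by blast
  have unit: "G x \<le> \<epsilon> * (\<bar>fst x\<bar> powr p + \<bar>snd x\<bar> powr p) + C * D x"
    if "max \<bar>fst x\<bar> \<bar>snd x\<bar> = 1" for x
  proof (cases "\<epsilon> \<le> G x")
    case True
    then have "G x \<le> C * D x" using that C by (auto simp: S_def)
    moreover have "0 \<le> \<epsilon> * (\<bar>fst x\<bar> powr p + \<bar>snd x\<bar> powr p)" using \<open>0 < \<epsilon>\<close> by simp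
    ultimately show ?thesis by linarith
  next
    case False
    have "1 \<le> \<bar>fst x\<bar> powr p + \<bar>snd x\<bar> powr p"
      using that by (cases "\<bar>fst x\<bar> \<le> \<bar>snd x\<bar>") (auto simp: max_def)
    then have "\<epsilon> \<le> \<epsilon> * (\<bar>fst x\<bar> powr p + \<bar>snd x\<bar> powr p)" using \<open>0 < \<epsilon>\<close> by simp
    moreover have "0 \<le> C * D x" using C Dnn by simp
    ultimately show ?thesis using False by linarith
  qed
  have "\<bar>a - b\<bar> powr p \<le> \<epsilon> * (\<bar>a\<bar> powr p + \<bar>b\<bar> powr p)
           + C * ((\<bar>a\<bar> powr p + \<bar>b\<bar> powr p) / 2 - \<bar>(a + b) / 2\<bar> powr p)" for a b
  proof (cases "a = 0 \<and> b = 0")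
    case False
    define t where "t = max \<bar>a\<bar> \<bar>b\<bar>"
    have t: "0 < t" using False by (auto simp: t_def max_def)
    define a' b' where "a' = a / t" and "b' = b / t"
    have ab: "a = t * a'" "b = t * b'" using t by (auto simp: a'_def b'_def)
    have "max \<bar>a'\<bar> \<bar>b'\<bar> = 1" unfolding a'_def b'_def using t
      by (auto simp: t_def max_def split: if_splits)
    from unit[of "(a', b')"] this
    have *: "\<bar>a' - b'\<bar> powr p \<le> \<epsilon> * (\<bar>a'\<bar> powr p + \<bar>b'\<bar> powr p)
        + C * ((\<bar>a'\<bar> powr p + \<bar>b'\<bar> powr p) / 2 - \<bar>(a' + b') / 2\<bar> powr p)"
      by (simp add: G_def D_def)
    have 1: "\<bar>a - b\<bar> = t * \<bar>a' - b'\<bar>" "\<bar>a\<bar> = t * \<bar>a'\<bar>" "\<bar>b\<bar> = t * \<bar>b'\<bar>" "\<bar>(a + b) / 2\<bar> = t * \<bar>(a' + b') / 2\<bar>"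
      using t by (simp_all add: ab abs_mult flip: right_diff_distrib distrib_left)
    define c' where "c' = (a' + b') / 2"
    show ?thesis unfolding 1 using mult_left_mono[OF *, of "t powr p"] t
      unfolding c'_def[symmetric] by (simp add: powr_mult algebra_simps)
  qed simp
  with C(1) show ?thesis by blast
qed

text \<open>
  Subtracting b from all coefficients does not change the difference of the two quotients, because
  the normalized weights add up to 1. What remains is a sum of (a v - b) times differences of
  normalized weights, and those are controlled by differences of the h v since the denominators
  are at least 1. Only the indices in U contribute, which makes the estimate local.
\<close>

lemma glue_difference_le:
  fixes h :: "'v \<Rightarrow> 'x \<Rightarrow> real" and a :: "'v \<Rightarrow> real"
  assumes fin: "finite V" and "U \<subseteq> V"
    and nn: "\<And>v z. v \<in> V \<Longrightarrow> 0 \<le> h v z"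
    and H: "1 \<le> (\<Sum>v\<in>V. h v x)" "1 \<le> (\<Sum>v\<in>V. h v y)"
    and out: "\<And>v. v \<in> V - U \<Longrightarrow> h v x = 0 \<and> h v y = 0"
  shows "\<bar>(\<Sum>v\<in>V. a v * h v x) / (\<Sum>v\<in>V. h v x) - (\<Sum>v\<in>V. a v * h v y) / (\<Sum>v\<in>V. h v y)\<bar>
           \<le> 2 * (\<Sum>v\<in>U. \<bar>a v - b\<bar>) * (\<Sum>v\<in>U. \<bar>h v x - h v y\<bar>)"
proof -
  have finU: "finite U" using fin assms(2) finite_subset by blast
  define Hx where "Hx = (\<Sum>v\<in>U. h v x)"
  define Hy where "Hy = (\<Sum>v\<in>U. h v y)"
  define D where "D = (\<Sum>v\<in>U. \<bar>h v x - h v y\<bar>)"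
  have red: "(\<Sum>v\<in>V. g v * h v z) = (\<Sum>v\<in>U. g v * h v z)" if "z = x \<or> z = y" for g z
    by (rule sum.mono_neutral_right) (use fin assms(2) out that in auto)
  have red1: "(\<Sum>v\<in>V. h v x) = Hx" "(\<Sum>v\<in>V. h v y) = Hy"
    using red[of x "\<lambda>_. 1"] red[of y "\<lambda>_. 1"] by (simp_all add: Hx_def Hy_def)
  have Hx: "1 \<le> Hx" and Hy: "1 \<le> Hy" using H red1 by auto
  have HD: "\<bar>Hx - Hy\<bar> \<le> D" unfolding Hx_def Hy_def D_def sum_subtractf[symmetric] by (rule sum_abs)
  have D0: "0 \<le> D" unfolding D_def by (intro sum_nonneg) auto
  have quot: "(\<Sum>v\<in>U. a v * h v z) / (\<Sum>v\<in>U. h v z) - b = (\<Sum>v\<in>U. (a v - b) * (h v z / (\<Sum>v\<in>U. h v z)))"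
    if "0 < (\<Sum>v\<in>U. h v z)" for z
    using that by (simp add: left_diff_distrib sum_subtractf sum_divide_distrib[symmetric]
        sum_distrib_left[symmetric] divide_simps)
  have trm: "\<bar>h v x / Hx - h v y / Hy\<bar> \<le> 2 * D" if v: "v \<in> U" for v
  proof -
    have v': "0 \<le> h v y" using nn v assms(2) by blast
    have hy: "h v y \<le> Hy" unfolding Hy_def
      using v nn assms(2) finU by (intro member_le_sum) auto
    have hD: "\<bar>h v x - h v y\<bar> \<le> D" unfolding D_def
      using v finU by (intro member_le_sum[of v U "\<lambda>v. \<bar>h v x - h v y\<bar>"]) auto
    have eq: "h v x / Hx - h v y / Hy = (h v x - h v y) / Hx + (h v y / Hy) * ((Hy - Hx) / Hx)"
      using Hx Hy by (simp add: field_simps)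
    have "\<bar>(h v x - h v y) / Hx\<bar> \<le> D / 1"
      unfolding abs_divide using hD Hx by (intro frac_le) auto
    moreover have "\<bar>(h v y / Hy) * ((Hy - Hx) / Hx)\<bar> \<le> 1 * (D / 1)"
      unfolding abs_mult abs_divide using hy v' HD Hx Hy by (intro mult_mono frac_le) auto
    ultimately show ?thesis unfolding eq by linarith
  qed
  have "(\<Sum>v\<in>V. a v * h v x) / (\<Sum>v\<in>V. h v x) - (\<Sum>v\<in>V. a v * h v y) / (\<Sum>v\<in>V. h v y)
      = (\<Sum>v\<in>U. (a v - b) * (h v x / Hx - h v y / Hy))"
    using quot[of x] quot[of y] Hx Hy unfolding red1 red[of x a, simplified] red[of y a, simplified]
    by (simp add: Hx_def Hy_def right_diff_distrib sum_subtractf)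
  also have "\<bar>\<dots>\<bar> \<le> (\<Sum>v\<in>U. \<bar>(a v - b) * (h v x / Hx - h v y / Hy)\<bar>)" by (rule sum_abs)
  also have "\<dots> \<le> (\<Sum>v\<in>U. \<bar>a v - b\<bar> * (2 * D))"
    unfolding abs_mult by (intro sum_mono mult_left_mono trm) auto
  also have "\<dots> = 2 * (\<Sum>v\<in>U. \<bar>a v - b\<bar>) * D" 
    by (simp add: sum_distrib_left sum_distrib_right mult_ac)
  finally show ?thesis unfolding D_def .
qed

lemma glue_powr_le:
  fixes h :: "'v \<Rightarrow> 'x \<Rightarrow> real" and a :: "'v \<Rightarrow> real"
  assumes fin: "finite V" and "U \<subseteq> V" "card U \<le> n" "0 < p"
    and nn: "\<And>v z. v \<in> V \<Longrightarrow> 0 \<le> h v z"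
    and H: "1 \<le> (\<Sum>v\<in>V. h v x)" "1 \<le> (\<Sum>v\<in>V. h v y)"
    and out: "\<And>v. v \<in> V - U \<Longrightarrow> h v x = 0 \<and> h v y = 0"
  shows "\<bar>(\<Sum>v\<in>V. a v * h v x) / (\<Sum>v\<in>V. h v x) - (\<Sum>v\<in>V. a v * h v y) / (\<Sum>v\<in>V. h v y)\<bar> powr p
           \<le> (2 * real n ^ 2) powr p * ((\<Sum>v\<in>U. \<bar>a v - b\<bar> powr p) * (\<Sum>v\<in>U. \<bar>h v x - h v y\<bar> powr p))"
proof -
  have finU: "finite U" using fin assms(2) finite_subset by blast
  have A: "0 \<le> (\<Sum>v\<in>U. \<bar>a v - b\<bar>)" "0 \<le> (\<Sum>v\<in>U. \<bar>h v x - h v y\<bar>)" by (auto intro: sum_nonneg)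
  have "\<bar>(\<Sum>v\<in>V. a v * h v x) / (\<Sum>v\<in>V. h v x) - (\<Sum>v\<in>V. a v * h v y) / (\<Sum>v\<in>V. h v y)\<bar> powr p
      \<le> (2 * (\<Sum>v\<in>U. \<bar>a v - b\<bar>) * (\<Sum>v\<in>U. \<bar>h v x - h v y\<bar>)) powr p"
    using assms by (intro powr_mono2 glue_difference_le) auto
  also have "\<dots> = 2 powr p * ((\<Sum>v\<in>U. \<bar>a v - b\<bar>) powr p * (\<Sum>v\<in>U. \<bar>h v x - h v y\<bar>) powr p)"
    using A by (simp add: powr_mult mult_ac)
  also have "\<dots> \<le> 2 powr p * ((real n powr p * (\<Sum>v\<in>U. \<bar>a v - b\<bar> powr p)) * (real n powr p * (\<Sum>v\<in>U. \<bar>h v x - h v y\<bar> powr p)))"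
    using assms finU by (intro mult_left_mono mult_mono powr_sum_le) (auto intro!: sum_nonneg mult_nonneg_nonneg)
  also have "\<dots> = (2 * real n ^ 2) powr p * ((\<Sum>v\<in>U. \<bar>a v - b\<bar> powr p) * (\<Sum>v\<in>U. \<bar>h v x - h v y\<bar> powr p))"
    by (simp add: powr_mult power2_eq_square mult_ac)
  finally show ?thesis .
qed

lemma epowr_epowr_inverse:
  assumes "0 < p"
  shows "epowr (epowr x (1 / p)) p = x"
proof (cases x)
  case (real r)
  then show ?thesis using assms by (auto simp: epowr_def powr_powr)
qed (simp add: epowr_def)

lemma epowr_less:
  assumes "0 < p" "0 < \<epsilon>" "x < ennreal (\<epsilon> powr p)"
  shows "epowr x (1 / p) < ennreal \<epsilon>"
proof -
  obtain r where r: "x = ennreal r" "0 \<le> r" using assms(3) by (cases x) auto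
  have "r < \<epsilon> powr p" using assms r by (simp add: ennreal_less_iff)
  then have "r powr (1 / p) < (\<epsilon> powr p) powr (1 / p)"
    using assms r by (intro powr_less_mono2) auto
  then show ?thesis using assms r by (simp add: epowr_def powr_powr ennreal_less_iff)
qed

lemma epowr_less_top_iff: "epowr x a < \<infinity> \<longleftrightarrow> x < \<infinity>"
  by (cases x) (auto simp: epowr_def)

section \<open>Heights and descendants in a rooted tree\<close>

locale rooted_tree =
  fixes E :: "'t set set" and root :: 't
  assumes tree: "is_tree E"
begin

abbreviation "par \<equiv> parent E root"
abbreviation "ht \<equiv> height E root"
abbreviation "lev \<equiv> level E root"
abbreviation "kids \<equiv> children E root"
abbreviation "dsc \<equiv> desc E root"

abbreviation "dscs \<equiv> desc_set E root"

definition path :: "'t \<Rightarrow> 't list" where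
  "path w = (THE xs. simple_path E root w xs)"

lemma path_unique: "simple_path E root w xs \<longleftrightarrow> xs = path w"
proof -
  have "\<exists>!xs. simple_path E root w xs" using tree by (simp add: is_tree_def)
  then show ?thesis unfolding path_def by (metis theI)
qed

lemma path_root: "path root = [root]"
proof -
  have "simple_path E root root [root]" by (simp add: simple_path_def walk_def)
  then show ?thesis using path_unique by metis
qed

text \<open>
  Removing the last vertex of a simple path leaves a simple path, which by uniqueness is the path
  to the parent. Thus the parent map shortens paths by one, and heights are path lengths.
\<close>

lemma path_parent:
  assumes "w \<noteq> root"
  shows "path (par w) = butlast (path w)" "2 \<le> length (path w)"
proof -
  define xs where "xs = path w"
  have xs: "xs \<noteq> []" "hd xs = root" "last xs = w" "successively (\<lambda>a b. {a, b} \<in> E) xs" "distinct xs"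
    using path_unique[of w xs] by (auto simp: simple_path_def walk_def xs_def)
  obtain ys y where ys: "xs = ys @ [y]" using xs(1) by (metis rev_exhaust)
  have ne: "ys \<noteq> []" using ys xs assms by auto
  have "simple_path E root (last ys) ys"
    using xs ne by (auto simp: ys simple_path_def walk_def successively_append_iff)
  then have "path (last ys) = ys" using path_unique by metis
  moreover have "par w = last ys"
    using assms by (simp add: parent_def path_def[symmetric] xs_def[symmetric] ys)
  ultimately show "path (par w) = butlast (path w)"
    by (simp add: xs_def[symmetric] ys)
  show "2 \<le> length (path w)" using ne by (cases ys) (auto simp: xs_def[symmetric] ys)
qed

lemma par_root [simp]: "par root = root"
  by (simp add: parent_def)

lemma funpow_par: "length (path ((par ^^ n) w)) - 1 = length (path w) - 1 - n"
proof (induction n)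
  case (Suc n)
  show ?case
  proof (cases "(par ^^ n) w = root")
    case True
    then show ?thesis using Suc by (simp add: path_root)
  next
    case False
    then show ?thesis using Suc path_parent[OF False] by simp
  qed
qed simp

lemma path_length_1: "length (path w) - 1 = 0 \<longleftrightarrow> w = root"
  using path_parent(2)[of w] path_root by force

lemma height_eq: "ht w = length (path w) - 1"
  unfolding height_def
proof (rule Least_equality)
  show "(par ^^ (length (path w) - 1)) w = root"
    using funpow_par[of "length (path w) - 1" w] path_length_1 by simp
next
  fix n assume "(par ^^ n) w = root"
  then show "length (path w) - 1 \<le> n"
    using funpow_par[of n w] path_length_1[of "(par ^^ n) w"] by simp
qed

lemma height_0_iff [simp]: "ht w = 0 \<longleftrightarrow> w = root"
  by (simp only: height_eq path_length_1)

lemma height_funpow: "ht ((par ^^ n) w) = ht w - n"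
  unfolding height_eq by (rule funpow_par)

lemma height_par: "ht (par w) = ht w - 1"
  using height_funpow[of 1 w] by simp

lemma children_iff: "v \<in> kids w \<longleftrightarrow> v \<noteq> root \<and> par v = w"
proof -
  have "par v \<noteq> v" if "v \<noteq> root"
    using that height_par[of v] height_0_iff[of v] by (cases "ht v") auto
  then show ?thesis unfolding children_def by auto
qed

text \<open>
  Turns descendants into a condition on the iterated parent map, so that statements about
  generations become computations with function powers. The height is needed because the root is
  its own parent.
\<close>

lemma desc_iff: "v \<in> dsc k w \<longleftrightarrow> (par ^^ k) v = w \<and> ht v = ht w + k"
proof (induction k arbitrary: w)
  case 0
  then show ?case by auto
next
  case (Suc k)
  have "v \<in> dsc (Suc k) w \<longleftrightarrow> (\<exists>u. u \<noteq> root \<and> par u = w \<and> (par ^^ k) v = u \<and> ht v = ht u + k)"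
    by (auto simp: Suc children_iff)
  also have "\<dots> \<longleftrightarrow> (par ^^ Suc k) v = w \<and> ht v = ht w + Suc k"
  proof safe
    assume "(par ^^ k) v \<noteq> root" "ht v = ht ((par ^^ k) v) + k"
    then show "ht v = ht (par ((par ^^ k) v)) + Suc k" 
      using height_par[of "(par ^^ k) v"] height_0_iff[of "(par ^^ k) v"] by (cases "ht ((par ^^ k) v)") auto
  next
    assume a: "ht v = ht ((par ^^ Suc k) v) + Suc k"
    show "\<exists>u. u \<noteq> root \<and> par u = (par ^^ Suc k) v \<and> (par ^^ k) v = u \<and> ht v = ht u + k"
      using a height_funpow[of k v] height_0_iff[of "(par ^^ k) v"] by (intro exI[of _ "(par ^^ k) v"]) auto
  qed simp_all
  finally show ?case .
qed

lemma level_iff: "w \<in> lev n \<longleftrightarrow> ht w = n"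
  by (simp add: level_def)

lemma funpow_par_level: "w \<in> lev (n + k) \<Longrightarrow> (par ^^ k) w \<in> lev n"
  by (simp add: level_iff height_funpow)

lemma desc_level: "v \<in> dsc k w \<Longrightarrow> w \<in> lev n \<Longrightarrow> v \<in> lev (n + k)"
  by (simp add: level_iff desc_iff)

lemma level_desc: "v \<in> lev (n + k) \<Longrightarrow> v \<in> dsc k ((par ^^ k) v)"
  by (simp add: level_iff desc_iff height_funpow)

lemma desc_root: "dsc n root = lev n"
proof -
  have "ht root = 0" by simp
  then show ?thesis
    by (auto simp: desc_iff level_iff simp del: height_0_iff) (simp flip: height_0_iff add: height_funpow)
qed

lemma desc_set_iff: "v \<in> dscs k A \<longleftrightarrow> (par ^^ k) v \<in> A \<and> ht v = ht ((par ^^ k) v) + k"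
  by (auto simp: desc_set_def desc_iff)

lemma desc_set_level: "A \<subseteq> lev n \<Longrightarrow> v \<in> dscs k A \<longleftrightarrow> v \<in> lev (n + k) \<and> (par ^^ k) v \<in> A"
  by (auto simp: desc_set_iff level_iff height_funpow subset_iff)

lemma desc_add: "dsc (k + l) w = (\<Union>v\<in>dsc k w. dsc l v)"
  by (auto simp: desc_iff funpow_add add.assoc) (simp add: height_funpow)

lemma desc_disjoint: "v \<noteq> w \<Longrightarrow> dsc k v \<inter> dsc k w = {}"
  by (auto simp: desc_iff)

lemma desc_1: "dsc 1 w = kids w" by simp

end

section \<open>Graphs of touching cells\<close>

lemma relpow_refl_mono:
  assumes "\<And>u v. (u, v) \<in> S \<Longrightarrow> (u, u) \<in> S \<and> (v, v) \<in> S" "1 \<le> i" "i \<le> j"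
  shows "(u, v) \<in> S ^^ i \<Longrightarrow> (u, v) \<in> S ^^ j"
proof -
  assume uv: "(u, v) \<in> S ^^ i"
  have step: "(u, v) \<in> S ^^ Suc n" if "(u, v) \<in> S ^^ n" "1 \<le> n" for n
  proof -
    obtain n' where "n = Suc n'" using \<open>1 \<le> n\<close> by (cases n) auto
    with \<open>(u, v) \<in> S ^^ n\<close> obtain w where "(w, v) \<in> S" by auto
    then show ?thesis using assms(1) that by (auto intro: relcompI)
  qed
  show ?thesis using assms(3,2)
  proof (induction j rule: dec_induct)
    case (step n)
    then show ?case using \<open>\<And>n. (u, v) \<in> S ^^ n \<Longrightarrow> 1 \<le> n \<Longrightarrow> (u, v) \<in> S ^^ Suc n\<close> by simp
  qed (use uv in simp)
qed

lemma relpow_subset_mono: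
  fixes R S :: "('x \<times> 'x) set"
  shows "R \<subseteq> S \<Longrightarrow> R ^^ n \<subseteq> S ^^ n"
  by (induction n) auto

lemma walk_imp_relpow:
  assumes "walk E u v xs"
  shows "(u, v) \<in> {(a, b). {a, b} \<in> E} ^^ (length xs - 1)"
  using assms
proof (induction xs arbitrary: u)
  case Nil
  then show ?case by (simp add: walk_def)
next
  case (Cons a xs)
  show ?case
  proof (cases xs)
    case Nil
    then show ?thesis using Cons.prems by (auto simp: walk_def)
  next
    case (Cons b ys)
    then have "walk E b v xs" "{u, b} \<in> E" using Cons.prems by (auto simp: walk_def)
    then have "(b, v) \<in> {(a, b). {a, b} \<in> E} ^^ (length xs - 1)" using Cons.IH by simp
    moreover have "(u, b) \<in> {(a, b). {a, b} \<in> E}" using \<open>{u, b} \<in> E\<close> by simp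
    ultimately have "(u, v) \<in> {(a, b). {a, b} \<in> E} ^^ Suc (length xs - 1)"
      by (metis relpow_Suc_I2)
    then show ?thesis using Cons by simp
  qed
qed

text \<open>
  The part of the geometric framework that involves only the topology and the masses of the cells.
  N bounds the number of cells touching a given cell of the same level, itself included, and Mst
  is the radius of the neighbourhoods in the definition of the capacities.
\<close>

locale cell_partition = rooted_tree E root for E :: "'t set set" and root :: 't +
  fixes K :: "'t \<Rightarrow> 'a::metric_space set" and m :: "'a measure" and p \<gamma> :: real and N Mst :: nat
  assumes p1: "1 < p"
    and compact_K: "\<And>w. compact (K w)" and K_ne: "\<And>w. K w \<noteq> {}" and connected_K: "\<And>w. connected (K w)"
    and K_root: "K root = UNIV" and K_children: "\<And>w. K w = (\<Union>v\<in>children E root w. K v)"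
    and prob_m: "prob_space m" and sets_m: "sets m = sets borel"
    and card_children: "\<And>w. 2 \<le> card (children E root w)"
    and \<gamma>_pos: "0 < \<gamma>" and measure_parent: "\<And>w. \<gamma> * measure m (K (parent E root w)) \<le> measure m (K w)"
    and measure_children: "\<And>w. measure m (K w) = (\<Sum>v\<in>children E root w. measure m (K v))"
    and card_nbhd1: "\<And>w. finite (cell_nbhd E root K 1 w) \<and> card (cell_nbhd E root K 1 w) \<le> N"
    and parent_nbhd: "\<And>w. parent E root ` cell_nbhd E root K (Mst + 1) w \<subseteq> cell_nbhd E root K Mst (parent E root w)"
begin

sublocale prob_space m by (rule prob_m)

lemma p0: "0 < p" using p1 by simp

text \<open>
  This relation contains the diagonal, unlike the edges of the cell graph: loops contribute
  nothing to an energy, and they make the powers of the relation increasing, so that \<open>touch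
  n ^^ i\<close> means graph distance at most i.
\<close>

definition touch :: "nat \<Rightarrow> ('t \<times> 't) set" where
  "touch n = {(u, v). u \<in> lev n \<and> v \<in> lev n \<and> K u \<inter> K v \<noteq> {}}"

lemma finite_kids: "finite (kids w)"
  using card_children[of w] by (metis card.infinite not_numeral_le_zero)

lemma finite_desc: "finite (dsc k w)"
  by (induction k arbitrary: w) (auto simp: finite_kids)

lemma finite_level: "finite (lev n)"
  using finite_desc[of n root] by (simp add: desc_root)

lemma K_desc: "K w = (\<Union>v\<in>dsc k w. K v)"
proof (induction k arbitrary: w)
  case (Suc k)
  have "K w = (\<Union>v\<in>kids w. K v)" by (rule K_children)
  also have "\<dots> = (\<Union>v\<in>kids w. \<Union>u\<in>dsc k v. K u)" by (intro SUP_cong refl Suc.IH)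
  finally show ?case by simp
qed simp

lemma K_level: "(\<Union>w\<in>lev n. K w) = UNIV"
  using K_desc[of root n] by (simp add: desc_root K_root)

lemma K_mono_par: "K w \<subseteq> K ((par ^^ k) w)"
proof (induction k)
  case (Suc k)
  have "K ((par ^^ k) w) \<subseteq> K (par ((par ^^ k) w))"
    by (cases "(par ^^ k) w = root") (auto simp: K_children[of "par ((par ^^ k) w)"] children_iff)
  with Suc show ?case by auto
qed simp

lemma touch_sym: "(u, v) \<in> touch n \<Longrightarrow> (v, u) \<in> touch n"
  by (auto simp: touch_def)

lemma touch_refl: "(u, v) \<in> touch n \<Longrightarrow> (u, u) \<in> touch n \<and> (v, v) \<in> touch n"
  using K_ne by (auto simp: touch_def)

lemma touch_refl_level: "u \<in> lev n \<Longrightarrow> (u, u) \<in> touch n"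
  using K_ne by (auto simp: touch_def)

lemma touch_pow_sym: "(u, v) \<in> touch n ^^ i \<Longrightarrow> (v, u) \<in> touch n ^^ i"
proof (induction i arbitrary: u v)
  case (Suc i)
  then obtain w where "(u, w) \<in> touch n ^^ i" "(w, v) \<in> touch n" by auto
  then show ?case using Suc.IH touch_sym by (metis relpow_Suc_I2)
qed auto

lemma touch_pow_refl: "u \<in> lev n \<Longrightarrow> (u, u) \<in> touch n ^^ i"
  by (induction i) (auto intro: touch_refl_level)

lemma touch_pow_mono: "u \<in> lev n \<Longrightarrow> i \<le> j \<Longrightarrow> (u, v) \<in> touch n ^^ i \<Longrightarrow> (u, v) \<in> touch n ^^ j"
  using touch_pow_refl[of u n "j - i"] relpow_add[of "j - i" i "touch n"] by (auto intro: relcompI)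

lemma touch_pow_level: "(u, v) \<in> touch n ^^ i \<Longrightarrow> u \<in> lev n \<Longrightarrow> v \<in> lev n"
  by (cases i) (auto simp: touch_def)

lemma finite_touch: "finite (touch n)"
  by (rule finite_subset[of _ "lev n \<times> lev n"]) (auto simp: touch_def finite_level)

lemma touch_pow_walk:
  assumes "(u, v) \<in> touch n ^^ i"
  shows "\<exists>xs. walk (cell_edges E root K n) u v xs \<and> length xs \<le> i + 1"
  using assms
proof (induction i arbitrary: v)
  case 0
  then show ?case by (intro exI[of _ "[u]"]) (auto simp: walk_def)
next
  case (Suc i)
  then obtain w where w: "(u, w) \<in> touch n ^^ i" "(w, v) \<in> touch n" by auto
  from Suc.IH[OF w(1)] obtain xs where xs: "walk (cell_edges E root K n) u w xs" "length xs \<le> i + 1" by blast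
  show ?case
  proof (cases "w = v")
    case True
    then show ?thesis using xs by auto
  next
    case False
    then have "{w, v} \<in> cell_edges E root K n" using w by (auto simp: touch_def cell_edges_def)
    then have "walk (cell_edges E root K n) u v (xs @ [v])"
      using xs by (auto simp: walk_def successively_append_iff)
    then show ?thesis using xs by (intro exI[of _ "xs @ [v]"]) auto
  qed
qed

lemma cell_edges_touch: "{u, v} \<in> cell_edges E root K n \<longleftrightarrow> (u, v) \<in> touch n \<and> u \<noteq> v"
  by (auto simp: cell_edges_def touch_def doubleton_eq_iff)

lemma cell_edges_on_touch:
  "{u, v} \<in> cell_edges_on E root K n A \<longleftrightarrow> (u, v) \<in> touch n \<inter> A \<times> A \<and> u \<noteq> v"
  by (auto simp: cell_edges_on_def cell_edges_touch doubleton_eq_iff touch_sym) 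

lemma cell_nbhd_eq: "cell_nbhd E root K M w = {v. (v, w) \<in> touch (ht w) ^^ M}"
proof (intro set_eqI iffI; unfold mem_Collect_eq)
  let ?n = "ht w" let ?E = "cell_edges E root K (ht w)"
  fix v assume "v \<in> cell_nbhd E root K M w"
  then have v: "v \<in> lev ?n" "graph_dist ?E v w \<le> enat M" by (auto simp: cell_nbhd_def)
  have "\<not> (\<forall>xs. walk ?E v w xs \<longrightarrow> enat (M + 1) \<le> enat (length xs - 1))"
  proof
    assume "\<forall>xs. walk ?E v w xs \<longrightarrow> enat (M + 1) \<le> enat (length xs - 1)"
    then have "enat (M + 1) \<le> graph_dist ?E v w" unfolding graph_dist_def by (intro INF_greatest) auto
    also note v(2)
    finally show False by simp
  qed
  then obtain xs where xs: "walk ?E v w xs" "length xs - 1 \<le> M" by auto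
  have "{(a, b). {a, b} \<in> ?E} \<subseteq> touch ?n" by (auto simp: cell_edges_touch)
  then have "(v, w) \<in> touch ?n ^^ (length xs - 1)"
    using walk_imp_relpow[OF xs(1)] relpow_subset_mono by blast
  then show "(v, w) \<in> touch ?n ^^ M" using touch_pow_mono v xs by blast
next
  let ?n = "ht w" let ?E = "cell_edges E root K (ht w)"
  fix v assume v: "(v, w) \<in> touch ?n ^^ M"
  obtain xs where xs: "walk ?E v w xs" "length xs \<le> M + 1" using touch_pow_walk[OF v] by blast
  have "graph_dist ?E v w \<le> enat (length xs - 1)" unfolding graph_dist_def
    by (rule INF_lower) (use xs in auto)
  also have "\<dots> \<le> enat M" using xs by simp
  finally have "graph_dist ?E v w \<le> enat M" .
  moreover have "v \<in> lev ?n" using touch_pow_level[OF touch_pow_sym[OF v]] by (simp add: level_iff)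
  ultimately show "v \<in> cell_nbhd E root K M w" by (simp add: cell_nbhd_def)
qed

lemma card_touch: "finite {v. (v, w) \<in> touch n} \<and> card {v. (v, w) \<in> touch n} \<le> N"
proof (cases "w \<in> lev n")
  case True
  then have "{v. (v, w) \<in> touch n} = cell_nbhd E root K 1 w"
    by (simp add: cell_nbhd_eq level_iff)
  then show ?thesis using card_nbhd1 by simp
next
  case False
  then have "{v. (v, w) \<in> touch n} = {}" by (auto simp: touch_def)
  then show ?thesis by simp
qed

lemma card_touch_pow: "finite {v. (v, w) \<in> touch n ^^ i} \<and> card {v. (v, w) \<in> touch n ^^ i} \<le> N ^ i"
proof (induction i)
  case (Suc i)
  have eq: "{v. (v, w) \<in> touch n ^^ Suc i} = (\<Union>u\<in>{u. (u, w) \<in> touch n ^^ i}. {v. (v, u) \<in> touch n})"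
    unfolding relpow.simps relpow_commute[symmetric] by auto
  have "card {v. (v, w) \<in> touch n ^^ Suc i} \<le> (\<Sum>u\<in>{u. (u, w) \<in> touch n ^^ i}. card {v. (v, u) \<in> touch n})"
    unfolding eq by (rule card_UN_le) (use Suc in auto)
  also have "\<dots> \<le> card {u. (u, w) \<in> touch n ^^ i} * N"
    using sum_bounded_above[of "{u. (u, w) \<in> touch n ^^ i}" _ N] card_touch by auto
  also have "\<dots> \<le> N ^ i * N" using Suc by auto
  finally show ?case unfolding eq using Suc card_touch by (simp add: mult.commute)
qed simp

lemma card_touch_pow2: "finite {v. (w, v) \<in> touch n ^^ i} \<and> card {v. (w, v) \<in> touch n ^^ i} \<le> N ^ i"
proof -
  have "{v. (w, v) \<in> touch n ^^ i} = {v. (v, w) \<in> touch n ^^ i}" using touch_pow_sym by auto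
  then show ?thesis using card_touch_pow by simp
qed

abbreviation "energy_on \<equiv> energy E root K p"
abbreviation "covers \<equiv> is_covering E root K"
abbreviation "sysc \<equiv> system_const E root K m"
abbreviation "nbhd \<equiv> cell_nbhd E root K"

definition incr :: "('t \<Rightarrow> real) \<Rightarrow> 't \<times> 't \<Rightarrow> real" where
  "incr f e = \<bar>f (fst e) - f (snd e)\<bar> powr p"

lemma incr_nonneg: "0 \<le> incr f e" by (simp add: incr_def)

lemma energy_eq: "energy_on n A f = (\<Sum>e\<in>touch n \<inter> A \<times> A. incr f e) / 2"
proof -
  have "(\<Sum>e\<in>{(u, v). {u, v} \<in> cell_edges_on E root K n A}. incr f e) = (\<Sum>e\<in>touch n \<inter> A \<times> A. incr f e)"
    by (rule sum.mono_neutral_left) (auto simp: finite_touch cell_edges_on_touch incr_def)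
  then show ?thesis unfolding energy_def by (simp add: incr_def case_prod_unfold)
qed

lemma energy_level: "energy_on n (lev n) f = (\<Sum>e\<in>touch n. incr f e) / 2"
proof -
  have "touch n \<inter> lev n \<times> lev n = touch n" by (auto simp: touch_def)
  then show ?thesis by (simp add: energy_eq)
qed

lemma energy_nonneg: "0 \<le> energy_on n A f"
  unfolding energy_eq by (intro divide_nonneg_pos sum_nonneg) (auto simp: incr_nonneg)

text \<open>
  Every pair in X is charged to a step of its chain that carries a share 1/D of its increment. A
  given step receives at most N^D * N^D pairs: the first endpoint lies within distance D of the
  start of the step, and the second one within distance D of the first.
\<close>

lemma chain_sum_le:
  assumes S: "S \<subseteq> touch n" and "finite X"
    and chain: "\<And>u v. (u, v) \<in> X \<Longrightarrow> u \<in> lev n \<and> (\<exists>i\<le>D. (u, v) \<in> S ^^ i)"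
  shows "(\<Sum>e\<in>X. incr f e) \<le> real (N ^ D * N ^ D) * real D powr p * (\<Sum>e\<in>S. incr f e)"
proof (rule sum_le_fibres[where rel = "\<lambda>(u, v) (a, b). (u, a) \<in> touch n ^^ D \<and> (u, v) \<in> touch n ^^ D"])
  show "finite S" using S finite_touch finite_subset by blast
  fix x assume x: "x \<in> X" "0 < incr f x"
  obtain u v where uv: "x = (u, v)" by force
  from chain[of u v] x uv obtain i where i: "u \<in> lev n" "i \<le> D" "(u, v) \<in> S ^^ i" by auto
  have "f u \<noteq> f v" using x by (auto simp: incr_def uv)
  from relpow_large_step[where f = f, OF i(3) this] obtain a b j where ab: "j < i" "(u, a) \<in> S ^^ j" "(a, b) \<in> S"
    "\<bar>f u - f v\<bar> \<le> real i * \<bar>f a - f b\<bar>" by blast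
  have "(u, a) \<in> touch n ^^ D" "(u, v) \<in> touch n ^^ D"
    using ab i relpow_subset_mono[OF S] touch_pow_mono[OF i(1)] by (meson order.trans less_imp_le subsetD)+
  moreover have "incr f x \<le> real D powr p * incr f (a, b)"
  proof -
    have "\<bar>f u - f v\<bar> \<le> real D * \<bar>f a - f b\<bar>" using ab i
      by (meson abs_ge_zero mult_right_mono of_nat_mono order.trans)
    then have "\<bar>f u - f v\<bar> powr p \<le> (real D * \<bar>f a - f b\<bar>) powr p" using p1 by (intro powr_mono2) auto
    then show ?thesis by (simp add: incr_def uv powr_mult)
  qed
  ultimately show "\<exists>y\<in>S. (case x of (u, v) \<Rightarrow> \<lambda>(a, b). (u, a) \<in> touch n ^^ D \<and> (u, v) \<in> touch n ^^ D) y \<and>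
      incr f x \<le> real D powr p * incr f y"
    using ab uv by (intro bexI[of _ "(a, b)"]) auto
next
  fix y assume "y \<in> S"
  obtain a b where y: "y = (a, b)" by force
  have "card {x \<in> X. (case x of (u, v) \<Rightarrow> \<lambda>(a, b). (u, a) \<in> touch n ^^ D \<and> (u, v) \<in> touch n ^^ D) y}
      \<le> card (SIGMA u:{u. (u, a) \<in> touch n ^^ D}. {v. (u, v) \<in> touch n ^^ D})"
    by (rule card_mono) (use card_touch_pow card_touch_pow2 in \<open>auto simp: y\<close>)
  also have "\<dots> = (\<Sum>u\<in>{u. (u, a) \<in> touch n ^^ D}. card {v. (u, v) \<in> touch n ^^ D})"
    by (rule card_SigmaI) (use card_touch_pow card_touch_pow2 in auto)
  also have "\<dots> \<le> card {u. (u, a) \<in> touch n ^^ D} * N ^ D"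
    using sum_bounded_above[of "{u. (u, a) \<in> touch n ^^ D}" _ "N ^ D"] card_touch_pow2 by auto
  also have "\<dots> \<le> N ^ D * N ^ D" using card_touch_pow by auto
  finally show "card {x \<in> X. (case x of (u, v) \<Rightarrow> \<lambda>(a, b). (u, a) \<in> touch n ^^ D \<and> (u, v) \<in> touch n ^^ D) y}
      \<le> N ^ D * N ^ D" .
qed (use assms in \<open>auto simp: incr_nonneg\<close>)

lemma nbhd_sum_le:
  "(\<Sum>e\<in>{(u, v). u \<in> lev n \<and> (u, v) \<in> touch n ^^ D}. incr f e)
     \<le> real (N ^ D * N ^ D) * real D powr p * (2 * energy_on n (lev n) f)"
  unfolding energy_level
  using chain_sum_le[of "touch n" n "{(u, v). u \<in> lev n \<and> (u, v) \<in> touch n ^^ D}" D f]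
    finite_subset[of "{(u, v). u \<in> lev n \<and> (u, v) \<in> touch n ^^ D}" "lev n \<times> lev n"] finite_level touch_pow_level
  by fastforce

text \<open>
  The cells reachable from u and the remaining ones have disjoint closed unions, so the second
  family is empty when the union of all cells is connected. The exponent may be fixed in advance
  because the relation is reflexive.
\<close>

lemma connected_chain:
  assumes "finite V" and conn: "connected (\<Union>v\<in>V. K v)" and "V \<subseteq> lev n" and uv: "u \<in> V" "v \<in> V"
  shows "(u, v) \<in> (touch n \<inter> V \<times> V) ^^ card (V \<times> V)"
proof -
  let ?R = "touch n \<inter> V \<times> V"
  define C where "C = {w \<in> V. (u, w) \<in> ?R\<^sup>*}"
  have C: "C \<subseteq> V" "u \<in> C" using uv by (auto simp: C_def)
  have cl: "closed (\<Union>w\<in>C. K w)" "closed (\<Union>w\<in>V - C. K w)"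
    using finite_subset[OF C(1)] \<open>finite V\<close> compact_K by (auto intro!: closed_UN compact_imp_closed)
  have disj: "(\<Union>w\<in>C. K w) \<inter> (\<Union>w\<in>V - C. K w) = {}"
  proof (rule ccontr)
    assume "\<not> ?thesis"
    then obtain a b where ab: "a \<in> C" "b \<in> V - C" "K a \<inter> K b \<noteq> {}" by blast
    then have "(a, b) \<in> ?R" using assms(3) C by (auto simp: touch_def)
    then have "b \<in> C" using ab by (auto simp: C_def intro: rtrancl_into_rtrancl)
    with ab show False by simp
  qed
  have "V - C = {}"
  proof (rule ccontr)
    assume "V - C \<noteq> {}"
    then obtain b where b: "b \<in> V - C" by blast
    have un: "(\<Union>w\<in>V. K w) = (\<Union>w\<in>C. K w) \<union> (\<Union>w\<in>V - C. K w)" using C by blast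
    have "(\<Union>w\<in>C. K w) \<inter> (\<Union>w\<in>V. K w) = {} \<or> (\<Union>w\<in>V - C. K w) \<inter> (\<Union>w\<in>V. K w) = {}"
      using conn cl disj un unfolding connected_closed by blast
    then show False using K_ne[of u] K_ne[of b] C b by blast
  qed
  then have "(u, v) \<in> ?R\<^sup>*" using uv by (auto simp: C_def)
  moreover have finR: "finite ?R" using finite_touch by blast
  ultimately obtain k where k: "k \<le> card ?R" "(u, v) \<in> ?R ^^ k"
    using rtrancl_finite_eq_relpow[OF finR] by auto
  have "card ?R \<le> card (V \<times> V)" using \<open>finite V\<close> by (intro card_mono) auto
  with k have kV: "k \<le> card (V \<times> V)" by linarith
  have refl: "(u, u) \<in> ?R" using touch_refl_level uv assms(3) by blast
  show ?thesis
  proof (cases "k = 0")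
    case True
    then have "u = v" using k by simp
    have "(u, u) \<in> ?R ^^ i" for i by (induction i) (use refl in auto)
    then show ?thesis using \<open>u = v\<close> by simp
  next
    case False
    show ?thesis
      by (rule relpow_refl_mono[OF _ _ kV k(2)]) (use False touch_refl in auto)
  qed
qed

end

context cell_partition
begin

section \<open>Masses and averages of cells\<close>

text \<open>
  A bound for the number of children of a cell: each child carries at least the fraction \<gamma>
  of the mass of its parent.
\<close>

definition L :: nat where "L = nat \<lceil>1 / \<gamma>\<rceil>"

abbreviation "\<mu> w \<equiv> measure m (K w)"
abbreviation "en n f \<equiv> energy_on n (lev n) f"
abbreviation "avg \<equiv> discrete_avg E root K m"

lemma space_m: "space m = UNIV"
  using sets_eq_imp_space_eq[OF sets_m] by simp

lemma measure_pos: "0 < \<mu> w"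
proof (induction "ht w" arbitrary: w)
  case 0
  then have "w = root" by (metis height_0_iff)
  then show ?case using prob_space by (simp add: K_root space_m[symmetric])
next
  case (Suc n)
  then have "0 < \<mu> (par w)" using height_par[of w] by simp
  then show ?case using measure_parent[of w] \<gamma>_pos by (meson less_le_trans mult_pos_pos)
qed

lemma measure_root: "\<mu> root = 1"
  using prob_space by (simp add: K_root space_m[symmetric])

lemma card_kids: "card (kids w) \<le> L"
proof -
  have "real (card (kids w)) * (\<gamma> * \<mu> w) = (\<Sum>v\<in>kids w. \<gamma> * \<mu> w)" by simp
  also have "\<dots> \<le> (\<Sum>v\<in>kids w. \<mu> v)"
    by (intro sum_mono) (use measure_parent children_iff in metis)
  also have "\<dots> = 1 * \<mu> w" using measure_children[of w] by simp
  finally have "real (card (kids w)) * \<gamma> \<le> 1"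
    using measure_pos[of w] by (simp add: mult.assoc[symmetric])
  then have "real (card (kids w)) \<le> 1 / \<gamma>" using \<gamma>_pos by (simp add: field_simps)
  then show ?thesis unfolding L_def by linarith
qed

lemma card_desc: "card (dsc k w) \<le> L ^ k"
proof (induction k arbitrary: w)
  case (Suc k)
  have "card (dsc (Suc k) w) \<le> (\<Sum>v\<in>kids w. card (dsc k v))"
    using card_UN_le[OF finite_kids[of w], of "dsc k"] by simp
  also have "\<dots> \<le> card (kids w) * L ^ k"
    using sum_bounded_above[of "kids w" "\<lambda>v. card (dsc k v)" "L ^ k"] Suc by simp
  also have "\<dots> \<le> L * L ^ k" using card_kids by simp
  finally show ?case by simp
qed simp

lemma card_desc_ge: "2 ^ k \<le> card (dsc k w)"
proof (induction k arbitrary: w)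
  case (Suc k)
  have "card (dsc (Suc k) w) = (\<Sum>v\<in>kids w. card (dsc k v))"
    using card_UN_disjoint[OF finite_kids[of w], of "dsc k"] desc_disjoint by (simp add: finite_desc)
  moreover have "card (kids w) * 2 ^ k \<le> (\<Sum>v\<in>kids w. card (dsc k v))"
    using sum_bounded_below[of "kids w" "2 ^ k" "\<lambda>v. card (dsc k v)"] Suc by simp
  moreover have "2 * 2 ^ k \<le> card (kids w) * 2 ^ k" using card_children[of w] by simp
  ultimately show ?case unfolding power_Suc by linarith
qed simp

lemma desc_nonempty: "\<exists>v. v \<in> dsc k w"
proof -
  have "0 < card (dsc k w)" using card_desc_ge[of k w] by (meson less_le_trans zero_less_numeral zero_less_power)
  then show ?thesis by (metis card.empty ex_in_conv less_irrefl)
qed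

lemma sum_desc_add: "(\<Sum>v\<in>dsc (k + l) w. g v) = (\<Sum>v\<in>dsc k w. \<Sum>u\<in>dsc l v. g u)"
  unfolding desc_add by (rule sum.UNION_disjoint) (use finite_desc desc_disjoint in auto)

lemma measure_desc: "\<mu> w = (\<Sum>v\<in>dsc k w. \<mu> v)"
proof (induction k)
  case (Suc k)
  have "(\<Sum>v\<in>dsc (k + 1) w. \<mu> v) = (\<Sum>v\<in>dsc k w. \<mu> v)"
    by (subst sum_desc_add) (simp add: desc_1[simplified] measure_children[symmetric])
  with Suc show ?case by simp
qed simp

lemma avg_eq: "avg k f w = (\<Sum>v\<in>dsc k w. f v * \<mu> v) / \<mu> w"
  by (simp add: discrete_avg_def measure_desc[symmetric])

lemma avg_add: "avg (k + l) f w = avg k (avg l f) w"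
proof -
  have "(\<Sum>v\<in>dsc k w. (\<Sum>u\<in>dsc l v. f u * \<mu> u) / \<mu> v * \<mu> v) = (\<Sum>v\<in>dsc k w. \<Sum>u\<in>dsc l v. f u * \<mu> u)"
    using measure_pos by (intro sum.cong) (auto simp: less_imp_neq[symmetric])
  then show ?thesis unfolding avg_eq by (simp add: sum_desc_add)
qed

lemma avg_const:
  assumes "\<And>v. v \<in> dsc k w \<Longrightarrow> f v = c"
  shows "avg k f w = c"
proof -
  have "(\<Sum>v\<in>dsc k w. f v * \<mu> v) = c * (\<Sum>v\<in>dsc k w. \<mu> v)"
    using assms by (simp add: sum_distrib_left)
  then show ?thesis using measure_pos[of w] by (simp add: avg_eq measure_desc[symmetric])
qed

lemma touch_par: "(u, v) \<in> touch (n + k) \<Longrightarrow> ((par ^^ k) u, (par ^^ k) v) \<in> touch n"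
  using K_mono_par[of u k] K_mono_par[of v k] by (auto simp: touch_def intro: funpow_par_level)

lemma touch_pow_par: "(u, v) \<in> touch (n + k) ^^ i \<Longrightarrow> ((par ^^ k) u, (par ^^ k) v) \<in> touch n ^^ i"
proof (induction i arbitrary: v)
  case (Suc i)
  then obtain w where w: "(u, w) \<in> touch (n + k) ^^ i" "(w, v) \<in> touch (n + k)" by auto
  show ?case using Suc.IH[OF w(1)] touch_par[OF w(2)] by auto
qed simp

text \<open>
  The only use of the condition on (Mst+1)-neighbourhoods: going up one level shortens a chain by
  one step, as long as its length exceeds Mst.
\<close>

lemma touch_contract1:
  assumes "(u, v) \<in> touch (Suc n) ^^ (Mst + Suc i)"
  shows "(par u, par v) \<in> touch n ^^ (Mst + i)"
proof -
  obtain w where w: "(u, w) \<in> touch (Suc n) ^^ (Mst + 1)" "(w, v) \<in> touch (Suc n) ^^ i"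
    using assms relpow_add[of "Mst + 1" i "touch (Suc n)"] by auto
  have "w \<in> lev (Suc n)" using w(1) by (auto simp: touch_def)
  then have hw: "ht w = Suc n" "ht (par w) = n" using height_par[of w] by (auto simp: level_iff)
  have "u \<in> nbhd (Mst + 1) w" using w(1) hw by (simp add: cell_nbhd_eq)
  then have "par u \<in> nbhd Mst (par w)" using parent_nbhd by blast
  then have "(par u, par w) \<in> touch n ^^ Mst" using hw by (simp add: cell_nbhd_eq)
  moreover have "(par w, par v) \<in> touch n ^^ i" 
    using touch_pow_par[where u = w and v = v and n = n and k = 1 and i = i] w(2) by simp
  ultimately show ?thesis unfolding relpow_add by auto
qed

text \<open>
  After j levels a chain of length Mst + j is no longer than Mst. This is how neighbourhoods that
  have grown in a construction are brought back to the radius Mst.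
\<close>

lemma touch_contract:
  "(u, v) \<in> touch (n + j) ^^ (Mst + (j + i)) \<Longrightarrow> ((par ^^ j) u, (par ^^ j) v) \<in> touch n ^^ (Mst + i)"
proof (induction j arbitrary: u v)
  case (Suc j)
  then have "(u, v) \<in> touch (Suc (n + j)) ^^ (Mst + Suc (j + i))" by (simp only: add_Suc add_Suc_right)
  then have "(par u, par v) \<in> touch (n + j) ^^ (Mst + (j + i))" by (rule touch_contract1)
  from Suc.IH[OF this] show ?case by (simp add: funpow_swap1)
qed simp

section \<open>Coverings and Poincare constants\<close>

text \<open>
  Each edge of A is replaced by a chain of at most NE edges lying in the members of the covering.
\<close>

lemma cover_energy_le:
  assumes cov: "covers n A NT NE G" and A: "A \<subseteq> lev n"
  shows "energy_on n A f \<le> real (N ^ NE * N ^ NE) * real NE powr p * (\<Sum>B\<in>G. energy_on n B f)"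
proof -
  define S where "S = (\<Union>B\<in>G. touch n \<inter> B \<times> B)"
  have finG: "finite G" and AG: "A = \<Union>G"
    and wk: "\<And>u v. {u, v} \<in> cell_edges_on E root K n A \<Longrightarrow>
        (\<exists>xs. walk (\<Union>B\<in>G. cell_edges_on E root K n B) u v xs \<and> set xs \<subseteq> A \<and> length xs \<le> NE + 1)"
    using cov by (auto simp: is_covering_def)
  have "(\<Sum>e\<in>touch n \<inter> A \<times> A. incr f e) \<le> real (N ^ NE * N ^ NE) * real NE powr p * (\<Sum>e\<in>S. incr f e)"
  proof (rule chain_sum_le)
    fix u v assume uv: "(u, v) \<in> touch n \<inter> A \<times> A"
    show "u \<in> lev n \<and> (\<exists>i\<le>NE. (u, v) \<in> S ^^ i)"
    proof (cases "u = v")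
      case True
      then show ?thesis using uv A by (auto intro!: exI[of _ 0])
    next
      case False
      then obtain xs where xs: "walk (\<Union>B\<in>G. cell_edges_on E root K n B) u v xs" "length xs \<le> NE + 1"
        using wk[of u v] uv by (auto simp: cell_edges_on_touch)
      have "{(a, b). {a, b} \<in> (\<Union>B\<in>G. cell_edges_on E root K n B)} \<subseteq> S"
        by (auto simp: S_def cell_edges_on_touch)
      then have "(u, v) \<in> S ^^ (length xs - 1)"
        using walk_imp_relpow[OF xs(1)] relpow_subset_mono by blast
      moreover have "length xs - 1 \<le> NE" using xs(2) by simp
      ultimately show ?thesis using uv A by blast
    qed
  qed (auto simp: S_def finite_touch)
  also have "\<dots> \<le> real (N ^ NE * N ^ NE) * real NE powr p * (\<Sum>B\<in>G. \<Sum>e\<in>touch n \<inter> B \<times> B. incr f e)"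
  proof (rule mult_left_mono)
    show "(\<Sum>e\<in>S. incr f e) \<le> (\<Sum>B\<in>G. \<Sum>e\<in>touch n \<inter> B \<times> B. incr f e)"
      unfolding S_def using finG
    proof (induction G rule: finite_induct)
      case (insert B G)
      have "(\<Sum>e\<in>(\<Union>B\<in>insert B G. touch n \<inter> B \<times> B). incr f e)
        \<le> (\<Sum>e\<in>touch n \<inter> B \<times> B. incr f e) + (\<Sum>e\<in>(\<Union>B\<in>G. touch n \<inter> B \<times> B). incr f e)"
        unfolding UN_insert using insert finite_touch
        by (subst sum_Un) (auto simp: incr_nonneg sum_nonneg)
      with insert show ?case by simp
    qed simp
  qed simp
  finally show ?thesis unfolding energy_eq by (simp add: sum_divide_distrib[symmetric])
qed

text \<open>
  An edge between descendants of A is counted once for each member of the covering that contains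
  the ancestors of both endpoints, hence at most NT times.
\<close>

lemma cover_desc_energy_le:
  assumes cov: "covers n A NT NE G" and A: "A \<subseteq> lev n"
  shows "(\<Sum>B\<in>G. energy_on (n + l) (dscs l B) f)
      \<le> real NT * energy_on (n + l) (dscs l A) f"
proof -
  let ?T = "\<lambda>B. touch (n + l) \<inter> dscs l B \<times> dscs l B"
  have finG: "finite G" and AG: "A = \<Union>G" and NT: "\<And>x. x \<in> A \<Longrightarrow> card {B \<in> G. x \<in> B} \<le> NT"
    using cov by (auto simp: is_covering_def)
  have eq: "?T B = {e \<in> ?T A. e \<in> ?T B}" if "B \<in> G" for B
    using that AG by (auto simp: desc_set_def)
  have "(\<Sum>B\<in>G. \<Sum>e\<in>?T B. incr f e) = (\<Sum>B\<in>G. \<Sum>e\<in>{e \<in> ?T A. e \<in> ?T B}. incr f e)"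
    using eq by (intro sum.cong) auto
  also have "\<dots> = (\<Sum>e\<in>?T A. \<Sum>B\<in>{B \<in> G. e \<in> ?T B}. incr f e)"
    by (rule sum.swap_restrict) (use finG finite_touch in auto)
  also have "\<dots> = (\<Sum>e\<in>?T A. real (card {B \<in> G. e \<in> ?T B}) * incr f e)" by simp
  also have "\<dots> \<le> (\<Sum>e\<in>?T A. real NT * incr f e)"
  proof (intro sum_mono mult_right_mono)
    fix e assume e: "e \<in> ?T A"
    obtain u v where uv: "e = (u, v)" by force
    have "card {B \<in> G. e \<in> ?T B} \<le> card {B \<in> G. (par ^^ l) u \<in> B}"
      by (rule card_mono) (use finG in \<open>auto simp: uv desc_set_iff\<close>)
    also have "\<dots> \<le> NT" using NT e by (auto simp: uv desc_set_iff)
    finally show "real (card {B \<in> G. e \<in> ?T B}) \<le> real NT" by simp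
  qed (rule incr_nonneg)
  finally show ?thesis unfolding energy_eq
    by (simp add: sum_divide_distrib[symmetric] sum_distrib_left)
qed

text \<open>
  The conventions 0/0 = 0 and a/0 = \<open>\<infinity>\<close> make a finite bound for the
  quotient valid as an inequality also when the denominator vanishes.
\<close>

lemma poincare_le:
  assumes "sysc J p k \<le> ennreal s" "A \<in> J" "A \<subseteq> lev n" "0 \<le> s"
  shows "energy_on n A (avg k f) \<le> s * energy_on (n + k) (dscs k A) f"
proof -
  let ?a = "energy_on n A (avg k f)" and ?b = "energy_on (n + k) (dscs k A) f"
  have "ennreal ?a / ennreal ?b \<le> poincare_const E root K m p k n A"
    unfolding poincare_const_def by (rule SUP_upper) simp
  also have "\<dots> \<le> sysc J p k"
    unfolding system_const_def using assms(2,3) by (intro SUP_upper2[of n] SUP_upper2[of A]) auto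
  also note assms(1)
  finally have le: "ennreal ?a / ennreal ?b \<le> ennreal s" .
  have a: "0 \<le> ?a" and b: "0 \<le> ?b" using energy_nonneg by auto
  show ?thesis
  proof (cases "?b = 0")
    case True
    have "?a = 0"
    proof (rule ccontr)
      assume "?a \<noteq> 0"
      then have "ennreal ?a / ennreal ?b = \<top>" using a True
        by (simp add: ennreal_divide_zero ennreal_eq_0_iff)
      with le show False by (simp add: top_unique)
    qed
    then show ?thesis using True by simp
  next
    case False
    then have "0 < ?b" using b by simp
    then have "ennreal (?a / ?b) \<le> ennreal s" using le a by (simp add: divide_ennreal)
    then have "?a / ?b \<le> s" using assms(4) by simp
    then show ?thesis using \<open>0 < ?b\<close> by (simp add: field_simps)
  qed
qed

lemma cover_poincare:
  assumes cov: "covers n A NT NE G" and A: "A \<subseteq> lev n" and G: "G \<subseteq> {A \<in> J. A \<subseteq> lev n}"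
    and s: "sysc J p l \<le> ennreal s" "0 \<le> s"
  shows "energy_on n A (avg l f)
    \<le> real (N ^ NE * N ^ NE) * real NE powr p * real NT * s * energy_on (n + l) (dscs l A) f"
proof -
  let ?C = "real (N ^ NE * N ^ NE) * real NE powr p"
  have "energy_on n A (avg l f) \<le> ?C * (\<Sum>B\<in>G. energy_on n B (avg l f))"
    by (rule cover_energy_le[OF cov A])
  also have "\<dots> \<le> ?C * (\<Sum>B\<in>G. s * energy_on (n + l) (dscs l B) f)"
    using G s by (intro mult_left_mono sum_mono poincare_le[where J = J]) auto
  also have "\<dots> = ?C * s * (\<Sum>B\<in>G. energy_on (n + l) (dscs l B) f)"
    by (simp add: sum_distrib_left mult_ac)
  also have "\<dots> \<le> ?C * s * (real NT * energy_on (n + l) (dscs l A) f)"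
    using s by (intro mult_left_mono cover_desc_energy_le[OF cov A]) auto
  finally show ?thesis by (simp add: mult_ac)
qed

lemma covering_systemE:
  assumes "covering_system E root K J"
  obtains NT NE where "\<forall>w. \<forall>k\<ge>1. \<exists>G \<subseteq> {A \<in> J. A \<subseteq> lev (ht w + k)}. covers (ht w + k) (dsc k w) NT NE G"
    and "\<forall>B\<in>J. \<forall>n. B \<subseteq> lev n \<longrightarrow> (\<forall>k. \<exists>G \<subseteq> {A \<in> J. A \<subseteq> lev (n + k)}.
         covers (n + k) (dscs k B) NT NE G)"
  using assms unfolding covering_system_def by (elim conjE exE) (rule that)

text \<open>
  A whole level consists of the descendants of the root, so the covering system provides a
  covering of it, with numbers that do not depend on the level. Level 0 is a single vertex and
  carries no energy.
\<close>

lemma level_poincare: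
  assumes "covering_system E root K J"
  shows "\<exists>C>0. \<forall>n l s f. sysc J p l \<le> ennreal s \<longrightarrow> 0 \<le> s \<longrightarrow>
           en n (avg l f) \<le> C * s * en (n + l) f"
proof -
  obtain NT NE where cov: "\<forall>w. \<forall>k\<ge>1. \<exists>G \<subseteq> {A \<in> J. A \<subseteq> lev (ht w + k)}. covers (ht w + k) (dsc k w) NT NE G"
    by (rule covering_systemE[OF assms])
  define C where "C = real (N ^ NE * N ^ NE) * real NE powr p * real NT"
  have C0: "0 \<le> C" by (simp add: C_def)
  have main: "en n (avg l f) \<le> (C + 1) * s * en (n + l) f"
    if s: "sysc J p l \<le> ennreal s" "0 \<le> s" for n l s f
  proof (cases "n = 0")
    case True
    have "touch 0 \<subseteq> {(root, root)}" by (auto simp: touch_def level_iff)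
    then have "(\<Sum>e\<in>touch 0. incr (avg l f) e) \<le> (\<Sum>e\<in>{(root, root)}. incr (avg l f) e)"
      by (intro sum_mono2) (auto simp: incr_nonneg)
    then have "en n (avg l f) \<le> 0" by (simp add: True energy_level incr_def)
    also have "0 \<le> (C + 1) * s * en (n + l) f" using C0 s energy_nonneg by simp
    finally show ?thesis .
  next
    case False
    have h0: "ht root = 0" by simp
    from cov[rule_format, of n root] False obtain G where G: "G \<subseteq> {A \<in> J. A \<subseteq> lev n}"
      "covers n (lev n) NT NE G" unfolding h0 desc_root by auto
    have ds: "dscs l (lev n) = lev (n + l)"
      using funpow_par_level by (auto simp: desc_set_level[of "lev n" n])
    have "en n (avg l f) \<le> C * s * en (n + l) f"
      using cover_poincare[OF G(2) _ G(1) s, of f] by (simp add: C_def ds)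
    also have "\<dots> \<le> (C + 1) * s * en (n + l) f"
      using s energy_nonneg by (intro mult_right_mono) auto
    finally show ?thesis .
  qed
  show ?thesis using C0 main by (intro exI[of _ "C + 1"]) auto
qed

lemma system_const_le:
  assumes "\<And>n A f. A \<in> J \<Longrightarrow> A \<subseteq> lev n \<Longrightarrow>
      energy_on n A (avg k f) \<le> s * energy_on (n + k) (dscs k A) f" "0 \<le> s"
  shows "sysc J p k \<le> ennreal s"
  unfolding system_const_def poincare_const_def
proof (intro SUP_least)
  fix n A f assume "A \<in> {A \<in> J. A \<subseteq> lev n}"
  let ?a = "energy_on n A (avg k f)" and ?b = "energy_on (n + k) (dscs k A) f"
  have le: "?a \<le> s * ?b" and a: "0 \<le> ?a" and b: "0 \<le> ?b"
    using assms \<open>A \<in> _\<close> energy_nonneg by auto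
  show "ennreal ?a / ennreal ?b \<le> ennreal s"
  proof (cases "?b = 0")
    case True
    then show ?thesis using le a by simp
  next
    case False
    then have "0 < ?b" using b by simp
    moreover from this have "?a / ?b \<le> s" using le by (simp add: field_simps)
    ultimately show ?thesis using a by (simp add: divide_ennreal ennreal_leI)
  qed
qed

text \<open>
  Averaging over k + l generations is averaging twice; the intermediate level is covered by
  members of the system, on which the second Poincare constant applies.
\<close>

lemma system_const_submultiplicative:
  assumes "covering_system E root K J"
  shows "\<exists>C>0. \<forall>k l s t. sysc J p k \<le> ennreal s \<longrightarrow> sysc J p l \<le> ennreal t \<longrightarrow>
     0 \<le> s \<longrightarrow> 0 \<le> t \<longrightarrow> sysc J p (k + l) \<le> ennreal (C * s * t)"
proof -
  obtain NT NE where cov: "\<forall>B\<in>J. \<forall>n. B \<subseteq> lev n \<longrightarrow> (\<forall>k. \<exists>G \<subseteq> {A \<in> J. A \<subseteq> lev (n + k)}.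
         covers (n + k) (dscs k B) NT NE G)"
    by (rule covering_systemE[OF assms])
  define C where "C = real (N ^ NE * N ^ NE) * real NE powr p * real NT"
  have C0: "0 \<le> C" by (simp add: C_def)
  have main: "sysc J p (k + l) \<le> ennreal ((C + 1) * s * t)"
    if s: "sysc J p k \<le> ennreal s" "0 \<le> s" 
      and t: "sysc J p l \<le> ennreal t" "0 \<le> t" for k l s t
  proof (rule system_const_le)
    show "0 \<le> (C + 1) * s * t" using C0 s t by simp
    fix n A f assume A: "A \<in> J" "A \<subseteq> lev n"
    let ?A = "dscs k A"
    have Ak: "?A \<subseteq> lev (n + k)" using desc_set_level[OF A(2)] by blast
    have Akl: "dscs l ?A = dscs (k + l) A"
    proof (intro set_eqI)
      fix v
      have "v \<in> dscs l ?A \<longleftrightarrow> v \<in> lev (n + k + l) \<and> (par ^^ l) v \<in> lev (n + k) \<and> (par ^^ k) ((par ^^ l) v) \<in> A"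
        unfolding desc_set_level[OF Ak] desc_set_level[OF A(2)] ..
      also have "\<dots> \<longleftrightarrow> v \<in> lev (n + (k + l)) \<and> (par ^^ (k + l)) v \<in> A"
        using funpow_par_level[where w = v and n = "n + k" and k = l] by (auto simp: funpow_add add.assoc)
      finally show "v \<in> dscs l ?A \<longleftrightarrow> v \<in> dscs (k + l) A"
        unfolding desc_set_level[OF A(2)] .
    qed
    from cov[rule_format, OF A, of k] obtain G where G: "G \<subseteq> {A \<in> J. A \<subseteq> lev (n + k)}"
      "covers (n + k) ?A NT NE G" by blast
    have "energy_on n A (avg (k + l) f) = energy_on n A (avg k (avg l f))"
      by (simp add: avg_add[abs_def])
    also have "\<dots> \<le> s * energy_on (n + k) ?A (avg l f)"
      by (rule poincare_le[OF s(1) A s(2)])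
    also have "\<dots> \<le> s * (C * t * energy_on (n + k + l) (dscs l ?A) f)"
      using cover_poincare[OF G(2) Ak G(1) t, of f] s by (intro mult_left_mono) (auto simp: C_def)
    also have "\<dots> \<le> (C + 1) * s * t * energy_on (n + (k + l)) (dscs (k + l) A) f"
      unfolding Akl using s t energy_nonneg by (auto simp: algebra_simps add.assoc)
    finally show "energy_on n A (avg (k + l) f)
       \<le> (C + 1) * s * t * energy_on (n + (k + l)) (dscs (k + l) A) f" .
  qed
  show ?thesis using C0 main by (intro exI[of _ "C + 1"]) auto
qed

section \<open>Capacities\<close>

abbreviation "cap \<equiv> nbhd_capacity E root K Mst p"

lemma card_touch2: "finite {v. (w, v) \<in> touch n} \<and> card {v. (w, v) \<in> touch n} \<le> N"
proof -
  have "{v. (w, v) \<in> touch n} = {v. (v, w) \<in> touch n}" using touch_sym by auto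
  then show ?thesis using card_touch by simp
qed

text \<open>
  The test functions for the capacity between the k-th generation of w and the descendants of the
  complement of its neighbourhood, expressed by the iterated parent map.
\<close>

definition admissible :: "nat \<Rightarrow> 't \<Rightarrow> ('t \<Rightarrow> real) \<Rightarrow> bool" where
  "admissible k w f \<longleftrightarrow> (\<forall>v\<in>dsc k w. f v = 0) \<and>
     (\<forall>v\<in>lev (ht w + k). ((par ^^ k) v, w) \<notin> touch (ht w) ^^ Mst \<longrightarrow> f v = 1)"

lemma admissible_eq:
  "capacity E root K p (ht w + k) (dsc k w) (dscs k (lev (ht w) - nbhd Mst w)) (lev (ht w + k))
     = (INF f\<in>Collect (admissible k w). ennreal (en (ht w + k) f))"
proof -
  have "dscs k (lev (ht w) - nbhd Mst w)
      = {v \<in> lev (ht w + k). ((par ^^ k) v, w) \<notin> touch (ht w) ^^ Mst}"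
  proof (intro set_eqI)
    fix v
    have sub: "lev (ht w) - nbhd Mst w \<subseteq> lev (ht w)" by auto
    show "v \<in> dscs k (lev (ht w) - nbhd Mst w)
      \<longleftrightarrow> v \<in> {v \<in> lev (ht w + k). ((par ^^ k) v, w) \<notin> touch (ht w) ^^ Mst}"
      unfolding desc_set_level[OF sub]
      using funpow_par_level[where w = v and n = "ht w" and k = k] by (auto simp: cell_nbhd_eq)
  qed
  then show ?thesis unfolding capacity_def admissible_def by (intro INF_cong) auto
qed

lemma cap_eq: "cap k = (SUP w. INF f\<in>Collect (admissible k w). ennreal (en (ht w + k) f))"
  unfolding nbhd_capacity_def admissible_eq ..

lemma cap_le:
  assumes "\<And>w. \<exists>f. admissible k w f \<and> en (ht w + k) f \<le> c"
  shows "cap k \<le> ennreal c"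
  unfolding cap_eq
proof (rule SUP_least)
  fix w
  obtain f where "admissible k w f" "en (ht w + k) f \<le> c" using assms by blast
  then show "(INF f\<in>Collect (admissible k w). ennreal (en (ht w + k) f)) \<le> ennreal c"
    by (intro INF_lower2[of f]) (auto intro: ennreal_leI)
qed

lemma cap_ge:
  assumes "\<And>f. admissible k w f \<Longrightarrow> c \<le> en (ht w + k) f"
  shows "ennreal c \<le> cap k"
  unfolding cap_eq
  by (intro SUP_upper2[of w] INF_greatest) (auto intro: ennreal_leI assms)

lemma cap_admissible:
  assumes "cap k < ennreal c"
  shows "\<exists>f. admissible k w f \<and> en (ht w + k) f \<le> c"
proof -
  have "(INF f\<in>Collect (admissible k w). ennreal (en (ht w + k) f)) \<le> cap k"
    unfolding cap_eq by (rule SUP_upper) simp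
  also note assms
  finally obtain f where f: "admissible k w f" "ennreal (en (ht w + k) f) < ennreal c"
    unfolding INF_less_iff by auto
  then show ?thesis using energy_nonneg by (auto simp: ennreal_less_iff intro: less_imp_le)
qed

lemma admissible_exists:
  "admissible k w (\<lambda>v. if ((par ^^ k) v, w) \<in> touch (ht w) ^^ Mst then 0 else 1)"
proof -
  have "w \<in> lev (ht w)" by (simp add: level_iff)
  then show ?thesis using touch_pow_refl by (auto simp: admissible_def desc_iff)
qed

text \<open>
  The indicator of the descendants of far vertices is admissible, and the number of edges where it
  jumps is bounded in terms of N, Mst, k and the number of children, independently of w.
\<close>

lemma cap_finite: "\<exists>c. cap k \<le> ennreal c"
proof (intro exI[of _ "real (N ^ Mst * L ^ k * N)"] cap_le)
  fix w
  let ?f = "\<lambda>v. if ((par ^^ k) v, w) \<in> touch (ht w) ^^ Mst then 0 else 1 :: real"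
  let ?n = "ht w + k"
  define D where "D = (\<Union>u\<in>{u. (u, w) \<in> touch (ht w) ^^ Mst}. dsc k u)"
  have fD: "finite D" unfolding D_def using card_touch_pow finite_desc by blast
  have "card D \<le> (\<Sum>u\<in>{u. (u, w) \<in> touch (ht w) ^^ Mst}. card (dsc k u))"
    unfolding D_def by (rule card_UN_le) (use card_touch_pow in auto)
  also have "\<dots> \<le> card {u. (u, w) \<in> touch (ht w) ^^ Mst} * L ^ k"
    using sum_bounded_above[of "{u. (u, w) \<in> touch (ht w) ^^ Mst}" _ "L ^ k"] card_desc by auto
  also have "\<dots> \<le> N ^ Mst * L ^ k" using card_touch_pow by simp
  finally have cD: "card D \<le> N ^ Mst * L ^ k" .
  define X where "X = (SIGMA u:D. {v. (u, v) \<in> touch ?n})"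
  define Y where "Y = (\<lambda>(u, v). (v, u)) ` X"
  have fX: "finite X" unfolding X_def using fD card_touch2 by auto
  have "card X = (\<Sum>u\<in>D. card {v. (u, v) \<in> touch ?n})"
    unfolding X_def by (rule card_SigmaI) (use fD card_touch2 in auto)
  also have "\<dots> \<le> card D * N"
    using sum_bounded_above[of D _ N] card_touch2 by auto
  also have "\<dots> \<le> N ^ Mst * L ^ k * N" using cD by simp
  finally have cX: "card X \<le> N ^ Mst * L ^ k * N" .
  have cY: "card Y \<le> card X" "finite Y" unfolding Y_def using fX by (auto intro: card_image_le)
  have inD: "v \<in> D" if "v \<in> lev ?n" "((par ^^ k) v, w) \<in> touch (ht w) ^^ Mst" for v
    using that level_desc by (auto simp: D_def)
  have "(\<Sum>e\<in>touch ?n. incr ?f e) = (\<Sum>e\<in>touch ?n \<inter> (X \<union> Y). incr ?f e)"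
  proof (rule sum.mono_neutral_right)
    show "\<forall>e\<in>touch ?n - touch ?n \<inter> (X \<union> Y). incr ?f e = 0"
    proof
      fix e assume e: "e \<in> touch ?n - touch ?n \<inter> (X \<union> Y)"
      obtain u v where uv: "e = (u, v)" by force
      have t: "(u, v) \<in> touch ?n" "(v, u) \<in> touch ?n" "u \<in> lev ?n" "v \<in> lev ?n"
        using e uv touch_sym by (auto simp: touch_def)
      have "u \<notin> D" using e t by (auto simp: X_def uv)
      moreover have "v \<notin> D"
      proof
        assume "v \<in> D"
        then have "(v, u) \<in> X" using t by (auto simp: X_def)
        then have "(u, v) \<in> Y" unfolding Y_def by (rule rev_image_eqI) simp
        then show False using e uv by auto
      qed
      ultimately show "incr ?f e = 0" using inD t by (auto simp: incr_def uv)
    qed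
  qed (auto simp: finite_touch)
  also have "\<dots> \<le> (\<Sum>e\<in>touch ?n \<inter> (X \<union> Y). 1)" by (intro sum_mono) (auto simp: incr_def)
  also have "\<dots> \<le> real (card (X \<union> Y))" using fX cY by (simp add: card_mono)
  also have "\<dots> \<le> real (card X + card Y)" by (intro of_nat_mono card_Un_le)
  also have "\<dots> \<le> 2 * real (N ^ Mst * L ^ k * N)" using cX cY by linarith
  finally have "en ?n ?f \<le> real (N ^ Mst * L ^ k * N)" unfolding energy_level by simp
  then show "\<exists>f. admissible k w f \<and> en (ht w + k) f \<le> real (N ^ Mst * L ^ k * N)"
    using admissible_exists by blast
qed

lemma level_connected: "u \<in> lev n \<Longrightarrow> v \<in> lev n \<Longrightarrow> (u, v) \<in> touch n ^^ card (lev n \<times> lev n)"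
  using connected_chain[OF finite_level, of n n u v] connected_K[of root]
  relpow_subset_mono[of "touch n \<inter> lev n \<times> lev n" "touch n"]
  by (auto simp: K_level K_root)

text \<open>
  A crude bound, with a constant depending on the level; it is applied at one fixed level, or
  where only the vanishing or the positivity of an energy matters.
\<close>

lemma energy_separates:
  assumes "u \<in> lev n" "v \<in> lev n"
  shows "\<bar>f u - f v\<bar> powr p \<le> (real (N ^ card (lev n \<times> lev n) * N ^ card (lev n \<times> lev n)) *
            real (card (lev n \<times> lev n)) powr p * 2) * en n f"
proof -
  have "(\<Sum>e\<in>{(u, v)}. incr f e) \<le> real (N ^ card (lev n \<times> lev n) * N ^ card (lev n \<times> lev n)) *
            real (card (lev n \<times> lev n)) powr p * (\<Sum>e\<in>touch n. incr f e)"
    by (rule chain_sum_le) (use assms level_connected[OF assms] in auto)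
  then show ?thesis by (simp add: energy_level incr_def)
qed

text \<open>
  The number of vertices of a level grows at least like 2^n, whereas the neighbourhoods of radius
  Mst have at most N^Mst elements.
\<close>

lemma far_vertices: "\<exists>n u v. u \<in> lev n \<and> v \<in> lev n \<and> (v, u) \<notin> touch n ^^ Mst"
proof -
  obtain n where n: "N ^ Mst < 2 ^ n" using less_exp by blast
  obtain u where u: "u \<in> lev n" using desc_nonempty[of n root] desc_root by auto
  have "card {v. (v, u) \<in> touch n ^^ Mst} < card (lev n)"
    using n card_desc_ge[of n root] card_touch_pow[where w = u and n = n and i = Mst] by (simp add: desc_root)
  then have "\<not> lev n \<subseteq> {v. (v, u) \<in> touch n ^^ Mst}"
    using card_mono card_touch_pow by (metis not_less)
  then show ?thesis using u by blast
qed

lemma cap_positive: "0 < cap k"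
proof -
  obtain n u v where uv: "u \<in> lev n" "v \<in> lev n" "(v, u) \<notin> touch n ^^ Mst" using far_vertices by blast
  obtain u' v' where d: "u' \<in> dsc k u" "v' \<in> dsc k v" using desc_nonempty by meson
  have l: "u' \<in> lev (n + k)" "v' \<in> lev (n + k)" using d uv desc_level by auto
  define C where "C = real (N ^ card (lev (n+k) \<times> lev (n+k)) * N ^ card (lev (n+k) \<times> lev (n+k))) *
            real (card (lev (n+k) \<times> lev (n+k))) powr p * 2"
  have le: "1 \<le> C * en (ht u + k) f" if f: "admissible k u f" for f
  proof -
    have hu: "ht u = n" using uv by (simp add: level_iff)
    have "f u' = 0" "f v' = 1" using f d l uv by (auto simp: admissible_def hu desc_iff)
    then show ?thesis using energy_separates[OF l, of f] by (simp add: C_def hu)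
  qed
  have "0 \<le> C" by (simp add: C_def)
  have "C \<noteq> 0" using le[OF admissible_exists] by auto
  with \<open>0 \<le> C\<close> have C: "0 < C" by simp
  then have "ennreal (1 / C) \<le> cap k" 
    using le by (intro cap_ge[of k u]) (simp add: field_simps)
  moreover have "0 < ennreal (1 / C)" using C by simp
  ultimately show ?thesis by (rule less_le_trans[rotated])
qed

text \<open>
  At a level that is wide enough to contain two vertices u and v at distance more than Mst, the
  averages of a test function for u are 0 at u and 1 at v. So its averaged energy is bounded
  below, and the Poincare inequality transfers this to the energy of the test function itself.
\<close>

lemma cap_system_lower:
  assumes "covering_system E root K J"
  shows "\<exists>c>0. \<forall>k s. sysc J p k \<le> ennreal s \<longrightarrow> 0 \<le> s \<longrightarrow> 0 < s \<and> ennreal (c / s) \<le> cap k"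
proof -
  obtain n u v where uv: "u \<in> lev n" "v \<in> lev n" "(v, u) \<notin> touch n ^^ Mst" using far_vertices by blast
  obtain C where C: "0 < C" and le: "\<And>n l s f. sysc J p l \<le> ennreal s \<Longrightarrow> 0 \<le> s \<Longrightarrow>
           en n (avg l f) \<le> C * s * en (n + l) f" using level_poincare[OF assms] by blast
  define B where "B = real (N ^ card (lev n \<times> lev n) * N ^ card (lev n \<times> lev n)) *
            real (card (lev n \<times> lev n)) powr p * 2"
  have B0: "0 \<le> B" by (simp add: B_def)
  have hu: "ht u = n" using uv by (simp add: level_iff)
  have main: "1 \<le> (B * C) * s * en (ht u + k) f"
    if s: "sysc J p k \<le> ennreal s" "0 \<le> s" and f: "admissible k u f" for s k f
  proof -
    have "avg k f u = 0" by (rule avg_const) (use f in \<open>auto simp: admissible_def\<close>)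
    moreover have "avg k f v = 1" 
      by (rule avg_const) (use f uv desc_level in \<open>auto simp: admissible_def hu desc_iff\<close>)
    ultimately have "1 \<le> B * en n (avg k f)"
      using energy_separates[OF uv(1,2), of "avg k f"] by (simp add: B_def)
    also have "\<dots> \<le> B * (C * s * en (n + k) f)" using le[OF s] B0 by (intro mult_left_mono)
    finally show ?thesis by (simp add: hu mult_ac)
  qed
  have B: "0 < B" if s: "sysc J p k \<le> ennreal s" "0 \<le> s" for s k
    using main[OF s admissible_exists] B0 by (cases "B = 0") auto
  show ?thesis
  proof (intro exI[of _ "1 / ((B + 1) * C)"] conjI allI impI)
    show "0 < 1 / ((B + 1) * C)" using B0 C by simp
    fix k s assume s: "sysc J p k \<le> ennreal s" "0 \<le> s"
    show s0: "0 < s" using main[OF s admissible_exists] s by (cases "s = 0") auto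
    show "ennreal (1 / ((B + 1) * C) / s) \<le> cap k"
    proof (rule cap_ge)
      fix f assume "admissible k u f"
      from main[OF s this] have "1 \<le> (B * C) * s * en (ht u + k) f" .
      also have "\<dots> \<le> ((B + 1) * C) * s * en (ht u + k) f"
        using C s energy_nonneg by (intro mult_right_mono) auto
      finally have "1 \<le> en (ht u + k) f * (((B + 1) * C) * s)" by (simp add: mult_ac)
      then show "1 / ((B + 1) * C) / s \<le> en (ht u + k) f"
        using B0 C s0 unfolding divide_divide_eq_left by (subst pos_divide_le_eq) auto
    qed
  qed
qed

end

section \<open>Submultiplicativity of capacities\<close>

text \<open>
  If x i is the smaller minimum, compare at i; otherwise compare at the minimizer of y.
\<close>

lemma Min_image_diff_le:
  fixes x y :: "'i \<Rightarrow> real"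
  assumes "finite I" "I \<noteq> {}"
  shows "\<exists>i\<in>I. \<bar>Min (x ` I) - Min (y ` I)\<bar> \<le> \<bar>x i - y i\<bar>"
proof -
  have att: "\<exists>i\<in>I. Min (z ` I) = z i" for z :: "'i \<Rightarrow> real"
    using Min_in[of "z ` I"] assms by (metis (mono_tags) finite_imageI imageE image_is_empty)
  have low: "Min (z ` I) \<le> z i" if "i \<in> I" for z :: "'i \<Rightarrow> real" and i
    using that assms by (intro Min_le) auto
  obtain i where i: "i \<in> I" "Min (x ` I) = x i" using att by blast
  obtain j where j: "j \<in> I" "Min (y ` I) = y j" using att by blast
  show ?thesis
  proof (cases "x i \<le> y j")
    case True
    then show ?thesis using i j low[of i y] by (intro bexI[of _ i]) auto
  next
    case False
    then show ?thesis using i j low[of j x] by (intro bexI[of _ j]) auto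
  qed
qed

context cell_partition
begin

text \<open>
  The minimum of test functions for several vertices is a test function for their union, at the
  price of adding up the energies. Absolute values keep the minimum nonnegative.
\<close>

lemma energy_Min_le:
  assumes "finite I" "I \<noteq> {}"
  shows "en n (\<lambda>u. Min ((\<lambda>v. \<bar>f v u\<bar>) ` I)) \<le> (\<Sum>v\<in>I. en n (f v))"
proof -
  have "(\<Sum>e\<in>touch n. incr (\<lambda>u. Min ((\<lambda>v. \<bar>f v u\<bar>) ` I)) e) \<le> (\<Sum>e\<in>touch n. \<Sum>v\<in>I. incr (f v) e)"
  proof (rule sum_mono)
    fix e
    obtain v where v: "v \<in> I" "\<bar>Min ((\<lambda>v. \<bar>f v (fst e)\<bar>) ` I) - Min ((\<lambda>v. \<bar>f v (snd e)\<bar>) ` I)\<bar>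
        \<le> \<bar>\<bar>f v (fst e)\<bar> - \<bar>f v (snd e)\<bar>\<bar>"
      using Min_image_diff_le[OF assms, of "\<lambda>v. \<bar>f v (fst e)\<bar>" "\<lambda>v. \<bar>f v (snd e)\<bar>"] by blast
    then have "\<bar>Min ((\<lambda>v. \<bar>f v (fst e)\<bar>) ` I) - Min ((\<lambda>v. \<bar>f v (snd e)\<bar>) ` I)\<bar>
        \<le> \<bar>f v (fst e) - f v (snd e)\<bar>" by linarith
    then have "incr (\<lambda>u. Min ((\<lambda>v. \<bar>f v u\<bar>) ` I)) e \<le> incr (f v) e"
      unfolding incr_def using p0 by (intro powr_mono2) auto
    also have "\<dots> \<le> (\<Sum>v\<in>I. incr (f v) e)"
      using v assms by (intro member_le_sum) (auto simp: incr_nonneg)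
    finally show "incr (\<lambda>u. Min ((\<lambda>v. \<bar>f v u\<bar>) ` I)) e \<le> (\<Sum>v\<in>I. incr (f v) e)" .
  qed
  also have "\<dots> = (\<Sum>v\<in>I. \<Sum>e\<in>touch n. incr (f v) e)" by (rule sum.swap)
  finally show ?thesis unfolding energy_level by (simp add: sum_divide_distrib[symmetric])
qed

text \<open>
  The product of the constants from the pointwise gluing estimate, from passing from
  neighbourhoods of radius Mst + 1 to edges, and from the number of vertices in such a
  neighbourhood.
\<close>

definition glue_const :: real where
  "glue_const = (2 * real (N ^ (Mst + 1)) ^ 2) powr p * (real (N ^ (Mst + 1) * N ^ (Mst + 1)) * real (Mst + 1) powr p * 2)
      * real (N ^ (Mst + 1))"

text \<open>
  The functions |1 - g u| are at least 1 on the descendants of u and vanish outside the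
  descendants of its neighbourhood, so normalizing them gives a partition of unity at level n + l.
  Interpolating f with it costs, at an edge lying over z, the increments of f near z times the
  increments of the g u for u near z. Summed over all edges the latter give the capacity bound c,
  and the former the energy of f.
\<close>

lemma glue_energy_le:
  assumes h: "\<And>u. u \<in> lev n \<Longrightarrow> admissible l u (g u)" and e: "\<And>u. u \<in> lev n \<Longrightarrow> en (n + l) (g u) \<le> c"
  shows "en (n + l) (\<lambda>x. (\<Sum>u\<in>lev n. f u * \<bar>1 - g u x\<bar>) / (\<Sum>u\<in>lev n. \<bar>1 - g u x\<bar>)) \<le> glue_const * c * en n f"
proof -
  define hh where "hh = (\<lambda>u x. \<bar>1 - g u x\<bar>)"
  define F where "F = (\<lambda>x. (\<Sum>u\<in>lev n. f u * hh u x) / (\<Sum>u\<in>lev n. hh u x))"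
  define U where "U = (\<lambda>z. {u. (u, z) \<in> touch n ^^ (Mst + 1)})"
  define A where "A = (\<lambda>z. \<Sum>u\<in>U z. \<bar>f u - f z\<bar> powr p)"
  let ?n = "real (N ^ (Mst + 1))"
  have A0: "0 \<le> A z" for z by (auto simp: A_def intro: sum_nonneg)
  have one: "1 \<le> (\<Sum>u\<in>lev n. hh u x)" if "x \<in> lev (n + l)" for x
  proof -
    have z: "(par ^^ l) x \<in> lev n" using that by (rule funpow_par_level)
    have "hh ((par ^^ l) x) x = 1"
      using h[OF z] level_desc[OF that] by (simp add: hh_def admissible_def)
    moreover have "hh ((par ^^ l) x) x \<le> (\<Sum>u\<in>lev n. hh u x)"
      using z finite_level by (intro member_le_sum) (auto simp: hh_def)
    ultimately show ?thesis by simp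
  qed
  have supp: "((par ^^ l) x, u) \<in> touch n ^^ Mst" if "x \<in> lev (n + l)" "u \<in> lev n" "hh u x \<noteq> 0" for x u
  proof (rule ccontr)
    assume c: "((par ^^ l) x, u) \<notin> touch n ^^ Mst"
    have "ht u = n" using that by (simp add: level_iff)
    then have "g u x = 1" using c h[OF that(2)] that(1) by (auto simp: admissible_def)
    then show False using that by (simp add: hh_def)
  qed
  have U_sub: "U z \<subseteq> lev n" if "z \<in> lev n" for z
    using touch_pow_level[OF touch_pow_sym] that unfolding U_def by blast
  have pw: "incr F e \<le> (2 * ?n ^ 2) powr p * (A ((par ^^ l) (fst e)) * (\<Sum>u\<in>U ((par ^^ l) (fst e)). incr (g u) e))"
    if e: "e \<in> touch (n + l)" for e
  proof -
    obtain x y where xy: "e = (x, y)" by force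
    have x: "x \<in> lev (n + l)" and y: "y \<in> lev (n + l)" using e by (auto simp: xy touch_def)
    define z where "z = (par ^^ l) x"
    have z: "z \<in> lev n" unfolding z_def using x by (rule funpow_par_level)
    have zy: "(z, (par ^^ l) y) \<in> touch n" unfolding z_def using e by (auto simp: xy intro: touch_par)
    have "\<bar>F x - F y\<bar> powr p \<le> (2 * ?n ^ 2) powr p *
        ((\<Sum>u\<in>U z. \<bar>f u - f z\<bar> powr p) * (\<Sum>u\<in>U z. \<bar>hh u x - hh u y\<bar> powr p))"
      unfolding F_def
    proof (rule glue_powr_le)
      show "U z \<subseteq> lev n" by (rule U_sub) (rule z)
      show "card (U z) \<le> N ^ (Mst + 1)" using card_touch_pow unfolding U_def by blast
      show "1 \<le> (\<Sum>u\<in>lev n. hh u x)" "1 \<le> (\<Sum>u\<in>lev n. hh u y)" using one x y by auto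
      fix u assume u: "u \<in> lev n - U z"
      have "hh u x = 0"
      proof (rule ccontr)
        assume "hh u x \<noteq> 0"
        then have "(u, z) \<in> touch n ^^ Mst" using supp[OF x] u touch_pow_sym by (auto simp: z_def)
        then have "u \<in> U z" unfolding U_def mem_Collect_eq
          by (rule touch_pow_mono[rotated 2]) (use u in auto)
        with u show False by simp
      qed
      moreover have "hh u y = 0"
      proof (rule ccontr)
        assume "hh u y \<noteq> 0"
        then have "(u, (par ^^ l) y) \<in> touch n ^^ Mst" using supp[OF y] u touch_pow_sym by auto
        then have "u \<in> U z" using touch_sym[OF zy] by (auto simp: U_def)
        with u show False by simp
      qed
      ultimately show "hh u x = 0 \<and> hh u y = 0" by simp
    qed (use finite_level p0 in \<open>auto simp: hh_def\<close>)
    also have "\<dots> \<le> (2 * ?n ^ 2) powr p * ((\<Sum>u\<in>U z. \<bar>f u - f z\<bar> powr p) * (\<Sum>u\<in>U z. incr (g u) e))"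
    proof (intro mult_left_mono sum_mono)
      fix u
      show "\<bar>hh u x - hh u y\<bar> powr p \<le> incr (g u) e"
        unfolding incr_def xy using p0 by (intro powr_mono2) (auto simp: hh_def)
    qed (auto intro: sum_nonneg)
    finally show ?thesis by (simp add: incr_def xy A_def z_def)
  qed
  have "(\<Sum>e\<in>touch (n + l). incr F e) \<le> (\<Sum>e\<in>touch (n + l). (2 * ?n ^ 2) powr p * (\<Sum>z\<in>lev n. A z * (\<Sum>u\<in>U z. incr (g u) e)))"
  proof (rule sum_mono)
    fix e assume e: "e \<in> touch (n + l)"
    have "(par ^^ l) (fst e) \<in> lev n" using e funpow_par_level by (auto simp: touch_def)
    then have "A ((par ^^ l) (fst e)) * (\<Sum>u\<in>U ((par ^^ l) (fst e)). incr (g u) e) \<le> (\<Sum>z\<in>lev n. A z * (\<Sum>u\<in>U z. incr (g u) e))"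
      using finite_level A0 by (intro member_le_sum) (auto intro!: mult_nonneg_nonneg sum_nonneg simp: incr_nonneg)
    then have "(2 * ?n ^ 2) powr p * (A ((par ^^ l) (fst e)) * (\<Sum>u\<in>U ((par ^^ l) (fst e)). incr (g u) e))
       \<le> (2 * ?n ^ 2) powr p * (\<Sum>z\<in>lev n. A z * (\<Sum>u\<in>U z. incr (g u) e))"
      by (intro mult_left_mono) auto
    with pw[OF e] show "incr F e \<le> (2 * ?n ^ 2) powr p * (\<Sum>z\<in>lev n. A z * (\<Sum>u\<in>U z. incr (g u) e))" by linarith
  qed
  also have "\<dots> = (2 * ?n ^ 2) powr p * (\<Sum>z\<in>lev n. A z * (\<Sum>u\<in>U z. \<Sum>e\<in>touch (n + l). incr (g u) e))"
  proof -
    have "(\<Sum>e\<in>touch (n + l). \<Sum>z\<in>lev n. A z * (\<Sum>u\<in>U z. incr (g u) e))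
        = (\<Sum>z\<in>lev n. \<Sum>e\<in>touch (n + l). A z * (\<Sum>u\<in>U z. incr (g u) e))" by (rule sum.swap)
    also have "\<dots> = (\<Sum>z\<in>lev n. A z * (\<Sum>e\<in>touch (n + l). \<Sum>u\<in>U z. incr (g u) e))"
      by (simp add: sum_distrib_left)
    also have "\<dots> = (\<Sum>z\<in>lev n. A z * (\<Sum>u\<in>U z. \<Sum>e\<in>touch (n + l). incr (g u) e))"
      by (intro sum.cong refl arg_cong2[where f = "(*)"]) (rule sum.swap)
    finally show ?thesis by (simp add: sum_distrib_left[symmetric])
  qed
  also have "\<dots> \<le> (2 * ?n ^ 2) powr p * (\<Sum>z\<in>lev n. A z * (?n * (2 * c)))"
  proof (intro mult_left_mono sum_mono)
    fix z assume z: "z \<in> lev n"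
    have sub: "U z \<subseteq> lev n" by (rule U_sub) (rule z)
    have c0: "0 \<le> c" using e[OF z] energy_nonneg order.trans by blast
    have "(\<Sum>u\<in>U z. \<Sum>e\<in>touch (n + l). incr (g u) e) \<le> real (card (U z)) * (2 * c)"
    proof (rule sum_bounded_above)
      fix u assume "u \<in> U z"
      then have "en (n + l) (g u) \<le> c" using sub e by blast
      then show "(\<Sum>e\<in>touch (n + l). incr (g u) e) \<le> 2 * c" unfolding energy_level by linarith
    qed
    also have "\<dots> \<le> ?n * (2 * c)"
      using c0 card_touch_pow[where w = z and n = n and i = "Mst + 1"] unfolding U_def
      by (intro mult_right_mono of_nat_mono) auto
    finally show "(\<Sum>u\<in>U z. \<Sum>e\<in>touch (n + l). incr (g u) e) \<le> ?n * (2 * c)" .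
  qed (use A0 in auto)
  also have "\<dots> = (2 * ?n ^ 2) powr p * (?n * (2 * c)) * (\<Sum>z\<in>lev n. A z)"
    by (simp add: sum_distrib_left sum_distrib_right mult_ac)
  also have "\<dots> \<le> (2 * ?n ^ 2) powr p * (?n * (2 * c)) *
      (real (N ^ (Mst + 1) * N ^ (Mst + 1)) * real (Mst + 1) powr p * (2 * en n f))"
  proof (rule mult_left_mono)
    have fU: "finite (U z)" for z using card_touch_pow unfolding U_def by blast
    have "(\<Sum>z\<in>lev n. A z) = (\<Sum>(z, u)\<in>(SIGMA z:lev n. U z). \<bar>f u - f z\<bar> powr p)"
      unfolding A_def by (rule sum.Sigma) (use finite_level fU in auto)
    also have "\<dots> = (\<Sum>e\<in>{(u, v). u \<in> lev n \<and> (u, v) \<in> touch n ^^ (Mst + 1)}. incr f e)"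
      by (intro sum.cong) (auto simp: U_def incr_def abs_minus_commute touch_pow_sym simp del: relpow.simps add_Suc_right)
    also have "\<dots> \<le> real (N ^ (Mst + 1) * N ^ (Mst + 1)) * real (Mst + 1) powr p * (2 * en n f)"
      by (rule nbhd_sum_le)
    finally show "(\<Sum>z\<in>lev n. A z) \<le> \<dots>" .
    obtain z where "z \<in> lev n" using desc_nonempty[of n root] desc_root by auto
    then have "0 \<le> c" using e[of z] energy_nonneg order.trans by blast
    then show "0 \<le> (2 * ?n ^ 2) powr p * (?n * (2 * c))" by simp
  qed
  finally show ?thesis unfolding energy_level glue_const_def F_def hh_def by (simp add: mult_ac)
qed

text \<open>
  Given w, a test function of capacity k is taken for each vertex that lies j = 2 Mst levels below
  w, up to a distance of Mst. Their minimum is a function f, and f is interpolated l levels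
  further down. Interpolation looks up to Mst away, so f must vanish not only on the descendants
  of w but also on a neighbourhood of radius Mst; then it can differ from 1 only within distance 3
  Mst of the descendants of w. The 2 Mst additional levels shrink this distance to Mst at the
  level of w.
\<close>

lemma cap_submultiplicative:
  "\<exists>C>0. \<forall>k l a b. cap k \<le> ennreal a \<longrightarrow> cap l \<le> ennreal b \<longrightarrow> 0 < a \<longrightarrow> 0 < b \<longrightarrow>
     cap (2 * Mst + k + l) \<le> ennreal (C * a * b)"
proof -
  let ?j = "2 * Mst"
  define B where "B = real (L ^ ?j * N ^ Mst)"
  have main: "cap (?j + k + l) \<le> ennreal ((glue_const * B * 4 + 1) * a * b)"
    if ab: "cap k \<le> ennreal a" "cap l \<le> ennreal b" "0 < a" "0 < b" for k l a b
  proof (rule cap_le)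
    fix w
    define n where "n = ht w"
    have wn: "w \<in> lev n" by (simp add: n_def level_iff)
    \<comment> \<open>The infimum in the capacity need not be attained; twice the bound leaves room for a test function.\<close>
    have "cap k < ennreal (2 * a)" using ab by (intro le_less_trans[OF ab(1)]) (auto simp: ennreal_less_iff)
    then have "\<forall>v. \<exists>f. admissible k v f \<and> en (ht v + k) f \<le> 2 * a" using cap_admissible by blast
    then obtain fv where fv: "\<And>v. admissible k v (fv v)" "\<And>v. en (ht v + k) (fv v) \<le> 2 * a" by metis
    have "cap l < ennreal (2 * b)" using ab by (intro le_less_trans[OF ab(2)]) (auto simp: ennreal_less_iff)
    then have "\<forall>v. \<exists>f. admissible l v f \<and> en (ht v + l) f \<le> 2 * b" using cap_admissible by blast
    then obtain g where g: "\<And>v. admissible l v (g v)" "\<And>v. en (ht v + l) (g v) \<le> 2 * b" by metis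
    define V0 where "V0 = (\<Union>v1\<in>dsc ?j w. {v. (v, v1) \<in> touch (n + ?j) ^^ Mst})"
    have finV0: "finite V0" unfolding V0_def using finite_desc card_touch_pow by blast
    obtain v1 where v1: "v1 \<in> dsc ?j w" using desc_nonempty by blast
    then have "v1 \<in> lev (n + ?j)" using wn desc_level by blast
    then have "v1 \<in> V0" using v1 touch_pow_refl by (auto simp: V0_def)
    then have neV0: "V0 \<noteq> {}" by blast
    have levV0: "v \<in> lev (n + ?j)" if "v \<in> V0" for v
      using that wn desc_level touch_pow_level[OF touch_pow_sym] by (force simp: V0_def)
    have "card V0 \<le> (\<Sum>v1\<in>dsc ?j w. card {v. (v, v1) \<in> touch (n + ?j) ^^ Mst})"
      unfolding V0_def by (rule card_UN_le) (rule finite_desc)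
    also have "\<dots> \<le> card (dsc ?j w) * N ^ Mst"
      using sum_bounded_above[of "dsc ?j w" _ "N ^ Mst"] card_touch_pow by auto
    also have "\<dots> \<le> L ^ ?j * N ^ Mst" by (intro mult_right_mono card_desc) simp
    finally have cV0: "real (card V0) \<le> B" unfolding B_def by (rule of_nat_mono)
    define f where "f = (\<lambda>u. Min ((\<lambda>v. \<bar>fv v u\<bar>) ` V0))"
    have ef: "en (n + ?j + k) f \<le> B * (2 * a)"
    proof -
      have "en (n + ?j + k) f \<le> (\<Sum>v\<in>V0. en (n + ?j + k) (fv v))"
        unfolding f_def by (rule energy_Min_le[OF finV0 neV0])
      also have "\<dots> \<le> real (card V0) * (2 * a)"
      proof (rule sum_bounded_above)
        fix v assume "v \<in> V0"
        then have "ht v = n + ?j" using levV0 level_iff by blast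
        then show "en (n + ?j + k) (fv v) \<le> 2 * a" using fv(2)[of v] by metis
      qed
      also have "\<dots> \<le> B * (2 * a)" using cV0 ab by (intro mult_right_mono) auto
      finally show ?thesis .
    qed
    let ?V = "lev (n + ?j + k)"
    define hh where "hh = (\<lambda>u x. \<bar>1 - g u x\<bar>)"
    define F where "F = (\<lambda>x. (\<Sum>u\<in>?V. f u * hh u x) / (\<Sum>u\<in>?V. hh u x))"
    have eF: "en (n + ?j + k + l) F \<le> glue_const * (2 * b) * en (n + ?j + k) f"
      unfolding F_def hh_def
    proof (rule glue_energy_le)
      fix u assume "u \<in> lev (n + ?j + k)"
      then have "ht u = n + ?j + k" by (simp add: level_iff)
      then show "en (n + ?j + k + l) (g u) \<le> 2 * b" using g(2)[of u] by metis
    qed (rule g(1))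
    have gc: "0 \<le> glue_const" by (simp add: glue_const_def)
    have "glue_const * (2 * b) * en (n + ?j + k) f \<le> glue_const * (2 * b) * (B * (2 * a))"
      using ef gc ab by (intro mult_left_mono) auto
    also have "\<dots> \<le> (glue_const * B * 4 + 1) * a * b" using ab by (simp add: algebra_simps)
    finally have eF2: "en (n + ?j + k + l) F \<le> (glue_const * B * 4 + 1) * a * b" using eF by linarith
    have supp: "((par ^^ l) x, u) \<in> touch (n + ?j + k) ^^ Mst"
      if "x \<in> lev (n + ?j + k + l)" "u \<in> ?V" "hh u x \<noteq> 0" for x u
    proof (rule ccontr)
      assume c: "((par ^^ l) x, u) \<notin> touch (n + ?j + k) ^^ Mst"
      have "ht u = n + ?j + k" using that by (simp add: level_iff)
      then have "g u x = 1" using c g(1)[of u] that(1) by (auto simp: admissible_def)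
      then show False using that by (simp add: hh_def)
    qed
    have supp2: "((par ^^ (k + l)) x, (par ^^ k) u) \<in> touch (n + ?j) ^^ Mst"
      if "x \<in> lev (n + ?j + k + l)" "u \<in> ?V" "hh u x \<noteq> 0" for x u
      using touch_pow_par[OF supp[OF that]] by (simp add: funpow_add)
    have adm: "admissible (?j + k + l) w F"
      unfolding admissible_def
    proof (intro conjI ballI impI)
      fix x assume x: "x \<in> dsc (?j + k + l) w"
      have xl: "x \<in> lev (n + ?j + k + l)" using desc_level[OF x wn] by (simp add: add.assoc)
      have "(par ^^ (?j + (k + l))) x = w" using x by (simp add: desc_iff add.assoc)
      then have pj: "(par ^^ ?j) ((par ^^ (k + l)) x) = w" by (simp add: funpow_add)
      have xd: "(par ^^ (k + l)) x \<in> dsc ?j w"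
        using xl funpow_par_level[where w = x and n = "n + ?j" and k = "k + l"] wn pj
        by (simp add: desc_iff level_iff add.assoc)
      have z: "f u * hh u x = 0" if u: "u \<in> ?V" for u
      proof (cases "hh u x = 0")
        case False
        have "(par ^^ k) u \<in> V0"
          using touch_pow_sym[OF supp2[OF xl u False]] xd by (auto simp: V0_def)
        moreover have "fv ((par ^^ k) u) u = 0"
          using fv(1)[of "(par ^^ k) u"] level_desc[OF u] by (auto simp: admissible_def)
        ultimately have "f u \<le> 0" unfolding f_def using finV0
          by (intro Min_le) (auto intro!: rev_image_eqI)
        moreover have "0 \<le> f u" unfolding f_def using finV0 neV0 by (subst Min_ge_iff) auto
        ultimately show ?thesis by simp
      qed simp
      have "(\<Sum>u\<in>?V. f u * hh u x) = 0" by (rule sum.neutral) (use z in blast)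
      then show "F x = 0" unfolding F_def by simp
    next
      fix x assume x: "x \<in> lev (ht w + (?j + k + l))" and far: "((par ^^ (?j + k + l)) x, w) \<notin> touch (ht w) ^^ Mst"
      have xl: "x \<in> lev (n + ?j + k + l)" using x by (simp add: n_def add.assoc)
      have z: "f u * hh u x = hh u x" if u: "u \<in> ?V" for u
      proof (cases "hh u x = 0")
        case False
        have "\<bar>fv v u\<bar> = 1" if v: "v \<in> V0" for v
        proof -
          have "((par ^^ k) u, v) \<notin> touch (n + ?j) ^^ Mst"
          proof
            assume t2: "((par ^^ k) u, v) \<in> touch (n + ?j) ^^ Mst"
            obtain v1 where v1: "v1 \<in> dsc ?j w" "(v, v1) \<in> touch (n + ?j) ^^ Mst" using v by (auto simp: V0_def)
            have "((par ^^ (k + l)) x, v1) \<in> touch (n + ?j) ^^ (Mst + (Mst + Mst))"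
              unfolding relpow_add using supp2[OF xl u False] t2 v1 by blast
            then have "((par ^^ (k + l)) x, v1) \<in> touch (n + ?j) ^^ (Mst + (?j + 0))" by (simp add: mult_2)
            from touch_contract[OF this] have "((par ^^ (?j + (k + l))) x, w) \<in> touch n ^^ Mst"
              using v1 by (simp add: desc_iff funpow_add)
            then show False using far by (simp add: n_def add.assoc)
          qed
          then have "fv v u = 1" using fv(1)[of v] levV0[OF v] u by (auto simp: admissible_def level_iff)
          then show ?thesis by simp
        qed
        then have "(\<lambda>v. \<bar>fv v u\<bar>) ` V0 = {1}" using neV0 by auto
        then show ?thesis by (simp add: f_def)
      qed simp
      have "0 < (\<Sum>u\<in>?V. hh u x)"
      proof -
        have zz: "(par ^^ l) x \<in> ?V" using xl by (rule funpow_par_level)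
        have "hh ((par ^^ l) x) x = 1"
          using g(1)[of "(par ^^ l) x"] level_desc[OF xl] by (simp add: hh_def admissible_def)
        moreover have "hh ((par ^^ l) x) x \<le> (\<Sum>u\<in>?V. hh u x)"
          using zz finite_level by (intro member_le_sum) (auto simp: hh_def)
        ultimately show ?thesis by linarith
      qed
      moreover have "(\<Sum>u\<in>?V. f u * hh u x) = (\<Sum>u\<in>?V. hh u x)" by (rule sum.cong[OF refl z])
      ultimately show "F x = 1" unfolding F_def by simp
    qed
    show "\<exists>f. admissible (?j + k + l) w f \<and> en (ht w + (?j + k + l)) f \<le> (glue_const * B * 4 + 1) * a * b"
      using adm eF2 by (intro exI[of _ F]) (simp add: n_def add.assoc)
  qed
  have "0 < glue_const * B * 4 + 1"
  proof -
    have "0 \<le> glue_const * B * 4" by (simp add: glue_const_def B_def)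
    then show ?thesis by linarith
  qed
  then show ?thesis using main by blast
qed

section \<open>The scaling factor\<close>

abbreviation "\<sigma> \<equiv> scaling_factor E root K m Mst p"

definition is_scaling :: "real \<Rightarrow> bool" where
  "is_scaling s \<longleftrightarrow> 0 < s \<and>
     (\<exists>c1>0. \<exists>c2>0. \<exists>J. covering_system E root K J \<and>
        (\<forall>k. ennreal (c1 / s ^ k) \<le> cap k \<and> cap k \<le> ennreal (c2 / s ^ k) \<and>
             ennreal (c1 * s ^ k) \<le> sysc J p k \<and>
             sysc J p k \<le> ennreal (c2 * s ^ k)))"

text \<open>
  Two different scalings would make a power of their quotient bounded. The covering systems for s
  and t may differ, and therefore the comparison uses the capacities.
\<close>

lemma is_scaling_le:
  assumes "is_scaling s" "is_scaling t"
  shows "s \<le> t"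
proof (rule ccontr)
  assume "\<not> s \<le> t"
  then have st: "t < s" by simp
  obtain c where c: "0 < c" "\<And>k. ennreal (c / t ^ k) \<le> cap k" "0 < t"
    using assms(2) unfolding is_scaling_def by blast
  obtain d where d: "0 < d" "\<And>k. cap k \<le> ennreal (d / s ^ k)" "0 < s"
    using assms(1) unfolding is_scaling_def by blast
  have bd: "(s / t) ^ k \<le> d / c" for k
  proof -
    have "ennreal (c / t ^ k) \<le> ennreal (d / s ^ k)" using c d order.trans by blast
    then have "c / t ^ k \<le> d / s ^ k" using c d by (subst (asm) ennreal_le_iff) auto
    then show ?thesis using c d by (simp add: field_simps power_divide)
  qed
  have "1 < s / t" using st c by simp
  then obtain k where "d / c < (s / t) ^ k" using real_arch_pow by blast
  with bd[of k] show False by simp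
qed

text \<open>
  With s and e the Poincare constants and the capacities, c \<le> s k * e k \<le> S for all k. The
  submultiplicativity of e becomes the supermultiplicativity of s, so ln \<open>\<circ>\<close> s
  is additive up to a bounded error.
\<close>

lemma scaling_exists:
  assumes "conductively_homogeneous E root K m Mst p"
  shows "\<exists>s. is_scaling s"
proof -
  obtain J where J: "covering_system E root K J"
    and fin: "(SUP k. sysc J p k * cap k) < \<infinity>"
    using assms unfolding conductively_homogeneous_def by blast
  obtain S where S: "(SUP k. sysc J p k * cap k) = ennreal S" "0 \<le> S"
    using fin by (cases "(SUP k. sysc J p k * cap k)") auto
  have prod: "sysc J p k * cap k \<le> ennreal S" for k
    unfolding S(1)[symmetric] by (rule SUP_upper) simp
  define e where "e = (\<lambda>k. enn2real (cap k))"
  define s where "s = (\<lambda>k. enn2real (sysc J p k))"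
  have ce: "cap k = ennreal (e k)" for k
    using cap_finite[of k] unfolding e_def by (metis ennreal_enn2real ennreal_less_top le_less_trans)
  have epos: "0 < e k" for k using cap_positive[of k] ce[of k] by simp
  have cs: "sysc J p k = ennreal (s k)" for k
  proof -
    have "sysc J p k \<noteq> \<top>"
    proof
      assume "sysc J p k = \<top>"
      then have "\<top> * ennreal (e k) \<le> ennreal S" using prod[of k] ce by simp
      then show False using epos[of k] by (simp add: ennreal_top_mult top_unique)
    qed
    then show ?thesis unfolding s_def by (simp add: less_top)
  qed
  have s0: "0 \<le> s k" for k by (simp add: s_def)
  obtain c where c: "0 < c" "\<And>k. 0 < s k \<and> ennreal (c / s k) \<le> ennreal (e k)"
    using cap_system_lower[OF J] cs ce s0 by (metis order_refl)
  have spos: "0 < s k" for k using c by blast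
  have lower: "c \<le> s k * e k" for k
  proof -
    have "c / s k \<le> e k" using c(2)[of k] epos[of k] by (subst (asm) ennreal_le_iff) auto
    then show ?thesis using spos[of k] by (simp add: field_simps)
  qed
  have upper: "s k * e k \<le> S" for k
    using prod[of k] S spos[of k] epos[of k] by (simp add: cs ce ennreal_mult[symmetric] ennreal_le_iff)
  obtain C where C: "0 < C" "\<And>k l. s (k + l) \<le> C * s k * s l"
  proof -
    obtain C where "0 < C" and *: "\<And>k l s t. sysc J p k \<le> ennreal s \<Longrightarrow> sysc J p l \<le> ennreal t \<Longrightarrow>
     0 \<le> s \<Longrightarrow> 0 \<le> t \<Longrightarrow> sysc J p (k + l) \<le> ennreal (C * s * t)"
      using system_const_submultiplicative[OF J] by blast
    moreover have "s (k + l) \<le> C * s k * s l" for k l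
      using *[of k "s k" l "s l"] cs s0 \<open>0 < C\<close> by (simp add: ennreal_le_iff)
    ultimately show ?thesis using that by blast
  qed
  obtain C' where C': "0 < C'" "\<And>k l. e (2 * Mst + k + l) \<le> C' * e k * e l"
  proof -
    obtain C where "0 < C" and *: "\<And>k l a b. cap k \<le> ennreal a \<Longrightarrow> cap l \<le> ennreal b \<Longrightarrow> 0 < a \<Longrightarrow> 0 < b \<Longrightarrow>
     cap (2 * Mst + k + l) \<le> ennreal (C * a * b)"
      using cap_submultiplicative by blast
    moreover have "e (2 * Mst + k + l) \<le> C * e k * e l" for k l
      using *[of k "e k" l "e l"] ce epos[of k] epos[of l] \<open>0 < C\<close> by (simp add: ennreal_le_iff)
    ultimately show ?thesis using that by blast
  qed
  have S0: "0 < S" using lower[of 0] upper[of 0] c by linarith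
  let ?j = "2 * Mst"
  \<comment> \<open>The shift by j levels in the submultiplicativity of e is paid for with the constant s j.\<close>
  define D where "D = S * S * C' * C * s ?j / c"
  have D0: "0 < D" using S0 C C' spos c by (simp add: D_def)
  have super: "s k * s l \<le> D * s (k + l)" for k l
  proof -
    have ee: "0 < e k * e l" using epos by simp
    have "(s k * s l) * (e k * e l) = (s k * e k) * (s l * e l)" by simp
    also have "\<dots> \<le> S * S" using upper lower c S0 by (intro mult_mono) (auto intro: order.trans less_imp_le)
    finally have 1: "(s k * s l) * (e k * e l) \<le> S * S" .
    have "c \<le> s (?j + k + l) * e (?j + k + l)" by (rule lower)
    also have "\<dots> \<le> (C * s ?j * s (k + l)) * (C' * e k * e l)"
      using C(2)[of ?j "k + l"] C'(2)[of k l] spos epos C by (intro mult_mono) (auto simp: add.assoc less_imp_le)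
    finally have 2: "c \<le> (C * s ?j * s (k + l)) * (C' * e k * e l)" .
    have "c * ((s k * s l) * (e k * e l)) \<le> c * (S * S)" using 1 c by (intro mult_left_mono) auto
    also have "\<dots> \<le> ((C * s ?j * s (k + l)) * (C' * e k * e l)) * (S * S)" using 2 S0 by (intro mult_right_mono) auto
    also have "\<dots> = (c * (D * s (k + l))) * (e k * e l)" using c by (simp add: D_def)
    finally have "(c * (s k * s l)) * (e k * e l) \<le> (c * (D * s (k + l))) * (e k * e l)" by (simp add: mult_ac)
    then have "c * (s k * s l) \<le> c * (D * s (k + l))" using ee by (simp only: mult_le_cancel_right_pos)
    then show ?thesis using c by simp
  qed
  define B where "B = \<bar>ln C\<bar> + \<bar>ln D\<bar>"
  have "\<bar>ln (s (k + l)) - ln (s k) - ln (s l)\<bar> \<le> B" for k l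
  proof -
    have "ln (s (k + l)) \<le> ln (C * s k * s l)" using C spos by (subst ln_le_cancel_iff) auto
    also have "\<dots> = ln C + ln (s k) + ln (s l)" using C spos by (simp add: ln_mult_pos)
    finally have 1: "ln (s (k + l)) \<le> ln C + ln (s k) + ln (s l)" .
    have "ln (s k * s l) \<le> ln (D * s (k + l))" using super spos D0 by (subst ln_le_cancel_iff) auto
    then have 2: "ln (s k) + ln (s l) \<le> ln D + ln (s (k + l))" using D0 spos by (simp add: ln_mult_pos)
    show ?thesis using 1 2 unfolding B_def by linarith
  qed
  from quasi_additive_linear[OF this] obtain a where a: "\<And>k. \<bar>ln (s k) - real k * a\<bar> \<le> B" by blast
  define t where "t = exp a"
  have t0: "0 < t" by (simp add: t_def)
  have tk: "t ^ k = exp (real k * a)" for k by (simp add: t_def exp_of_nat_mult)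
  have s_up: "s k \<le> exp B * t ^ k" for k
  proof -
    have "ln (s k) \<le> B + real k * a" using a[of k] by linarith
    then have "exp (ln (s k)) \<le> exp (B + real k * a)" by simp
    then show ?thesis using spos[of k] by (simp add: tk exp_add)
  qed
  have s_low: "exp (- B) * t ^ k \<le> s k" for k
  proof -
    have "- B + real k * a \<le> ln (s k)" using a[of k] by linarith
    then have "exp (- B + real k * a) \<le> exp (ln (s k))" by (simp only: exp_le_cancel_iff)
    then show ?thesis using spos[of k] by (simp only: tk exp_add exp_ln)
  qed
  have e_up: "e k \<le> S * exp B / t ^ k" for k
  proof -
    have "exp (- B) * t ^ k * e k \<le> s k * e k" using s_low epos by (intro mult_right_mono) (auto intro: less_imp_le)
    also have "\<dots> \<le> S" by (rule upper)
    finally show ?thesis using t0 by (simp add: field_simps exp_minus)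
  qed
  have e_low: "c * exp (- B) / t ^ k \<le> e k" for k
  proof -
    have "c \<le> s k * e k" by (rule lower)
    also have "\<dots> \<le> exp B * t ^ k * e k" using s_up epos by (intro mult_right_mono) (auto intro: less_imp_le)
    finally show ?thesis using t0 by (simp add: field_simps exp_minus)
  qed
  define c1 where "c1 = min (exp (- B)) (c * exp (- B))"
  define c2 where "c2 = max (exp B) (S * exp B)"
  have cc: "0 < c1" "0 < c2" using c S0 by (auto simp: c1_def c2_def less_max_iff_disj)
  have all: "\<forall>k. ennreal (c1 / t ^ k) \<le> cap k \<and> cap k \<le> ennreal (c2 / t ^ k) \<and>
             ennreal (c1 * t ^ k) \<le> sysc J p k \<and>
             sysc J p k \<le> ennreal (c2 * t ^ k)"
  proof (intro conjI allI)
    fix k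
    have tp: "0 < t ^ k" using t0 by simp
    have "c1 / t ^ k \<le> c * exp (- B) / t ^ k" using tp by (intro divide_right_mono) (auto simp: c1_def)
    also note e_low[of k]
    finally show "ennreal (c1 / t ^ k) \<le> cap k" unfolding ce by (rule ennreal_leI)
    have "e k \<le> S * exp B / t ^ k" by (rule e_up)
    also have "\<dots> \<le> c2 / t ^ k" using tp by (intro divide_right_mono) (auto simp: c2_def)
    finally show "cap k \<le> ennreal (c2 / t ^ k)" unfolding ce by (rule ennreal_leI)
    have "c1 * t ^ k \<le> exp (- B) * t ^ k" using tp by (intro mult_right_mono) (auto simp: c1_def)
    also note s_low[of k]
    finally show "ennreal (c1 * t ^ k) \<le> sysc J p k" unfolding cs by (rule ennreal_leI)
    have "s k \<le> exp B * t ^ k" by (rule s_up)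
    also have "\<dots> \<le> c2 * t ^ k" using tp by (intro mult_right_mono) (auto simp: c2_def)
    finally show "sysc J p k \<le> ennreal (c2 * t ^ k)" unfolding cs by (rule ennreal_leI)
  qed
  have "is_scaling t" unfolding is_scaling_def
    by (rule conjI[OF t0], rule exI[of _ c1], rule conjI[OF cc(1)], rule exI[of _ c2],
        rule conjI[OF cc(2)], rule exI[of _ J], rule conjI[OF J all])
  then show ?thesis by blast
qed

lemma scaling_factor:
  assumes "conductively_homogeneous E root K m Mst p"
  shows "is_scaling \<sigma>"
proof -
  have eq: "\<sigma> = (THE s. is_scaling s)" unfolding scaling_factor_def is_scaling_def ..
  obtain s where s: "is_scaling s" using scaling_exists[OF assms] by blast
  have "(THE s. is_scaling s) = s"
  proof (rule the_equality)
    fix t assume "is_scaling t"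
    then show "t = s" using is_scaling_le[OF s, of t] is_scaling_le[of t s] s by linarith
  qed (rule s)
  then show ?thesis unfolding eq using s by simp
qed

end

section \<open>Measure of balls and cells\<close>

text \<open>
  The tangent of the convex function t^p at A, from Bernoulli's inequality. Integrating it over a
  cell, with A the average, is Jensen's inequality.
\<close>

lemma powr_tangent_le:
  fixes t A p :: real
  assumes "1 < p" "0 \<le> t" "0 < A"
  shows "A powr p + p * A powr (p - 1) * (t - A) \<le> t powr p"
proof -
  have bern: "1 + p * (u - 1) \<le> u powr p" if "0 \<le> u" for u :: real
  proof (cases "u = 0")
    case False
    then have u: "0 < u" using that by simp
    have "(u powr p) powr (1 / p) * 1 powr (1 - 1 / p) \<le> (1 / p) * u powr p + (1 - 1 / p) * 1"
      using assms u by (intro Youngs_inequality_0) auto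
    then have "u \<le> u powr p / p + 1 - 1 / p" using assms u by (simp add: powr_powr)
    then have "p * u \<le> p * (u powr p / p + 1 - 1 / p)" using assms by (intro mult_left_mono) auto
    also have "\<dots> = u powr p + p - 1" using assms by (simp add: algebra_simps)
    finally show ?thesis by (simp add: algebra_simps)
  qed (use assms in simp)
  have "A powr p * (1 + p * (t / A - 1)) \<le> A powr p * (t / A) powr p"
    using bern[of "t / A"] assms by (intro mult_left_mono) auto
  also have "\<dots> = t powr p" using assms by (simp add: powr_divide)
  also have "A powr p * (1 + p * (t / A - 1)) = A powr p + p * A powr (p - 1) * (t - A)"
    using assms by (simp add: powr_diff field_simps)
  finally show ?thesis .
qed

text \<open>
  The metric and measure theoretic part of the framework. The sizes rst^n of the cells of level n
  and the Ahlfors exponent Q give each of these cells a mass comparable to \<theta>^n, where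
  \<theta> = rst powr Q.
\<close>

locale framework = cell_partition E root K m p \<gamma> N Mst
  for E :: "'t set set" and root :: 't and K :: "'t \<Rightarrow> 'a::metric_space set" and m :: "'a measure"
    and p \<gamma> :: real and N Mst :: nat +
  fixes rst Q CA c2 c3 c5 :: real
  assumes rst: "0 < rst" "rst < 1" and diam1: "diameter (UNIV :: 'a set) = 1"
    and diam_K: "\<And>w. diameter (K w) \<le> c2 * rst ^ height E root w" and c2: "0 < c2"
    and ball_nbhd: "\<And>n x. 1 \<le> n \<Longrightarrow> ball x (c3 * rst ^ n) \<subseteq> point_nbhd E root K Mst x n" and c3: "0 < c3"
    and inner_ball: "\<And>n w. 1 \<le> n \<Longrightarrow> w \<in> level E root n \<Longrightarrow> \<exists>x\<in>K w. ball x (c5 * rst ^ n) \<subseteq> K w" and c5: "0 < c5"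
    and Q: "0 < Q" and CA: "1 \<le> CA"
    and ahlfors: "\<And>x s. 0 < s \<Longrightarrow> s < 2 \<Longrightarrow> s powr Q / CA \<le> measure m (ball x s) \<and> measure m (ball x s) \<le> CA * s powr Q"
    and homog: "conductively_homogeneous E root K m Mst p"
begin

lemma compact_UNIV: "compact (UNIV :: 'a set)"
  using compact_K[of root] by (simp add: K_root)

lemma sets_K [measurable]: "K w \<in> sets m"
  unfolding sets_m using compact_K compact_imp_closed by (intro borel_closed) blast

lemma sets_ball [measurable]: "ball x r \<in> sets m"
  unfolding sets_m by simp

definition \<theta> :: real where "\<theta> = rst powr Q"

lemma \<theta>: "0 < \<theta>" "\<theta> < 1"
  using rst Q unfolding \<theta>_def by (auto simp: powr01_less_one)

lemma \<theta>_power: "(c * rst ^ n) powr Q = c powr Q * \<theta> ^ n" if "0 \<le> c"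
proof -
  have "(rst ^ n) powr Q = \<theta> ^ n" using rst unfolding \<theta>_def
    by (simp add: powr_powr powr_realpow[symmetric] mult.commute)
  then show ?thesis using that rst by (simp add: powr_mult)
qed

lemma ball_upper: "0 < s \<Longrightarrow> measure m (ball x s) \<le> CA * s powr Q"
proof (cases "s < 2")
  case False
  have "1 \<le> s powr Q" using False Q by (intro ge_one_powr_ge_zero) auto
  then have "1 * 1 \<le> CA * s powr Q" using CA by (intro mult_mono[of 1 CA 1 "s powr Q"]) auto
  then show ?thesis using prob_le_1[of "ball x s"] by linarith
qed (use ahlfors in blast)

lemma ball_lower: "0 < s \<Longrightarrow> s \<le> 1 \<Longrightarrow> s powr Q / CA \<le> measure m (ball x s)"
  using ahlfors[of s x] by simp

lemma ball_pos: "0 < s \<Longrightarrow> 0 < measure m (ball x s)"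
proof -
  assume s: "0 < s"
  have "0 < min s 1 powr Q / CA" using s CA by simp
  also have "\<dots> \<le> measure m (ball x (min s 1))" using s by (intro ball_lower) auto
  also have "\<dots> \<le> measure m (ball x s)" by (intro finite_measure_mono) auto
  finally show ?thesis .
qed

lemma dist_K: "x \<in> K w \<Longrightarrow> y \<in> K w \<Longrightarrow> dist x y \<le> c2 * rst ^ ht w"
  using diameter_bounded_bound[OF compact_imp_bounded[OF compact_K], of x w y] diam_K[of w] by linarith

lemma dist_touch:
  assumes "(u, v) \<in> touch n" "x \<in> K u" "y \<in> K v"
  shows "dist x y \<le> 2 * c2 * rst ^ n"
proof -
  obtain z where z: "z \<in> K u" "z \<in> K v" and l: "ht u = n" "ht v = n"
    using assms(1) by (auto simp: touch_def level_iff)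
  have "dist x z \<le> c2 * rst ^ n" using dist_K[OF assms(2) z(1)] by (simp add: l)
  moreover have "dist z y \<le> c2 * rst ^ n" using dist_K[OF z(2) assms(3)] by (simp add: l)
  ultimately show ?thesis using dist_triangle[of x y z] by linarith
qed

lemma mass_lower: "\<exists>b>0. \<forall>n. \<forall>w\<in>lev n. b * \<theta> ^ n \<le> \<mu> w"
proof (intro exI[of _ "min 1 (min c5 1 powr Q / CA)"] conjI allI ballI)
  let ?c = "min c5 1"
  show "0 < min 1 (?c powr Q / CA)" using c5 CA by simp
  fix n w assume w: "w \<in> lev n"
  show "min 1 (?c powr Q / CA) * \<theta> ^ n \<le> \<mu> w"
  proof (cases "n = 0")
    case True
    then have "w = root" using w by (simp add: level_iff)
    then show ?thesis using True by (simp add: measure_root)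
  next
    case False
    then obtain x where x: "ball x (c5 * rst ^ n) \<subseteq> K w" using inner_ball[of n w] w by auto
    have r1: "rst ^ n \<le> 1" using rst by (simp add: power_le_one)
    have "?c * rst ^ n \<le> 1 * 1" using r1 rst c5 by (intro mult_mono) auto
    then have s: "0 < ?c * rst ^ n" "?c * rst ^ n \<le> 1" using rst c5 by auto
    have "min 1 (?c powr Q / CA) * \<theta> ^ n \<le> (?c powr Q / CA) * \<theta> ^ n"
      using \<theta> by (intro mult_right_mono) auto
    also have "\<dots> = (?c * rst ^ n) powr Q / CA" using \<theta>_power[of ?c n] c5 by simp
    also have "\<dots> \<le> measure m (ball x (?c * rst ^ n))" by (rule ball_lower[OF s])
    also have "\<dots> \<le> \<mu> w"
    proof (intro finite_measure_mono sets_K)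
      have "?c * rst ^ n \<le> c5 * rst ^ n" using rst by (intro mult_right_mono) auto
      then show "ball x (?c * rst ^ n) \<subseteq> K w" using x subset_ball by blast
    qed
    finally show ?thesis .
  qed
qed

lemma mass_upper: "\<exists>b>0. \<forall>n. \<forall>w\<in>lev n. \<mu> w \<le> b * \<theta> ^ n"
proof (intro exI[of _ "CA * (2 * c2) powr Q"] conjI allI ballI)
  show "0 < CA * (2 * c2) powr Q" using CA c2 by simp
  fix n w assume w: "w \<in> lev n"
  obtain x where x: "x \<in> K w" using K_ne by blast
  have "K w \<subseteq> ball x (2 * c2 * rst ^ n)"
  proof
    fix y assume "y \<in> K w"
    then have "dist x y \<le> c2 * rst ^ n" using dist_K[OF x] w by (simp add: level_iff)
    also have "\<dots> < 2 * c2 * rst ^ n" using c2 rst by simp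
    finally show "y \<in> ball x (2 * c2 * rst ^ n)" by simp
  qed
  then have "\<mu> w \<le> measure m (ball x (2 * c2 * rst ^ n))" by (intro finite_measure_mono) auto
  also have "\<dots> \<le> CA * (2 * c2 * rst ^ n) powr Q" using c2 rst by (intro ball_upper) auto
  also have "\<dots> = CA * (2 * c2) powr Q * \<theta> ^ n" using \<theta>_power[of "2 * c2" n] c2 by simp
  finally show "\<mu> w \<le> CA * (2 * c2) powr Q * \<theta> ^ n" .
qed

lemma cells_at_card: "finite {v \<in> lev n. x \<in> K v} \<and> card {v \<in> lev n. x \<in> K v} \<le> N"
proof (cases "\<exists>v\<in>lev n. x \<in> K v")
  case True
  then obtain v where v: "v \<in> lev n" "x \<in> K v" by blast
  have sub: "{v \<in> lev n. x \<in> K v} \<subseteq> {u. (u, v) \<in> touch n}" using v by (auto simp: touch_def)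
  then show ?thesis using card_touch[of v n] card_mono[OF _ sub] finite_level by (auto intro: order.trans)
next
  case False
  then have e: "{v \<in> lev n. x \<in> K v} = {}" by blast
  show ?thesis unfolding e by simp
qed

text \<open>
  Cells of one level may overlap, but not by sets of positive measure: the sum of the indicators
  of the descendants exceeds the indicator of w by a nonnegative function, whose integral is 0
  because masses add up.
\<close>

lemma AE_indicator_desc:
  "AE x in m. indicator (K w) x = (\<Sum>v\<in>dsc k w. indicator (K v) x :: real)"
proof -
  let ?g = "\<lambda>x. (\<Sum>v\<in>dsc k w. indicator (K v) x) - indicator (K w) x :: real"
  have int: "integrable m ?g" by (intro Bochner_Integration.integrable_diff Bochner_Integration.integrable_sum) (auto intro: integrable_real_indicator simp: emeasure_eq_measure)
  have "(\<integral>x. ?g x \<partial>m) = (\<Sum>v\<in>dsc k w. \<mu> v) - \<mu> w"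
    by (subst Bochner_Integration.integral_diff) (auto intro!: Bochner_Integration.integrable_sum integrable_real_indicator simp: emeasure_eq_measure space_m)
  then have "(\<integral>x. ?g x \<partial>m) = 0" using measure_desc[of w k] by simp
  moreover have nn: "0 \<le> ?g x" for x
  proof (cases "x \<in> K w")
    case True
    then obtain v where v: "v \<in> dsc k w" "x \<in> K v" using K_desc[of w k] by blast
    have "indicator (K v) x \<le> (\<Sum>v\<in>dsc k w. indicator (K v) x :: real)"
      using v finite_desc by (intro member_le_sum) auto
    then show ?thesis using v True by simp
  qed (auto intro: sum_nonneg)
  ultimately have "AE x in m. ?g x = 0"
    using integral_nonneg_eq_0_iff_AE[OF int] by simp
  then show ?thesis by eventually_elim simp
qed

lemma AE_indicator_level: "AE x in m. (\<Sum>v\<in>lev n. indicator (K v) x :: real) = 1"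
  using AE_indicator_desc[of root n] by eventually_elim (simp add: desc_root K_root)

section \<open>Cell averages of p-integrable functions\<close>

abbreviation "ca \<equiv> cell_avg K m"
abbreviation "Lp \<equiv> lp_space m p"

lemma lp_meas: "f \<in> Lp \<Longrightarrow> f \<in> borel_measurable m"
  by (simp add: lp_space_def)

lemma lp_powr_integrable: "f \<in> Lp \<Longrightarrow> integrable m (\<lambda>x. \<bar>f x\<bar> powr p)"
  by (simp add: lp_space_def)

lemma abs_le_powr: "\<bar>t\<bar> \<le> 1 + \<bar>t\<bar> powr p" for t :: real
proof (cases "\<bar>t\<bar> \<le> 1")
  case False
  then have "\<bar>t\<bar> powr 1 \<le> \<bar>t\<bar> powr p" using p1 by (intro powr_mono) auto
  then show ?thesis using False by simp
qed (simp add: add_increasing2)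

lemma lp_integrable:
  assumes "f \<in> Lp" shows "integrable m f"
proof (rule Bochner_Integration.integrable_bound)
  show "integrable m (\<lambda>x. 1 + \<bar>f x\<bar> powr p)" using lp_powr_integrable[OF assms] by simp
  show "AE x in m. norm (f x) \<le> norm (1 + \<bar>f x\<bar> powr p)"
  proof (rule AE_I2)
    fix x
    have "0 \<le> 1 + \<bar>f x\<bar> powr p" by (simp add: add_nonneg_nonneg)
    then show "norm (f x) \<le> norm (1 + \<bar>f x\<bar> powr p)" using abs_le_powr[of "f x"] by simp
  qed
qed (rule lp_meas[OF assms])

lemma lp_add: 
  assumes "f \<in> Lp" "g \<in> Lp"
  shows "(\<lambda>x. f x + g x) \<in> Lp"
proof -
  have [measurable]: "f \<in> borel_measurable m" "g \<in> borel_measurable m" using assms lp_meas by auto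
  have "integrable m (\<lambda>x. \<bar>f x + g x\<bar> powr p)"
  proof (rule Bochner_Integration.integrable_bound[of m "\<lambda>x. 2 powr p * (\<bar>f x\<bar> powr p + \<bar>g x\<bar> powr p)"])
    show "integrable m (\<lambda>x. 2 powr p * (\<bar>f x\<bar> powr p + \<bar>g x\<bar> powr p))"
      using assms lp_powr_integrable by auto
    show "AE x in m. norm (\<bar>f x + g x\<bar> powr p) \<le> norm (2 powr p * (\<bar>f x\<bar> powr p + \<bar>g x\<bar> powr p))"
    proof (rule AE_I2)
      fix x
      have "\<bar>f x + g x\<bar> powr p \<le> (\<bar>f x\<bar> + \<bar>g x\<bar>) powr p" using p0 by (intro powr_mono2) auto
      also have "\<dots> \<le> 2 powr p * (\<bar>f x\<bar> powr p + \<bar>g x\<bar> powr p)" using p0 by (intro powr_add_le) auto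
      finally show "norm (\<bar>f x + g x\<bar> powr p) \<le> norm (2 powr p * (\<bar>f x\<bar> powr p + \<bar>g x\<bar> powr p))" by simp
    qed
  qed measurable
  then show ?thesis by (simp add: lp_space_def)
qed

lemma lp_scale: 
  assumes "f \<in> Lp" shows "(\<lambda>x. c * f x) \<in> Lp"
proof -
  have [measurable]: "f \<in> borel_measurable m" using assms lp_meas by auto
  have "(\<lambda>x. \<bar>c * f x\<bar> powr p) = (\<lambda>x. \<bar>c\<bar> powr p * \<bar>f x\<bar> powr p)" by (simp add: abs_mult powr_mult)
  then show ?thesis using lp_powr_integrable[OF assms] by (simp add: lp_space_def)
qed

lemma lp_const: "(\<lambda>x. c) \<in> Lp"
  by (simp add: lp_space_def)

lemma lp_diff: "f \<in> Lp \<Longrightarrow> g \<in> Lp \<Longrightarrow> (\<lambda>x. f x - g x) \<in> Lp"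
  using lp_add[of f "\<lambda>x. (-1) * g x"] lp_scale[of g "-1"] by simp

lemma lp_bounded:
  assumes [measurable]: "f \<in> borel_measurable m" and "\<And>x. \<bar>f x\<bar> \<le> B"
  shows "f \<in> Lp"
proof -
  have "integrable m (\<lambda>x. \<bar>f x\<bar> powr p)"
  proof (rule integrable_const_bound[of _ "B powr p"])
    show "AE x in m. norm (\<bar>f x\<bar> powr p) \<le> B powr p"
      using assms(2) p0 by (intro AE_I2) (auto intro!: powr_mono2)
  qed measurable
  then show ?thesis by (simp add: lp_space_def)
qed

lemma continuous_measurable: "continuous_on UNIV f \<Longrightarrow> f \<in> borel_measurable m" for f :: "'a \<Rightarrow> real"
  using borel_measurable_continuous_onI[of f] measurable_cong_sets[OF sets_m refl] by blast

lemma lp_continuous: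
  fixes f :: "'a \<Rightarrow> real" assumes "continuous_on UNIV f" shows "f \<in> Lp"
proof -
  have "bounded (range f)" using compact_continuous_image[OF assms compact_UNIV] by (rule compact_imp_bounded)
  then obtain B where "\<And>x. \<bar>f x\<bar> \<le> B" unfolding bounded_iff by auto
  then show ?thesis using continuous_measurable[OF assms] by (rule lp_bounded[rotated])
qed

lemma integrable_indicator_mult:
  "integrable m f \<Longrightarrow> integrable m (\<lambda>x. indicator (K w) x * f x)" for f :: "'a \<Rightarrow> real"
  using integrable_mult_indicator[OF sets_K, of f w] by simp

lemma ca_eq: "ca f w = (\<integral>x. indicator (K w) x * f x \<partial>m) / \<mu> w"
  by (simp add: cell_avg_def set_lebesgue_integral_def)

lemma ca_diff: "f \<in> Lp \<Longrightarrow> g \<in> Lp \<Longrightarrow> ca (\<lambda>x. f x - g x) w = ca f w - ca g w"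
  unfolding ca_eq right_diff_distrib
  by (subst Bochner_Integration.integral_diff)
    (simp_all add: integrable_indicator_mult lp_integrable diff_divide_distrib)

lemma ca_add: "f \<in> Lp \<Longrightarrow> g \<in> Lp \<Longrightarrow> ca (\<lambda>x. f x + g x) w = ca f w + ca g w"
  unfolding ca_eq distrib_left
  by (subst Bochner_Integration.integral_add)
    (simp_all add: integrable_indicator_mult lp_integrable add_divide_distrib)

lemma ca_scale: "ca (\<lambda>x. c * f x) w = c * ca f w"
proof -
  have "(\<lambda>x. indicator (K w) x * (c * f x)) = (\<lambda>x. c * (indicator (K w) x * f x))" by (simp add: mult_ac)
  then show ?thesis unfolding ca_eq by simp
qed

lemma ca_const: "ca (\<lambda>x. c) w = c"
  using measure_pos[of w] by (simp add: ca_eq space_m)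

lemma ca_desc: 
  assumes "f \<in> Lp" shows "avg k (ca f) w = ca f w"
proof -
  have [measurable]: "f \<in> borel_measurable m" using assms lp_meas by auto
  have "(\<integral>x. indicator (K w) x * f x \<partial>m) = (\<integral>x. (\<Sum>v\<in>dsc k w. indicator (K v) x * f x) \<partial>m)"
    using AE_indicator_desc[of w k] 
    by (intro integral_cong_AE) (auto elim!: eventually_mono simp: sum_distrib_right)
  also have "\<dots> = (\<Sum>v\<in>dsc k w. \<integral>x. indicator (K v) x * f x \<partial>m)"
    by (intro Bochner_Integration.integral_sum integrable_indicator_mult lp_integrable assms)
  also have "\<dots> = (\<Sum>v\<in>dsc k w. ca f v * \<mu> v)"
    using measure_pos by (intro sum.cong) (auto simp: ca_eq less_imp_neq[symmetric])
  finally show ?thesis by (simp add: avg_eq ca_eq)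
qed

text \<open>
  The tangent inequality at A = |ca f w - c|, integrated over the cell; the linear term is
  nonnegative because the average of |f - c| is at least A.
\<close>

lemma ca_jensen:
  assumes "f \<in> Lp"
  shows "\<bar>ca f w - c\<bar> powr p * \<mu> w \<le> (\<integral>x. indicator (K w) x * \<bar>f x - c\<bar> powr p \<partial>m)"
proof (cases "ca f w = c")
  case True
  then show ?thesis by (auto intro!: integral_nonneg_AE)
next
  case False
  define A where "A = \<bar>ca f w - c\<bar>"
  have A: "0 < A" using False by (simp add: A_def)
  have fc: "(\<lambda>x. f x - c) \<in> Lp" by (intro lp_diff assms lp_const)
  have int1: "integrable m (\<lambda>x. indicator (K w) x * \<bar>f x - c\<bar>)"
    by (intro integrable_indicator_mult integrable_abs lp_integrable fc)
  have int0: "integrable m (indicator (K w) :: _ \<Rightarrow> real)"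
    by (intro integrable_real_indicator) (auto simp: emeasure_eq_measure)
  have "ca f w - c = (\<integral>x. indicator (K w) x * (f x - c) \<partial>m) / \<mu> w"
    using ca_diff[OF assms lp_const, of c w] by (simp add: ca_const ca_eq)
  then have "A * \<mu> w = \<bar>\<integral>x. indicator (K w) x * (f x - c) \<partial>m\<bar>"
    using measure_pos[of w] by (simp add: A_def)
  also have "\<dots> \<le> (\<integral>x. \<bar>indicator (K w) x * (f x - c)\<bar> \<partial>m)" by (rule integral_abs_bound)
  finally have Am: "A * \<mu> w \<le> (\<integral>x. indicator (K w) x * \<bar>f x - c\<bar> \<partial>m)" by (simp add: abs_mult)
  let ?B = "p * A powr (p - 1)"
  have "A powr p * \<mu> w \<le> (A powr p - ?B * A) * \<mu> w + ?B * (\<integral>x. indicator (K w) x * \<bar>f x - c\<bar> \<partial>m)"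
    using mult_left_mono[OF Am, of ?B] p0 by (simp add: algebra_simps)
  also have "\<dots> = (\<integral>x. (A powr p - ?B * A) * indicator (K w) x + ?B * (indicator (K w) x * \<bar>f x - c\<bar>) \<partial>m)"
    using int0 int1 by (subst Bochner_Integration.integral_add) (auto simp: space_m)
  also have "\<dots> \<le> (\<integral>x. indicator (K w) x * \<bar>f x - c\<bar> powr p \<partial>m)"
  proof (rule integral_mono)
    show "integrable m (\<lambda>x. (A powr p - ?B * A) * indicator (K w) x + ?B * (indicator (K w) x * \<bar>f x - c\<bar>))"
      using int0 int1 by (intro Bochner_Integration.integrable_add integrable_mult_right) auto
    show "integrable m (\<lambda>x. indicator (K w) x * \<bar>f x - c\<bar> powr p)"
      by (intro integrable_indicator_mult lp_powr_integrable fc)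
    fix x
    show "(A powr p - ?B * A) * indicator (K w) x + ?B * (indicator (K w) x * \<bar>f x - c\<bar>) \<le> indicator (K w) x * \<bar>f x - c\<bar> powr p"
      using powr_tangent_le[OF p1, of "\<bar>f x - c\<bar>" A] A by (auto simp: indicator_def algebra_simps)
  qed
  finally show ?thesis unfolding A_def .
qed

lemma ca_jensen_nn:
  assumes "f \<in> Lp"
  shows "ennreal (\<bar>ca f w - c\<bar> powr p * \<mu> w) \<le> (\<integral>\<^sup>+x. ennreal (\<bar>f x - c\<bar> powr p) * indicator (K w) x \<partial>m)"
proof -
  have "(\<integral>\<^sup>+x. ennreal (\<bar>f x - c\<bar> powr p) * indicator (K w) x \<partial>m) = (\<integral>\<^sup>+x. ennreal (indicator (K w) x * \<bar>f x - c\<bar> powr p) \<partial>m)"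
    by (intro nn_integral_cong) (auto simp: indicator_def)
  also have "\<dots> = ennreal (\<integral>x. indicator (K w) x * \<bar>f x - c\<bar> powr p \<partial>m)"
    by (intro nn_integral_eq_integral integrable_indicator_mult lp_powr_integrable lp_diff assms lp_const) auto
  finally show ?thesis using ennreal_leI[OF ca_jensen[OF assms, of w c]] by simp
qed

lemma scaling: "is_scaling \<sigma>" by (rule scaling_factor[OF homog])

lemma \<sigma>_pos: "0 < \<sigma>" using scaling by (simp add: is_scaling_def)

abbreviation "se n f \<equiv> \<sigma> ^ n * en n (ca f)"

text \<open>
  Cell averages at level n are averages of cell averages at level n + k, so this is the Poincare
  inequality for levels, in which the constant C \<sigma>^k cancels the change of normalization.
\<close>

lemma weak_monotone_energy: "\<exists>C>0. \<forall>f\<in>Lp. \<forall>n k. se n f \<le> C * se (n + k) f"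
proof -
  obtain c J where J: "covering_system E root K J" and c: "0 < c"
    and sc: "\<And>k. sysc J p k \<le> ennreal (c * \<sigma> ^ k)"
    using scaling unfolding is_scaling_def by blast
  obtain C where C: "0 < C" "\<And>n l s f. sysc J p l \<le> ennreal s \<Longrightarrow> 0 \<le> s \<Longrightarrow>
           en n (avg l f) \<le> C * s * en (n + l) f"
    using level_poincare[OF J] by blast
  have "se n f \<le> (C * c) * se (n + k) f" if f: "f \<in> Lp" for f n k
  proof -
    have "en n (ca f) = en n (avg k (ca f))" using ca_desc[OF f, of k] by presburger
    also have "\<dots> \<le> C * (c * \<sigma> ^ k) * en (n + k) (ca f)" using sc c \<sigma>_pos by (intro C(2)) auto
    finally have "\<sigma> ^ n * en n (ca f) \<le> \<sigma> ^ n * (C * (c * \<sigma> ^ k) * en (n + k) (ca f))"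
      using \<sigma>_pos by (intro mult_left_mono) auto
    then show ?thesis by (simp add: power_add mult_ac)
  qed
  then show ?thesis using C c by (intro exI[of _ "C * c"]) auto
qed

text \<open>
  The p-th power of the Sobolev seminorm, without the detour through a p-th root.
\<close>

definition Np :: "('a \<Rightarrow> real) \<Rightarrow> ennreal" where
  "Np f = (SUP n. ennreal (se n f))"

lemma Np_eq: "epowr (sobolev_seminorm E root K m Mst p f) p = Np f"
  unfolding sobolev_seminorm_def Np_def by (rule epowr_epowr_inverse[OF p0])

lemma se_nonneg: "0 \<le> se n f" using \<sigma>_pos energy_nonneg by simp

sublocale pr: pair_sigma_finite m m
  by unfold_locales

section \<open>The double integral over close pairs\<close>

text \<open>
  The product \<sigma>-algebra of m with itself contains the open sets of the product space
  because the space is separable; here this is done by hand with finite nets, which exist by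
  compactness.
\<close>

lemma sets_near: "{z. dist (fst z) (snd z) < r} \<in> sets (m \<Otimes>\<^sub>M m)"
proof -
  have "\<exists>F. finite F \<and> (UNIV :: 'a set) \<subseteq> (\<Union>x\<in>F. ball x (1 / real (Suc k)))" for k
    using compact_UNIV unfolding compact_eq_totally_bounded by simp
  then obtain F where F: "\<And>k. finite (F k)" "\<And>k. (UNIV :: 'a set) \<subseteq> (\<Union>x\<in>F k. ball x (1 / real (Suc k)))"
    by metis
  have "{z. dist (fst z) (snd z) < r} = (\<Union>k. \<Union>c\<in>F k. ball c (1 / real (Suc k)) \<times> ball c (r - 1 / real (Suc k)))" (is "?L = ?R")
  proof (intro set_eqI iffI)
    fix z assume "z \<in> ?L"
    then have z: "0 < (r - dist (fst z) (snd z)) / 2" by simp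
    then obtain k where k: "1 / real (Suc k) < (r - dist (fst z) (snd z)) / 2"
      using nat_approx_posE by metis
    have "fst z \<in> (\<Union>x\<in>F k. ball x (1 / real (Suc k)))" using F(2) by blast
    then obtain c where c: "c \<in> F k" "dist c (fst z) < 1 / real (Suc k)" by auto
    have "dist c (snd z) \<le> dist c (fst z) + dist (fst z) (snd z)" by (rule dist_triangle)
    then have "dist c (snd z) < r - 1 / real (Suc k)" using k c by argo
    then show "z \<in> ?R" using c by (cases z) auto
  next
    fix z assume "z \<in> ?R"
    then obtain k c where c: "dist c (fst z) < 1 / real (Suc k)" "dist c (snd z) < r - 1 / real (Suc k)" by auto
    then show "z \<in> ?L" using dist_triangle3[of "fst z" "snd z" c] by simp
  qed
  moreover have "?R \<in> sets (m \<Otimes>\<^sub>M m)"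
    using F(1) by (intro sets.countable_UN sets.finite_UN) auto
  ultimately show ?thesis by simp
qed

text \<open>
  The Korevaar-Schoen energy without its normalization. By Ahlfors regularity the normalizing
  factors are comparable to a power of r, uniformly in the centre of the ball.
\<close>

definition G :: "real \<Rightarrow> ('a \<Rightarrow> real) \<Rightarrow> ennreal" where
  "G r f = (\<integral>\<^sup>+x. \<integral>\<^sup>+y. ennreal (\<bar>f x - f y\<bar> powr p) * indicator (ball x r) y \<partial>m \<partial>m)"

abbreviation "ksJ s \<equiv> kernel_energy m p (ks_kernel m p s)"

lemma near_meas [measurable]: "(\<lambda>z. indicator (ball (fst z) r) (snd z) :: real) \<in> borel_measurable (m \<Otimes>\<^sub>M m)"
proof -
  have eq: "(\<lambda>z. indicator (ball (fst z) r) (snd z) :: real) = indicator {z. dist (fst z) (snd z) < r}"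
    by (auto simp: indicator_def)
  show ?thesis unfolding eq by (rule borel_measurable_indicator[OF sets_near])
qed

lemma near_meas_ennreal [measurable]: "(\<lambda>z. indicator (ball (fst z) r) (snd z) :: ennreal) \<in> borel_measurable (m \<Otimes>\<^sub>M m)"
proof -
  have eq: "(\<lambda>z. indicator (ball (fst z) r) (snd z) :: ennreal) = indicator {z. dist (fst z) (snd z) < r}"
    by (auto simp: indicator_def)
  show ?thesis unfolding eq by (rule borel_measurable_indicator[OF sets_near])
qed

lemma measure_ball_meas [measurable]: "(\<lambda>x. measure m (ball x r)) \<in> borel_measurable m"
proof -
  have eq: "Pair x -` {z. dist (fst z) (snd z) < r} = ball x r" for x :: 'a by (auto simp: ball_def)
  have "(\<lambda>x. emeasure m (ball x r)) \<in> borel_measurable m"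
    using measurable_emeasure_Pair[OF sets_near[of r]] unfolding eq .
  then show ?thesis unfolding measure_def by simp
qed

lemma incr_meas [measurable]:
  assumes [measurable]: "f \<in> borel_measurable m"
  shows "(\<lambda>z. \<bar>f (fst z) - f (snd z)\<bar> powr p) \<in> borel_measurable (m \<Otimes>\<^sub>M m)"
  by measurable

lemma kernel_meas [measurable]:
  "(\<lambda>z. ks_kernel m p s r (fst z) (snd z)) \<in> borel_measurable (m \<Otimes>\<^sub>M m)"
  unfolding ks_kernel_def by measurable

lemma G_product:
  assumes [measurable]: "f \<in> borel_measurable m"
  shows "G r f = (\<integral>\<^sup>+z. ennreal (\<bar>f (fst z) - f (snd z)\<bar> powr p) * indicator (ball (fst z) r) (snd z) \<partial>(m \<Otimes>\<^sub>M m))"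
proof -
  have "(\<integral>\<^sup>+x. \<integral>\<^sup>+y. (\<lambda>z. ennreal (\<bar>f (fst z) - f (snd z)\<bar> powr p) * indicator (ball (fst z) r) (snd z)) (x, y) \<partial>m \<partial>m)
    = (\<integral>\<^sup>+z. ennreal (\<bar>f (fst z) - f (snd z)\<bar> powr p) * indicator (ball (fst z) r) (snd z) \<partial>(m \<Otimes>\<^sub>M m))"
    by (rule nn_integral_fst) measurable
  then show ?thesis unfolding G_def by simp
qed

lemma kernel_product:
  assumes [measurable]: "f \<in> borel_measurable m"
  shows "ksJ s r f
    = (\<integral>\<^sup>+z. ennreal (\<bar>f (fst z) - f (snd z)\<bar> powr p * ks_kernel m p s r (fst z) (snd z)) \<partial>(m \<Otimes>\<^sub>M m))"
proof -
  have "(\<integral>\<^sup>+x. \<integral>\<^sup>+y. (\<lambda>z. ennreal (\<bar>f (fst z) - f (snd z)\<bar> powr p * ks_kernel m p s r (fst z) (snd z))) (x, y) \<partial>m \<partial>m)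
    = (\<integral>\<^sup>+z. ennreal (\<bar>f (fst z) - f (snd z)\<bar> powr p * ks_kernel m p s r (fst z) (snd z)) \<partial>(m \<Otimes>\<^sub>M m))"
    by (rule nn_integral_fst) measurable
  then show ?thesis unfolding kernel_energy_def by simp
qed

lemma G_le_kernel:
  assumes f: "f \<in> borel_measurable m" and r: "0 < r" and b: "\<And>x. r powr (p * s) * measure m (ball x r) \<le> B" and "0 \<le> B"
  shows "G r f \<le> ennreal B * ksJ s r f"
proof -
  note [measurable] = f
  have "G r f \<le> (\<integral>\<^sup>+z. ennreal B * ennreal (\<bar>f (fst z) - f (snd z)\<bar> powr p * ks_kernel m p s r (fst z) (snd z)) \<partial>(m \<Otimes>\<^sub>M m))"
    unfolding G_product[OF f]
  proof (rule nn_integral_mono)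
    fix z :: "'a \<times> 'a"
    let ?d = "r powr (p * s) * measure m (ball (fst z) r)"
    have d: "0 < ?d" using r ball_pos[OF r] by simp
    have "\<bar>f (fst z) - f (snd z)\<bar> powr p \<le> B * (\<bar>f (fst z) - f (snd z)\<bar> powr p / ?d)"
    proof -
      have "\<bar>f (fst z) - f (snd z)\<bar> powr p * ?d \<le> \<bar>f (fst z) - f (snd z)\<bar> powr p * B"
        using b by (intro mult_left_mono) auto
      then show ?thesis using d by (simp add: field_simps)
    qed
    then show "ennreal (\<bar>f (fst z) - f (snd z)\<bar> powr p) * indicator (ball (fst z) r) (snd z)
      \<le> ennreal B * ennreal (\<bar>f (fst z) - f (snd z)\<bar> powr p * ks_kernel m p s r (fst z) (snd z))"
      using assms(4) by (auto simp: indicator_def ks_kernel_def ennreal_mult'[symmetric] intro!: ennreal_leI)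
  qed
  also have "\<dots> = ennreal B * ksJ s r f"
    unfolding kernel_product[OF f] by (rule nn_integral_cmult) measurable
  finally show ?thesis .
qed

lemma kernel_le_G:
  assumes f: "f \<in> borel_measurable m" and r: "0 < r" and b: "\<And>x. b \<le> r powr (p * s) * measure m (ball x r)" and "0 < b"
  shows "ksJ s r f \<le> ennreal (1 / b) * G r f"
proof -
  note [measurable] = f
  have "ksJ s r f
    \<le> (\<integral>\<^sup>+z. ennreal (1 / b) * (ennreal (\<bar>f (fst z) - f (snd z)\<bar> powr p) * indicator (ball (fst z) r) (snd z)) \<partial>(m \<Otimes>\<^sub>M m))"
    unfolding kernel_product[OF f]
  proof (rule nn_integral_mono)
    fix z :: "'a \<times> 'a"
    let ?d = "r powr (p * s) * measure m (ball (fst z) r)"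
    have "\<bar>f (fst z) - f (snd z)\<bar> powr p / ?d \<le> \<bar>f (fst z) - f (snd z)\<bar> powr p / b"
      using b[of "fst z"] assms(4) by (intro divide_left_mono) (auto intro!: mult_pos_pos)
    then show "ennreal (\<bar>f (fst z) - f (snd z)\<bar> powr p * ks_kernel m p s r (fst z) (snd z))
      \<le> ennreal (1 / b) * (ennreal (\<bar>f (fst z) - f (snd z)\<bar> powr p) * indicator (ball (fst z) r) (snd z))"
      using assms(4) by (auto simp: indicator_def ks_kernel_def ennreal_mult'[symmetric] intro!: ennreal_leI)
  qed
  also have "\<dots> = ennreal (1 / b) * G r f"
    unfolding G_product[OF f] by (rule nn_integral_cmult) measurable
  finally show ?thesis .
qed

text \<open>
  Jensen's inequality in each of the two variables.
\<close>

lemma edge_le_integral: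
  assumes f: "f \<in> Lp"
  shows "ennreal (\<bar>ca f v - ca f w\<bar> powr p * \<mu> v * \<mu> w)
    \<le> (\<integral>\<^sup>+z. ennreal (\<bar>f (fst z) - f (snd z)\<bar> powr p) * (indicator (K v) (fst z) * indicator (K w) (snd z)) \<partial>(m \<Otimes>\<^sub>M m))"
proof -
  have [measurable]: "f \<in> borel_measurable m" by (rule lp_meas[OF f])
  have "ennreal (\<bar>ca f v - ca f w\<bar> powr p * \<mu> v * \<mu> w) = ennreal (\<mu> w) * ennreal (\<bar>ca f v - ca f w\<bar> powr p * \<mu> v)"
    by (simp add: ennreal_mult'[symmetric] mult_ac)
  also have "\<dots> \<le> ennreal (\<mu> w) * (\<integral>\<^sup>+x. ennreal (\<bar>f x - ca f w\<bar> powr p) * indicator (K v) x \<partial>m)"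
    by (intro mult_left_mono ca_jensen_nn f) simp
  also have "\<dots> = (\<integral>\<^sup>+x. ennreal (\<mu> w) * (ennreal (\<bar>f x - ca f w\<bar> powr p) * indicator (K v) x) \<partial>m)"
    by (rule nn_integral_cmult[symmetric]) measurable
  also have "\<dots> \<le> (\<integral>\<^sup>+x. \<integral>\<^sup>+y. ennreal (\<bar>f x - f y\<bar> powr p) * (indicator (K v) x * indicator (K w) y) \<partial>m \<partial>m)"
  proof (rule nn_integral_mono)
    fix x
    have "ennreal (\<mu> w) * (ennreal (\<bar>f x - ca f w\<bar> powr p) * indicator (K v) x)
        = indicator (K v) x * ennreal (\<bar>ca f w - f x\<bar> powr p * \<mu> w)"
      by (simp add: ennreal_mult'' abs_minus_commute mult_ac)
    also have "\<dots> \<le> indicator (K v) x * (\<integral>\<^sup>+y. ennreal (\<bar>f y - f x\<bar> powr p) * indicator (K w) y \<partial>m)"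
      by (intro mult_left_mono ca_jensen_nn f) simp
    also have "\<dots> = (\<integral>\<^sup>+y. indicator (K v) x * (ennreal (\<bar>f y - f x\<bar> powr p) * indicator (K w) y) \<partial>m)"
      by (rule nn_integral_cmult[symmetric]) measurable
    also have "\<dots> = (\<integral>\<^sup>+y. ennreal (\<bar>f x - f y\<bar> powr p) * (indicator (K v) x * indicator (K w) y) \<partial>m)"
      by (intro nn_integral_cong) (simp add: abs_minus_commute mult_ac)
    finally show "ennreal (\<mu> w) * (ennreal (\<bar>f x - ca f w\<bar> powr p) * indicator (K v) x)
      \<le> (\<integral>\<^sup>+y. ennreal (\<bar>f x - f y\<bar> powr p) * (indicator (K v) x * indicator (K w) y) \<partial>m)" .
  qed
  also have "\<dots> = (\<integral>\<^sup>+z. ennreal (\<bar>f (fst z) - f (snd z)\<bar> powr p) * (indicator (K v) (fst z) * indicator (K w) (snd z)) \<partial>(m \<Otimes>\<^sub>M m))"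
  proof -
    have "(\<integral>\<^sup>+x. \<integral>\<^sup>+y. (\<lambda>z. ennreal (\<bar>f (fst z) - f (snd z)\<bar> powr p) * (indicator (K v) (fst z) * indicator (K w) (snd z))) (x, y) \<partial>m \<partial>m)
      = (\<integral>\<^sup>+z. ennreal (\<bar>f (fst z) - f (snd z)\<bar> powr p) * (indicator (K v) (fst z) * indicator (K w) (snd z)) \<partial>(m \<Otimes>\<^sub>M m))"
      by (rule nn_integral_fst) measurable
    then show ?thesis by simp
  qed
  finally show ?thesis .
qed

text \<open>
  The integrals of |f x - f y|^p over the products of touching cells add up to at most N * N times
  the integral over all pairs of points closer than r, since a point lies in at most N cells of a
  level. Each such product has mass at least a constant times \<theta>^n \<theta>^n.
\<close>

lemma energy_le_G:
  "\<exists>C>0. \<forall>f\<in>Lp. \<forall>n r. 2 * c2 * rst ^ n < r \<longrightarrow> ennreal (en n (ca f) * \<theta> ^ n * \<theta> ^ n) \<le> ennreal C * G r f"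
proof -
  obtain b where b: "0 < b" "\<And>n w. w \<in> lev n \<Longrightarrow> b * \<theta> ^ n \<le> \<mu> w" using mass_lower by blast
  define C where "C = real (N * N) / (b * b) + 1"
  have C: "0 < C" "real (N * N) / (b * b) \<le> C" by (auto simp: C_def intro: add_nonneg_pos)
  have "ennreal (en n (ca f) * \<theta> ^ n * \<theta> ^ n) \<le> ennreal C * G r f"
    if f: "f \<in> Lp" and r: "2 * c2 * rst ^ n < r" for f n r
  proof -
    have [measurable]: "f \<in> borel_measurable m" by (rule lp_meas[OF f])
    let ?h = "\<lambda>z. ennreal (\<bar>f (fst z) - f (snd z)\<bar> powr p)"
    have "b * \<theta> ^ n * (b * \<theta> ^ n) * (2 * en n (ca f)) = (\<Sum>e\<in>touch n. incr (ca f) e * (b * \<theta> ^ n) * (b * \<theta> ^ n))"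
      unfolding energy_level by (simp add: sum_distrib_left sum_distrib_right mult_ac)
    also have "\<dots> \<le> (\<Sum>e\<in>touch n. incr (ca f) e * \<mu> (fst e) * \<mu> (snd e))"
      using b \<theta> by (intro sum_mono mult_mono) (auto simp: incr_nonneg touch_def intro!: mult_nonneg_nonneg)
    finally have 1: "b * \<theta> ^ n * (b * \<theta> ^ n) * (2 * en n (ca f)) \<le> (\<Sum>e\<in>touch n. incr (ca f) e * \<mu> (fst e) * \<mu> (snd e))" .
    have "ennreal (\<Sum>e\<in>touch n. incr (ca f) e * \<mu> (fst e) * \<mu> (snd e)) = (\<Sum>e\<in>touch n. ennreal (incr (ca f) e * \<mu> (fst e) * \<mu> (snd e)))"
      by (intro sum_ennreal[symmetric]) (auto simp: incr_nonneg)
    also have "\<dots> \<le> (\<Sum>e\<in>touch n. \<integral>\<^sup>+z. ?h z * (indicator (K (fst e)) (fst z) * indicator (K (snd e)) (snd z)) \<partial>(m \<Otimes>\<^sub>M m))"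
      unfolding incr_def by (intro sum_mono edge_le_integral f)
    also have "\<dots> = (\<integral>\<^sup>+z. (\<Sum>e\<in>touch n. ?h z * (indicator (K (fst e)) (fst z) * indicator (K (snd e)) (snd z))) \<partial>(m \<Otimes>\<^sub>M m))"
      by (rule nn_integral_sum[symmetric]) measurable
    also have "\<dots> \<le> (\<integral>\<^sup>+z. ennreal (real (N * N)) * (?h z * indicator (ball (fst z) r) (snd z)) \<partial>(m \<Otimes>\<^sub>M m))"
    proof (rule nn_integral_mono)
      fix z :: "'a \<times> 'a"
      define X where "X = (\<lambda>x. {v \<in> lev n. x \<in> K v})"
      have fX: "finite (X x)" "card (X x) \<le> N" for x using cells_at_card unfolding X_def by auto
      have "(\<Sum>e\<in>touch n. ?h z * (indicator (K (fst e)) (fst z) * indicator (K (snd e)) (snd z)))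
          = (\<Sum>e\<in>touch n \<inter> X (fst z) \<times> X (snd z). ?h z)"
      proof (rule sum.mono_neutral_cong_right)
        show "\<forall>e\<in>touch n - touch n \<inter> X (fst z) \<times> X (snd z). ?h z * (indicator (K (fst e)) (fst z) * indicator (K (snd e)) (snd z)) = 0"
        proof
          fix e assume e: "e \<in> touch n - touch n \<inter> X (fst z) \<times> X (snd z)"
          then have "fst e \<in> lev n" "snd e \<in> lev n" by (auto simp: touch_def)
          with e have "fst z \<notin> K (fst e) \<or> snd z \<notin> K (snd e)" by (cases e) (auto simp: X_def)
          then show "?h z * (indicator (K (fst e)) (fst z) * indicator (K (snd e)) (snd z)) = 0" by auto
        qed
      qed (auto simp: finite_touch X_def)
      also have "\<dots> = of_nat (card (touch n \<inter> X (fst z) \<times> X (snd z))) * ?h z" by simp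
      also have "\<dots> \<le> ennreal (real (N * N)) * (?h z * indicator (ball (fst z) r) (snd z))"
      proof (cases "touch n \<inter> X (fst z) \<times> X (snd z) = {}")
        case False
        then obtain u v where "(u, v) \<in> touch n" "fst z \<in> K u" "snd z \<in> K v" by (auto simp: X_def)
        then have "dist (fst z) (snd z) < r" using dist_touch r by force
        moreover have "card (touch n \<inter> X (fst z) \<times> X (snd z)) \<le> N * N"
        proof -
          have "card (touch n \<inter> X (fst z) \<times> X (snd z)) \<le> card (X (fst z) \<times> X (snd z))"
            using fX by (intro card_mono) auto
          also have "\<dots> \<le> N * N" unfolding card_cartesian_product using fX by (intro mult_mono) auto
          finally show ?thesis .
        qed
        then have "(of_nat (card (touch n \<inter> X (fst z) \<times> X (snd z))) :: ennreal) \<le> ennreal (real (N * N))"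
          unfolding ennreal_of_nat_eq_real_of_nat by (intro ennreal_leI of_nat_mono)
        ultimately show ?thesis by (auto intro!: mult_right_mono)
      qed simp
      finally show "(\<Sum>e\<in>touch n. ?h z * (indicator (K (fst e)) (fst z) * indicator (K (snd e)) (snd z)))
        \<le> ennreal (real (N * N)) * (?h z * indicator (ball (fst z) r) (snd z))" .
    qed
    also have "\<dots> = ennreal (real (N * N)) * G r f"
      unfolding G_product[OF lp_meas[OF f]] by (rule nn_integral_cmult) measurable
    finally have 2: "ennreal (b * \<theta> ^ n * (b * \<theta> ^ n) * (2 * en n (ca f))) \<le> ennreal (real (N * N)) * G r f"
      using ennreal_leI[OF 1] order.trans by blast
    have bb: "0 < b * b" using b by simp
    have "ennreal (en n (ca f) * \<theta> ^ n * \<theta> ^ n) \<le> ennreal (1 / (b * b) * (b * \<theta> ^ n * (b * \<theta> ^ n) * (2 * en n (ca f))))"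
      using b \<theta> energy_nonneg by (intro ennreal_leI) (auto simp: mult_ac)
    also have "\<dots> = ennreal (1 / (b * b)) * ennreal (b * \<theta> ^ n * (b * \<theta> ^ n) * (2 * en n (ca f)))"
      using b \<theta> energy_nonneg by (intro ennreal_mult) auto
    also have "\<dots> \<le> ennreal (1 / (b * b)) * (ennreal (real (N * N)) * G r f)"
      by (intro mult_left_mono 2) simp
    also have "\<dots> = ennreal (real (N * N) / (b * b)) * G r f"
      using b by (simp add: mult.assoc[symmetric] ennreal_mult'[symmetric])
    also have "\<dots> \<le> ennreal C * G r f" using C by (intro mult_right_mono ennreal_leI) auto
    finally show ?thesis .
  qed
  then show ?thesis using C by blast
qed

end

context framework
begin

section \<open>Hausdorff dimension\<close>

lemma measure_singleton: "measure m {x} = 0"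
proof (rule ccontr)
  assume "measure m {x} \<noteq> 0"
  then have pos: "0 < measure m {x}" by (simp add: zero_less_measure_iff)
  have le: "measure m {x} \<le> CA * t powr Q" if "0 < t" for t
  proof -
    have "measure m {x} \<le> measure m (ball x t)" using that by (intro finite_measure_mono) auto
    also have "\<dots> \<le> CA * t powr Q" by (rule ball_upper[OF that])
    finally show ?thesis .
  qed
  define t where "t = (measure m {x} / (2 * CA)) powr (1 / Q)"
  have t: "0 < t" using pos CA by (simp add: t_def)
  have "t powr Q = measure m {x} / (2 * CA)" using pos CA Q by (simp add: t_def powr_powr)
  with le[OF t] have "measure m {x} \<le> measure m {x} / 2" using CA by simp
  with pos show False by simp
qed

text \<open>
  The mass distribution principle: a set of diameter d has measure at most CA (2 d)^Q, so the
  diameters of a countable covering cannot have a small sum of powers. Sets of diameter 0 are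
  points and have measure 0.
\<close>

lemma hausdorff_premeasure_lower:
  assumes s: "0 < s" "s < Q"
  shows "ennreal (1 / (CA * 2 powr Q)) \<le> hausdorff_premeasure s 1 (UNIV :: 'a set)"
  unfolding hausdorff_premeasure_def
proof (rule INF_greatest)
  fix U :: "nat \<Rightarrow> 'a set"
  assume "U \<in> {U. UNIV \<subseteq> (\<Union>i. U i) \<and> (\<forall>i. bounded (U i) \<and> diameter (U i) \<le> 1)}"
  then have cov: "UNIV \<subseteq> (\<Union>i. U i)" and bd: "\<And>i. bounded (U i)" and dm: "\<And>i. diameter (U i) \<le> 1" by auto
  define C where "C = CA * 2 powr Q"
  have C: "0 < C" using CA by (simp add: C_def)
  have "\<exists>V. U i \<subseteq> V \<and> V \<in> sets m \<and> emeasure m V \<le> ennreal C * ennreal (diameter (U i) powr s)" for i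
  proof (cases "U i = {}")
    case True
    then show ?thesis by (intro exI[of _ "{}"]) auto
  next
    case False
    then obtain x where x: "x \<in> U i" by blast
    have dx: "dist x y \<le> diameter (U i)" if "y \<in> U i" for y
      by (rule diameter_bounded_bound[OF bd x that])
    show ?thesis
    proof (cases "diameter (U i) = 0")
      case True
      then have "U i \<subseteq> {x}" using dx by force
      moreover have "emeasure m {x} = 0" by (simp add: emeasure_eq_measure measure_singleton)
      moreover have "{x} \<in> sets m" by (simp add: sets_m)
      ultimately show ?thesis by (intro exI[of _ "{x}"]) auto
    next
      case False
      then have d: "0 < diameter (U i)" using diameter_ge_0[OF bd[of i]] by simp
      have "U i \<subseteq> ball x (2 * diameter (U i))" using dx d by force
      moreover have "emeasure m (ball x (2 * diameter (U i))) \<le> ennreal C * ennreal (diameter (U i) powr s)"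
      proof -
        have "measure m (ball x (2 * diameter (U i))) \<le> CA * (2 * diameter (U i)) powr Q"
          using d by (intro ball_upper) simp
        also have "\<dots> = C * diameter (U i) powr Q" using d by (simp add: C_def powr_mult)
        also have "\<dots> \<le> C * diameter (U i) powr s"
          using d dm[of i] s C by (intro mult_left_mono powr_mono') auto
        finally show ?thesis using C by (simp add: emeasure_eq_measure ennreal_mult'[symmetric] ennreal_leI)
      qed
      ultimately show ?thesis by (intro exI[of _ "ball x (2 * diameter (U i))"]) (auto simp: sets_ball)
    qed
  qed
  then obtain V where V: "\<And>i. U i \<subseteq> V i" "\<And>i. V i \<in> sets m"
    "\<And>i. emeasure m (V i) \<le> ennreal C * ennreal (diameter (U i) powr s)" by metis
  have "(\<Union>i. U i) \<subseteq> (\<Union>i. V i)" by (rule UN_mono[OF order_refl V(1)])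
  with cov have "UNIV \<subseteq> (\<Union>i. V i)" by (rule order.trans)
  then have "(\<Union>i. V i) = space m" by (auto simp: space_m)
  then have "1 = emeasure m (\<Union>i. V i)" using emeasure_space_1 by simp
  also have "\<dots> \<le> (\<Sum>i. emeasure m (V i))" using V(2) by (intro emeasure_subadditive_countably) auto
  also have "\<dots> \<le> (\<Sum>i. ennreal C * ennreal (diameter (U i) powr s))" by (intro suminf_le V(3)) auto
  also have "\<dots> = ennreal C * (\<Sum>i. ennreal (diameter (U i) powr s))" by simp
  finally have 1: "1 \<le> ennreal C * (\<Sum>i. ennreal (diameter (U i) powr s))" .
  have "ennreal (1 / C) * 1 \<le> ennreal (1 / C) * (ennreal C * (\<Sum>i. ennreal (diameter (U i) powr s)))"
    by (intro mult_left_mono 1) simp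
  also have "\<dots> = (\<Sum>i. ennreal (diameter (U i) powr s))"
    using C by (simp add: mult.assoc[symmetric] ennreal_mult'[symmetric])
  finally show "ennreal (1 / (CA * 2 powr Q)) \<le> (\<Sum>i. ennreal (diameter (U i) powr s))" by (simp add: C_def)
qed

text \<open>
  The cells of level n are at most a constant times \<theta>^(-n) in number, and the s-th powers
  of their diameters are at most a constant times rst^(n s), so for s > Q these coverings have
  sums tending to 0.
\<close>

lemma hausdorff_premeasure_zero:
  assumes s: "Q < s" and \<delta>: "0 < \<delta>"
  shows "hausdorff_premeasure s \<delta> (UNIV :: 'a set) = 0"
proof -
  obtain b where b: "0 < b" "\<forall>n. \<forall>w\<in>lev n. b * \<theta> ^ n \<le> \<mu> w" using mass_lower by blast
  define \<rho> where "\<rho> = rst powr (s - Q)"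
  have \<rho>: "0 < \<rho>" "\<rho> < 1" using rst s by (auto simp: \<rho>_def powr01_less_one)
  have rs: "(rst ^ n) powr s / \<theta> ^ n = \<rho> ^ n" for n
    using rst by (simp add: \<rho>_def \<theta>_def powr_realpow[symmetric] powr_powr powr_diff[symmetric] powr_power power_divide[symmetric] algebra_simps)
  have bound: "hausdorff_premeasure s \<delta> (UNIV :: 'a set) \<le> ennreal (c2 powr s / b * \<rho> ^ n)"
    if n: "c2 * rst ^ n \<le> \<delta>" for n
  proof -
    obtain h where h: "bij_betw h {0..<card (lev n)} (lev n)"
      using ex_bij_betw_nat_finite[OF finite_level] by blast
    define U where "U = (\<lambda>i. if i < card (lev n) then K (h i) else {})"
    have hl: "h i \<in> lev n" if "i < card (lev n)" for i
      using h that by (auto simp: bij_betw_def)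
    have dU: "diameter (U i) \<le> c2 * rst ^ n" for i
      using diam_K[of "h i"] hl c2 rst by (auto simp: U_def level_iff)
    have bU: "bounded (U i)" for i using compact_K compact_imp_bounded by (auto simp: U_def)
    have covU: "UNIV \<subseteq> (\<Union>i. U i)"
    proof
      fix x :: 'a
      obtain w where w: "w \<in> lev n" "x \<in> K w" using K_level[of n] by blast
      then obtain i where "i < card (lev n)" "h i = w" using bij_betw_imp_surj_on[OF h] by force
      then show "x \<in> (\<Union>i. U i)" using w by (intro UN_I[of i]) (auto simp: U_def)
    qed
    have "hausdorff_premeasure s \<delta> (UNIV :: 'a set) \<le> (\<Sum>i. ennreal (diameter (U i) powr s))"
      unfolding hausdorff_premeasure_def
    proof (rule INF_lower)
      show "U \<in> {U. UNIV \<subseteq> (\<Union>i. U i) \<and> (\<forall>i. bounded (U i) \<and> diameter (U i) \<le> \<delta>)}"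
        using covU bU dU n order.trans by blast
    qed
    also have "\<dots> = (\<Sum>i<card (lev n). ennreal (diameter (U i) powr s))"
      by (rule suminf_finite) (auto simp: U_def)
    also have "\<dots> = ennreal (\<Sum>i<card (lev n). diameter (U i) powr s)" by simp
    also have "\<dots> \<le> ennreal (c2 powr s / b * \<rho> ^ n)"
    proof (rule ennreal_leI)
      have "(\<Sum>i<card (lev n). diameter (U i) powr s) \<le> real (card (lev n)) * (c2 * rst ^ n) powr s"
      proof -
        have "diameter (U i) powr s \<le> (c2 * rst ^ n) powr s" for i
          using s Q by (intro powr_mono2 dU diameter_ge_0 bU) auto
        then show ?thesis
          using sum_bounded_above[of "{..<card (lev n)}" "\<lambda>i. diameter (U i) powr s" "(c2 * rst ^ n) powr s"] by simp
      qed
      also have "\<dots> \<le> (1 / (b * \<theta> ^ n)) * (c2 * rst ^ n) powr s"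
      proof (rule mult_right_mono)
        have "real (card (lev n)) * (b * \<theta> ^ n) \<le> (\<Sum>w\<in>lev n. \<mu> w)"
          using sum_bounded_below[of "lev n" "b * \<theta> ^ n" \<mu>] b by simp
        also have "\<dots> = 1" using measure_desc[of root n] by (simp add: desc_root measure_root)
        finally show "real (card (lev n)) \<le> 1 / (b * \<theta> ^ n)" using b \<theta> by (simp add: field_simps)
      qed simp
      also have "\<dots> = c2 powr s / b * ((rst ^ n) powr s / \<theta> ^ n)" using c2 rst by (simp add: powr_mult)
      finally show "(\<Sum>i<card (lev n). diameter (U i) powr s) \<le> c2 powr s / b * \<rho> ^ n" by (simp only: rs)
    qed
    finally show ?thesis .
  qed
  have "(\<lambda>n. c2 * rst ^ n) \<longlonglongrightarrow> c2 * 0"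
    using rst by (intro tendsto_intros LIMSEQ_realpow_zero) auto
  then have "eventually (\<lambda>n. c2 * rst ^ n < \<delta>) sequentially"
    using \<delta> by (auto dest: order_tendstoD(2))
  then have ev: "eventually (\<lambda>n. hausdorff_premeasure s \<delta> (UNIV :: 'a set) \<le> ennreal (c2 powr s / b * \<rho> ^ n)) sequentially"
    by eventually_elim (rule bound, simp)
  have "(\<lambda>n. c2 powr s / b * \<rho> ^ n) \<longlonglongrightarrow> c2 powr s / b * 0"
    using \<rho> by (intro tendsto_intros LIMSEQ_realpow_zero) auto
  then have "(\<lambda>n. ennreal (c2 powr s / b * \<rho> ^ n)) \<longlonglongrightarrow> ennreal 0"
    by (intro tendsto_ennrealI) simp
  from tendsto_lowerbound[OF this ev] show ?thesis by simp
qed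

lemma hausdorff_dim_eq: "hausdorff_dim (UNIV :: 'a set) = ereal Q"
proof -
  have zero: "hausdorff_measure s (UNIV :: 'a set) = 0" if "Q < s" for s
    using hausdorff_premeasure_zero[OF that] unfolding hausdorff_measure_def by simp
  have pos: "hausdorff_measure s (UNIV :: 'a set) \<noteq> 0" if "0 < s" "s < Q" for s
  proof
    assume z: "hausdorff_measure s (UNIV :: 'a set) = 0"
    have "ennreal (1 / (CA * 2 powr Q)) \<le> hausdorff_premeasure s 1 (UNIV :: 'a set)"
      by (rule hausdorff_premeasure_lower[OF that])
    also have "\<dots> \<le> hausdorff_measure s (UNIV :: 'a set)"
      unfolding hausdorff_measure_def by (rule SUP_upper) simp
    finally show False using z CA by simp
  qed
  show ?thesis unfolding hausdorff_dim_def
  proof (rule antisym)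
    show "(INF s\<in>{s. 0 < s \<and> hausdorff_measure s (UNIV :: 'a set) = 0}. ereal s) \<le> ereal Q"
    proof (rule ereal_le_epsilon2)
      fix e :: real assume "0 < e"
      then have "(INF s\<in>{s. 0 < s \<and> hausdorff_measure s (UNIV :: 'a set) = 0}. ereal s) \<le> ereal (Q + e)"
        using Q zero[of "Q + e"] by (intro INF_lower) auto
      then show "(INF s\<in>{s. 0 < s \<and> hausdorff_measure s (UNIV :: 'a set) = 0}. ereal s) \<le> ereal Q + ereal e" by simp
    qed
    show "ereal Q \<le> (INF s\<in>{s. 0 < s \<and> hausdorff_measure s (UNIV :: 'a set) = 0}. ereal s)"
      using pos by (intro INF_greatest) (auto simp: not_less[symmetric])
  qed
qed

section \<open>Discrete energies and Korevaar-Schoen energies at small radii\<close>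

abbreviation "dw \<equiv> walk_dim E root K m Mst rst p"

lemma dw_eq: "dw = Q + ln \<sigma> / ln (1 / rst)"
  by (simp add: walk_dim_def hausdorff_dim_eq)

lemma rst_dw: "rst powr dw = \<theta> / \<sigma>"
proof -
  have "ln rst < 0" using rst by simp
  then have "ln \<sigma> / ln (1 / rst) * ln rst = - ln \<sigma>" using rst by (simp add: ln_div)
  then have "rst powr (ln \<sigma> / ln (1 / rst)) = 1 / \<sigma>"
    using rst \<sigma>_pos by (simp add: powr_def exp_minus field_simps)
  then show ?thesis unfolding dw_eq powr_add \<theta>_def by simp
qed

lemma rst_dw_power: "(rst ^ n) powr dw = (\<theta> / \<sigma>) ^ n"
  using rst by (simp add: rst_dw[symmetric] powr_realpow[symmetric] powr_powr powr_power mult.commute)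

text \<open>
  The first level n' on which two touching cells have a union of diameter less than r is deeper
  than n and has cells of size comparable to r.
\<close>

lemma scale_exists:
  assumes "0 < r" "r \<le> 2 * c2 * rst ^ n"
  shows "\<exists>n'>n. 2 * c2 * rst ^ n' < r \<and> r \<le> 2 * c2 * rst ^ (n' - 1)"
proof -
  have "0 < r / (2 * c2)" using assms c2 by simp
  then obtain k where "rst ^ k < r / (2 * c2)" using rst real_arch_pow_inv by blast
  then have k: "2 * c2 * rst ^ k < r" using c2 by (simp add: field_simps)
  define n' where "n' = (LEAST k. 2 * c2 * rst ^ k < r)"
  have n': "2 * c2 * rst ^ n' < r" unfolding n'_def using k by (rule LeastI)
  have "n < n'"
  proof (rule ccontr)
    assume "\<not> n < n'"
    then have "rst ^ n \<le> rst ^ n'" using rst by (intro power_decreasing) auto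
    then have "2 * c2 * rst ^ n \<le> 2 * c2 * rst ^ n'" using c2 by simp
    with assms n' show False by linarith
  qed
  moreover from this have "\<not> 2 * c2 * rst ^ (n' - 1) < r"
    unfolding n'_def by (intro not_less_Least) simp
  ultimately show ?thesis using n' by (intro exI[of _ n']) auto
qed

text \<open>
  A bound for both signs of the exponent, which here is dw + Q and whose sign is not known at this
  stage.
\<close>

lemma powr_between:
  fixes a u R :: real
  assumes "1 \<le> u" "u \<le> R"
  shows "u powr a \<le> 1 + R powr a"
proof (cases "0 \<le> a")
  case True
  then have "u powr a \<le> R powr a" using assms by (intro powr_mono2) auto
  then show ?thesis by simp
next
  case False
  then have "u powr a \<le> u powr 0" using assms by (intro powr_mono) auto
  then show ?thesis using assms by (simp add: add_increasing2)
qed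

text \<open>
  Weak monotonicity passes from level n to the level n' of cells of size r, where the energy is at
  most the double integral. The exponent s is arbitrary: s = dw / p gives the lower bound for the
  critical energies, and a larger s makes the factor r powr (p * s - dw) vanish as r tends to 0.
\<close>

lemma energy_le_kernel:
  "\<exists>C>0. \<forall>f\<in>Lp. \<forall>n r s. 0 < r \<longrightarrow> r \<le> 2 * c2 * rst ^ n \<longrightarrow>
     ennreal (se n f) \<le> ennreal (C * r powr (p * s - dw)) * ksJ s r f"
proof -
  obtain C1 where C1: "0 < C1" "\<forall>f\<in>Lp. \<forall>n k. se n f \<le> C1 * se (n + k) f"
    using weak_monotone_energy by blast
  obtain C2 where C2: "0 < C2" "\<forall>f\<in>Lp. \<forall>n r. 2 * c2 * rst ^ n < r \<longrightarrow> ennreal (en n (ca f) * \<theta> ^ n * \<theta> ^ n) \<le> ennreal C2 * G r f"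
    using energy_le_G by blast
  define a where "a = dw + Q"
  define U where "U = (2 * c2) powr a * (1 + (1 / rst) powr a)"
  have U: "0 < U" using c2 by (simp add: U_def add_pos_nonneg)
  have "ennreal (se n f) \<le> ennreal (C1 * C2 * U * CA * r powr (p * s - dw)) * ksJ s r f"
    if f: "f \<in> Lp" and r: "0 < r" "r \<le> 2 * c2 * rst ^ n" for f n r s
  proof -
    obtain n' where n': "n < n'" "2 * c2 * rst ^ n' < r" "r \<le> 2 * c2 * rst ^ (n' - 1)"
      using scale_exists[OF r] by blast
    have mono: "se n f \<le> C1 * se n' f" using C1(2) f n'(1) by (metis le_add_diff_inverse less_imp_le)
    \<comment> \<open>The ratio of r to the size of cells of level n', which lies between 1 and 1 / rst.\<close>
    define u where "u = r / (2 * c2 * rst ^ n')"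
    have den: "0 < 2 * c2 * rst ^ n'" using c2 rst by simp
    have ru: "r = 2 * c2 * rst ^ n' * u" using den c2 rst by (simp add: u_def)
    have "rst ^ n' = rst * rst ^ (n' - 1)" using n'(1) by (metis gr_implies_not0 power_eq_if)
    then have u: "1 \<le> u" "u \<le> 1 / rst" using n' den rst c2 unfolding u_def by (auto simp: field_simps)
    have ra: "r powr a \<le> U * ((\<theta> / \<sigma>) ^ n' * \<theta> ^ n')"
    proof -
      have "r powr a = (2 * c2) powr a * ((rst ^ n') powr dw * (rst ^ n') powr Q) * u powr a"
        unfolding ru using c2 rst u by (simp add: powr_mult a_def powr_add)
      also have "\<dots> = (2 * c2) powr a * ((\<theta> / \<sigma>) ^ n' * \<theta> ^ n') * u powr a"
        using \<theta>_power[of 1 n'] by (simp add: rst_dw_power)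
      also have "\<dots> \<le> (2 * c2) powr a * ((\<theta> / \<sigma>) ^ n' * \<theta> ^ n') * (1 + (1 / rst) powr a)"
        using \<theta> \<sigma>_pos by (intro mult_left_mono powr_between u) auto
      finally show ?thesis by (simp add: U_def mult_ac)
    qed
    have ra0: "0 < r powr a" using r by simp
    define e where "e = en n' (ca f) * \<theta> ^ n' * \<theta> ^ n'"
    have e0: "0 \<le> e" using energy_nonneg \<theta> by (simp add: e_def)
    have "se n' f * r powr a \<le> se n' f * (U * ((\<theta> / \<sigma>) ^ n' * \<theta> ^ n'))"
      using ra se_nonneg by (rule mult_left_mono)
    also have "\<dots> = U * e" using \<sigma>_pos by (simp add: e_def power_divide field_simps)
    finally have "se n' f \<le> U * r powr (- a) * e" using ra0 by (simp add: powr_minus field_simps)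
    then have "se n f \<le> C1 * (U * r powr (- a)) * e" using mono C1(1) by (smt (verit) mult.assoc mult_left_mono)
    then have "ennreal (se n f) \<le> ennreal (C1 * (U * r powr (- a)) * e)" by (rule ennreal_leI)
    also have "\<dots> = ennreal (C1 * (U * r powr (- a))) * ennreal e" using C1 U e0 by (intro ennreal_mult) auto
    also have "\<dots> \<le> ennreal (C1 * (U * r powr (- a))) * (ennreal C2 * G r f)"
      using C2(2) f n' unfolding e_def by (intro mult_left_mono) auto
    also have "\<dots> \<le> ennreal (C1 * (U * r powr (- a))) * (ennreal C2 * (ennreal (CA * r powr (p * s + Q)) * ksJ s r f))"
    proof (intro mult_left_mono G_le_kernel)
      fix x show "r powr (p * s) * measure m (ball x r) \<le> CA * r powr (p * s + Q)"
        using mult_left_mono[OF ball_upper[OF r(1), of x], of "r powr (p * s)"] by (simp add: powr_add mult_ac)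
    qed (use f lp_meas r CA in auto)
    also have "\<dots> = ennreal (C1 * (U * r powr (- a)) * C2 * (CA * r powr (p * s + Q))) * ksJ s r f"
      using C1 C2 U CA by (simp add: ennreal_mult' mult.assoc)
    also have "C1 * (U * r powr (- a)) * C2 * (CA * r powr (p * s + Q)) = C1 * C2 * U * CA * (r powr (- a) * r powr (p * s + Q))" by simp
    also have "r powr (- a) * r powr (p * s + Q) = r powr (p * s - dw)" by (simp add: powr_add[symmetric] a_def)
    finally show ?thesis .
  qed
  then show ?thesis using C1 C2 U CA by (intro exI[of _ "C1 * C2 * U * CA"]) auto
qed

lemma Np_le_Liminf:
  "\<exists>C>0. \<forall>f\<in>Lp. Np f \<le> ennreal C * Liminf (at_right 0) (\<lambda>r. ksJ (dw / p) r f)"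
proof -
  obtain C where C: "0 < C" "\<forall>f\<in>Lp. \<forall>n r s. 0 < r \<longrightarrow> r \<le> 2 * c2 * rst ^ n \<longrightarrow>
     ennreal (se n f) \<le> ennreal (C * r powr (p * s - dw)) * ksJ s r f"
    using energy_le_kernel by blast
  have "Np f \<le> ennreal C * Liminf (at_right 0) (\<lambda>r. ksJ (dw / p) r f)" if f: "f \<in> Lp" for f
    unfolding Np_def
  proof (rule SUP_least)
    fix n
    let ?J = "\<lambda>r. ksJ (dw / p) r f"
    have "\<forall>\<^sub>F r in at_right 0. r < 2 * c2 * rst ^ n"
      using c2 rst by (intro order_tendstoD(2)[OF tendsto_ident_at]) auto
    moreover have "\<forall>\<^sub>F r in at_right (0::real). 0 < r" by (simp add: eventually_at_right_less)
    ultimately have "\<forall>\<^sub>F r in at_right 0. ennreal (1 / C) * ennreal (se n f) \<le> ?J r"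
    proof eventually_elim
      case (elim r)
      then have "ennreal (se n f) \<le> ennreal (C * r powr (p * (dw / p) - dw)) * ?J r"
        using C(2) f by (meson less_imp_le)
      also have "C * r powr (p * (dw / p) - dw) = C" using p0 elim by simp
      finally have "ennreal (1 / C) * ennreal (se n f) \<le> ennreal (1 / C) * (ennreal C * ?J r)"
        by (intro mult_left_mono) auto
      also have "\<dots> = ?J r" using C by (simp add: mult.assoc[symmetric] ennreal_mult'[symmetric])
      finally show ?case .
    qed
    then have "ennreal (1 / C) * ennreal (se n f) \<le> Liminf (at_right 0) ?J" by (rule Liminf_bounded)
    then have "ennreal C * (ennreal (1 / C) * ennreal (se n f)) \<le> ennreal C * Liminf (at_right 0) ?J"
      by (intro mult_left_mono) auto
    then show "ennreal (se n f) \<le> ennreal C * Liminf (at_right 0) ?J"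
      using C by (simp add: mult.assoc[symmetric] ennreal_mult'[symmetric])
  qed
  with C(1) show ?thesis by blast
qed

section \<open>Functions determined by their cell integrals\<close>

text \<open>
  An open set is the increasing union of the cells contained in it, level by level, because
  diameters of cells tend to 0. Overlaps of cells of the same level have measure 0, so the
  integral over each union is a sum of integrals over cells.
\<close>

lemma cell_integrals_zero_open:
  fixes h :: "'a \<Rightarrow> real"
  assumes h: "integrable m h" and z: "\<And>w. (\<integral>x. indicator (K w) x * h x \<partial>m) = 0" and "open S"
  shows "(\<integral>x. indicator S x * h x \<partial>m) = 0"
proof -
  have [measurable]: "h \<in> borel_measurable m" using h by auto
  define W where "W = (\<lambda>n. {w \<in> lev n. K w \<subseteq> S})"
  have finW: "finite (W n)" for n unfolding W_def using finite_level by simp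
  define g where "g = (\<lambda>n x. indicator (\<Union>w\<in>W n. K w) x * h x)"
  have mg [measurable]: "(\<Union>w\<in>W n. K w) \<in> sets m" for n using finW by auto
  have S [measurable]: "S \<in> sets m" using \<open>open S\<close> by (simp add: sets_m)
  have zero: "(\<integral>x. g n x \<partial>m) = 0" for n
  proof -
    have "(\<integral>x. g n x \<partial>m) = (\<integral>x. (\<Sum>w\<in>W n. indicator (K w) x * h x) \<partial>m)"
    proof (rule integral_cong_AE)
      show "AE x in m. g n x = (\<Sum>w\<in>W n. indicator (K w) x * h x)"
        using AE_indicator_level[of n]
      proof eventually_elim
        case (elim x)
        have le: "(\<Sum>w\<in>W n. indicator (K w) x) \<le> (1::real)"
          unfolding elim[symmetric] using finite_level by (intro sum_mono2) (auto simp: W_def)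
        have "indicator (\<Union>w\<in>W n. K w) x = (\<Sum>w\<in>W n. indicator (K w) x :: real)"
        proof (cases "x \<in> (\<Union>w\<in>W n. K w)")
          case True
          then obtain w where w: "w \<in> W n" "x \<in> K w" by blast
          have "indicator (K w) x \<le> (\<Sum>w\<in>W n. indicator (K w) x :: real)"
            using w finW by (intro member_le_sum) auto
          then show ?thesis using le w True by simp
        qed auto
        then show ?case by (simp add: g_def sum_distrib_right)
      qed
    qed (auto simp: g_def)
    also have "\<dots> = (\<Sum>w\<in>W n. \<integral>x. indicator (K w) x * h x \<partial>m)"
      by (intro Bochner_Integration.integral_sum integrable_indicator_mult h)
    finally show ?thesis using z by simp
  qed
  have "(\<lambda>n. \<integral>x. g n x \<partial>m) \<longlonglongrightarrow> (\<integral>x. indicator S x * h x \<partial>m)"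
  proof (rule integral_dominated_convergence[where w = "\<lambda>x. \<bar>h x\<bar>"])
    show "AE x in m. (\<lambda>n. g n x) \<longlonglongrightarrow> indicator S x * h x"
    proof (rule AE_I2)
      fix x
      show "(\<lambda>n. g n x) \<longlonglongrightarrow> indicator S x * h x"
      proof (cases "x \<in> S")
        case True
        then obtain e where e: "0 < e" "ball x e \<subseteq> S" using \<open>open S\<close> open_contains_ball by blast
        have "(\<lambda>n. c2 * rst ^ n) \<longlonglongrightarrow> c2 * 0"
          using rst by (intro tendsto_intros LIMSEQ_realpow_zero) auto
        then have "eventually (\<lambda>n. c2 * rst ^ n < e) sequentially"
          using e by (auto dest: order_tendstoD(2))
        then have "eventually (\<lambda>n. g n x = indicator S x * h x) sequentially"
        proof eventually_elim
          case (elim n)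
          obtain w where w: "w \<in> lev n" "x \<in> K w" using K_level[of n] by blast
          have "K w \<subseteq> ball x e"
          proof
            fix y assume "y \<in> K w"
            then have "dist x y \<le> c2 * rst ^ n" using dist_K[OF w(2)] w(1) by (simp add: level_iff)
            then show "y \<in> ball x e" using elim by simp
          qed
          then have "w \<in> W n" using e w by (auto simp: W_def)
          then have "x \<in> (\<Union>w\<in>W n. K w)" using w by blast
          then show ?case using True by (simp add: g_def)
        qed
        then show ?thesis by (rule tendsto_eventually)
      next
        case False
        then have "x \<notin> (\<Union>w\<in>W n. K w)" for n by (auto simp: W_def)
        then have "g n x = 0" for n by (simp add: g_def)
        then show ?thesis using False by simp
      qed
    qed
    show "AE x in m. norm (g n x) \<le> \<bar>h x\<bar>" for n
      by (rule AE_I2) (auto simp: g_def indicator_def)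
  qed (use h in \<open>auto simp: g_def\<close>)
  then have "(\<lambda>n. 0) \<longlonglongrightarrow> (\<integral>x. indicator S x * h x \<partial>m)" by (simp add: zero)
  then show ?thesis by (simp add: LIMSEQ_const_iff)
qed

text \<open>
  From open sets, which are stable under intersection, to all Borel sets by Dynkin's argument.
\<close>

lemma cell_integrals_zero:
  fixes h :: "'a \<Rightarrow> real"
  assumes h: "integrable m h" and z: "\<And>w. (\<integral>x. indicator (K w) x * h x \<partial>m) = 0"
  shows "AE x in m. h x = 0"
proof -
  have [measurable]: "h \<in> borel_measurable m" using h by auto
  have intA: "integrable m (\<lambda>x. indicator A x * h x)" if "A \<in> sets m" for A
    using integrable_mult_indicator[OF that h] by simp
  have all: "(\<integral>x. indicator A x * h x \<partial>m) = 0" if "A \<in> sigma_sets UNIV {S :: 'a set. open S}" for A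
  proof -
    have "Int_stable {S :: 'a set. open S}" "{S :: 'a set. open S} \<subseteq> Pow UNIV" by (auto simp: Int_stable_def)
    then show ?thesis using that
  proof (induction rule: sigma_sets_induct_disjoint)
    case (basic A)
    then show ?case using cell_integrals_zero_open[OF h z] by simp
  next
    case empty
    then show ?case by simp
  next
    case (compl A)
    then have A: "A \<in> sets m" by (simp add: sets_m sets_borel)
    have "(\<integral>x. indicator (UNIV - A) x * h x \<partial>m) = (\<integral>x. indicator UNIV x * h x - indicator A x * h x \<partial>m)"
      by (intro Bochner_Integration.integral_cong) (auto simp: indicator_def)
    also have "\<dots> = (\<integral>x. indicator UNIV x * h x \<partial>m) - (\<integral>x. indicator A x * h x \<partial>m)"
      using intA[OF A] h by (intro Bochner_Integration.integral_diff) auto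
    finally show ?case using compl cell_integrals_zero_open[OF h z, of UNIV] by simp
  next
    case (union A)
    then have A [measurable]: "A i \<in> sets m" for i by (auto simp: sets_m sets_borel)
    have "(\<integral>x. indicator (\<Union>i. A i) x * h x \<partial>m) = (\<Sum>i. \<integral>x\<in>A i. h x \<partial>m)"
    proof -
      have "(\<Union>i. A i) \<in> sets m" using A by blast
      then have "set_integrable m (\<Union>i. A i) h" using intA by (simp add: set_integrable_def)
      moreover have "A i \<inter> A j = {}" if "i \<noteq> j" for i j using union(1) that by (auto simp: disjoint_family_on_def)
      ultimately show ?thesis
        using lebesgue_integral_countable_add[of A m h] A by (simp add: set_lebesgue_integral_def)
    qed
    then show ?case using union by (simp add: set_lebesgue_integral_def)
  qed
  qed
  show ?thesis
  proof (rule density_unique_real)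
    fix A assume "A \<in> sets m"
    then have "A \<in> sigma_sets UNIV {S. open S}" by (simp add: sets_m sets_borel)
    from all[OF this] show "(\<integral>x\<in>A. h x \<partial>m) = (\<integral>x\<in>A. 0 \<partial>m)" by (simp add: set_lebesgue_integral_def)
  qed (use h in auto)
qed

text \<open>
  Levels are connected, so vanishing energy makes all cell averages of a level equal, and
  averaging identifies the common number with the mean over the whole space.
\<close>

lemma zero_energy_const:
  assumes f: "f \<in> Lp" and z: "\<And>n. en n (ca f) = 0"
  shows "AE x in m. f x = ca f root"
proof -
  have eq: "ca f w = ca f root" for w
  proof -
    let ?n = "ht w"
    have w: "w \<in> lev ?n" by (simp add: level_iff)
    have same: "ca f v = ca f w" if "v \<in> lev ?n" for v
      using energy_separates[OF that w, of "ca f"] z[of ?n] powr_gt_zero[of "\<bar>ca f v - ca f w\<bar>" p] by simp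
    have "avg ?n (ca f) root = ca f w" by (rule avg_const) (use same desc_root in auto)
    then show ?thesis using ca_desc[OF f, of ?n root] by simp
  qed
  have hi: "(\<lambda>x. f x - ca f root) \<in> Lp" by (intro lp_diff f lp_const)
  have "AE x in m. f x - ca f root = 0"
  proof (rule cell_integrals_zero)
    show "integrable m (\<lambda>x. f x - ca f root)" by (rule lp_integrable[OF hi])
    fix w
    have "ca (\<lambda>x. f x - ca f root) w = 0" using ca_diff[OF f lp_const, of "ca f root" w] eq[of w] by (simp add: ca_const)
    then show "(\<integral>x. indicator (K w) x * (f x - ca f root) \<partial>m) = 0" using measure_pos[of w] by (simp add: ca_eq)
  qed
  then show ?thesis by eventually_elim simp
qed

section \<open>Upper bound for the critical exponent\<close>

text \<open>
  For s > dw / p the discrete energies are bounded by a positive power of r times a bounded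
  quantity, for all small r.
\<close>

lemma besov_supercritical:
  assumes s: "dw / p < s" and f: "f \<in> besov_space m p (ks_kernel m p s)"
  shows "\<exists>c. AE x in m. f x = c"
proof -
  have fp: "f \<in> Lp" and fin: "(SUP r\<in>{0<..}. ksJ s r f) < \<infinity>"
    using f by (auto simp: besov_space_def)
  obtain S where S: "(SUP r\<in>{0<..}. ksJ s r f) = ennreal S" "0 \<le> S"
    using fin by (cases "(SUP r\<in>{0<..}. ksJ s r f)") auto
  have SJ: "ksJ s r f \<le> ennreal S" if "0 < r" for r
    unfolding S(1)[symmetric] using that by (intro SUP_upper) auto
  obtain C where C: "0 < C" "\<forall>f\<in>Lp. \<forall>n r s. 0 < r \<longrightarrow> r \<le> 2 * c2 * rst ^ n \<longrightarrow>
     ennreal (se n f) \<le> ennreal (C * r powr (p * s - dw)) * ksJ s r f"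
    using energy_le_kernel by blast
  have a: "0 < p * s - dw" using s p0 by (simp add: field_simps)
  have "en n (ca f) = 0" for n
  proof -
    have le: "se n f \<le> C * r powr (p * s - dw) * S" if r: "0 < r" "r \<le> 2 * c2 * rst ^ n" for r
    proof -
      have "ennreal (se n f) \<le> ennreal (C * r powr (p * s - dw)) * ksJ s r f"
        using C(2) fp r by blast
      also have "\<dots> \<le> ennreal (C * r powr (p * s - dw)) * ennreal S" by (intro mult_left_mono SJ r) simp
      also have "\<dots> = ennreal (C * r powr (p * s - dw) * S)" using C S by (intro ennreal_mult[symmetric]) auto
      finally show ?thesis using C S by (subst (asm) ennreal_le_iff) auto
    qed
    have "((\<lambda>r. C * r powr (p * s - dw) * S) \<longlongrightarrow> C * 0 powr (p * s - dw) * S) (at_right 0)"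
      using a by (intro tendsto_intros tendsto_powr') (auto intro!: eventually_mono[OF eventually_at_right_less])
    then have lim: "((\<lambda>r. C * r powr (p * s - dw) * S) \<longlongrightarrow> 0) (at_right 0)" by simp
    have "\<forall>\<^sub>F r in at_right 0. r < 2 * c2 * rst ^ n"
      using c2 rst by (intro order_tendstoD(2)[OF tendsto_ident_at]) auto
    moreover have "\<forall>\<^sub>F r in at_right (0::real). 0 < r" by (simp add: eventually_at_right_less)
    ultimately have "\<forall>\<^sub>F r in at_right 0. se n f \<le> C * r powr (p * s - dw) * S"
      by eventually_elim (use le in auto)
    from tendsto_lowerbound[OF lim this] have "se n f \<le> 0" by simp
    then show ?thesis using zero_less_power[OF \<sigma>_pos, of n] energy_nonneg[of n "lev n" "ca f"]
      by (auto simp: mult_le_0_iff)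
  qed
  then show ?thesis using zero_energy_const[OF fp] by blast
qed

lemma AE_const_continuous:
  fixes f :: "'a \<Rightarrow> real"
  assumes "continuous_on UNIV f" "AE x in m. f x = c"
  shows "f x = c"
proof (rule ccontr)
  assume "f x \<noteq> c"
  have "open {x. f x \<noteq> c}"
    using assms(1) by (intro open_Collect_neq) auto
  then obtain e where e: "0 < e" "ball x e \<subseteq> {x. f x \<noteq> c}"
    using \<open>f x \<noteq> c\<close> open_contains_ball by blast
  have "AE y in m. y \<notin> ball x e" using assms(2) by eventually_elim (use e in auto)
  moreover have "{y \<in> space m. \<not> y \<notin> ball x e} = ball x e" by (auto simp: space_m)
  ultimately have "emeasure m (ball x e) = 0"
    using AE_iff_measurable[OF sets_ball, of "\<lambda>y. y \<notin> ball x e" x e] by blast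
  then show False using ball_pos[OF e(1), of x] by (simp add: emeasure_eq_measure)
qed

lemma two_points: "\<exists>x y :: 'a. x \<noteq> y"
proof (rule ccontr)
  assume "\<not> ?thesis"
  then have "diameter (UNIV :: 'a set) = 0" by (metis diameter_empty diameter_singleton UNIV_eq_I insertI1 singletonD)
  with diam1 show False by simp
qed

text \<open>
  Distance functions are Lipschitz, so |f x - f y|^p \<le> r^p on balls of radius r, which is the
  normalization for s = 1.
\<close>

lemma dist_besov: "(\<lambda>x. dist x x0) \<in> besov_space m p (ks_kernel m p 1)"
proof -
  have "ksJ 1 r (\<lambda>x. dist x x0) \<le> 1" if r: "0 < r" for r
  proof -
    have "ksJ 1 r (\<lambda>x. dist x x0) \<le> (\<integral>\<^sup>+x. 1 \<partial>m)"
      unfolding kernel_energy_def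
    proof (rule nn_integral_mono)
      fix x
      have mb: "0 < measure m (ball x r)" by (rule ball_pos[OF r])
      have "(\<integral>\<^sup>+y. ennreal (\<bar>dist x x0 - dist y x0\<bar> powr p * ks_kernel m p 1 r x y) \<partial>m)
          \<le> (\<integral>\<^sup>+y. ennreal (1 / measure m (ball x r)) * indicator (ball x r) y \<partial>m)"
      proof (rule nn_integral_mono)
        fix y
        show "ennreal (\<bar>dist x x0 - dist y x0\<bar> powr p * ks_kernel m p 1 r x y) \<le> ennreal (1 / measure m (ball x r)) * indicator (ball x r) y"
        proof (cases "y \<in> ball x r")
          case True
          have "\<bar>dist x x0 - dist y x0\<bar> \<le> dist x y"
            using dist_triangle[of x x0 y] dist_triangle[of y x0 x] by (simp add: dist_commute abs_le_iff)
          then have "\<bar>dist x x0 - dist y x0\<bar> powr p \<le> r powr p" using True p0 by (intro powr_mono2) auto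
          then have "\<bar>dist x x0 - dist y x0\<bar> powr p * (1 / (r powr p * measure m (ball x r))) \<le> r powr p * (1 / (r powr p * measure m (ball x r)))"
            by (intro mult_right_mono) auto
          also have "\<dots> = 1 / measure m (ball x r)" using r by simp
          finally show ?thesis using True by (auto simp: ks_kernel_def intro: ennreal_leI)
        qed (simp add: ks_kernel_def)
      qed
      also have "\<dots> = ennreal (1 / measure m (ball x r)) * emeasure m (ball x r)"
        by (rule nn_integral_cmult_indicator) simp
      also have "\<dots> = 1" using mb by (simp add: emeasure_eq_measure ennreal_mult'[symmetric])
      finally show "(\<integral>\<^sup>+y. ennreal (\<bar>dist x x0 - dist y x0\<bar> powr p * ks_kernel m p 1 r x y) \<partial>m) \<le> 1" .
    qed
    also have "\<dots> = 1" using emeasure_space_1 by simp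
    finally show ?thesis .
  qed
  then have "(SUP r\<in>{0<..}. ksJ 1 r (\<lambda>x. dist x x0)) \<le> 1"
    by (intro SUP_least) auto
  then have "(SUP r\<in>{0<..}. ksJ 1 r (\<lambda>x. dist x x0)) < \<infinity>"
    by (rule le_less_trans) simp
  moreover have "(\<lambda>x. dist x x0) \<in> Lp" by (intro lp_continuous continuous_intros)
  ultimately show ?thesis by (simp add: besov_space_def)
qed

text \<open>
  If dw / p < 1, distance functions would be constant.
\<close>

lemma dw_ge_p: "p \<le> dw"
proof (rule ccontr)
  assume "\<not> p \<le> dw"
  then have "dw / p < 1" using p0 by simp
  obtain x0 y0 :: 'a where xy: "x0 \<noteq> y0" using two_points by blast
  obtain c where "AE x in m. dist x x0 = c" using besov_supercritical[OF \<open>dw / p < 1\<close> dist_besov] by blast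
  moreover have "continuous_on UNIV (\<lambda>x. dist x x0)" by (intro continuous_intros)
  ultimately have "dist x x0 = c" for x using AE_const_continuous by blast
  from this[of x0] this[of y0] xy show False by simp
qed

lemma dw_pos: "0 < dw" using dw_ge_p p0 by linarith

end

section \<open>Approximation by cell averages\<close>

text \<open>
  A Hoelder inequality against a geometric weight, in the form of a termwise bound: either d i is
  at most t l^i, or it is bounded by the weighted p-th power. Choosing t with t^p = S balances the
  two contributions, and summability comes as a by-product.
\<close>

lemma weighted_powr_sum:
  fixes d :: "nat \<Rightarrow> real"
  assumes p: "1 < p" and l: "0 < l" "l < 1" and d: "\<And>i. 0 \<le> d i"
    and S: "\<And>n. (\<Sum>i<n. (l powr (1 - p)) ^ i * d i powr p) \<le> S"
  shows "summable d" "suminf d powr p \<le> (1 / (1 - l) + 1) powr p * S"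
proof -
  let ?k = "l powr (1 - p)"
  have k: "0 < ?k" using l by simp
  have S0: "0 \<le> S" using S[of 0] by simp
  have young: "d i \<le> t * l ^ i + t powr (1 - p) * (?k ^ i * d i powr p)" if t: "0 < t" for t i
  proof (cases "d i \<le> t * l ^ i")
    case True
    have "0 \<le> t powr (1 - p) * (?k ^ i * d i powr p)" using k by simp
    with True show ?thesis by linarith
  next
    case False
    have tl: "0 < t * l ^ i" using t l by simp
    have "d i = d i powr p * d i powr (1 - p)" using False tl by (simp add: powr_add[symmetric])
    also have "\<dots> \<le> d i powr p * (t * l ^ i) powr (1 - p)"
      using False tl p by (intro mult_left_mono powr_mono2') auto
    also have "(t * l ^ i) powr (1 - p) = t powr (1 - p) * ?k ^ i"
      using t l by (simp add: powr_mult powr_realpow[symmetric] powr_powr powr_power mult.commute)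
    finally have "d i \<le> t powr (1 - p) * (?k ^ i * d i powr p)" by (simp add: mult_ac)
    with tl show ?thesis by linarith
  qed
  have geo: "(\<Sum>i<n. l ^ i) \<le> 1 / (1 - l)" for n
  proof -
    have "(\<Sum>i<n. l ^ i) \<le> (\<Sum>i. l ^ i)" using l by (intro sum_le_suminf summable_geometric) auto
    then show ?thesis using l by (simp add: suminf_geometric)
  qed
  define B where "B = S powr (1 / p) * (1 / (1 - l) + 1)"
  have part: "(\<Sum>i<n. d i) \<le> B" for n
  proof (cases "S = 0")
    case True
    have "d i = 0" for i
    proof -
      have "?k ^ i * d i powr p \<le> (\<Sum>j<Suc i. ?k ^ j * d j powr p)"
        using k by (intro member_le_sum) auto
      also have "\<dots> \<le> 0" using S[of "Suc i"] True by simp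
      finally have "?k ^ i * d i powr p \<le> 0" .
      moreover have "0 < ?k ^ i" using k by simp
      ultimately have "d i powr p \<le> 0" by (meson mult_pos_pos not_le)
      then show ?thesis by simp
    qed
    then show ?thesis using True by (simp add: B_def)
  next
    case False
    define t where "t = S powr (1 / p)"
    have t: "0 < t" using False S0 by (simp add: t_def)
    have tS: "t powr (1 - p) * S = t"
    proof -
      have "S = t powr p" using S0 p by (simp add: t_def powr_powr)
      then have "t powr (1 - p) * S = t powr ((1 - p) + p)" by (simp only: powr_add)
      then show ?thesis using t by simp
    qed
    have "(\<Sum>i<n. d i) \<le> (\<Sum>i<n. t * l ^ i + t powr (1 - p) * (?k ^ i * d i powr p))"
      by (intro sum_mono young t)
    also have "\<dots> = t * (\<Sum>i<n. l ^ i) + t powr (1 - p) * (\<Sum>i<n. ?k ^ i * d i powr p)"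
      by (simp add: sum.distrib sum_distrib_left)
    also have "\<dots> \<le> t * (1 / (1 - l)) + t powr (1 - p) * S"
      using t geo S by (intro add_mono mult_left_mono) auto
    also have "\<dots> = B" unfolding tS by (simp add: B_def t_def algebra_simps)
    finally show ?thesis .
  qed
  show sm: "summable d" by (rule summableI_nonneg_bounded[OF d part])
  have "suminf d \<le> B" by (rule suminf_le_const[OF sm part])
  then have "suminf d powr p \<le> B powr p" using sm d p by (intro powr_mono2 suminf_nonneg) auto
  also have "\<dots> = (1 / (1 - l) + 1) powr p * S" using l S0 p by (simp add: B_def powr_mult powr_powr)
  finally show "suminf d powr p \<le> (1 / (1 - l) + 1) powr p * S" .
qed

context framework
begin

text \<open>
  The factor \<theta> / \<sigma> by which the p-th power of the error of cell averages improves
  from one level to the next.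
\<close>

definition q :: real where "q = rst powr dw"

lemma q: "0 < q" "q < 1"
  using rst dw_pos by (auto simp: q_def powr01_less_one)

lemma q_eq: "q = \<theta> / \<sigma>"
  by (simp add: q_def rst_dw)

definition step :: "('a \<Rightarrow> real) \<Rightarrow> nat \<Rightarrow> 'a \<Rightarrow> real" where
  "step f n x = (\<Sum>w\<in>lev n. ca f w * indicator (K w) x)"

lemma step_meas [measurable]: "step f n \<in> borel_measurable m"
  unfolding step_def by measurable

lemma step_lp: "step f n \<in> Lp"
proof (rule lp_bounded)
  fix x
  have "\<bar>step f n x\<bar> \<le> (\<Sum>w\<in>lev n. \<bar>ca f w * indicator (K w) x\<bar>)" unfolding step_def by (rule sum_abs)
  also have "\<dots> \<le> (\<Sum>w\<in>lev n. \<bar>ca f w\<bar>)" by (intro sum_mono) (auto simp: indicator_def)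
  finally show "\<bar>step f n x\<bar> \<le> (\<Sum>w\<in>lev n. \<bar>ca f w\<bar>)" .
qed measurable

text \<open>
  Points lying in exactly one cell of each level, which are almost all points. At such points a
  step function has the value of a single cell average.
\<close>

definition regular :: "'a \<Rightarrow> bool" where
  "regular x \<longleftrightarrow> (\<forall>n. (\<Sum>v\<in>lev n. indicator (K v) x :: real) = 1)"

lemma AE_regular: "AE x in m. regular x"
  unfolding regular_def using AE_indicator_level by (simp add: AE_all_countable)

lemma regular_unique:
  assumes "regular x" "v \<in> lev n" "x \<in> K v" "w \<in> lev n" "x \<in> K w"
  shows "v = w"
proof (rule ccontr)
  assume "v \<noteq> w"
  then have "(2::real) = (\<Sum>u\<in>{v, w}. indicator (K u) x)" using assms by simp
  also have "\<dots> \<le> (\<Sum>u\<in>lev n. indicator (K u) x)" using assms finite_level by (intro sum_mono2) auto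
  also have "\<dots> = 1" using assms(1) by (simp add: regular_def)
  finally show False by simp
qed

lemma regular_sum:
  fixes g :: "'t \<Rightarrow> 'b::semiring_1"
  assumes "regular x" "w \<in> lev n" "x \<in> K w"
  shows "(\<Sum>v\<in>lev n. g v * indicator (K v) x) = g w"
proof -
  have "(\<Sum>v\<in>lev n. g v * indicator (K v) x) = (\<Sum>v\<in>{w}. g v * indicator (K v) x)"
    using assms finite_level regular_unique[OF assms(1)] by (intro sum.mono_neutral_right) (auto simp: indicator_def)
  then show ?thesis using assms by simp
qed

lemma step_regular: "regular x \<Longrightarrow> w \<in> lev n \<Longrightarrow> x \<in> K w \<Longrightarrow> step f n x = ca f w"
  unfolding step_def by (rule regular_sum)

text \<open>
  The difference between the number at a child and the average over all children of its parent is
  bounded by differences between siblings. Siblings are joined by a chain of siblings, since their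
  parent cell is connected, of length at most the square of the number of siblings.
\<close>

lemma sibling_sum:
  "\<exists>C>0. \<forall>g n. (\<Sum>v\<in>lev (Suc n). \<bar>g v - avg 1 g (par v)\<bar> powr p) \<le> C * en (Suc n) g"
proof -
  define D where "D = L * L"
  define C where "C = real L powr p * (real (N ^ D * N ^ D) * real D powr p * 2)"
  have C0: "0 \<le> C" by (simp add: C_def)
  have main: "(\<Sum>v\<in>lev (Suc n). \<bar>g v - avg 1 g (par v)\<bar> powr p) \<le> C * en (Suc n) g" for g n
  proof -
    have one: "\<bar>g v - avg 1 g w\<bar> powr p \<le> real L powr p * (\<Sum>u\<in>kids w. incr g (v, u))" for v w
    proof -
      have "g v = (\<Sum>u\<in>kids w. g v * \<mu> u) / \<mu> w"
        using measure_pos[of w] by (simp add: sum_distrib_left[symmetric] measure_children[symmetric])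
      then have "g v - avg 1 g w = (\<Sum>u\<in>kids w. (g v - g u) * \<mu> u) / \<mu> w"
        by (simp add: avg_eq desc_1[simplified] left_diff_distrib sum_subtractf diff_divide_distrib)
      also have "\<bar>\<dots>\<bar> \<le> (\<Sum>u\<in>kids w. \<bar>(g v - g u) * \<mu> u\<bar>) / \<mu> w"
        unfolding abs_divide using measure_pos[of w] by (intro frac_le sum_abs) (auto intro: sum_nonneg)
      also have "\<dots> = (\<Sum>u\<in>kids w. \<bar>g v - g u\<bar> * (\<mu> u / \<mu> w))"
        by (simp add: sum_divide_distrib abs_mult)
      also have "\<dots> \<le> (\<Sum>u\<in>kids w. \<bar>g v - g u\<bar> * 1)"
      proof (intro sum_mono mult_left_mono)
        fix u assume u: "u \<in> kids w"
        have "\<mu> u \<le> (\<Sum>u\<in>kids w. \<mu> u)" using u finite_kids by (intro member_le_sum) auto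
        then show "\<mu> u / \<mu> w \<le> 1" using measure_pos[of w] by (simp add: measure_children[symmetric])
      qed simp
      finally have "\<bar>g v - avg 1 g w\<bar> powr p \<le> (\<Sum>u\<in>kids w. \<bar>g v - g u\<bar>) powr p"
        using p0 by (intro powr_mono2) auto
      also have "\<dots> \<le> real L powr p * (\<Sum>u\<in>kids w. \<bar>g v - g u\<bar> powr p)"
        using p0 finite_kids card_kids by (intro powr_sum_le) auto
      finally show ?thesis by (simp add: incr_def)
    qed
    let ?X = "SIGMA v:lev (Suc n). kids (par v)"
    have "(\<Sum>v\<in>lev (Suc n). \<bar>g v - avg 1 g (par v)\<bar> powr p)
        \<le> (\<Sum>v\<in>lev (Suc n). real L powr p * (\<Sum>u\<in>kids (par v). incr g (v, u)))"
      by (intro sum_mono one)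
    also have "\<dots> = real L powr p * (\<Sum>(v, u)\<in>?X. incr g (v, u))"
      using finite_level finite_kids by (simp add: sum_distrib_left[symmetric] sum.Sigma)
    also have "\<dots> = real L powr p * (\<Sum>e\<in>?X. incr g e)" by (simp add: case_prod_unfold)
    also have "\<dots> \<le> real L powr p * (real (N ^ D * N ^ D) * real D powr p * (\<Sum>e\<in>touch (Suc n). incr g e))"
    proof (intro mult_left_mono chain_sum_le)
      show "finite ?X" using finite_level finite_kids by auto
      fix v u assume vu: "(v, u) \<in> ?X"
      let ?V = "kids (par v)"
      have hv: "ht v = Suc n" using vu by (simp add: level_iff)
      then have v: "v \<in> ?V" using height_0_iff[of v] by (simp add: children_iff)
      have sub: "?V \<subseteq> lev (Suc n)"
      proof
        fix u assume "u \<in> ?V"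
        then have u: "u \<noteq> root" "par u = par v" by (auto simp: children_iff)
        then have "ht u \<noteq> 0" "ht u - 1 = ht v - 1" using height_0_iff[of u] height_par[of u] height_par[of v] by auto
        then show "u \<in> lev (Suc n)" unfolding level_iff using hv by arith
      qed
      have "connected (\<Union>v\<in>?V. K v)" using connected_K[of "par v"] K_children[of "par v"] by simp
      from connected_chain[OF finite_kids this sub v, of u]
      have "(v, u) \<in> touch (Suc n) ^^ card (?V \<times> ?V)"
        using vu relpow_subset_mono[of "touch (Suc n) \<inter> ?V \<times> ?V" "touch (Suc n)"] by blast
      moreover have "card (?V \<times> ?V) \<le> D"
        unfolding D_def card_cartesian_product using card_kids by (intro mult_mono) auto
      ultimately show "v \<in> lev (Suc n) \<and> (\<exists>i\<le>D. (v, u) \<in> touch (Suc n) ^^ i)" using vu by blast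
    qed auto
    also have "\<dots> = C * en (Suc n) g" by (simp add: C_def energy_level)
    finally show ?thesis .
  qed
  show ?thesis
  proof (intro exI[of _ "C + 1"] conjI allI)
    show "0 < C + 1" using C0 by simp
    fix g n
    have "C * en (Suc n) g \<le> (C + 1) * en (Suc n) g" using energy_nonneg by (intro mult_right_mono) auto
    with main[of g n] show "(\<Sum>v\<in>lev (Suc n). \<bar>g v - avg 1 g (par v)\<bar> powr p) \<le> (C + 1) * en (Suc n) g" by linarith
  qed
qed

text \<open>
  On a cell v of level n + 1 the increment is the difference between the average on v and on its
  parent. The masses give \<theta>^(n+1) and the normalization of the energy \<sigma>^(-(n+1)),
  which together make up a power of q.
\<close>

lemma step_increment:
  "\<exists>C>0. \<forall>f\<in>Lp. \<forall>M n. (\<forall>j. se j f \<le> M) \<longrightarrow>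
     (\<integral>\<^sup>+x. ennreal (\<bar>step f (Suc n) x - step f n x\<bar> powr p) \<partial>m) \<le> ennreal (C * q ^ n * M)"
proof -
  obtain C where C: "0 < C" "\<forall>g n. (\<Sum>v\<in>lev (Suc n). \<bar>g v - avg 1 g (par v)\<bar> powr p) \<le> C * en (Suc n) g"
    using sibling_sum by blast
  obtain b where b: "0 < b" "\<forall>n. \<forall>w\<in>lev n. \<mu> w \<le> b * \<theta> ^ n" using mass_upper by blast
  have "(\<integral>\<^sup>+x. ennreal (\<bar>step f (Suc n) x - step f n x\<bar> powr p) \<partial>m) \<le> ennreal (b * C * q * q ^ n * M)"
    if f: "f \<in> Lp" and M: "\<And>j. se j f \<le> M" for f M n
  proof -
    let ?i = "\<lambda>v. \<bar>ca f v - ca f (par v)\<bar> powr p"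
    have "(\<integral>\<^sup>+x. ennreal (\<bar>step f (Suc n) x - step f n x\<bar> powr p) \<partial>m)
        = (\<integral>\<^sup>+x. (\<Sum>v\<in>lev (Suc n). ennreal (?i v) * indicator (K v) x) \<partial>m)"
    proof (rule nn_integral_cong_AE)
      show "AE x in m. ennreal (\<bar>step f (Suc n) x - step f n x\<bar> powr p) = (\<Sum>v\<in>lev (Suc n). ennreal (?i v) * indicator (K v) x)"
        using AE_regular
      proof eventually_elim
        case (elim x)
        obtain v where v: "v \<in> lev (Suc n)" "x \<in> K v" using K_level[of "Suc n"] by blast
        have pv: "par v \<in> lev n" "x \<in> K (par v)"
          using funpow_par_level[of v n 1] v K_mono_par[of v 1] by auto
        show ?case using regular_sum[OF elim v, of "\<lambda>v. ennreal (?i v)"] step_regular[OF elim v] step_regular[OF elim pv] by simp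
      qed
    qed
    also have "\<dots> = (\<Sum>v\<in>lev (Suc n). \<integral>\<^sup>+x. ennreal (?i v) * indicator (K v) x \<partial>m)"
      by (rule nn_integral_sum) measurable
    also have "\<dots> = (\<Sum>v\<in>lev (Suc n). ennreal (?i v * \<mu> v))"
      by (intro sum.cong refl) (simp add: nn_integral_cmult_indicator emeasure_eq_measure ennreal_mult')
    also have "\<dots> = ennreal (\<Sum>v\<in>lev (Suc n). ?i v * \<mu> v)" by (intro sum_ennreal) auto
    also have "\<dots> \<le> ennreal (b * C * q * q ^ n * M)"
    proof (rule ennreal_leI)
      have "(\<Sum>v\<in>lev (Suc n). ?i v * \<mu> v) \<le> (\<Sum>v\<in>lev (Suc n). ?i v * (b * \<theta> ^ Suc n))"
        by (intro sum_mono mult_left_mono b(2)[rule_format]) simp_all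
      also have "\<dots> = b * \<theta> ^ Suc n * (\<Sum>v\<in>lev (Suc n). \<bar>ca f v - avg 1 (ca f) (par v)\<bar> powr p)"
        by (simp only: ca_desc[OF f] sum_distrib_left) (simp only: mult_ac)
      also have "\<dots> \<le> b * \<theta> ^ Suc n * (C * en (Suc n) (ca f))"
        using C(2) b \<theta> by (intro mult_left_mono) auto
      also have "\<dots> = b * C * (\<theta> / \<sigma>) ^ Suc n * se (Suc n) f"
        using \<sigma>_pos by (simp add: power_divide)
      also have "\<dots> \<le> b * C * (\<theta> / \<sigma>) ^ Suc n * M"
        using b C \<theta> \<sigma>_pos by (intro mult_left_mono M) auto
      finally show "(\<Sum>v\<in>lev (Suc n). ?i v * \<mu> v) \<le> b * C * q * q ^ n * M" by (simp add: q_eq mult_ac)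
    qed
    finally show ?thesis .
  qed
  then show ?thesis using b C q by (intro exI[of _ "b * C * q"]) auto
qed

lemma ca_step:
  assumes w: "w \<in> lev n"
  shows "ca (step f n) w = ca f w"
proof -
  have "(\<integral>x. indicator (K w) x * step f n x \<partial>m) = (\<integral>x. indicator (K w) x * ca f w \<partial>m)"
  proof (rule integral_cong_AE)
    show "AE x in m. indicator (K w) x * step f n x = indicator (K w) x * ca f w"
      using AE_regular by eventually_elim (auto simp: indicator_def step_regular w)
  qed auto
  then show ?thesis using measure_pos[of w] by (simp add: ca_eq[of "step f n"] space_m)
qed

lemma ca_step_coarse:
  assumes f: "f \<in> Lp" and n: "ht w \<le> n"
  shows "ca (step f n) w = ca f w"
proof -
  let ?k = "n - ht w"
  have "ca (step f n) w = avg ?k (ca (step f n)) w" by (rule ca_desc[OF step_lp, symmetric])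
  also have "\<dots> = avg ?k (ca f) w"
    unfolding avg_eq using n by (intro arg_cong2[where f = "(/)"] sum.cong refl) (auto simp: ca_step level_iff desc_iff)
  also have "\<dots> = ca f w" by (rule ca_desc[OF f])
  finally show ?thesis .
qed

text \<open>
  The increments of the step functions decay geometrically in L^p, so the step functions converge
  almost everywhere to a function g with the stated error. All cell averages of g agree with those
  of f, hence g = f almost everywhere. Working with a weighted sum of p-th powers of increments
  avoids Minkowski's inequality for infinite sums.
\<close>

lemma step_approx:
  "\<exists>C>0. \<forall>f\<in>Lp. \<forall>M n. (\<forall>j. se j f \<le> M) \<longrightarrow>
     (\<integral>\<^sup>+x. ennreal (\<bar>f x - step f n x\<bar> powr p) \<partial>m) \<le> ennreal (C * q ^ n * M)"
proof -
  obtain C where C: "0 < C" "\<forall>f\<in>Lp. \<forall>M n. (\<forall>j. se j f \<le> M) \<longrightarrow>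
     (\<integral>\<^sup>+x. ennreal (\<bar>step f (Suc n) x - step f n x\<bar> powr p) \<partial>m) \<le> ennreal (C * q ^ n * M)"
    using step_increment by blast
  \<comment> \<open>The weight l is chosen less than 1 but so close to 1 that k = l powr (1 - p) still satisfies k * q < 1.\<close>
  define l where "l = rst powr (dw / (2 * p))"
  have l: "0 < l" "l < 1" using rst dw_pos p0 by (auto simp: l_def powr01_less_one)
  define k where "k = l powr (1 - p)"
  have k: "0 < k" using l by (simp add: k_def)
  have kq: "k * q < 1"
  proof -
    have "k * q = rst powr (dw / (2 * p) * (1 - p) + dw)"
      by (simp add: k_def l_def q_def powr_powr powr_add)
    also have "dw / (2 * p) * (1 - p) + dw = dw * (p + 1) / (2 * p)" using p0 by (simp add: field_simps)
    also have "rst powr (dw * (p + 1) / (2 * p)) < 1" using rst dw_pos p0 by (simp add: powr01_less_one)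
    finally show ?thesis .
  qed
  define B where "B = (1 / (1 - l) + 1) powr p"
  have "0 < 1 / (1 - l) + 1" using l by (simp add: add_pos_pos)
  then have B: "0 < B" unfolding B_def powr_gt_zero by linarith
  define C' where "C' = B * (C / (1 - k * q))"
  have C': "0 < C'" using B C kq by (simp add: C'_def)
  have "(\<integral>\<^sup>+x. ennreal (\<bar>f x - step f n x\<bar> powr p) \<partial>m) \<le> ennreal (C' * q ^ n * M)"
    if f: "f \<in> Lp" and M: "\<And>j. se j f \<le> M" for f M n
  proof -
    have [measurable]: "f \<in> borel_measurable m" by (rule lp_meas[OF f])
    have M0: "0 \<le> M" using M[of 0] se_nonneg[of 0 f] by linarith
    define d where "d = (\<lambda>n x. \<bar>step f (Suc n) x - step f n x\<bar>)"
    have [measurable]: "d n \<in> borel_measurable m" for n unfolding d_def by measurable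
    define S where "S = (\<lambda>n x. \<Sum>i. ennreal (k ^ i * d (n + i) x powr p))"
    have [measurable]: "S n \<in> borel_measurable m" for n unfolding S_def by measurable
    have intS: "(\<integral>\<^sup>+x. S n x \<partial>m) \<le> ennreal (C / (1 - k * q) * q ^ n * M)" for n
    proof -
      have "(\<integral>\<^sup>+x. S n x \<partial>m) = (\<Sum>i. \<integral>\<^sup>+x. ennreal (k ^ i * d (n + i) x powr p) \<partial>m)"
        unfolding S_def by (rule nn_integral_suminf) measurable
      also have "\<dots> \<le> (\<Sum>i. ennreal (C * q ^ n * M * (k * q) ^ i))"
      proof (intro suminf_le)
        fix i
        have "(\<integral>\<^sup>+x. ennreal (k ^ i * d (n + i) x powr p) \<partial>m) = (\<integral>\<^sup>+x. ennreal (k ^ i) * ennreal (d (n + i) x powr p) \<partial>m)"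
          using k by (intro nn_integral_cong) (simp add: ennreal_mult')
        also have "\<dots> = ennreal (k ^ i) * (\<integral>\<^sup>+x. ennreal (d (n + i) x powr p) \<partial>m)"
          by (rule nn_integral_cmult) measurable
        also have "\<dots> \<le> ennreal (k ^ i) * ennreal (C * q ^ (n + i) * M)"
          using C(2) f M unfolding d_def by (intro mult_left_mono) auto
        also have "\<dots> = ennreal (C * q ^ n * M * (k * q) ^ i)"
        proof -
          have "k ^ i * (C * q ^ (n + i) * M) = C * q ^ n * M * (k * q) ^ i"
            by (simp add: power_add power_mult_distrib mult_ac)
          moreover have "ennreal (k ^ i) * ennreal (C * q ^ (n + i) * M) = ennreal (k ^ i * (C * q ^ (n + i) * M))"
            using k by (intro ennreal_mult'[symmetric]) simp
          ultimately show ?thesis by (simp only:)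
        qed
        finally show "(\<integral>\<^sup>+x. ennreal (k ^ i * d (n + i) x powr p) \<partial>m) \<le> ennreal (C * q ^ n * M * (k * q) ^ i)" .
      qed auto
      also have "\<dots> = ennreal (\<Sum>i. C * q ^ n * M * (k * q) ^ i)"
        using C q M0 k kq by (intro suminf_ennreal2 summable_mult summable_geometric) auto
      also have "(\<Sum>i. C * q ^ n * M * (k * q) ^ i) = C * q ^ n * M * (1 / (1 - k * q))"
        using k q kq by (subst suminf_mult) (auto simp: suminf_geometric summable_geometric)
      finally show ?thesis by (simp add: mult_ac)
    qed
    define g where "g = (\<lambda>x. lim (\<lambda>n. step f n x))"
    have [measurable]: "g \<in> borel_measurable m" unfolding g_def by measurable
    have ptw: "AE x in m. ennreal (\<bar>g x - step f n x\<bar> powr p) \<le> ennreal B * S n x" for n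
    proof -
      have "(\<integral>\<^sup>+x. S n x \<partial>m) \<noteq> \<infinity>" using intS[of n] by (auto simp: top_unique)
      then have "AE x in m. S n x \<noteq> \<infinity>" by (intro nn_integral_PInf_AE) auto
      then show ?thesis
      proof eventually_elim
        case (elim x)
        then obtain s where s: "S n x = ennreal s" "0 \<le> s" by (cases "S n x") auto
        have part: "(\<Sum>i<j. k ^ i * d (n + i) x powr p) \<le> s" for j
        proof -
          have "ennreal (\<Sum>i<j. k ^ i * d (n + i) x powr p) = (\<Sum>i<j. ennreal (k ^ i * d (n + i) x powr p))"
            using k by (intro sum_ennreal[symmetric]) auto
          also have "\<dots> \<le> S n x" unfolding S_def by (intro sum_le_suminf) auto
          finally show ?thesis using s by simp
        qed
        have dn: "0 \<le> d (n + i) x" for i by (simp add: d_def)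
        have sm: "summable (\<lambda>i. d (n + i) x)" and bd: "(\<Sum>i. d (n + i) x) powr p \<le> B * s"
          using weighted_powr_sum[OF p1 l, of "\<lambda>i. d (n + i) x" s] part dn by (auto simp: k_def B_def)
        define e where "e = (\<lambda>i. step f (Suc (n + i)) x - step f (n + i) x)"
        have ea: "\<bar>e i\<bar> = d (n + i) x" for i by (simp add: e_def d_def)
        have sme: "summable (\<lambda>i. \<bar>e i\<bar>)" using sm by (simp add: ea)
        then have sme': "summable e" by (rule summable_rabs_cancel)
        have tel: "(\<Sum>i<j. e i) = step f (n + j) x - step f n x" for j
          by (induction j) (auto simp: e_def)
        have "(\<lambda>j. (\<Sum>i<j. e i) + step f n x) \<longlonglongrightarrow> suminf e + step f n x"
          using summable_LIMSEQ[OF sme'] by (intro tendsto_intros)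
        then have "(\<lambda>j. step f (j + n) x) \<longlonglongrightarrow> suminf e + step f n x" by (simp add: tel add.commute)
        then have "(\<lambda>j. step f j x) \<longlonglongrightarrow> suminf e + step f n x" by (rule LIMSEQ_offset)
        then have "g x = suminf e + step f n x" unfolding g_def by (rule limI)
        then have "\<bar>g x - step f n x\<bar> \<le> (\<Sum>i. d (n + i) x)"
          using summable_rabs[OF sme] by (simp add: ea)
        then have "\<bar>g x - step f n x\<bar> powr p \<le> (\<Sum>i. d (n + i) x) powr p" using p0 by (intro powr_mono2) auto
        also note bd
        finally show ?case using s B by (simp add: ennreal_mult'[symmetric] ennreal_leI)
      qed
    qed
    have g_approx: "(\<integral>\<^sup>+x. ennreal (\<bar>g x - step f n x\<bar> powr p) \<partial>m) \<le> ennreal (C' * q ^ n * M)" for n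
    proof -
      have "(\<integral>\<^sup>+x. ennreal (\<bar>g x - step f n x\<bar> powr p) \<partial>m) \<le> (\<integral>\<^sup>+x. ennreal B * S n x \<partial>m)"
        by (rule nn_integral_mono_AE[OF ptw])
      also have "\<dots> = ennreal B * (\<integral>\<^sup>+x. S n x \<partial>m)" by (rule nn_integral_cmult) measurable
      also have "\<dots> \<le> ennreal B * ennreal (C / (1 - k * q) * q ^ n * M)" by (intro mult_left_mono intS) simp
      also have "\<dots> = ennreal (C' * q ^ n * M)" using B by (simp add: C'_def ennreal_mult'[symmetric] mult_ac)
      finally show ?thesis .
    qed
    have gs: "(\<lambda>x. g x - step f n x) \<in> Lp" for n
    proof -
      have "(\<integral>\<^sup>+x. ennreal (norm (\<bar>g x - step f n x\<bar> powr p)) \<partial>m) < \<infinity>"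
        using g_approx[of n] by (simp add: le_less_trans)
      then have "integrable m (\<lambda>x. \<bar>g x - step f n x\<bar> powr p)" by (intro integrableI_bounded) auto
      then show ?thesis by (simp add: lp_space_def)
    qed
    have g: "g \<in> Lp" using lp_add[OF gs[of 0] step_lp[of f 0]] by simp
    have ca_gf: "ca g w = ca f w" for w
    proof -
      have le: "\<bar>ca g w - ca f w\<bar> powr p * \<mu> w \<le> C' * q ^ n * M" if n: "ht w \<le> n" for n
      proof -
        have "ca g w - ca f w = ca (\<lambda>x. g x - step f n x) w"
          using ca_diff[OF g step_lp, of f n w] ca_step_coarse[OF f n] by simp
        then have "ennreal (\<bar>ca g w - ca f w\<bar> powr p * \<mu> w) \<le> (\<integral>\<^sup>+x. ennreal (\<bar>g x - step f n x - 0\<bar> powr p) * indicator (K w) x \<partial>m)"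
          using ca_jensen_nn[OF gs[of n], of w 0] by simp
        also have "\<dots> \<le> (\<integral>\<^sup>+x. ennreal (\<bar>g x - step f n x\<bar> powr p) \<partial>m)"
          by (intro nn_integral_mono) (auto simp: indicator_def)
        also have "\<dots> \<le> ennreal (C' * q ^ n * M)" by (rule g_approx)
        finally show ?thesis using C' q M0 by (subst (asm) ennreal_le_iff) auto
      qed
      have "(\<lambda>n. C' * q ^ n * M) \<longlonglongrightarrow> C' * 0 * M"
        using q by (intro tendsto_intros LIMSEQ_realpow_zero) auto
      then have lim: "(\<lambda>n. C' * q ^ n * M) \<longlonglongrightarrow> 0" by simp
      have "eventually (\<lambda>n. \<bar>ca g w - ca f w\<bar> powr p * \<mu> w \<le> C' * q ^ n * M) sequentially"
        using le by (auto simp: eventually_sequentially)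
      from tendsto_lowerbound[OF lim this] have "\<bar>ca g w - ca f w\<bar> powr p * \<mu> w \<le> 0" by simp
      then have "\<bar>ca g w - ca f w\<bar> powr p \<le> 0" using measure_pos[of w] by (simp add: mult_le_0_iff)
      then show ?thesis using powr_gt_zero[of "\<bar>ca g w - ca f w\<bar>" p] by auto
    qed
    have fg: "(\<lambda>x. f x - g x) \<in> Lp" by (rule lp_diff[OF f g])
    have "AE x in m. f x - g x = 0"
    proof (rule cell_integrals_zero)
      show "integrable m (\<lambda>x. f x - g x)" by (rule lp_integrable[OF fg])
      fix w
      have "ca (\<lambda>x. f x - g x) w = 0" using ca_diff[OF f g] ca_gf by simp
      then show "(\<integral>x. indicator (K w) x * (f x - g x) \<partial>m) = 0" using measure_pos[of w] by (simp add: ca_eq)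
    qed
    then have "(\<integral>\<^sup>+x. ennreal (\<bar>f x - step f n x\<bar> powr p) \<partial>m) = (\<integral>\<^sup>+x. ennreal (\<bar>g x - step f n x\<bar> powr p) \<partial>m)"
      by (intro nn_integral_cong_AE) (auto elim: eventually_mono)
    with g_approx[of n] show ?thesis by simp
  qed
  then show ?thesis using C' by blast
qed

lemma Np_finite_bound:
  assumes "Np f = ennreal M" "0 \<le> M"
  shows "se n f \<le> M"
proof -
  have "ennreal (se n f) \<le> Np f" unfolding Np_def by (rule SUP_upper) simp
  then show ?thesis using assms by simp
qed

lemma cell_approx:
  "\<exists>C>0. \<forall>f\<in>Lp. \<forall>M n. (\<forall>j. se j f \<le> M) \<longrightarrow>
     (\<Sum>w\<in>lev n. \<integral>\<^sup>+x. ennreal (\<bar>f x - ca f w\<bar> powr p) * indicator (K w) x \<partial>m) \<le> ennreal (C * q ^ n * M)"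
proof -
  obtain C where C: "0 < C" "\<forall>f\<in>Lp. \<forall>M n. (\<forall>j. se j f \<le> M) \<longrightarrow>
     (\<integral>\<^sup>+x. ennreal (\<bar>f x - step f n x\<bar> powr p) \<partial>m) \<le> ennreal (C * q ^ n * M)"
    using step_approx by blast
  have "(\<Sum>w\<in>lev n. \<integral>\<^sup>+x. ennreal (\<bar>f x - ca f w\<bar> powr p) * indicator (K w) x \<partial>m)
      = (\<integral>\<^sup>+x. ennreal (\<bar>f x - step f n x\<bar> powr p) \<partial>m)" if f: "f \<in> Lp" for f n
  proof -
    have [measurable]: "f \<in> borel_measurable m" by (rule lp_meas[OF f])
    have "(\<Sum>w\<in>lev n. \<integral>\<^sup>+x. ennreal (\<bar>f x - ca f w\<bar> powr p) * indicator (K w) x \<partial>m)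
      = (\<integral>\<^sup>+x. (\<Sum>w\<in>lev n. ennreal (\<bar>f x - ca f w\<bar> powr p) * indicator (K w) x) \<partial>m)"
      by (rule nn_integral_sum[symmetric]) measurable
    also have "\<dots> = (\<integral>\<^sup>+x. ennreal (\<bar>f x - step f n x\<bar> powr p) \<partial>m)"
    proof (rule nn_integral_cong_AE)
      show "AE x in m. (\<Sum>w\<in>lev n. ennreal (\<bar>f x - ca f w\<bar> powr p) * indicator (K w) x) = ennreal (\<bar>f x - step f n x\<bar> powr p)"
        using AE_regular
      proof eventually_elim
        case (elim x)
        obtain v where v: "v \<in> lev n" "x \<in> K v" using K_level[of n] by blast
        show ?case using regular_sum[OF elim v, of "\<lambda>w. ennreal (\<bar>f x - ca f w\<bar> powr p)"] step_regular[OF elim v] by simp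
      qed
    qed
    finally show ?thesis .
  qed
  with C show ?thesis by (intro exI[of _ C]) auto
qed

lemma nn_integral_product:
  fixes F H :: "'a \<Rightarrow> ennreal"
  assumes [measurable]: "F \<in> borel_measurable m" "H \<in> borel_measurable m"
  shows "(\<integral>\<^sup>+z. F (fst z) * H (snd z) \<partial>(m \<Otimes>\<^sub>M m)) = (\<integral>\<^sup>+x. F x \<partial>m) * (\<integral>\<^sup>+x. H x \<partial>m)"
proof -
  have "(\<integral>\<^sup>+z. F (fst z) * H (snd z) \<partial>(m \<Otimes>\<^sub>M m)) = (\<integral>\<^sup>+x. \<integral>\<^sup>+y. (\<lambda>z. F (fst z) * H (snd z)) (x, y) \<partial>m \<partial>m)"
    by (rule nn_integral_fst[symmetric]) measurable
  also have "\<dots> = (\<integral>\<^sup>+x. F x * (\<integral>\<^sup>+y. H y \<partial>m) \<partial>m)" by (simp add: nn_integral_cmult)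
  also have "\<dots> = (\<integral>\<^sup>+x. F x \<partial>m) * (\<integral>\<^sup>+x. H x \<partial>m)" by (rule nn_integral_multc) measurable
  finally show ?thesis .
qed

section \<open>Upper bound for Korevaar-Schoen energies\<close>

text \<open>
  The scale r is small compared to the cells of level n, in the sense that points closer than r
  lie in cells of that level joined by a chain of length Mst.
\<close>

definition reaches :: "nat \<Rightarrow> real \<Rightarrow> bool" where
  "reaches n r \<longleftrightarrow> (\<forall>x y. dist x y < r \<longrightarrow> (\<exists>z\<in>lev n. x \<in> K z \<and> (\<exists>u. (z, u) \<in> touch n ^^ Mst \<and> y \<in> K u)))"

text \<open>
  For points x and y in cells v and u joined by a short chain, f x - f y splits into the two
  deviations from the cell averages and the difference of these averages. The former are
  controlled by the approximation property, each multiplied by the mass of the other cell, and the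
  latter by the discrete energy, since a chain of length Mst costs a constant factor. Both are of
  the order q^n \<theta>^n.
\<close>

lemma G_le_energy:
  "\<exists>C>0. \<forall>f\<in>Lp. \<forall>M n r. reaches n r \<longrightarrow> (\<forall>j. se j f \<le> M) \<longrightarrow> G r f \<le> ennreal (C * (q ^ n * \<theta> ^ n) * M)"
proof -
  obtain C where C: "0 < C" "\<forall>f\<in>Lp. \<forall>M n. (\<forall>j. se j f \<le> M) \<longrightarrow>
     (\<Sum>w\<in>lev n. \<integral>\<^sup>+x. ennreal (\<bar>f x - ca f w\<bar> powr p) * indicator (K w) x \<partial>m) \<le> ennreal (C * q ^ n * M)"
    using cell_approx by blast
  obtain b where b: "0 < b" "\<forall>n. \<forall>w\<in>lev n. \<mu> w \<le> b * \<theta> ^ n" using mass_upper by blast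
  define A where "A = real (N ^ Mst * N ^ Mst) * real Mst powr p * 2"
  have A: "0 \<le> A" by (simp add: A_def)
  define C' where "C' = 3 powr p * (b * (real (N ^ Mst) * C) + b * (real (N ^ Mst) * C) + b * b * A) + 1"
  have C'0: "0 \<le> 3 powr p * (b * (real (N ^ Mst) * C) + b * (real (N ^ Mst) * C) + b * b * A)"
    using b C A by simp
  have C': "0 < C'" using C'0 by (simp add: C'_def)
  have "G r f \<le> ennreal (C' * (q ^ n * \<theta> ^ n) * M)"
    if f: "f \<in> Lp" and r: "reaches n r" and M: "\<And>j. se j f \<le> M" for f M n r
  proof -
    have [measurable]: "f \<in> borel_measurable m" by (rule lp_meas[OF f])
    have M0: "0 \<le> M" using M[of 0] se_nonneg[of 0 f] by linarith
    \<comment> \<open>Pairs of cells in which two points closer than r can lie.\<close>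
    define P where "P = {(z, u). z \<in> lev n \<and> (z, u) \<in> touch n ^^ Mst}"
    have Plev: "z \<in> lev n" "u \<in> lev n" if "(z, u) \<in> P" for z u
      using that touch_pow_level by (auto simp: P_def)
    have finP: "finite P" by (rule finite_subset[of _ "lev n \<times> lev n"]) (use Plev finite_level in auto)
    define i where "i = (\<lambda>w x. ennreal (\<bar>f x - ca f w\<bar> powr p) * indicator (K w) x)"
    have [measurable]: "i w \<in> borel_measurable m" for w unfolding i_def by measurable
    define I where "I = (\<lambda>w. \<integral>\<^sup>+x. i w x \<partial>m)"
    have SI: "(\<Sum>w\<in>lev n. I w) \<le> ennreal (C * q ^ n * M)" using C(2) f M by (auto simp: I_def i_def)
    let ?T = "\<lambda>e z. (i (fst e) (fst z) * indicator (K (snd e)) (snd z) + indicator (K (fst e)) (fst z) * i (snd e) (snd z))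
          + ennreal (incr (ca f) e) * (indicator (K (fst e)) (fst z) * indicator (K (snd e)) (snd z))"
    have "G r f \<le> (\<integral>\<^sup>+z. ennreal (3 powr p) * (\<Sum>e\<in>P. ?T e z) \<partial>(m \<Otimes>\<^sub>M m))"
      unfolding G_product[OF lp_meas[OF f]]
    proof (rule nn_integral_mono)
      fix z :: "'a \<times> 'a"
      obtain x y where xy: "z = (x, y)" by force
      show "ennreal (\<bar>f (fst z) - f (snd z)\<bar> powr p) * indicator (ball (fst z) r) (snd z) \<le> ennreal (3 powr p) * (\<Sum>e\<in>P. ?T e z)"
      proof (cases "dist x y < r")
        case True
        then obtain v u where vu: "v \<in> lev n" "x \<in> K v" "(v, u) \<in> touch n ^^ Mst" "y \<in> K u"
          using r unfolding reaches_def by blast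
        then have e: "(v, u) \<in> P" by (simp add: P_def)
        have "\<bar>f x - f y\<bar> powr p \<le> (\<bar>f x - ca f v\<bar> + \<bar>f y - ca f u\<bar> + \<bar>ca f v - ca f u\<bar>) powr p"
          using p0 by (intro powr_mono2) auto
        also have "\<dots> \<le> 3 powr p * (\<bar>f x - ca f v\<bar> powr p + \<bar>f y - ca f u\<bar> powr p + \<bar>ca f v - ca f u\<bar> powr p)"
          using p0 by (intro powr_add3_le) auto
        finally have "ennreal (\<bar>f x - f y\<bar> powr p) \<le> ennreal (3 powr p * (\<bar>f x - ca f v\<bar> powr p + \<bar>f y - ca f u\<bar> powr p + \<bar>ca f v - ca f u\<bar> powr p))"
          by (rule ennreal_leI)
        also have "\<dots> = ennreal (3 powr p) * ?T (v, u) z"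
          using vu by (simp add: i_def xy incr_def ennreal_mult')
        also have "\<dots> \<le> ennreal (3 powr p) * (\<Sum>e\<in>P. ?T e z)"
          by (intro mult_left_mono member_le_sum e finP) auto
        finally show ?thesis using True by (simp add: xy)
      qed (simp add: xy)
    qed
    also have "\<dots> = ennreal (3 powr p) * (\<Sum>e\<in>P. \<integral>\<^sup>+z. ?T e z \<partial>(m \<Otimes>\<^sub>M m))"
    proof -
      have "(\<integral>\<^sup>+z. (\<Sum>e\<in>P. ?T e z) \<partial>(m \<Otimes>\<^sub>M m)) = (\<Sum>e\<in>P. \<integral>\<^sup>+z. ?T e z \<partial>(m \<Otimes>\<^sub>M m))"
        by (rule nn_integral_sum) measurable
      moreover have "(\<integral>\<^sup>+z. ennreal (3 powr p) * (\<Sum>e\<in>P. ?T e z) \<partial>(m \<Otimes>\<^sub>M m)) = ennreal (3 powr p) * (\<integral>\<^sup>+z. (\<Sum>e\<in>P. ?T e z) \<partial>(m \<Otimes>\<^sub>M m))"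
        by (rule nn_integral_cmult) measurable
      ultimately show ?thesis by simp
    qed
    finally have G1: "G r f \<le> ennreal (3 powr p) * (\<Sum>e\<in>P. \<integral>\<^sup>+z. ?T e z \<partial>(m \<Otimes>\<^sub>M m))" .
    have "(\<Sum>e\<in>P. \<integral>\<^sup>+z. ?T e z \<partial>(m \<Otimes>\<^sub>M m))
        = (\<Sum>e\<in>P. I (fst e) * ennreal (\<mu> (snd e)) + ennreal (\<mu> (fst e)) * I (snd e) + ennreal (incr (ca f) e) * (ennreal (\<mu> (fst e)) * ennreal (\<mu> (snd e))))"
    proof (intro sum.cong refl)
      fix e
      have 1: "(\<integral>\<^sup>+z. i (fst e) (fst z) * indicator (K (snd e)) (snd z) \<partial>(m \<Otimes>\<^sub>M m)) = I (fst e) * ennreal (\<mu> (snd e))"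
        by (subst nn_integral_product) (auto simp: I_def emeasure_eq_measure)
      have 2: "(\<integral>\<^sup>+z. indicator (K (fst e)) (fst z) * i (snd e) (snd z) \<partial>(m \<Otimes>\<^sub>M m)) = ennreal (\<mu> (fst e)) * I (snd e)"
        by (subst nn_integral_product) (auto simp: I_def emeasure_eq_measure)
      have "(\<integral>\<^sup>+z. indicator (K (fst e)) (fst z) * indicator (K (snd e)) (snd z) \<partial>(m \<Otimes>\<^sub>M m)) = ennreal (\<mu> (fst e)) * ennreal (\<mu> (snd e))"
        by (subst nn_integral_product) (auto simp: emeasure_eq_measure)
      then have 3: "(\<integral>\<^sup>+z. ennreal (incr (ca f) e) * (indicator (K (fst e)) (fst z) * indicator (K (snd e)) (snd z)) \<partial>(m \<Otimes>\<^sub>M m))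
         = ennreal (incr (ca f) e) * (ennreal (\<mu> (fst e)) * ennreal (\<mu> (snd e)))"
        by (subst nn_integral_cmult) auto
      show "(\<integral>\<^sup>+z. ?T e z \<partial>(m \<Otimes>\<^sub>M m)) = I (fst e) * ennreal (\<mu> (snd e)) + ennreal (\<mu> (fst e)) * I (snd e) + ennreal (incr (ca f) e) * (ennreal (\<mu> (fst e)) * ennreal (\<mu> (snd e)))"
        by (simp add: nn_integral_add 1 2 3)
    qed
    also have "\<dots> \<le> (\<Sum>e\<in>P. I (fst e) * ennreal (b * \<theta> ^ n) + ennreal (b * \<theta> ^ n) * I (snd e) + ennreal (incr (ca f) e) * (ennreal (b * \<theta> ^ n) * ennreal (b * \<theta> ^ n)))"
      using b Plev by (intro sum_mono add_mono mult_left_mono mult_right_mono mult_mono ennreal_leI) (auto simp: case_prod_unfold)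
    also have "\<dots> = ennreal (b * \<theta> ^ n) * (\<Sum>e\<in>P. I (fst e)) + ennreal (b * \<theta> ^ n) * (\<Sum>e\<in>P. I (snd e))
        + (ennreal (b * \<theta> ^ n) * ennreal (b * \<theta> ^ n)) * (\<Sum>e\<in>P. ennreal (incr (ca f) e))"
      by (simp only: sum.distrib flip: sum_distrib_left sum_distrib_right) (simp only: mult_ac)
    also have "\<dots> \<le> ennreal (b * \<theta> ^ n) * ennreal (real (N ^ Mst) * (C * q ^ n * M)) + ennreal (b * \<theta> ^ n) * ennreal (real (N ^ Mst) * (C * q ^ n * M))
        + (ennreal (b * \<theta> ^ n) * ennreal (b * \<theta> ^ n)) * ennreal (A * (M / \<sigma> ^ n))"
    proof (intro add_mono mult_left_mono)
      let ?U = "\<lambda>z. {u. (z, u) \<in> touch n ^^ Mst}"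
      have fU: "finite (?U z)" "card (?U z) \<le> N ^ Mst" for z using card_touch_pow2 by auto
      have PS: "P = (SIGMA z:lev n. ?U z)" by (auto simp: P_def)
      have cb: "(of_nat (card (?U z)) :: ennreal) \<le> ennreal (real (N ^ Mst))" for z
        unfolding ennreal_of_nat_eq_real_of_nat using fU by (intro ennreal_leI of_nat_mono)
      have NI: "(\<Sum>z\<in>lev n. of_nat (card (?U z)) * I z) \<le> ennreal (real (N ^ Mst) * (C * q ^ n * M))"
      proof -
        have "(\<Sum>z\<in>lev n. of_nat (card (?U z)) * I z) \<le> (\<Sum>z\<in>lev n. ennreal (real (N ^ Mst)) * I z)"
          by (intro sum_mono mult_right_mono cb) simp
        also have "\<dots> = ennreal (real (N ^ Mst)) * (\<Sum>z\<in>lev n. I z)" by (simp add: sum_distrib_left)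
        also have "\<dots> \<le> ennreal (real (N ^ Mst)) * ennreal (C * q ^ n * M)" by (intro mult_left_mono SI) simp
        also have "\<dots> = ennreal (real (N ^ Mst) * (C * q ^ n * M))" by (rule ennreal_mult'[symmetric]) simp
        finally show ?thesis .
      qed
      have "(\<Sum>e\<in>P. I (fst e)) = (\<Sum>z\<in>lev n. \<Sum>u\<in>?U z. I z)"
        unfolding PS by (subst sum.Sigma) (auto simp: finite_level fU case_prod_unfold)
      also have "\<dots> = (\<Sum>z\<in>lev n. of_nat (card (?U z)) * I z)" by simp
      finally show 1: "(\<Sum>e\<in>P. I (fst e)) \<le> ennreal (real (N ^ Mst) * (C * q ^ n * M))" using NI by simp
      have swapP: "(u, z) \<in> P" if "(z, u) \<in> P" for z u
        using Plev(2)[OF that] touch_pow_sym that unfolding P_def by blast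
      have "(\<Sum>e\<in>P. I (snd e)) = (\<Sum>e\<in>P. I (fst e))"
      proof (rule sum.reindex_bij_witness[where i = prod.swap and j = prod.swap])
        fix e assume "e \<in> P"
        then show "prod.swap e \<in> P" by (cases e) (simp add: swapP)
      next
        fix e assume "e \<in> P"
        then show "prod.swap e \<in> P" by (cases e) (simp add: swapP)
      qed auto
      with 1 show "(\<Sum>e\<in>P. I (snd e)) \<le> ennreal (real (N ^ Mst) * (C * q ^ n * M))" by simp
      have "(\<Sum>e\<in>P. ennreal (incr (ca f) e)) = ennreal (\<Sum>e\<in>P. incr (ca f) e)"
        by (intro sum_ennreal) (auto simp: incr_nonneg)
      also have "\<dots> \<le> ennreal (A * (M / \<sigma> ^ n))"
      proof (rule ennreal_leI)
        have "(\<Sum>e\<in>P. incr (ca f) e) \<le> A * en n (ca f)"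
          using nbhd_sum_le[of "ca f" n Mst] unfolding P_def A_def by (simp only: mult_ac)
        also have "\<dots> \<le> A * (M / \<sigma> ^ n)"
          using M[of n] \<sigma>_pos A by (intro mult_left_mono) (auto simp: field_simps)
        finally show "(\<Sum>e\<in>P. incr (ca f) e) \<le> A * (M / \<sigma> ^ n)" .
      qed
      finally show "(\<Sum>e\<in>P. ennreal (incr (ca f) e)) \<le> ennreal (A * (M / \<sigma> ^ n))" .
    qed auto
    also have "\<dots> = ennreal (b * \<theta> ^ n * (real (N ^ Mst) * (C * q ^ n * M)) + b * \<theta> ^ n * (real (N ^ Mst) * (C * q ^ n * M)) + b * \<theta> ^ n * (b * \<theta> ^ n) * (A * (M / \<sigma> ^ n)))"
      using b \<theta> C q M0 A \<sigma>_pos by (simp add: ennreal_mult'[symmetric] ennreal_plus[symmetric] del: ennreal_plus)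
    also have "b * \<theta> ^ n * (real (N ^ Mst) * (C * q ^ n * M)) + b * \<theta> ^ n * (real (N ^ Mst) * (C * q ^ n * M)) + b * \<theta> ^ n * (b * \<theta> ^ n) * (A * (M / \<sigma> ^ n))
       = (b * (real (N ^ Mst) * C) + b * (real (N ^ Mst) * C) + b * b * A) * (q ^ n * \<theta> ^ n) * M"
      unfolding q_eq using \<sigma>_pos by (simp add: power_divide field_simps)
    finally have G2: "(\<Sum>e\<in>P. \<integral>\<^sup>+z. ?T e z \<partial>(m \<Otimes>\<^sub>M m))
      \<le> ennreal ((b * (real (N ^ Mst) * C) + b * (real (N ^ Mst) * C) + b * b * A) * (q ^ n * \<theta> ^ n) * M)" .
    have "G r f \<le> ennreal (3 powr p) * ennreal ((b * (real (N ^ Mst) * C) + b * (real (N ^ Mst) * C) + b * b * A) * (q ^ n * \<theta> ^ n) * M)"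
      by (rule order.trans[OF G1]) (intro mult_left_mono G2, simp)
    also have "\<dots> = ennreal (3 powr p * (b * (real (N ^ Mst) * C) + b * (real (N ^ Mst) * C) + b * b * A) * (q ^ n * \<theta> ^ n) * M)"
      by (simp add: ennreal_mult'[symmetric] mult.assoc)
    also have "\<dots> \<le> ennreal (C' * (q ^ n * \<theta> ^ n) * M)"
      using q \<theta> M0 by (intro ennreal_leI mult_right_mono) (auto simp: C'_def)
    finally show ?thesis .
  qed
  then show ?thesis using C' by blast
qed

text \<open>
  The deepest level whose cells are still large compared to r; for large r this is level 0,
  consisting of the whole space.
\<close>

lemma reaches_exists:
  assumes r: "0 < r"
  shows "\<exists>n. reaches n r \<and> min c3 1 * rst ^ Suc n \<le> r"
proof (cases "min c3 1 * rst ^ Suc 0 \<le> r")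
  case True
  have "reaches 0 r" unfolding reaches_def
  proof (intro allI impI)
    fix x y :: 'a
    have "root \<in> lev 0" by (simp add: level_iff)
    then show "\<exists>z\<in>lev 0. x \<in> K z \<and> (\<exists>u. (z, u) \<in> touch 0 ^^ Mst \<and> y \<in> K u)"
      using touch_pow_refl[of root 0 Mst] K_root by (intro bexI[of _ root] conjI exI[of _ root]) auto
  qed
  with True show ?thesis by blast
next
  case False
  let ?c = "min c3 1"
  have c: "0 < ?c" using c3 by simp
  then have "0 < r / ?c" using r by simp
  then obtain k where "rst ^ k < r / ?c" using rst real_arch_pow_inv by blast
  then have k: "?c * rst ^ k \<le> r" using c by (simp add: field_simps)
  define n' where "n' = (LEAST k. ?c * rst ^ k \<le> r)"
  have n': "?c * rst ^ n' \<le> r" unfolding n'_def using k by (rule LeastI)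
  have "1 < n'"
  proof (rule ccontr)
    assume "\<not> 1 < n'"
    then have "rst ^ 1 \<le> rst ^ n'" using rst by (intro power_decreasing) auto
    then have "?c * rst ^ 1 \<le> ?c * rst ^ n'" using c by simp
    with False n' show False by simp
  qed
  define n where "n = n' - 1"
  have n: "1 \<le> n" "Suc n = n'" using \<open>1 < n'\<close> by (auto simp: n_def)
  have "\<not> ?c * rst ^ n \<le> r" unfolding n_def n'_def
    by (rule not_less_Least) (use \<open>1 < n'\<close> in \<open>simp add: n'_def\<close>)
  then have rn: "r < c3 * rst ^ n" using rst by (smt (verit) mult_right_mono zero_le_power)
  have "reaches n r" unfolding reaches_def
  proof (intro allI impI)
    fix x y :: 'a assume "dist x y < r"
    then have "y \<in> point_nbhd E root K Mst x n" using ball_nbhd[OF n(1), of x] rn by auto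
    then obtain w v where wv: "w \<in> lev n" "x \<in> K w" "v \<in> nbhd Mst w" "y \<in> K v"
      unfolding point_nbhd_def by blast
    then have "(v, w) \<in> touch n ^^ Mst" by (simp add: cell_nbhd_eq level_iff)
    then show "\<exists>z\<in>lev n. x \<in> K z \<and> (\<exists>u. (z, u) \<in> touch n ^^ Mst \<and> y \<in> K u)"
      using wv touch_pow_sym by blast
  qed
  with n n' show ?thesis by auto
qed

text \<open>
  At the level n given by r, the double integral is of the order q^n \<theta>^n, and so is the
  normalizing factor r^dw times the mass of a ball of radius r.
\<close>

lemma kernel_le_Np:
  "\<exists>C>0. \<forall>f\<in>Lp. \<forall>r>0. ksJ (dw / p) r f \<le> ennreal C * Np f"
proof -
  obtain C where C: "0 < C" "\<forall>f\<in>Lp. \<forall>M n r. reaches n r \<longrightarrow> (\<forall>j. se j f \<le> M) \<longrightarrow> G r f \<le> ennreal (C * (q ^ n * \<theta> ^ n) * M)"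
    using G_le_energy by blast
  let ?c = "min c3 1"
  define a where "a = (?c * rst) powr dw * (?c * rst) powr Q / CA"
  have cr: "0 < ?c * rst" using c3 rst by simp
  have "0 < (?c * rst) powr dw" "0 < (?c * rst) powr Q" unfolding powr_gt_zero using cr by linarith+
  then have a: "0 < a" unfolding a_def using CA by (intro divide_pos_pos mult_pos_pos) linarith+
  have "ksJ (dw / p) r f \<le> ennreal (C / a) * Np f" if f: "f \<in> Lp" and r: "0 < r" for f r
  proof (cases "Np f")
    case (real M)
    obtain n where n: "reaches n r" "?c * rst ^ Suc n \<le> r" using reaches_exists[OF r] by blast
    let ?s = "?c * rst ^ Suc n"
    have s0: "0 < ?s" using c3 rst by simp
    have "?c * rst ^ Suc n \<le> 1 * 1" using c3 rst by (intro mult_mono power_le_one) auto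
    then have s1: "?s \<le> 1" by simp
    have low: "a * (q ^ n * \<theta> ^ n) \<le> r powr (p * (dw / p)) * measure m (ball x r)" for x
    proof -
      have eq: "?s = ?c * rst * rst ^ n" by simp
      have "a * (q ^ n * \<theta> ^ n) = ?s powr dw * (?s powr Q / CA)"
        unfolding eq using cr rst \<theta>_power[of 1 n] by (simp add: a_def powr_mult rst_dw_power q_eq)
      also have "\<dots> \<le> r powr dw * measure m (ball x ?s)"
        using n s0 s1 dw_pos CA by (intro mult_mono powr_mono2 ball_lower) auto
      also have "\<dots> \<le> r powr dw * measure m (ball x r)"
        using n by (intro mult_left_mono finite_measure_mono) auto
      finally show ?thesis using p0 by simp
    qed
    have M: "se j f \<le> M" for j using Np_finite_bound real by auto
    have qt: "0 < q ^ n * \<theta> ^ n" using q \<theta> by simp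
    have "ksJ (dw / p) r f \<le> ennreal (1 / (a * (q ^ n * \<theta> ^ n))) * G r f"
      using a qt by (intro kernel_le_G lp_meas[OF f] r low) auto
    also have "\<dots> \<le> ennreal (1 / (a * (q ^ n * \<theta> ^ n))) * ennreal (C * (q ^ n * \<theta> ^ n) * M)"
      using C(2) f n M by (intro mult_left_mono) auto
    also have "\<dots> = ennreal (1 / (a * (q ^ n * \<theta> ^ n)) * (C * (q ^ n * \<theta> ^ n) * M))"
      using a qt by (intro ennreal_mult'[symmetric]) simp
    also have "1 / (a * (q ^ n * \<theta> ^ n)) * (C * (q ^ n * \<theta> ^ n) * M) = C / a * M"
      using a q(1) \<theta>(1) by (simp add: divide_simps)
    also have "ennreal (C / a * M) = ennreal (C / a) * ennreal M" using C a by (intro ennreal_mult') simp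
    finally show ?thesis using real by (simp only:)
  next
    case top
    then show ?thesis using C a by (simp add: ennreal_mult_top)
  qed
  then show ?thesis using C a by (intro exI[of _ "C / a"]) auto
qed

end

section \<open>Iterated midpoints\<close>

text \<open>
  Iterated midpoints of the functions F k with k \<ge> n. Midpoints are all that the convexity
  argument needs, and they avoid finite convex combinations.
\<close>

inductive midhull :: "(nat \<Rightarrow> 'x \<Rightarrow> real) \<Rightarrow> nat \<Rightarrow> ('x \<Rightarrow> real) \<Rightarrow> bool" for F n where
  base: "n \<le> k \<Longrightarrow> midhull F n (F k)"
| mid: "midhull F n g \<Longrightarrow> midhull F n h \<Longrightarrow> midhull F n (\<lambda>x. (g x + h x) / 2)"

lemma midhull_mono: "midhull F n g \<Longrightarrow> k \<le> n \<Longrightarrow> midhull F k g"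
  by (induction rule: midhull.induct) (auto intro: midhull.intros)

lemma powr_abs_midpoint_le:
  fixes a b p :: real
  assumes "1 < p"
  shows "\<bar>(a + b) / 2\<bar> powr p \<le> (\<bar>a\<bar> powr p + \<bar>b\<bar> powr p) / 2"
proof (cases "a = b")
  case True
  then have "(a + b) / 2 = a" by simp
  then show ?thesis using True by simp
next
  case False
  then show ?thesis using powr_abs_midpoint_less[OF assms, of a b] by simp
qed

context framework
begin

section \<open>Smoothing with partitions of unity\<close>

lemma kernel_nonneg: "0 \<le> ks_kernel m p s r x y"
  by (simp add: ks_kernel_def)

text \<open>
  A pointwise bound of increments on pairs closer than r is inherited by the energies at radius r,
  because the kernel vanishes elsewhere.
\<close>

lemma kernel_sum_le:
  assumes "finite I" and F: "F \<in> borel_measurable m" and h: "\<And>i. i \<in> I \<Longrightarrow> h i \<in> borel_measurable m"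
    and c: "\<And>i. i \<in> I \<Longrightarrow> 0 \<le> c i"
    and le: "\<And>x y. dist x y < r \<Longrightarrow> \<bar>F x - F y\<bar> powr p \<le> (\<Sum>i\<in>I. c i * \<bar>h i x - h i y\<bar> powr p)"
  shows "ksJ s r F \<le> (\<Sum>i\<in>I. ennreal (c i) * ksJ s r (h i))"
proof -
  let ?k = "\<lambda>z. ks_kernel m p s r (fst z) (snd z)"
  have meas: "(\<lambda>z. ennreal (\<bar>h i (fst z) - h i (snd z)\<bar> powr p * ?k z)) \<in> borel_measurable (m \<Otimes>\<^sub>M m)" if "i \<in> I" for i
  proof -
    have [measurable]: "h i \<in> borel_measurable m" using h that by blast
    show ?thesis by measurable
  qed
  have "ksJ s r F
      \<le> (\<integral>\<^sup>+z. (\<Sum>i\<in>I. ennreal (c i) * ennreal (\<bar>h i (fst z) - h i (snd z)\<bar> powr p * ?k z)) \<partial>(m \<Otimes>\<^sub>M m))"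
    unfolding kernel_product[OF F]
  proof (rule nn_integral_mono)
    fix z :: "'a \<times> 'a"
    obtain x y where xy: "z = (x, y)" by force
    have "\<bar>F x - F y\<bar> powr p * ?k z \<le> (\<Sum>i\<in>I. c i * \<bar>h i x - h i y\<bar> powr p) * ?k z"
    proof (cases "dist x y < r")
      case True
      then show ?thesis using le kernel_nonneg by (intro mult_right_mono) auto
    qed (simp add: ks_kernel_def xy)
    then have "ennreal (\<bar>F x - F y\<bar> powr p * ?k z) \<le> ennreal (\<Sum>i\<in>I. c i * (\<bar>h i x - h i y\<bar> powr p * ?k z))"
      by (intro ennreal_leI) (simp add: sum_distrib_right mult.assoc)
    also have "\<dots> = (\<Sum>i\<in>I. ennreal (c i * (\<bar>h i x - h i y\<bar> powr p * ?k z)))"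
      using c kernel_nonneg by (intro sum_ennreal[symmetric]) auto
    also have "\<dots> = (\<Sum>i\<in>I. ennreal (c i) * ennreal (\<bar>h i x - h i y\<bar> powr p * ?k z))"
      using c by (intro sum.cong refl ennreal_mult') auto
    finally show "ennreal (\<bar>F (fst z) - F (snd z)\<bar> powr p * ?k z)
      \<le> (\<Sum>i\<in>I. ennreal (c i) * ennreal (\<bar>h i (fst z) - h i (snd z)\<bar> powr p * ?k z))" by (simp add: xy)
  qed
  also have "\<dots> = (\<Sum>i\<in>I. \<integral>\<^sup>+z. ennreal (c i) * ennreal (\<bar>h i (fst z) - h i (snd z)\<bar> powr p * ?k z) \<partial>(m \<Otimes>\<^sub>M m))"
    by (intro nn_integral_sum borel_measurable_times_ennreal meas) auto
  also have "\<dots> = (\<Sum>i\<in>I. ennreal (c i) * ksJ s r (h i))"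
    by (intro sum.cong refl) (simp add: nn_integral_cmult meas kernel_product h)
  finally show ?thesis .
qed

text \<open>
  The capacity hypothesis, with actual functions in place of an infimum and with a support
  condition that refers only to points.
\<close>

definition cutoffs :: "real \<Rightarrow> bool" where
  "cutoffs C \<longleftrightarrow> 0 < C \<and> (\<forall>x s. 0 < s \<longrightarrow> s \<le> 1 \<longrightarrow> (\<exists>h. continuous_on UNIV h \<and> (\<forall>y\<in>ball x s. h y = 1) \<and>
      (\<forall>y. y \<notin> ball x (2 * s) \<longrightarrow> h y = 0) \<and> Np h \<le> ennreal (C * s powr (Q - dw))))"

abbreviation "c3' \<equiv> min c3 1"
abbreviation "Jc r f \<equiv> ksJ (dw / p) r f"

text \<open>
  One cutoff is attached to each of the boundedly many descendants of z that are small enough to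
  fit into a ball of radius s, a fixed fraction of rst^n, and the cutoffs are added up. With s
  comparable to rst^n, the factor s powr (Q - dw) is comparable to \<sigma>^n.
\<close>

lemma cell_cutoffs:
  assumes "cutoffs C0"
  shows "\<exists>C>0. \<forall>n. \<exists>h. \<forall>z\<in>lev n. continuous_on UNIV (h z) \<and> (\<forall>x. 0 \<le> h z x) \<and> (\<forall>x\<in>K z. 1 \<le> h z x) \<and>
     (\<forall>y. h z y \<noteq> 0 \<longrightarrow> (\<exists>x\<in>K z. dist x y < c3' * rst ^ n / 4)) \<and> (\<forall>r>0. Jc r (h z) \<le> ennreal (C * \<sigma> ^ n))"
proof -
  obtain C1 where C1: "0 < C1" "\<forall>f\<in>Lp. \<forall>r>0. Jc r f \<le> ennreal C1 * Np f" using kernel_le_Np by blast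
  have C0: "0 < C0" using assms by (simp add: cutoffs_def)
  have c3': "0 < c3'" using c3 by simp
  \<comment> \<open>Cells j levels below level n have diameter less than s = c3' * rst ^ n / 8, so a ball of radius s around any of their points contains them.\<close>
  obtain j where j: "rst ^ j < c3' / (8 * c2)"
    using real_arch_pow_inv[of "c3' / (8 * c2)" rst] c3' c2 rst by auto
  define D where "D = (c3' / 8) powr (Q - dw)"
  have D: "0 < D" unfolding D_def powr_gt_zero using c3' by linarith
  define B where "B = real (L ^ j) powr p * real (L ^ j) * C1 * C0 * D + 1"
  have B0: "0 \<le> real (L ^ j) powr p * real (L ^ j) * C1 * C0 * D" using C1 C0 D by simp
  have B: "0 < B" using B0 by (simp add: B_def)
  have "\<exists>h. \<forall>z\<in>lev n. continuous_on UNIV (h z) \<and> (\<forall>x. 0 \<le> h z x) \<and> (\<forall>x\<in>K z. 1 \<le> h z x) \<and>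
     (\<forall>y. h z y \<noteq> 0 \<longrightarrow> (\<exists>x\<in>K z. dist x y < c3' * rst ^ n / 4)) \<and> (\<forall>r>0. Jc r (h z) \<le> ennreal (B * \<sigma> ^ n))" for n
  proof -
    \<comment> \<open>Supports reach 2 * s = c3' * rst ^ n / 4 beyond a cell; together with a distance c3' * rst ^ n / 2 between two points this is less than the radius c3 * rst ^ n of balls contained in neighbourhoods.\<close>
    define s where "s = c3' * rst ^ n / 8"
    have rn: "0 < rst ^ n" "rst ^ n \<le> 1" using rst by (auto simp: power_le_one)
    have s0: "0 < s" using c3' rn by (simp add: s_def)
    have "c3' * rst ^ n \<le> 1 * 1" using rn c3' by (intro mult_mono) auto
    then have s1: "s \<le> 1" by (simp add: s_def)
    have sD: "s powr (Q - dw) = D * \<sigma> ^ n"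
    proof -
      have "s powr (Q - dw) = (c3' / 8) powr (Q - dw) * (rst ^ n) powr (Q - dw)"
        unfolding s_def using c3' rn by (simp add: powr_mult[symmetric])
      also have "(rst ^ n) powr (Q - dw) = \<theta> ^ n / (\<theta> / \<sigma>) ^ n"
        using \<theta>_power[of 1 n] by (simp add: powr_diff rst_dw_power)
      also have "\<dots> = \<sigma> ^ n" using \<theta> \<sigma>_pos by (simp add: power_divide)
      finally show ?thesis by (simp add: D_def)
    qed
    have "\<forall>v. \<exists>x. x \<in> K v" using K_ne by blast
    then obtain xc where xc: "\<And>v. xc v \<in> K v" by metis
    have "\<forall>v. \<exists>h. continuous_on UNIV h \<and> (\<forall>y\<in>ball (xc v) s. h y = 1) \<and>
      (\<forall>y. y \<notin> ball (xc v) (2 * s) \<longrightarrow> h y = 0) \<and> Np h \<le> ennreal (C0 * s powr (Q - dw))"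
      using assms s0 s1 unfolding cutoffs_def by blast
    then obtain g where g: "\<And>v. continuous_on UNIV (g v)" "\<And>v y. y \<in> ball (xc v) s \<Longrightarrow> g v y = 1"
      "\<And>v y. y \<notin> ball (xc v) (2 * s) \<Longrightarrow> g v y = 0" "\<And>v. Np (g v) \<le> ennreal (C0 * s powr (Q - dw))" by metis
    define h where "h = (\<lambda>z x. \<Sum>v\<in>dsc j z. \<bar>g v x\<bar>)"
    have h0: "0 \<le> h z x" for z x unfolding h_def by (intro sum_nonneg) auto
    have hc: "continuous_on UNIV (h z)" for z unfolding h_def by (intro continuous_intros g(1))
    have h1: "1 \<le> h z x" if z: "z \<in> lev n" and x: "x \<in> K z" for z x
    proof -
      obtain v where v: "v \<in> dsc j z" "x \<in> K v" using K_desc[of z j] x by blast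
      have "ht v = n + j" using v(1) z by (simp add: desc_iff level_iff)
      then have "dist (xc v) x \<le> c2 * rst ^ (n + j)" using dist_K[OF xc v(2)] by simp
      also have "\<dots> = rst ^ n * (c2 * rst ^ j)" by (simp add: power_add)
      also have "\<dots> < rst ^ n * (c3' / 8)" using j c2 rn by (intro mult_strict_left_mono) (auto simp: field_simps)
      also have "\<dots> = s" by (simp add: s_def)
      finally have "g v x = 1" using g(2) by simp
      then have "1 = \<bar>g v x\<bar>" by simp
      also have "\<dots> \<le> h z x" unfolding h_def using v finite_desc by (intro member_le_sum) auto
      finally show ?thesis .
    qed
    have hs: "\<exists>x\<in>K z. dist x y < c3' * rst ^ n / 4" if "h z y \<noteq> 0" for z y
    proof -
      have "\<exists>v\<in>dsc j z. g v y \<noteq> 0"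
      proof (rule ccontr)
        assume "\<not> ?thesis"
        then have "h z y = 0" unfolding h_def by (intro sum.neutral) auto
        with that show False by simp
      qed
      then obtain v where v: "v \<in> dsc j z" "g v y \<noteq> 0" by blast
      then have "y \<in> ball (xc v) (2 * s)" using g(3) by blast
      moreover have "xc v \<in> K z" using xc K_desc[of z j] v(1) by blast
      ultimately show ?thesis by (intro bexI[of _ "xc v"]) (auto simp: s_def)
    qed
    have hJ: "Jc r (h z) \<le> ennreal (B * \<sigma> ^ n)" if r: "0 < r" for r z
    proof -
      have "Jc r (h z) \<le> (\<Sum>v\<in>dsc j z. ennreal (real (L ^ j) powr p) * Jc r (g v))"
      proof (rule kernel_sum_le)
        fix x y
        have "\<bar>h z x - h z y\<bar> \<le> (\<Sum>v\<in>dsc j z. \<bar>\<bar>g v x\<bar> - \<bar>g v y\<bar>\<bar>)"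
          unfolding h_def sum_subtractf[symmetric] by (rule sum_abs)
        also have "\<dots> \<le> (\<Sum>v\<in>dsc j z. \<bar>g v x - g v y\<bar>)" by (intro sum_mono abs_triangle_ineq3)
        finally have "\<bar>h z x - h z y\<bar> powr p \<le> (\<Sum>v\<in>dsc j z. \<bar>g v x - g v y\<bar>) powr p"
          using p0 by (intro powr_mono2) auto
        also have "\<dots> \<le> real (L ^ j) powr p * (\<Sum>v\<in>dsc j z. \<bar>g v x - g v y\<bar> powr p)"
          using finite_desc card_desc p0 by (intro powr_sum_le) auto
        finally show "\<bar>h z x - h z y\<bar> powr p \<le> (\<Sum>v\<in>dsc j z. real (L ^ j) powr p * \<bar>g v x - g v y\<bar> powr p)"
          by (simp add: sum_distrib_left)
      qed (use finite_desc hc g continuous_measurable in auto)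
      also have "\<dots> \<le> (\<Sum>v\<in>dsc j z. ennreal (real (L ^ j) powr p) * ennreal (C1 * C0 * D * \<sigma> ^ n))"
      proof (intro sum_mono mult_left_mono)
        fix v
        have "Jc r (g v) \<le> ennreal C1 * Np (g v)" using C1 r lp_continuous[OF g(1)] by blast
        also have "\<dots> \<le> ennreal C1 * ennreal (C0 * s powr (Q - dw))" by (intro mult_left_mono g(4)) simp
        also have "\<dots> = ennreal (C1 * C0 * D * \<sigma> ^ n)" using C1 by (simp add: sD ennreal_mult'[symmetric] mult_ac)
        finally show "Jc r (g v) \<le> ennreal (C1 * C0 * D * \<sigma> ^ n)" .
      qed simp
      also have "\<dots> = ennreal (real (card (dsc j z))) * (ennreal (real (L ^ j) powr p) * ennreal (C1 * C0 * D * \<sigma> ^ n))"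
        by (simp add: ennreal_of_nat_eq_real_of_nat)
      also have "\<dots> = ennreal (real (card (dsc j z)) * (real (L ^ j) powr p * (C1 * C0 * D * \<sigma> ^ n)))"
        by (simp only: ennreal_mult'[symmetric] powr_ge_zero of_nat_0_le_iff)
      also have "\<dots> \<le> ennreal (B * \<sigma> ^ n)"
      proof (rule ennreal_leI)
        have "real (card (dsc j z)) * (real (L ^ j) powr p * (C1 * C0 * D * \<sigma> ^ n)) \<le> real (L ^ j) * (real (L ^ j) powr p * (C1 * C0 * D * \<sigma> ^ n))"
          using card_desc[of j z] C1 C0 D \<sigma>_pos by (intro mult_right_mono of_nat_mono) auto
        also have "\<dots> = (real (L ^ j) powr p * real (L ^ j) * C1 * C0 * D) * \<sigma> ^ n" by (simp only: mult_ac)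
        also have "\<dots> \<le> B * \<sigma> ^ n" using \<sigma>_pos by (intro mult_right_mono) (auto simp: B_def)
        finally show "real (card (dsc j z)) * (real (L ^ j) powr p * (C1 * C0 * D * \<sigma> ^ n)) \<le> B * \<sigma> ^ n" .
      qed
      finally show ?thesis .
    qed
    show ?thesis using h0 hc h1 hs hJ by (intro exI[of _ h]) blast
  qed
  with B show ?thesis by blast
qed

text \<open>
  The function g interpolates the cell averages of level n with the normalized cutoffs. At pairs
  of points closer than a fraction of rst^n, increments of g are bounded by increments of cell
  averages near a cell times increments of the cutoffs; the energy bound \<sigma>^n for the latter
  compensates the factor \<sigma>^(-n) in the former. The lower bound for Korevaar-Schoen energies
  needs only small radii, so the seminorm of g is bounded. The error f - g is the error of cell
  averages plus differences of neighbouring averages, both of order q^n.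
\<close>

lemma smoothing:
  assumes "cutoffs C0"
  shows "\<exists>C>0. \<forall>f\<in>Lp. \<forall>M n. (\<forall>j. se j f \<le> M) \<longrightarrow> 1 \<le> n \<longrightarrow>
    (\<exists>g. continuous_on UNIV g \<and> Np g \<le> ennreal (C * M) \<and> (\<integral>\<^sup>+x. ennreal (\<bar>f x - g x\<bar> powr p) \<partial>m) \<le> ennreal (C * q ^ n * M))"
proof -
  obtain C1 where C1: "0 < C1" "\<forall>n. \<exists>h. \<forall>z\<in>lev n. continuous_on UNIV (h z) \<and> (\<forall>x. 0 \<le> h z x) \<and> (\<forall>x\<in>K z. 1 \<le> h z x) \<and>
     (\<forall>y. h z y \<noteq> 0 \<longrightarrow> (\<exists>x\<in>K z. dist x y < c3' * rst ^ n / 4)) \<and> (\<forall>r>0. Jc r (h z) \<le> ennreal (C1 * \<sigma> ^ n))"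
    using cell_cutoffs[OF assms] by blast
  obtain C2 where C2: "0 < C2" "\<forall>f\<in>Lp. Np f \<le> ennreal C2 * Liminf (at_right 0) (\<lambda>r. Jc r f)"
    using Np_le_Liminf by blast
  obtain C3 where C3: "0 < C3" "\<forall>f\<in>Lp. \<forall>M n. (\<forall>j. se j f \<le> M) \<longrightarrow>
     (\<Sum>w\<in>lev n. \<integral>\<^sup>+x. ennreal (\<bar>f x - ca f w\<bar> powr p) * indicator (K w) x \<partial>m) \<le> ennreal (C3 * q ^ n * M)"
    using cell_approx by blast
  obtain b where b: "0 < b" "\<forall>n. \<forall>w\<in>lev n. \<mu> w \<le> b * \<theta> ^ n" using mass_upper by blast
  \<comment> \<open>A neighbourhood of radius Mst around a point, enlarged by one step at either end for the choice of the cells containing the two points.\<close>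
  define T where "T = Mst + 2"
  define N' where "N' = N ^ T"
  define H where "H = (2 * real N' ^ 2) powr p"
  define A' where "A' = real (N ^ T * N ^ T) * real T powr p * 2"
  have A'0: "0 \<le> A'" by (simp add: A'_def)
  define D1 where "D1 = H * real N' * C1 * A'"
  have D1: "0 \<le> D1" using C1 A'0 by (simp add: D1_def H_def)
  define D2 where "D2 = 2 powr p * (C3 + real N' powr p * b * A')"
  have D2: "0 \<le> D2" using C3 b A'0 by (simp add: D2_def)
  define C where "C = C2 * D1 + D2 + 1"
  have C: "0 < C" "C2 * D1 \<le> C" "D2 \<le> C" using C2 D1 D2 by (auto simp: C_def add_nonneg_pos)
  have c3': "0 < c3'" using c3 by simp
  have "\<exists>g. continuous_on UNIV g \<and> Np g \<le> ennreal (C * M) \<and> (\<integral>\<^sup>+x. ennreal (\<bar>f x - g x\<bar> powr p) \<partial>m) \<le> ennreal (C * q ^ n * M)"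
    if f: "f \<in> Lp" and M: "\<And>j. se j f \<le> M" and n: "1 \<le> n" for f M n
  proof -
    have M0: "0 \<le> M" using M[of 0] se_nonneg[of 0 f] by linarith
    have rn: "0 < rst ^ n" using rst by simp
    from C1(2)[THEN spec, of n] obtain h where hh: "\<forall>z\<in>lev n. continuous_on UNIV (h z) \<and> (\<forall>x. 0 \<le> h z x) \<and> (\<forall>x\<in>K z. 1 \<le> h z x) \<and>
     (\<forall>y. h z y \<noteq> 0 \<longrightarrow> (\<exists>x\<in>K z. dist x y < c3' * rst ^ n / 4)) \<and> (\<forall>r>0. Jc r (h z) \<le> ennreal (C1 * \<sigma> ^ n))"
      by (rule exE)
    have h: "\<And>z. z \<in> lev n \<Longrightarrow> continuous_on UNIV (h z)" "\<And>z x. z \<in> lev n \<Longrightarrow> 0 \<le> h z x"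
      "\<And>z x. z \<in> lev n \<Longrightarrow> x \<in> K z \<Longrightarrow> 1 \<le> h z x"
      "\<And>z y. z \<in> lev n \<Longrightarrow> h z y \<noteq> 0 \<Longrightarrow> \<exists>x\<in>K z. dist x y < c3' * rst ^ n / 4"
      "\<And>z r. z \<in> lev n \<Longrightarrow> 0 < r \<Longrightarrow> Jc r (h z) \<le> ennreal (C1 * \<sigma> ^ n)"
      using hh by blast+
    have hm: "h z \<in> borel_measurable m" if "z \<in> lev n" for z by (rule continuous_measurable[OF h(1)[OF that]])
    define a where "a = ca f"
    define U where "U = (\<lambda>z. {u. (z, u) \<in> touch n ^^ T})"
    have finU: "finite (U z)" and cardU: "card (U z) \<le> N'" for z
      using card_touch_pow2[where w = z and n = n and i = T] by (auto simp: U_def N'_def)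
    have subU: "U z \<subseteq> lev n" if "z \<in> lev n" for z unfolding U_def using touch_pow_level that by blast
    define A where "A = (\<lambda>z. \<Sum>u\<in>U z. \<bar>a u - a z\<bar> powr p)"
    have A0: "0 \<le> A z" for z unfolding A_def by (intro sum_nonneg) simp
    have SA: "(\<Sum>z\<in>lev n. A z) \<le> A' * (M / \<sigma> ^ n)"
    proof -
      have "(\<Sum>z\<in>lev n. A z) = (\<Sum>(z, u)\<in>(SIGMA z:lev n. U z). \<bar>a u - a z\<bar> powr p)"
        unfolding A_def by (rule sum.Sigma) (use finite_level finU in auto)
      also have "\<dots> = (\<Sum>e\<in>{(u, v). u \<in> lev n \<and> (u, v) \<in> touch n ^^ T}. incr a e)"
        by (intro sum.cong) (auto simp: U_def incr_def abs_minus_commute)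
      also have "\<dots> \<le> A' * en n a" using nbhd_sum_le[of a n T] unfolding A'_def by (simp only: mult_ac)
      also have "\<dots> \<le> A' * (M / \<sigma> ^ n)" using M[of n] \<sigma>_pos A'0 by (intro mult_left_mono) (auto simp: a_def field_simps)
      finally show ?thesis .
    qed
    define Hs where "Hs = (\<lambda>x. \<Sum>z\<in>lev n. h z x)"
    have Hs1: "1 \<le> Hs x" for x
    proof -
      obtain z where z: "z \<in> lev n" "x \<in> K z" using K_level[of n] by blast
      have "1 \<le> h z x" using h z by blast
      also have "\<dots> \<le> Hs x" unfolding Hs_def using z h finite_level by (intro member_le_sum) auto
      finally show ?thesis .
    qed
    define g where "g = (\<lambda>x. (\<Sum>z\<in>lev n. a z * h z x) / Hs x)"
    have gc: "continuous_on UNIV g"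
    proof -
      have "Hs x \<noteq> 0" for x using Hs1[of x] by simp
      then show ?thesis unfolding g_def Hs_def by (intro continuous_intros h(1)) auto
    qed
    have near: "u \<in> U z" if z: "z \<in> lev n" "x \<in> K z" and u: "u \<in> lev n" and xy: "dist x y \<le> c3' * rst ^ n / 2"
      and nz: "h u y \<noteq> 0" for z x u y
    proof -
      obtain x' where x': "x' \<in> K u" "dist x' y < c3' * rst ^ n / 4" using h(4)[OF u nz] by blast
      have "dist x x' < c3' * rst ^ n"
        using dist_triangle2[of x x' y] x'(2) xy mult_pos_pos[OF c3' rn] by linarith
      also have "\<dots> \<le> c3 * rst ^ n" using rn by (intro mult_right_mono) auto
      finally have "x' \<in> point_nbhd E root K Mst x n" using ball_nbhd[OF n, of x] by auto
      then obtain w v where wv: "w \<in> lev n" "x \<in> K w" "v \<in> nbhd Mst w" "x' \<in> K v"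
        unfolding point_nbhd_def by blast
      then have vw: "(v, w) \<in> touch n ^^ Mst" by (simp add: cell_nbhd_eq level_iff)
      then have vl: "v \<in> lev n" using touch_pow_level[OF touch_pow_sym] wv by blast
      have 1: "(z, w) \<in> touch n" using z wv by (auto simp: touch_def)
      have 2: "(v, u) \<in> touch n" using x' wv vl u by (auto simp: touch_def)
      have "(z, v) \<in> touch n ^^ Suc Mst" using 1 touch_pow_sym[OF vw] by (rule relpow_Suc_I2)
      then have "(z, u) \<in> touch n ^^ Suc (Suc Mst)" using 2 by (rule relpow_Suc_I)
      then show ?thesis by (simp add: U_def T_def del: relpow.simps)
    qed
    have pw: "\<bar>g x - g y\<bar> powr p \<le> (\<Sum>e\<in>(SIGMA z:lev n. U z). (H * A (fst e)) * \<bar>h (snd e) x - h (snd e) y\<bar> powr p)"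
      if xy: "dist x y < c3' * rst ^ n / 2" for x y
    proof -
      obtain z where z: "z \<in> lev n" "x \<in> K z" using K_level[of n] by blast
      have "\<bar>g x - g y\<bar> powr p \<le> H * (A z * (\<Sum>u\<in>U z. \<bar>h u x - h u y\<bar> powr p))"
        unfolding g_def Hs_def H_def A_def
      proof (rule glue_powr_le)
        show "1 \<le> (\<Sum>z\<in>lev n. h z x)" "1 \<le> (\<Sum>z\<in>lev n. h z y)" using Hs1 unfolding Hs_def by auto
        fix u assume u: "u \<in> lev n - U z"
        have "dist x x \<le> c3' * rst ^ n / 2" using c3' rn by simp
        then show "h u x = 0 \<and> h u y = 0" using near[OF z, of u x] near[OF z, of u y] u xy by auto
      qed (use finite_level subU[OF z(1)] cardU p0 h(2) in auto)
      also have "\<dots> = (\<Sum>u\<in>U z. (H * A z) * \<bar>h u x - h u y\<bar> powr p)" by (simp add: sum_distrib_left mult.assoc)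
      also have "\<dots> \<le> (\<Sum>z\<in>lev n. \<Sum>u\<in>U z. (H * A z) * \<bar>h u x - h u y\<bar> powr p)"
        using z finite_level A0 by (intro member_le_sum[of z "lev n" "\<lambda>z. \<Sum>u\<in>U z. (H * A z) * \<bar>h u x - h u y\<bar> powr p"])
          (auto intro!: sum_nonneg simp: H_def)
      also have "\<dots> = (\<Sum>e\<in>(SIGMA z:lev n. U z). (H * A (fst e)) * \<bar>h (snd e) x - h (snd e) y\<bar> powr p)"
        by (subst sum.Sigma) (auto simp: finite_level finU case_prod_unfold)
      finally show ?thesis .
    qed
    have Jg: "Jc r g \<le> ennreal (D1 * M)" if r: "0 < r" "r < c3' * rst ^ n / 2" for r
    proof -
      have "Jc r g \<le> (\<Sum>e\<in>(SIGMA z:lev n. U z). ennreal (H * A (fst e)) * Jc r (h (snd e)))"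
      proof (rule kernel_sum_le)
        fix x y :: 'a assume "dist x y < r"
        then have "dist x y < c3' * rst ^ n / 2" using r by linarith
        then show "\<bar>g x - g y\<bar> powr p \<le> (\<Sum>e\<in>(SIGMA z:lev n. U z). (H * A (fst e)) * \<bar>h (snd e) x - h (snd e) y\<bar> powr p)" by (rule pw)
      next
        fix e assume "e \<in> (SIGMA z:lev n. U z)"
        then have "fst e \<in> lev n" "snd e \<in> U (fst e)" by auto
        then have "snd e \<in> lev n" using subU by blast
        then show "h (snd e) \<in> borel_measurable m" by (rule hm)
      qed (use finite_level finU gc continuous_measurable A0 in \<open>auto simp: H_def\<close>)
      also have "\<dots> \<le> (\<Sum>e\<in>(SIGMA z:lev n. U z). ennreal (H * A (fst e)) * ennreal (C1 * \<sigma> ^ n))"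
      proof (intro sum_mono mult_left_mono)
        fix e assume "e \<in> (SIGMA z:lev n. U z)"
        then have "fst e \<in> lev n" "snd e \<in> U (fst e)" by auto
        then have "snd e \<in> lev n" using subU by blast
        then show "Jc r (h (snd e)) \<le> ennreal (C1 * \<sigma> ^ n)" using h(5) r by blast
      qed simp
      also have "\<dots> = (\<Sum>e\<in>(SIGMA z:lev n. U z). ennreal (H * A (fst e) * (C1 * \<sigma> ^ n)))"
        using A0 by (intro sum.cong refl ennreal_mult'[symmetric]) (auto simp: H_def)
      also have "\<dots> = ennreal (\<Sum>e\<in>(SIGMA z:lev n. U z). H * A (fst e) * (C1 * \<sigma> ^ n))"
        using A0 C1 \<sigma>_pos by (intro sum_ennreal) (auto simp: H_def)
      also have "\<dots> \<le> ennreal (D1 * M)"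
      proof (rule ennreal_leI)
        have "(\<Sum>e\<in>(SIGMA z:lev n. U z). H * A (fst e) * (C1 * \<sigma> ^ n)) = (\<Sum>z\<in>lev n. \<Sum>u\<in>U z. H * A z * (C1 * \<sigma> ^ n))"
          by (subst sum.Sigma) (auto simp: finite_level finU case_prod_unfold)
        also have "\<dots> = (\<Sum>z\<in>lev n. real (card (U z)) * (H * A z * (C1 * \<sigma> ^ n)))" by simp
        also have "\<dots> \<le> (\<Sum>z\<in>lev n. real N' * (H * A z * (C1 * \<sigma> ^ n)))"
          using cardU A0 C1 \<sigma>_pos by (intro sum_mono mult_right_mono of_nat_mono) (auto simp: H_def)
        also have "\<dots> = real N' * H * C1 * \<sigma> ^ n * (\<Sum>z\<in>lev n. A z)"
            by (simp add: sum_distrib_left sum_distrib_right mult_ac)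
        also have "\<dots> \<le> real N' * H * C1 * \<sigma> ^ n * (A' * (M / \<sigma> ^ n))"
          using C1 \<sigma>_pos by (intro mult_left_mono SA) (auto simp: H_def)
        also have "\<dots> = D1 * M" using \<sigma>_pos by (simp add: D1_def)
        finally show "(\<Sum>e\<in>(SIGMA z:lev n. U z). H * A (fst e) * (C1 * \<sigma> ^ n)) \<le> D1 * M" .
      qed
      finally show ?thesis .
    qed
    have Npg: "Np g \<le> ennreal (C * M)"
    proof -
      have "\<forall>\<^sub>F r in at_right 0. r < c3' * rst ^ n / 2"
        using c3' rn by (intro order_tendstoD(2)[OF tendsto_ident_at]) auto
      moreover have "\<forall>\<^sub>F r in at_right (0::real). 0 < r" by (simp add: eventually_at_right_less)
      ultimately have "\<forall>\<^sub>F r in at_right 0. Jc r g \<le> ennreal (D1 * M)"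
        by eventually_elim (rule Jg)
      then have "Limsup (at_right 0) (\<lambda>r. Jc r g) \<le> ennreal (D1 * M)" by (rule Limsup_bounded)
      moreover have "Liminf (at_right 0) (\<lambda>r. Jc r g) \<le> Limsup (at_right 0) (\<lambda>r. Jc r g)"
        by (rule Liminf_le_Limsup) simp
      ultimately have "Liminf (at_right 0) (\<lambda>r. Jc r g) \<le> ennreal (D1 * M)" by (rule order.trans[rotated])
      then have "ennreal C2 * Liminf (at_right 0) (\<lambda>r. Jc r g) \<le> ennreal C2 * ennreal (D1 * M)" by (intro mult_left_mono) auto
      also have "\<dots> = ennreal (C2 * D1 * M)" using C2 by (simp add: ennreal_mult'[symmetric] mult.assoc)
      also have "\<dots> \<le> ennreal (C * M)" using C M0 by (intro ennreal_leI mult_right_mono) auto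
      finally show ?thesis using C2(2) lp_continuous[OF gc] order.trans by blast
    qed
    have "(\<integral>\<^sup>+x. ennreal (\<bar>f x - g x\<bar> powr p) \<partial>m)
        \<le> (\<integral>\<^sup>+x. ennreal (2 powr p) * (\<Sum>z\<in>lev n. ennreal (\<bar>f x - a z\<bar> powr p) * indicator (K z) x + ennreal (real N' powr p * A z) * indicator (K z) x) \<partial>m)"
    proof (rule nn_integral_mono)
      fix x
      obtain z where z: "z \<in> lev n" "x \<in> K z" using K_level[of n] by blast
      have ga: "\<bar>a z - g x\<bar> powr p \<le> real N' powr p * A z"
      proof -
        have "\<bar>a z - g x\<bar> \<le> (\<Sum>u\<in>U z. \<bar>a u - a z\<bar>)"
        proof -
          have z0: "h u x = 0" if "u \<in> lev n - U z" for u
            using near[OF z, of u x] that c3' rn by auto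
          have HsU: "Hs x = (\<Sum>u\<in>U z. h u x)" unfolding Hs_def
            by (rule sum.mono_neutral_right) (use finite_level subU[OF z(1)] z0 in auto)
          have "(\<Sum>u\<in>lev n. a u * h u x) = (\<Sum>u\<in>U z. a u * h u x)"
            by (rule sum.mono_neutral_right) (use finite_level subU[OF z(1)] z0 in auto)
          moreover have "a z = (\<Sum>u\<in>U z. a z * h u x) / Hs x"
            unfolding sum_distrib_left[symmetric] HsU[symmetric] using Hs1[of x] by simp
          ultimately have "a z - g x = (\<Sum>u\<in>U z. (a z - a u) * h u x) / Hs x"
            by (simp add: g_def left_diff_distrib sum_subtractf diff_divide_distrib)
          also have "\<bar>\<dots>\<bar> \<le> (\<Sum>u\<in>U z. \<bar>(a z - a u) * h u x\<bar>) / Hs x"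
            unfolding abs_divide using Hs1[of x] by (intro frac_le sum_abs) (auto intro: sum_nonneg)
          also have "\<dots> = (\<Sum>u\<in>U z. \<bar>a u - a z\<bar> * (h u x / Hs x))"
            using h(2) subU[OF z(1)] by (auto simp: sum_divide_distrib abs_mult abs_minus_commute intro!: sum.cong)
          also have "\<dots> \<le> (\<Sum>u\<in>U z. \<bar>a u - a z\<bar> * 1)"
          proof (intro sum_mono mult_left_mono)
            fix u assume u: "u \<in> U z"
            then have "h u x \<le> Hs x" unfolding Hs_def using subU[OF z(1)] h(2) finite_level by (intro member_le_sum) auto
            then show "h u x / Hs x \<le> 1" using Hs1[of x] by simp
          qed simp
          finally show ?thesis by simp
        qed
        then have "\<bar>a z - g x\<bar> powr p \<le> (\<Sum>u\<in>U z. \<bar>a u - a z\<bar>) powr p" using p0 by (intro powr_mono2) auto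
        also have "\<dots> \<le> real N' powr p * A z" unfolding A_def using finU cardU p0 by (intro powr_sum_le) auto
        finally show ?thesis .
      qed
      have "\<bar>f x - g x\<bar> powr p \<le> (\<bar>f x - a z\<bar> + \<bar>a z - g x\<bar>) powr p" using p0 by (intro powr_mono2) auto
      also have "\<dots> \<le> 2 powr p * (\<bar>f x - a z\<bar> powr p + \<bar>a z - g x\<bar> powr p)" using p0 by (intro powr_add_le) auto
      also have "\<dots> \<le> 2 powr p * (\<bar>f x - a z\<bar> powr p + real N' powr p * A z)" using ga by simp
      finally have "ennreal (\<bar>f x - g x\<bar> powr p) \<le> ennreal (2 powr p * (\<bar>f x - a z\<bar> powr p + real N' powr p * A z))" by (rule ennreal_leI)
      also have "\<dots> = ennreal (2 powr p) * (ennreal (\<bar>f x - a z\<bar> powr p) * indicator (K z) x + ennreal (real N' powr p * A z) * indicator (K z) x)"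
        using z A0 by (simp add: ennreal_mult')
      also have "\<dots> \<le> ennreal (2 powr p) * (\<Sum>z\<in>lev n. ennreal (\<bar>f x - a z\<bar> powr p) * indicator (K z) x + ennreal (real N' powr p * A z) * indicator (K z) x)"
        using z finite_level by (intro mult_left_mono member_le_sum) auto
      finally show "ennreal (\<bar>f x - g x\<bar> powr p) \<le> ennreal (2 powr p) * (\<Sum>z\<in>lev n. ennreal (\<bar>f x - a z\<bar> powr p) * indicator (K z) x + ennreal (real N' powr p * A z) * indicator (K z) x)" .
    qed
    also have "\<dots> = ennreal (2 powr p) * ((\<Sum>z\<in>lev n. \<integral>\<^sup>+x. ennreal (\<bar>f x - a z\<bar> powr p) * indicator (K z) x \<partial>m) + (\<Sum>z\<in>lev n. ennreal (real N' powr p * A z) * ennreal (\<mu> z)))"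
    proof -
      have [measurable]: "f \<in> borel_measurable m" by (rule lp_meas[OF f])
      have "(\<integral>\<^sup>+x. ennreal (2 powr p) * (\<Sum>z\<in>lev n. ennreal (\<bar>f x - a z\<bar> powr p) * indicator (K z) x + ennreal (real N' powr p * A z) * indicator (K z) x) \<partial>m)
        = ennreal (2 powr p) * (\<integral>\<^sup>+x. (\<Sum>z\<in>lev n. ennreal (\<bar>f x - a z\<bar> powr p) * indicator (K z) x + ennreal (real N' powr p * A z) * indicator (K z) x) \<partial>m)"
        by (rule nn_integral_cmult) measurable
      also have "(\<integral>\<^sup>+x. (\<Sum>z\<in>lev n. ennreal (\<bar>f x - a z\<bar> powr p) * indicator (K z) x + ennreal (real N' powr p * A z) * indicator (K z) x) \<partial>m)
        = (\<Sum>z\<in>lev n. \<integral>\<^sup>+x. ennreal (\<bar>f x - a z\<bar> powr p) * indicator (K z) x + ennreal (real N' powr p * A z) * indicator (K z) x \<partial>m)"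
        by (rule nn_integral_sum) measurable
      also have "\<dots> = (\<Sum>z\<in>lev n. (\<integral>\<^sup>+x. ennreal (\<bar>f x - a z\<bar> powr p) * indicator (K z) x \<partial>m) + ennreal (real N' powr p * A z) * ennreal (\<mu> z))"
        by (intro sum.cong refl) (simp add: nn_integral_add nn_integral_cmult_indicator emeasure_eq_measure)
      finally show ?thesis by (simp add: sum.distrib)
    qed
    also have "\<dots> \<le> ennreal (2 powr p) * (ennreal (C3 * q ^ n * M) + ennreal (real N' powr p * b * A' * q ^ n * M))"
    proof (intro mult_left_mono add_mono)
      show "(\<Sum>z\<in>lev n. \<integral>\<^sup>+x. ennreal (\<bar>f x - a z\<bar> powr p) * indicator (K z) x \<partial>m) \<le> ennreal (C3 * q ^ n * M)"
        unfolding a_def using C3(2) f M by blast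
      have "(\<Sum>z\<in>lev n. ennreal (real N' powr p * A z) * ennreal (\<mu> z)) = ennreal (\<Sum>z\<in>lev n. real N' powr p * A z * \<mu> z)"
        using A0 by (simp add: ennreal_mult'[symmetric])
      also have "\<dots> \<le> ennreal (real N' powr p * b * A' * q ^ n * M)"
      proof (rule ennreal_leI)
        have "(\<Sum>z\<in>lev n. real N' powr p * A z * \<mu> z) \<le> (\<Sum>z\<in>lev n. real N' powr p * A z * (b * \<theta> ^ n))"
          using A0 by (intro sum_mono mult_left_mono b(2)[rule_format]) auto
        also have "\<dots> = real N' powr p * (b * \<theta> ^ n) * (\<Sum>z\<in>lev n. A z)"
            by (simp add: sum_distrib_left sum_distrib_right mult_ac)
        also have "\<dots> \<le> real N' powr p * (b * \<theta> ^ n) * (A' * (M / \<sigma> ^ n))"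
          using b \<theta> by (intro mult_left_mono SA) auto
        also have "\<dots> = real N' powr p * b * A' * q ^ n * M" by (simp add: q_eq power_divide)
        finally show "(\<Sum>z\<in>lev n. real N' powr p * A z * \<mu> z) \<le> real N' powr p * b * A' * q ^ n * M" .
      qed
      finally show "(\<Sum>z\<in>lev n. ennreal (real N' powr p * A z) * ennreal (\<mu> z)) \<le> ennreal (real N' powr p * b * A' * q ^ n * M)" .
    qed simp
    also have "\<dots> = ennreal (2 powr p * (C3 * q ^ n * M + real N' powr p * b * A' * q ^ n * M))"
      using C3 b A'0 q M0 by (simp add: ennreal_mult' ennreal_plus)
    also have "2 powr p * (C3 * q ^ n * M + real N' powr p * b * A' * q ^ n * M) = D2 * q ^ n * M"
      by (simp add: D2_def algebra_simps)
    also have "ennreal (D2 * q ^ n * M) \<le> ennreal (C * q ^ n * M)"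
      using C q M0 by (intro ennreal_leI mult_right_mono) auto
    finally show ?thesis using gc Npg by blast
  qed
  with C(1) show ?thesis by blast
qed

end

context framework
begin

section \<open>Density of continuous functions\<close>

text \<open>
  Uniform convexity of t^p, summed over the edges; the constants do not depend on the level.
\<close>

lemma energy_uniformly_convex:
  assumes "0 < \<epsilon>"
  shows "\<exists>C\<ge>0. \<forall>n u v. en n (\<lambda>w. u w - v w) \<le> \<epsilon> * (en n u + en n v)
           + C * ((en n u + en n v) / 2 - en n (\<lambda>w. (u w + v w) / 2))"
proof -
  obtain C where C: "0 \<le> C" "\<forall>a b. \<bar>a - b\<bar> powr p \<le> \<epsilon> * (\<bar>a\<bar> powr p + \<bar>b\<bar> powr p)
           + C * ((\<bar>a\<bar> powr p + \<bar>b\<bar> powr p) / 2 - \<bar>(a + b) / 2\<bar> powr p)"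
    using powr_uniformly_convex[OF p1 assms] by blast
  have "en n (\<lambda>w. u w - v w) \<le> \<epsilon> * (en n u + en n v) + C * ((en n u + en n v) / 2 - en n (\<lambda>w. (u w + v w) / 2))" for n u v
  proof -
    have "(\<Sum>e\<in>touch n. incr (\<lambda>w. u w - v w) e) \<le> (\<Sum>e\<in>touch n. \<epsilon> * (incr u e + incr v e) + C * ((incr u e + incr v e) / 2 - incr (\<lambda>w. (u w + v w) / 2) e))"
    proof (rule sum_mono)
      fix e :: "'t \<times> 't"
      let ?a = "u (fst e) - u (snd e)" and ?b = "v (fst e) - v (snd e)"
      have 1: "u (fst e) - v (fst e) - (u (snd e) - v (snd e)) = ?a - ?b" by simp
      have 2: "(u (fst e) + v (fst e)) / 2 - (u (snd e) + v (snd e)) / 2 = (?a + ?b) / 2" by (simp add: field_simps)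
      show "incr (\<lambda>w. u w - v w) e \<le> \<epsilon> * (incr u e + incr v e) + C * ((incr u e + incr v e) / 2 - incr (\<lambda>w. (u w + v w) / 2) e)"
        unfolding incr_def 1 2 using C(2) by blast
    qed
    also have "\<dots> = \<epsilon> * ((\<Sum>e\<in>touch n. incr u e) + (\<Sum>e\<in>touch n. incr v e))
        + C * (((\<Sum>e\<in>touch n. incr u e) + (\<Sum>e\<in>touch n. incr v e)) / 2 - (\<Sum>e\<in>touch n. incr (\<lambda>w. (u w + v w) / 2) e))"
      by (simp add: sum.distrib sum_subtractf sum_distrib_left[symmetric] sum_divide_distrib[symmetric])
    finally show ?thesis unfolding energy_level by (simp add: field_simps)
  qed
  with C(1) show ?thesis by blast
qed

lemma ca_mid: "g \<in> Lp \<Longrightarrow> h \<in> Lp \<Longrightarrow> ca (\<lambda>x. (g x + h x) / 2) w = (ca g w + ca h w) / 2"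
  using ca_scale[of "1 / 2" "\<lambda>x. g x + h x" w] ca_add[of g h w] by simp

lemma se_mid:
  assumes "g \<in> Lp" "h \<in> Lp"
  shows "se n (\<lambda>x. (g x + h x) / 2) \<le> (se n g + se n h) / 2"
proof -
  have "(\<Sum>e\<in>touch n. incr (ca (\<lambda>x. (g x + h x) / 2)) e) \<le> (\<Sum>e\<in>touch n. (incr (ca g) e + incr (ca h) e) / 2)"
  proof (rule sum_mono)
    fix e :: "'t \<times> 't"
    let ?a = "ca g (fst e) - ca g (snd e)" and ?b = "ca h (fst e) - ca h (snd e)"
    have 2: "(ca g (fst e) + ca h (fst e)) / 2 - (ca g (snd e) + ca h (snd e)) / 2 = (?a + ?b) / 2" by (simp add: field_simps)
    show "incr (ca (\<lambda>x. (g x + h x) / 2)) e \<le> (incr (ca g) e + incr (ca h) e) / 2"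
      unfolding incr_def ca_mid[OF assms] 2 by (rule powr_abs_midpoint_le[OF p1])
  qed
  also have "\<dots> = ((\<Sum>e\<in>touch n. incr (ca g) e) + (\<Sum>e\<in>touch n. incr (ca h) e)) / 2"
    by (simp add: sum.distrib sum_divide_distrib[symmetric])
  finally have "en n (ca (\<lambda>x. (g x + h x) / 2)) \<le> (en n (ca g) + en n (ca h)) / 2" unfolding energy_level by simp
  then have "\<sigma> ^ n * en n (ca (\<lambda>x. (g x + h x) / 2)) \<le> \<sigma> ^ n * ((en n (ca g) + en n (ca h)) / 2)"
    using \<sigma>_pos by (intro mult_left_mono) auto
  then show ?thesis by (simp add: distrib_left add_divide_distrib)
qed

abbreviation "dp f g \<equiv> \<integral>\<^sup>+x. ennreal (\<bar>f x - g x\<bar> powr p) \<partial>m"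

text \<open>
  Each of the three properties is preserved by midpoints, the bounds by convexity of t^p.
\<close>

lemma midhull_props:
  assumes f: "f \<in> Lp" and "midhull F n g"
    and F: "\<And>k. n \<le> k \<Longrightarrow> continuous_on UNIV (F k)" "\<And>k j. n \<le> k \<Longrightarrow> se j (F k) \<le> B"
      "\<And>k. n \<le> k \<Longrightarrow> dp f (F k) \<le> ennreal d"
  shows "continuous_on UNIV g \<and> (\<forall>j. se j g \<le> B) \<and> dp f g \<le> ennreal d"
  using assms(2)
proof (induction rule: midhull.induct)
  case (base k)
  then show ?case using F by blast
next
  case (mid g h)
  have g: "g \<in> Lp" and h: "h \<in> Lp" using mid lp_continuous by auto
  have [measurable]: "f \<in> borel_measurable m" "g \<in> borel_measurable m" "h \<in> borel_measurable m"
    using f g h lp_meas by auto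
  have "dp f (\<lambda>x. (g x + h x) / 2) \<le> (\<integral>\<^sup>+x. ennreal (1 / 2) * (ennreal (\<bar>f x - g x\<bar> powr p) + ennreal (\<bar>f x - h x\<bar> powr p)) \<partial>m)"
  proof (rule nn_integral_mono)
    fix x
    have eq: "f x - (g x + h x) / 2 = ((f x - g x) + (f x - h x)) / 2" by (simp add: field_simps)
    have "\<bar>f x - (g x + h x) / 2\<bar> powr p \<le> (\<bar>f x - g x\<bar> powr p + \<bar>f x - h x\<bar> powr p) / 2"
      unfolding eq by (rule powr_abs_midpoint_le[OF p1])
    then have "ennreal (\<bar>f x - (g x + h x) / 2\<bar> powr p) \<le> ennreal ((1 / 2) * (\<bar>f x - g x\<bar> powr p + \<bar>f x - h x\<bar> powr p))"
      by (intro ennreal_leI) simp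
    also have "\<dots> = ennreal (1 / 2) * ennreal (\<bar>f x - g x\<bar> powr p + \<bar>f x - h x\<bar> powr p)" by (rule ennreal_mult') simp
    also have "ennreal (\<bar>f x - g x\<bar> powr p + \<bar>f x - h x\<bar> powr p) = ennreal (\<bar>f x - g x\<bar> powr p) + ennreal (\<bar>f x - h x\<bar> powr p)"
      by (rule ennreal_plus) auto
    finally show "ennreal (\<bar>f x - (g x + h x) / 2\<bar> powr p) \<le> ennreal (1 / 2) * (ennreal (\<bar>f x - g x\<bar> powr p) + ennreal (\<bar>f x - h x\<bar> powr p))" .
  qed
  also have "\<dots> = ennreal (1 / 2) * (\<integral>\<^sup>+x. ennreal (\<bar>f x - g x\<bar> powr p) + ennreal (\<bar>f x - h x\<bar> powr p) \<partial>m)"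
    by (rule nn_integral_cmult) measurable
  also have "(\<integral>\<^sup>+x. ennreal (\<bar>f x - g x\<bar> powr p) + ennreal (\<bar>f x - h x\<bar> powr p) \<partial>m) = dp f g + dp f h"
    by (rule nn_integral_add) measurable
  also have "ennreal (1 / 2) * (dp f g + dp f h) \<le> ennreal (1 / 2) * (ennreal d + ennreal d)"
    using mid by (intro mult_left_mono add_mono) auto
  also have "\<dots> = ennreal d"
  proof (cases "0 \<le> d")
    case True
    then have "ennreal d + ennreal d = ennreal (2 * d)" by (simp add: ennreal_plus[symmetric] del: ennreal_plus)
    then have "ennreal (1 / 2) * (ennreal d + ennreal d) = ennreal ((1 / 2) * (2 * d))" 
      by (simp only:) (rule ennreal_mult'[symmetric], simp)
    then show ?thesis by simp
  qed (simp add: ennreal_neg)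
  finally have "dp f (\<lambda>x. (g x + h x) / 2) \<le> ennreal d" .
  moreover have "continuous_on UNIV (\<lambda>x. (g x + h x) / 2)" using mid by (intro continuous_intros) auto
  moreover have "se j (\<lambda>x. (g x + h x) / 2) \<le> B" for j
  proof -
    have le: "se j (\<lambda>x. (g x + h x) / 2) \<le> (se j g + se j h) / 2" by (rule se_mid[OF g h])
    have "se j g \<le> B" "se j h \<le> B" using mid by auto
    then have "(se j g + se j h) / 2 \<le> (B + B) / 2" by (intro divide_right_mono add_mono) auto
    with le show ?thesis by simp
  qed
  ultimately show ?case by blast
qed

lemma ca_tendsto:
  assumes f: "f \<in> Lp" and g: "\<And>k. g k \<in> Lp" and lim: "(\<lambda>k. dp f (g k)) \<longlonglongrightarrow> 0"
  shows "(\<lambda>k. ca (g k) w) \<longlonglongrightarrow> ca f w"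
proof -
  have bound: "ennreal (\<bar>ca f w - ca (g k) w\<bar> powr p) \<le> ennreal (1 / \<mu> w) * dp f (g k)" for k
  proof -
    have d: "(\<lambda>x. f x - g k x) \<in> Lp" by (intro lp_diff f g)
    have "ennreal (\<bar>ca f w - ca (g k) w\<bar> powr p * \<mu> w) \<le> (\<integral>\<^sup>+x. ennreal (\<bar>f x - g k x - 0\<bar> powr p) * indicator (K w) x \<partial>m)"
      using ca_jensen_nn[OF d, of w 0] ca_diff[OF f g, of k w] by simp
    also have "\<dots> \<le> dp f (g k)" by (intro nn_integral_mono) (auto simp: indicator_def)
    finally have "ennreal (1 / \<mu> w) * ennreal (\<bar>ca f w - ca (g k) w\<bar> powr p * \<mu> w) \<le> ennreal (1 / \<mu> w) * dp f (g k)"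
      by (intro mult_left_mono) auto
    moreover have "ennreal (1 / \<mu> w) * ennreal (\<bar>ca f w - ca (g k) w\<bar> powr p * \<mu> w) = ennreal (\<bar>ca f w - ca (g k) w\<bar> powr p)"
      using measure_pos[of w] by (simp add: ennreal_mult'[symmetric])
    ultimately show ?thesis by simp
  qed
  have "(\<lambda>k. ennreal (1 / \<mu> w) * dp f (g k)) \<longlonglongrightarrow> ennreal (1 / \<mu> w) * 0"
    by (intro ennreal_tendsto_cmult lim) simp
  then have lim0: "(\<lambda>k. ennreal (1 / \<mu> w) * dp f (g k)) \<longlonglongrightarrow> 0" by simp
  have "(\<lambda>k. ennreal (\<bar>ca f w - ca (g k) w\<bar> powr p)) \<longlonglongrightarrow> 0"
    by (rule tendsto_sandwich[OF _ _ tendsto_const lim0]) (use bound in auto)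
  then have "(\<lambda>k. \<bar>ca f w - ca (g k) w\<bar> powr p) \<longlonglongrightarrow> 0"
    by (simp add: ennreal_0[symmetric] del: ennreal_0)
  then have "(\<lambda>k. (\<bar>ca f w - ca (g k) w\<bar> powr p) powr (1 / p)) \<longlonglongrightarrow> 0 powr (1 / p)"
    using p0 by (intro tendsto_powr') auto
  then have "(\<lambda>k. \<bar>ca f w - ca (g k) w\<bar>) \<longlonglongrightarrow> 0" using p0 by (simp add: powr_powr)
  then have "(\<lambda>k. ca f w - ca (g k) w) \<longlonglongrightarrow> 0" by (rule tendsto_rabs_zero_cancel)
  then have "(\<lambda>k. ca f w - (ca f w - ca (g k) w)) \<longlonglongrightarrow> ca f w - 0" by (intro tendsto_intros)
  then show ?thesis by simp
qed

lemma se_tendsto: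
  assumes f: "f \<in> Lp" and g: "\<And>k. g k \<in> Lp" and h: "h \<in> Lp" and lim: "(\<lambda>k. dp f (g k)) \<longlonglongrightarrow> 0"
  shows "(\<lambda>k. se i (\<lambda>x. h x - g k x)) \<longlonglongrightarrow> se i (\<lambda>x. h x - f x)"
proof -
  have "(\<lambda>k. \<sigma> ^ i * ((\<Sum>e\<in>touch i. \<bar>(ca h (fst e) - ca (g k) (fst e)) - (ca h (snd e) - ca (g k) (snd e))\<bar> powr p) / 2))
     \<longlonglongrightarrow> \<sigma> ^ i * ((\<Sum>e\<in>touch i. \<bar>(ca h (fst e) - ca f (fst e)) - (ca h (snd e) - ca f (snd e))\<bar> powr p) / 2)"
    using p0 by (intro tendsto_intros tendsto_powr' ca_tendsto[OF f g lim]) auto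
  then show ?thesis unfolding energy_level incr_def using ca_diff[OF h g] ca_diff[OF h f] by simp
qed

text \<open>
  The limit superior of the renormalized energies. The convexity inequality compares energies at
  one and the same level, which must be a level where the energy of a midpoint is close to its
  upper bound while those of the two functions do not exceed theirs by much. With the limit
  superior such levels exist, with the supremum they need not.
\<close>

definition up_energy :: "('a \<Rightarrow> real) \<Rightarrow> real" where
  "up_energy g = Inf {e. eventually (\<lambda>j. se j g \<le> e) sequentially}"

lemma up_energy_bdd: "bdd_below {e. eventually (\<lambda>j. se j g \<le> e) sequentially}"
proof (rule bdd_belowI[of _ 0])
  fix e assume "e \<in> {e. eventually (\<lambda>j. se j g \<le> e) sequentially}"
  then have "eventually (\<lambda>j. se j g \<le> e) sequentially" by simp
  then obtain j where "se j g \<le> e" using eventually_happens by fastforce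
  then show "0 \<le> e" using se_nonneg[of j g] by linarith
qed

lemma up_energy_le: "(\<And>j. se j g \<le> B) \<Longrightarrow> up_energy g \<le> B"
  unfolding up_energy_def by (rule cInf_lower[OF _ up_energy_bdd]) auto

lemma up_energy_nonneg: "(\<And>j. se j g \<le> B) \<Longrightarrow> 0 \<le> up_energy g"
  unfolding up_energy_def
proof (rule cInf_greatest)
  assume B: "\<And>j. se j g \<le> B"
  then show "{e. eventually (\<lambda>j. se j g \<le> e) sequentially} \<noteq> {}" by (auto intro!: exI[of _ B])
  fix e assume "e \<in> {e. eventually (\<lambda>j. se j g \<le> e) sequentially}"
  then have "eventually (\<lambda>j. se j g \<le> e) sequentially" by simp
  then obtain j where "se j g \<le> e" using eventually_happens by fastforce
  then show "0 \<le> e" using se_nonneg[of j g] by linarith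
qed

lemma up_energy_eventually:
  assumes "\<And>j. se j g \<le> B" "up_energy g < e"
  shows "eventually (\<lambda>j. se j g \<le> e) sequentially"
proof -
  have "{e. eventually (\<lambda>j. se j g \<le> e) sequentially} \<noteq> {}" using assms(1) by (auto intro!: exI[of _ B])
  then obtain e' where "eventually (\<lambda>j. se j g \<le> e') sequentially" "e' < e"
    using cInf_lessD[of "{e. eventually (\<lambda>j. se j g \<le> e) sequentially}" e] assms(2) unfolding up_energy_def by blast
  then show ?thesis by (auto elim: eventually_mono)
qed

lemma up_energy_frequently:
  assumes "e < up_energy g"
  shows "\<exists>j\<ge>n. e < se j g"
proof (rule ccontr)
  assume "\<not> ?thesis"
  then have "eventually (\<lambda>j. se j g \<le> e) sequentially" by (auto simp: eventually_sequentially not_less)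
  then have "up_energy g \<le> e" unfolding up_energy_def by (intro cInf_lower up_energy_bdd) auto
  with assms show False by simp
qed

text \<open>
  Let \<alpha> n be the infimum of the limit superior energies over the midpoints of F k with k
  \<ge> n. It increases to a limit S. Take n with \<alpha> n close to S, a near minimizer g, and
  near minimizers h k for the indices n + k. Their midpoint has energy at least \<alpha> n, so
  uniform convexity makes the energy of g - h k small at infinitely many levels, hence at all
  levels by weak monotonicity. As h k converges to f in L^p, each discrete energy of g - f is
  small as well.
\<close>

lemma density:
  assumes cut: "cutoffs C0" and f: "f \<in> Lp" and Nf: "Np f < \<infinity>" and \<epsilon>: "0 < \<epsilon>"
  shows "\<exists>g. continuous_on UNIV g \<and> Np g < \<infinity> \<and> dp f g \<le> ennreal \<epsilon> \<and> Np (\<lambda>x. f x - g x) \<le> ennreal \<epsilon>"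
proof -
  obtain M where M: "Np f = ennreal M" "0 \<le> M" using Nf by (cases "Np f") auto
  have seM: "se j f \<le> M" for j by (rule Np_finite_bound[OF M])
  obtain C where C: "0 < C" "\<forall>f\<in>Lp. \<forall>M n. (\<forall>j. se j f \<le> M) \<longrightarrow> 1 \<le> n \<longrightarrow>
    (\<exists>g. continuous_on UNIV g \<and> Np g \<le> ennreal (C * M) \<and> dp f g \<le> ennreal (C * q ^ n * M))"
    using smoothing[OF cut] by blast
  define B where "B = C * M"
  have B0: "0 \<le> B" using C M by (simp add: B_def)
  define d where "d = (\<lambda>n. C * q ^ n * M)"
  have "\<forall>n. \<exists>g. continuous_on UNIV g \<and> Np g \<le> ennreal B \<and> dp f g \<le> ennreal (d (Suc n))"
    unfolding B_def d_def by (intro allI C(2)[rule_format, OF f seM]) simp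
  then obtain F where F: "\<And>n. continuous_on UNIV (F n)" "\<And>n. Np (F n) \<le> ennreal B" "\<And>n. dp f (F n) \<le> ennreal (d (Suc n))" by metis
  have dmono: "d k \<le> d n" if "n \<le> k" for n k
    unfolding d_def using that C M q by (intro mult_right_mono mult_left_mono power_decreasing) auto
  have dlim: "d \<longlonglongrightarrow> 0"
  proof -
    have "(\<lambda>n. C * q ^ n * M) \<longlonglongrightarrow> C * 0 * M" using q by (intro tendsto_intros LIMSEQ_realpow_zero) auto
    then show ?thesis by (simp add: d_def)
  qed
  have hull: "continuous_on UNIV g \<and> (\<forall>j. se j g \<le> B) \<and> dp f g \<le> ennreal (d n)" if "midhull F n g" for n g
  proof (rule midhull_props[OF f that F(1)])
    fix k j assume "n \<le> k"
    have "ennreal (se j (F k)) \<le> Np (F k)" unfolding Np_def by (rule SUP_upper) simp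
    also have "\<dots> \<le> ennreal B" by (rule F(2))
    finally show "se j (F k) \<le> B" using B0 by simp
    have "dp f (F k) \<le> ennreal (d (Suc k))" by (rule F(3))
    also have "\<dots> \<le> ennreal (d n)" using dmono \<open>n \<le> k\<close> by (intro ennreal_leI) simp
    finally show "dp f (F k) \<le> ennreal (d n)" .
  qed
  have hullp: "g \<in> Lp" if "midhull F n g" for n g using hull[OF that] lp_continuous by blast
  define \<alpha> where "\<alpha> = (\<lambda>n. Inf (up_energy ` {g. midhull F n g}))"
  have ne: "{g. midhull F n g} \<noteq> {}" for n using midhull.base[of n n F] by blast
  have bdd: "bdd_below (up_energy ` {g. midhull F n g})" for n
    by (rule bdd_belowI[of _ 0]) (use hull up_energy_nonneg in blast)
  have \<alpha>le: "\<alpha> n \<le> up_energy g" if "midhull F n g" for n g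
    unfolding \<alpha>_def by (rule cInf_lower[OF _ bdd]) (use that in blast)
  have \<alpha>B: "\<alpha> n \<le> B" for n
  proof -
    have mh: "midhull F n (F n)" by (rule midhull.base) simp
    have "up_energy (F n) \<le> B" using hull[OF mh] by (intro up_energy_le) blast
    with \<alpha>le[OF mh] show ?thesis by linarith
  qed
  have \<alpha>mono: "\<alpha> n \<le> \<alpha> k" if "n \<le> k" for n k
  proof -
    have "\<alpha> n \<le> Inf (up_energy ` {g. midhull F k g})"
    proof (rule cInf_greatest)
      show "up_energy ` {g. midhull F k g} \<noteq> {}" using ne by simp
      fix e assume "e \<in> up_energy ` {g. midhull F k g}"
      then obtain g where "midhull F k g" "e = up_energy g" by blast
      then show "\<alpha> n \<le> e" using \<alpha>le[OF midhull_mono[OF _ that]] by blast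
    qed
    then show ?thesis by (simp add: \<alpha>_def)
  qed
  have bddA: "bdd_above (range \<alpha>)" using \<alpha>B by (intro bdd_aboveI[of _ B]) auto
  define S where "S = (SUP n. \<alpha> n)"
  have \<alpha>S: "\<alpha> n \<le> S" for n unfolding S_def by (rule cSUP_upper[OF _ bddA]) simp
  have SB: "S \<le> B" unfolding S_def by (rule cSUP_least) (use \<alpha>B in auto)
  obtain W where W: "0 < W" "\<forall>f\<in>Lp. \<forall>n k. se n f \<le> W * se (n + k) f" using weak_monotone_energy by blast
  \<comment> \<open>The part of the convexity inequality without the midpoint defect contributes W * e1 * (2 * B + 2), at most a quarter of \<epsilon>.\<close>
  define e1 where "e1 = \<epsilon> / (4 * W * (2 * B + 3))"
  have e1: "0 < e1" using \<epsilon> W B0 by (simp add: e1_def)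
  obtain Ce where Ce: "0 \<le> Ce" "\<forall>n u v. en n (\<lambda>w. u w - v w) \<le> e1 * (en n u + en n v)
           + Ce * ((en n u + en n v) / 2 - en n (\<lambda>w. (u w + v w) / 2))"
    using energy_uniformly_convex[OF e1] by blast
  \<comment> \<open>The midpoint defect is at most 3 * \<eta>, so that its contribution W * Ce * 3 * \<eta> stays below half of \<epsilon>.\<close>
  define \<eta> where "\<eta> = min 1 (\<epsilon> / (8 * W * (Ce + 1)))"
  have \<eta>: "0 < \<eta>" "\<eta> \<le> 1" "\<eta> \<le> \<epsilon> / (8 * W * (Ce + 1))" using \<epsilon> W Ce by (auto simp: \<eta>_def)
  have "S - \<eta> < S" using \<eta> by simp
  then obtain n0 where n0: "S - \<eta> < \<alpha> n0" unfolding S_def using less_cSUP_iff[OF UNIV_not_empty bddA] by blast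
  have "eventually (\<lambda>n. d n < \<epsilon>) sequentially" using order_tendstoD(2)[OF dlim \<epsilon>] .
  then obtain n1 where n1: "\<And>n. n1 \<le> n \<Longrightarrow> d n < \<epsilon>" by (auto simp: eventually_sequentially)
  define n where "n = max n0 n1"
  have n: "S - \<eta> < \<alpha> n" "d n < \<epsilon>" using n0 \<alpha>mono[of n0 n] n1[of n] by (auto simp: n_def)
  have near: "\<exists>g. midhull F k g \<and> up_energy g < \<alpha> k + \<eta>" for k
  proof -
    have "Inf (up_energy ` {g. midhull F k g}) < \<alpha> k + \<eta>" using \<eta> by (simp add: \<alpha>_def)
    from cInf_lessD[OF _ this] ne show ?thesis by blast
  qed
  then obtain g where g: "midhull F n g" "up_energy g < \<alpha> n + \<eta>" by blast
  have "\<forall>k. \<exists>h. midhull F (n + k) h \<and> up_energy h < \<alpha> (n + k) + \<eta>" using near by blast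
  then obtain h where h: "\<And>k. midhull F (n + k) (h k)" "\<And>k. up_energy (h k) < \<alpha> (n + k) + \<eta>" by metis
  have key: "se i (\<lambda>x. g x - h k x) \<le> \<epsilon>" for i k
  proof -
    have hk: "midhull F n (h k)" using midhull_mono[OF h(1)[of k]] by simp
    let ?m = "\<lambda>x. (g x + h k x) / 2"
    have mm: "midhull F n ?m" by (rule midhull.mid[OF g(1) hk])
    have gp: "g \<in> Lp" and hp: "h k \<in> Lp" using hullp g(1) hk by auto
    have Bg: "\<And>j. se j g \<le> B" and Bh: "\<And>j. se j (h k) \<le> B" using hull[OF g(1)] hull[OF hk] by auto
    have "up_energy g < S + \<eta>" using g(2) \<alpha>S[of n] by linarith
    then have ev1: "eventually (\<lambda>j. se j g \<le> S + \<eta>) sequentially" by (rule up_energy_eventually[OF Bg])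
    have "up_energy (h k) < S + \<eta>" using h(2)[of k] \<alpha>S[of "n + k"] by linarith
    then have ev2: "eventually (\<lambda>j. se j (h k) \<le> S + \<eta>) sequentially" by (rule up_energy_eventually[OF Bh])
    obtain j0 where j0: "\<And>j. j0 \<le> j \<Longrightarrow> se j g \<le> S + \<eta> \<and> se j (h k) \<le> S + \<eta>"
      using eventually_conj[OF ev1 ev2] by (auto simp: eventually_sequentially)
    have "S - 2 * \<eta> < up_energy ?m" using \<alpha>le[OF mm] n(1) \<eta> by linarith
    then obtain j where j: "max i j0 \<le> j" "S - 2 * \<eta> < se j ?m" using up_energy_frequently by blast
    have "se j (\<lambda>x. g x - h k x) \<le> e1 * (se j g + se j (h k)) + Ce * ((se j g + se j (h k)) / 2 - se j ?m)"
    proof -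
      have "en j (ca (\<lambda>x. g x - h k x)) \<le> e1 * (en j (ca g) + en j (ca (h k))) + Ce * ((en j (ca g) + en j (ca (h k))) / 2 - en j (ca ?m))"
      proof -
        have 1: "ca (\<lambda>x. g x - h k x) = (\<lambda>w. ca g w - ca (h k) w)" by (rule ext) (rule ca_diff[OF gp hp])
        have 2: "ca ?m = (\<lambda>w. (ca g w + ca (h k) w) / 2)" by (rule ext) (rule ca_mid[OF gp hp])
        show ?thesis unfolding 1 2 by (rule Ce(2)[rule_format])
      qed
      then have "\<sigma> ^ j * en j (ca (\<lambda>x. g x - h k x)) \<le> \<sigma> ^ j * (e1 * (en j (ca g) + en j (ca (h k))) + Ce * ((en j (ca g) + en j (ca (h k))) / 2 - en j (ca ?m)))"
        using \<sigma>_pos by (intro mult_left_mono) auto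
      also have "\<dots> = e1 * (se j g + se j (h k)) + Ce * ((se j g + se j (h k)) / 2 - se j ?m)"
        by (simp add: algebra_simps add_divide_distrib)
      finally show ?thesis .
    qed
    also have "\<dots> \<le> e1 * (2 * B + 2) + Ce * (3 * \<eta>)"
    proof (rule add_mono[OF mult_left_mono mult_left_mono])
      have jj: "se j g \<le> S + \<eta>" "se j (h k) \<le> S + \<eta>" using j0[of j] j(1) by auto
      show "se j g + se j (h k) \<le> 2 * B + 2" using jj SB \<eta> by linarith
      have "(a + b) / 2 - c \<le> 3 * \<eta>" if "a \<le> S + \<eta>" "b \<le> S + \<eta>" "S - 2 * \<eta> < c" for a b c :: real
        using that by (simp add: field_simps)
      from this[OF jj j(2)] show "(se j g + se j (h k)) / 2 - se j ?m \<le> 3 * \<eta>" .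
    qed (use e1 Ce in auto)
    finally have le: "se j (\<lambda>x. g x - h k x) \<le> e1 * (2 * B + 2) + Ce * (3 * \<eta>)" .
    have "se i (\<lambda>x. g x - h k x) \<le> W * se (i + (j - i)) (\<lambda>x. g x - h k x)"
      using W(2) lp_diff[OF gp hp] by blast
    also have "i + (j - i) = j" using j(1) by simp
    also have "W * se j (\<lambda>x. g x - h k x) \<le> W * (e1 * (2 * B + 2) + Ce * (3 * \<eta>))" using le W by (intro mult_left_mono) auto
    also have "\<dots> \<le> \<epsilon>"
    proof -
      have "e1 * (2 * B + 2) \<le> e1 * (2 * B + 3)" using e1 by (intro mult_left_mono) auto
      also have "\<dots> = \<epsilon> / (4 * W)"
      proof -
        have "2 * B + 3 \<noteq> 0" using B0 by linarith
        then show ?thesis using W by (simp add: e1_def)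
      qed
      finally have 1: "W * (e1 * (2 * B + 2)) \<le> \<epsilon> / 4" using W by (simp add: field_simps)
      have "Ce * \<eta> \<le> (Ce + 1) * (\<epsilon> / (8 * W * (Ce + 1)))" using Ce \<eta> by (intro mult_mono) auto
      also have "\<dots> = \<epsilon> / (8 * W)"
      proof -
        have "Z * (\<epsilon> / (8 * W * Z)) = \<epsilon> / (8 * W)" if "0 < Z" for Z using that by simp
        from this[of "Ce + 1"] Ce(1) show ?thesis by simp
      qed
      finally have 2: "W * (Ce * \<eta>) \<le> \<epsilon> / 8" using W by (simp add: field_simps)
      have "W * (e1 * (2 * B + 2) + Ce * (3 * \<eta>)) = W * (e1 * (2 * B + 2)) + 3 * (W * (Ce * \<eta>))" by (simp add: algebra_simps)
      with 1 2 \<epsilon> show ?thesis by linarith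
    qed
    finally show ?thesis .
  qed
  have hl: "h k \<in> Lp" for k using hullp h(1) by blast
  have gl: "g \<in> Lp" using hullp g(1) by blast
  have lim: "(\<lambda>k. dp f (h k)) \<longlonglongrightarrow> 0"
  proof (rule tendsto_sandwich[OF _ _ tendsto_const])
    have "(\<lambda>k. d (n + k)) \<longlonglongrightarrow> 0" using LIMSEQ_ignore_initial_segment[OF dlim, of n] by (simp add: add.commute)
    then show "(\<lambda>k. ennreal (d (n + k))) \<longlonglongrightarrow> 0" using tendsto_ennrealI by fastforce
    show "eventually (\<lambda>k. dp f (h k) \<le> ennreal (d (n + k))) sequentially" using hull[OF h(1)] by auto
  qed simp
  have final: "se i (\<lambda>x. f x - g x) \<le> \<epsilon>" for i
  proof -
    have "(\<lambda>k. se i (\<lambda>x. g x - h k x)) \<longlonglongrightarrow> se i (\<lambda>x. g x - f x)"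
      by (rule se_tendsto[OF f hl gl lim])
    then have "se i (\<lambda>x. g x - f x) \<le> \<epsilon>" by (rule LIMSEQ_le_const2) (use key in auto)
    moreover have "en i (ca (\<lambda>x. g x - f x)) = en i (ca (\<lambda>x. f x - g x))"
    proof -
      have neg: "ca (\<lambda>x. g x - f x) w = - ca (\<lambda>x. f x - g x) w" for w
        by (simp add: ca_diff gl f)
      show ?thesis unfolding energy_level incr_def neg by (simp add: abs_minus_commute)
    qed
    ultimately show ?thesis by simp
  qed
  have "Np (\<lambda>x. f x - g x) \<le> ennreal \<epsilon>" unfolding Np_def by (intro SUP_least ennreal_leI final)
  moreover have "Np g < \<infinity>"
  proof -
    have "Np g \<le> ennreal B" unfolding Np_def using hull[OF g(1)] by (intro SUP_least ennreal_leI) blast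
    then show ?thesis by (rule le_less_trans) simp
  qed
  moreover have "dp f g \<le> ennreal \<epsilon>"
    using hull[OF g(1)] n(2) by (meson ennreal_leI less_imp_le order.trans)
  ultimately show ?thesis using hull[OF g(1)] by blast
qed

section \<open>The characterization\<close>

abbreviation "Sob \<equiv> sobolev_space E root K m Mst p"
abbreviation "Sob_seminorm \<equiv> sobolev_seminorm E root K m Mst p"

lemma sobolev_iff: "f \<in> Sob \<longleftrightarrow> f \<in> Lp \<and> Np f < \<infinity>"
  unfolding sobolev_space_def sobolev_seminorm_def Np_def mem_Collect_eq epowr_less_top_iff ..

text \<open>
  The cutoff at radius 1/8 is 1 at its centre and 0 at a point at distance at least 1/4, which
  exists because the diameter is 1.
\<close>

lemma nonconstant_cutoff:
  assumes "cutoffs C0"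
  shows "\<exists>h\<in>Lp. Np h < \<infinity> \<and> \<not> (\<exists>c. AE x in m. h x = c)"
proof -
  fix x :: 'a
  have "(0::real) < 1 / 8" "(1 / 8 :: real) \<le> 1" by auto
  then obtain h where h: "continuous_on UNIV h" "\<forall>y\<in>ball x (1 / 8). h y = 1"
      "\<forall>y. y \<notin> ball x (2 * (1 / 8)) \<longrightarrow> h y = 0" "Np h \<le> ennreal (C0 * (1 / 8) powr (Q - dw))"
    using assms unfolding cutoffs_def by blast
  have "\<exists>y. y \<notin> ball x (1 / 4)"
  proof (rule ccontr)
    assume "\<not> ?thesis"
    then have d: "dist x y < 1 / 4" for y by auto
    obtain y z :: 'a where yz: "dist y z = diameter (UNIV :: 'a set)"
      using diameter_compact_attained[OF compact_UNIV] by auto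
    have "dist y z \<le> 1 / 2" using dist_triangle3[of y z x] d[of y] d[of z] by linarith
    with yz diam1 show False by simp
  qed
  then obtain y where y: "y \<notin> ball x (1 / 4)" by blast
  have "\<not> (\<exists>c. AE x in m. h x = c)"
  proof
    assume "\<exists>c. AE x in m. h x = c"
    then obtain c where "h z = c" for z using AE_const_continuous[OF h(1)] by blast
    moreover have "h x = 1" "h y = 0" using h(2,3) y by auto
    ultimately show False by simp
  qed
  moreover have "Np h < \<infinity>" using h(4) by (rule le_less_trans) simp
  ultimately show ?thesis using lp_continuous[OF h(1)] by blast
qed

lemma kernel_Sup_finite: "f \<in> Lp \<Longrightarrow> Np f < \<infinity> \<longleftrightarrow> (SUP r\<in>{0<..}. Jc r f) < \<infinity>"
proof -
  assume f: "f \<in> Lp"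
  obtain C1 where C1: "0 < C1" "\<forall>f\<in>Lp. \<forall>r>0. Jc r f \<le> ennreal C1 * Np f" using kernel_le_Np by blast
  obtain C2 where C2: "0 < C2" "\<forall>f\<in>Lp. Np f \<le> ennreal C2 * Liminf (at_right 0) (\<lambda>r. Jc r f)"
    using Np_le_Liminf by blast
  show ?thesis
  proof
    assume "Np f < \<infinity>"
    then have "ennreal C1 * Np f < \<infinity>" by (simp add: ennreal_mult_less_top)
    moreover have "(SUP r\<in>{0<..}. Jc r f) \<le> ennreal C1 * Np f" using C1 f by (intro SUP_least) auto
    ultimately show "(SUP r\<in>{0<..}. Jc r f) < \<infinity>" by (rule le_less_trans[rotated])
  next
    assume fin: "(SUP r\<in>{0<..}. Jc r f) < \<infinity>"
    have "Liminf (at_right 0) (\<lambda>r. Jc r f) \<le> Limsup (at_right 0) (\<lambda>r. Jc r f)" by (rule Liminf_le_Limsup) simp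
    also have "\<dots> \<le> (SUP r\<in>{0<..}. Jc r f)"
      by (intro Limsup_bounded eventually_mono[OF eventually_at_right_less] SUP_upper) auto
    finally have "ennreal C2 * Liminf (at_right 0) (\<lambda>r. Jc r f) < \<infinity>"
      using fin by (auto simp: ennreal_mult_less_top intro: le_less_trans)
    then show "Np f < \<infinity>" using C2(2) f le_less_trans by blast
  qed
qed

lemma besov_iff: "f \<in> besov_space m p (ks_kernel m p (dw / p)) \<longleftrightarrow> f \<in> Lp \<and> Np f < \<infinity>"
  using kernel_Sup_finite[of f] by (auto simp: besov_space_def)

text \<open>
  At the exponent dw / p itself there is a nonconstant function, so the supremum is attained.
\<close>

lemma ks_exponent_eq:
  assumes "cutoffs C0"
  shows "ks_exponent m p = ereal (dw / p)"
  unfolding ks_exponent_def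
proof (rule antisym)
  show "(SUP s\<in>{s. 0 < s \<and> (\<exists>f\<in>besov_space m p (ks_kernel m p s). \<not> (\<exists>c. AE x in m. f x = c))}. ereal s) \<le> ereal (dw / p)"
  proof (rule SUP_least)
    fix s assume "s \<in> {s. 0 < s \<and> (\<exists>f\<in>besov_space m p (ks_kernel m p s). \<not> (\<exists>c. AE x in m. f x = c))}"
    then obtain f where "f \<in> besov_space m p (ks_kernel m p s)" "\<not> (\<exists>c. AE x in m. f x = c)" by blast
    then have "\<not> dw / p < s" using besov_supercritical by blast
    then show "ereal s \<le> ereal (dw / p)" by simp
  qed
  show "ereal (dw / p) \<le> (SUP s\<in>{s. 0 < s \<and> (\<exists>f\<in>besov_space m p (ks_kernel m p s). \<not> (\<exists>c. AE x in m. f x = c))}. ereal s)"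
  proof (rule SUP_upper)
    show "dw / p \<in> {s. 0 < s \<and> (\<exists>f\<in>besov_space m p (ks_kernel m p s). \<not> (\<exists>c. AE x in m. f x = c))}"
      using nonconstant_cutoff[OF assms] besov_iff dw_pos p0 by auto
  qed
qed

text \<open>
  The factor 2 replaces the infimum by the energy of an actual function; since s powr (Q - dw) >
  0, the inequality becomes strict.
\<close>

lemma cutoffs_from_capacities:
  assumes "0 < C0" and cap: "\<forall>x. \<forall>s. 0 < s \<and> s \<le> 1 \<longrightarrow>
           (INF f \<in> {f \<in> Sob. continuous_on UNIV f \<and> (\<forall>y\<in>ball x s. f y = 1) \<and>
                       closure {y. f y \<noteq> 0} \<subseteq> ball x (2 * s)}. epowr (Sob_seminorm f) p)
             \<le> ennreal (C0 * s powr (Q - dw))"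
  shows "cutoffs (2 * C0)"
  unfolding cutoffs_def
proof (intro conjI allI impI)
  show "0 < 2 * C0" using assms by simp
  fix x :: 'a and s :: real assume s: "0 < s" "s \<le> 1"
  have "C0 * s powr (Q - dw) < 2 * C0 * s powr (Q - dw)" using assms(1) s by simp
  then have lt: "ennreal (C0 * s powr (Q - dw)) < ennreal (2 * C0 * s powr (Q - dw))"
    using assms(1) by (intro ennreal_lessI) auto
  have "(INF f \<in> {f \<in> Sob. continuous_on UNIV f \<and> (\<forall>y\<in>ball x s. f y = 1) \<and>
                       closure {y. f y \<noteq> 0} \<subseteq> ball x (2 * s)}. epowr (Sob_seminorm f) p) < ennreal (2 * C0 * s powr (Q - dw))"
    using cap s lt le_less_trans by blast
  then obtain h where h: "continuous_on UNIV h" "\<forall>y\<in>ball x s. h y = 1" "closure {y. h y \<noteq> 0} \<subseteq> ball x (2 * s)"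
    "epowr (Sob_seminorm h) p < ennreal (2 * C0 * s powr (Q - dw))"
    unfolding INF_less_iff by blast
  have "h y = 0" if "y \<notin> ball x (2 * s)" for y
    using h(3) that closure_subset[of "{y. h y \<noteq> 0}"] by blast
  then show "\<exists>h. continuous_on UNIV h \<and> (\<forall>y\<in>ball x s. h y = 1) \<and>
      (\<forall>y. y \<notin> ball x (2 * s) \<longrightarrow> h y = 0) \<and> Np h \<le> ennreal (2 * C0 * s powr (Q - dw))"
    using h by (intro exI[of _ h]) (auto simp: Np_eq less_imp_le)
qed

lemma sobolev_norm_less:
  assumes "f \<in> Lp" "0 < \<epsilon>" "dp f g \<le> ennreal (\<epsilon> powr p / 4)" "Np (\<lambda>x. f x - g x) \<le> ennreal (\<epsilon> powr p / 4)"
  shows "sobolev_norm E root K m Mst p (\<lambda>x. f x - g x) < ennreal \<epsilon>"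
proof -
  have e: "0 < \<epsilon> powr p" using assms(2) by simp
  have "dp f g + Np (\<lambda>x. f x - g x) \<le> ennreal (\<epsilon> powr p / 4) + ennreal (\<epsilon> powr p / 4)" by (intro add_mono assms)
  also have "\<dots> = ennreal (\<epsilon> powr p / 2)" by (simp add: ennreal_plus[symmetric] del: ennreal_plus)
  also have "\<dots> < ennreal (\<epsilon> powr p)" using e by (intro ennreal_lessI) auto
  finally have "epowr (dp f g + Np (\<lambda>x. f x - g x)) (1 / p) < ennreal \<epsilon>" by (rule epowr_less[OF p0 assms(2)])
  then show ?thesis unfolding sobolev_norm_def Np_eq lp_norm_def epowr_epowr_inverse[OF p0] .
qed

text \<open>
  Everything rests on the two bounds sup J \<le> C1 N and N \<le> C2 liminf J: composing them
  gives weak monotonicity, and their finiteness parts identify the two spaces.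
\<close>

theorem characterization:
  assumes cut: "cutoffs C0"
  shows "ks_exponent m p = ereal (dw / p) \<and>
         Sob = ks_space m p \<and>
         (\<forall>f\<in>Sob. \<forall>\<epsilon>>0. \<exists>g\<in>Sob. continuous_on UNIV g \<and>
            sobolev_norm E root K m Mst p (\<lambda>x. f x - g x) < ennreal \<epsilon>) \<and>
         weak_monotonicity m p (critical_kernel m p) \<and>
         (\<exists>C::real. C \<ge> 1 \<and> (\<forall>f\<in>lp_space m p.
            ennreal (1 / C) * (SUP r\<in>{0<..}. kernel_energy m p (critical_kernel m p) r f) \<le> epowr (Sob_seminorm f) p \<and>
            epowr (Sob_seminorm f) p \<le> ennreal C * Liminf (at_right 0) (\<lambda>r. kernel_energy m p (critical_kernel m p) r f)))"
proof -
  have ex: "ks_exponent m p = ereal (dw / p)" by (rule ks_exponent_eq[OF cut])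
  have ck: "critical_kernel m p = ks_kernel m p (dw / p)" by (simp add: critical_kernel_def ex)
  obtain C1 where C1: "0 < C1" "\<forall>f\<in>Lp. \<forall>r>0. Jc r f \<le> ennreal C1 * Np f" using kernel_le_Np by blast
  obtain C2 where C2: "0 < C2" "\<forall>f\<in>Lp. Np f \<le> ennreal C2 * Liminf (at_right 0) (\<lambda>r. Jc r f)"
    using Np_le_Liminf by blast
  have sup_le: "(SUP r\<in>{0<..}. Jc r f) \<le> ennreal C1 * Np f" if "f \<in> Lp" for f
    using C1 that by (intro SUP_least) auto
  have dens: "\<exists>g\<in>Sob. continuous_on UNIV g \<and> sobolev_norm E root K m Mst p (\<lambda>x. f x - g x) < ennreal \<epsilon>"
    if f: "f \<in> Sob" and \<epsilon>: "0 < \<epsilon>" for f \<epsilon>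
  proof -
    have fp: "f \<in> Lp" "Np f < \<infinity>" using f by (auto simp: sobolev_iff)
    have "0 < \<epsilon> powr p / 4" using \<epsilon> by simp
    from density[OF cut fp this] obtain g where g: "continuous_on UNIV g" "Np g < \<infinity>" "dp f g \<le> ennreal (\<epsilon> powr p / 4)"
      "Np (\<lambda>x. f x - g x) \<le> ennreal (\<epsilon> powr p / 4)" by blast
    then show ?thesis using sobolev_norm_less[OF fp(1) \<epsilon> g(3,4)] lp_continuous by (intro bexI[of _ g]) (auto simp: sobolev_iff)
  qed
  have sp: "Sob = ks_space m p"
    unfolding ks_space_def ck using sobolev_iff besov_iff by blast
  have wm: "weak_monotonicity m p (critical_kernel m p)"
    unfolding weak_monotonicity_def ck
  proof (intro exI[of _ "max 1 (C1 * C2)"] conjI ballI)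
    fix f assume "f \<in> besov_space m p (ks_kernel m p (dw / p))"
    then have f: "f \<in> Lp" by (simp add: besov_iff)
    have "(SUP r\<in>{0<..}. Jc r f) \<le> ennreal C1 * Np f" by (rule sup_le[OF f])
    also have "\<dots> \<le> ennreal C1 * (ennreal C2 * Liminf (at_right 0) (\<lambda>r. Jc r f))"
      using C2(2) f by (intro mult_left_mono) auto
    also have "\<dots> = ennreal (C1 * C2) * Liminf (at_right 0) (\<lambda>r. Jc r f)" using C1 by (simp add: ennreal_mult' mult.assoc)
    also have "\<dots> \<le> ennreal (max 1 (C1 * C2)) * Liminf (at_right 0) (\<lambda>r. Jc r f)"
      by (intro mult_right_mono ennreal_leI) auto
    finally show "(SUP r\<in>{0<..}. Jc r f) \<le> ennreal (max 1 (C1 * C2)) * Liminf (at_right 0) (\<lambda>r. Jc r f)" .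
  qed simp
  have comp: "\<exists>C::real. C \<ge> 1 \<and> (\<forall>f\<in>Lp. ennreal (1 / C) * (SUP r\<in>{0<..}. Jc r f) \<le> Np f \<and>
            Np f \<le> ennreal C * Liminf (at_right 0) (\<lambda>r. Jc r f))"
  proof (intro exI[of _ "max 1 (max C1 C2)"] conjI ballI)
    let ?C = "max 1 (max C1 C2)"
    fix f assume f: "f \<in> Lp"
    have "ennreal (1 / ?C) * (SUP r\<in>{0<..}. Jc r f) \<le> ennreal (1 / ?C) * (ennreal C1 * Np f)"
      by (intro mult_left_mono sup_le f) simp
    also have "\<dots> = ennreal (1 / ?C * C1) * Np f" by (simp add: ennreal_mult'[symmetric] mult.assoc[symmetric])
    also have "\<dots> \<le> ennreal 1 * Np f"
    proof (intro mult_right_mono ennreal_leI)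
      have "C1 \<le> ?C" "0 < ?C" by auto
      then show "1 / ?C * C1 \<le> 1" by (simp only: times_divide_eq_left mult_1_left divide_le_eq_1_pos)
    qed simp
    finally show "ennreal (1 / ?C) * (SUP r\<in>{0<..}. Jc r f) \<le> Np f" by simp
    have "Np f \<le> ennreal C2 * Liminf (at_right 0) (\<lambda>r. Jc r f)" using C2(2) f by blast
    also have "\<dots> \<le> ennreal ?C * Liminf (at_right 0) (\<lambda>r. Jc r f)" by (intro mult_right_mono ennreal_leI) auto
    finally show "Np f \<le> ennreal ?C * Liminf (at_right 0) (\<lambda>r. Jc r f)" .
  qed simp
  show ?thesis
    using ex sp dens wm comp unfolding Np_eq ck by blast
qed

end

theorem theorem5p26:
  fixes E :: "'t set set" and root :: 't and K :: "'t \<Rightarrow> 'a::metric_space set"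
    and m :: "'a measure" and Mst :: nat and rst p :: real
  defines "W \<equiv> sobolev_space E root K m Mst p"
    and "N \<equiv> sobolev_seminorm E root K m Mst p"
    and "df \<equiv> real_of_ereal (hausdorff_dim (UNIV :: 'a set))"
    and "dw \<equiv> walk_dim E root K m Mst rst p"
    and "k \<equiv> critical_kernel m p"
  assumes "1 < p"
    and "basic_framework E root K m Mst rst"
    and "ahlfors_regular m"
    and "conductively_homogeneous E root K m Mst p"
    and "\<exists>C0>0. \<forall>x. \<forall>s. 0 < s \<and> s \<le> 1 \<longrightarrow>
           (INF f \<in> {f \<in> W. continuous_on UNIV f \<and> (\<forall>y\<in>ball x s. f y = 1) \<and>
                       closure {y. f y \<noteq> 0} \<subseteq> ball x (2 * s)}. epowr (N f) p)
             \<le> ennreal (C0 * s powr (df - dw))"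
  shows "ks_exponent m p = ereal (dw / p) \<and>
         W = ks_space m p \<and>
         (\<forall>f\<in>W. \<forall>\<epsilon>>0. \<exists>g\<in>W. continuous_on UNIV g \<and>
            sobolev_norm E root K m Mst p (\<lambda>x. f x - g x) < ennreal \<epsilon>) \<and>
         weak_monotonicity m p k \<and>
         (\<exists>C::real. C \<ge> 1 \<and> (\<forall>f\<in>lp_space m p.
            ennreal (1 / C) * (SUP r\<in>{0<..}. kernel_energy m p k r f) \<le> epowr (N f) p \<and>
            epowr (N f) p \<le> ennreal C * Liminf (at_right 0) (\<lambda>r. kernel_energy m p k r f)))"
proof -
  note bf = assms(7)[unfolded basic_framework_def]
  have part: "is_partition E root K" and diam: "diameter (UNIV :: 'a set) = 1"
    and prob: "prob_space m" and sets: "sets m = sets borel" and rst: "0 < rst" "rst < 1"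
    and conn: "\<forall>w. connected (K w)" and unif: "uniformly_finite E root K"
    and kids: "\<forall>w. 2 \<le> card (children E root w)"
    and add: "\<forall>w. measure m (K w) = (\<Sum>v\<in>children E root w. measure m (K v))"
    and par: "\<forall>w. parent E root ` cell_nbhd E root K (Mst + 1) w \<subseteq> cell_nbhd E root K Mst (parent E root w)"
    using bf by - (elim conjE, assumption)+
  obtain c1 c2 c3 c4 c5 :: real where c: "0 < c2" "0 < c3" "0 < c5"
    and geo: "\<forall>w. c1 * rst ^ height E root w \<le> diameter (K w) \<and> diameter (K w) \<le> c2 * rst ^ height E root w"
      "\<forall>n\<ge>1. \<forall>x. ball x (c3 * rst ^ n) \<subseteq> point_nbhd E root K Mst x n \<and>
                    point_nbhd E root K Mst x n \<subseteq> ball x (c4 * rst ^ n)"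
      "\<forall>n\<ge>1. \<forall>w\<in>level E root n. \<exists>x\<in>K w. ball x (c5 * rst ^ n) \<subseteq> K w"
    using bf by (elim conjE exE) (rule that; assumption)
  obtain \<gamma> :: real where \<gamma>: "0 < \<gamma>" "\<forall>w. measure m (K w) \<ge> \<gamma> * measure m (K (parent E root w))"
    using bf by (elim conjE exE) (rule that; assumption)
  obtain N0 where N0: "\<forall>w. finite (cell_nbhd E root K 1 w) \<and> card (cell_nbhd E root K 1 w) \<le> N0"
    using unif unfolding uniformly_finite_def by (rule exE)
  have tr: "is_tree E" and cells: "\<forall>w. compact (K w) \<and> K w \<noteq> {}" and Kr: "K root = UNIV"
    and Kc: "\<forall>w. (\<exists>x\<in>K w. \<exists>y\<in>K w. x \<noteq> y) \<and> K w = (\<Union>v\<in>children E root w. K v)"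
    using part unfolding is_partition_def infinite_tree_def by - (elim conjE, assumption)+
  obtain Q CA where Q: "0 < Q" "1 \<le> CA" and ah: "\<And>x s. 0 < s \<and> s < 2 * diameter (UNIV :: 'a set) \<Longrightarrow>
        s powr Q / CA \<le> measure m (ball x s) \<and> measure m (ball x s) \<le> CA * s powr Q"
    using assms(8) unfolding ahlfors_regular_def by blast
  interpret framework E root K m p \<gamma> N0 Mst rst Q CA c2 c3 c5
  proof (intro framework.intro cell_partition.intro rooted_tree.intro
      cell_partition_axioms.intro framework_axioms.intro)
    show "compact (K w)" "K w \<noteq> {}" for w using cells by auto
    show "K w = (\<Union>v\<in>children E root w. K v)" for w using Kc[THEN spec, of w] by (rule conjunct2)
    show "connected (K w)" "2 \<le> card (children E root w)"
      "measure m (K w) = (\<Sum>v\<in>children E root w. measure m (K v))"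
      "parent E root ` cell_nbhd E root K (Mst + 1) w \<subseteq> cell_nbhd E root K Mst (parent E root w)"
      "finite (cell_nbhd E root K 1 w) \<and> card (cell_nbhd E root K 1 w) \<le> N0"
      "\<gamma> * measure m (K (parent E root w)) \<le> measure m (K w)" for w
      by (rule conn[THEN spec] kids[THEN spec] add[THEN spec] par[THEN spec] N0[THEN spec] \<gamma>(2)[THEN spec])+
    show "diameter (K w) \<le> c2 * rst ^ height E root w" for w using geo(1) by blast
    show "ball x (c3 * rst ^ n) \<subseteq> point_nbhd E root K Mst x n" if "1 \<le> n" for n x using geo(2) that by blast
    show "\<exists>x\<in>K w. ball x (c5 * rst ^ n) \<subseteq> K w" if "1 \<le> n" "w \<in> level E root n" for n w using geo(3) that by blast
    show "s powr Q / CA \<le> measure m (ball x s) \<and> measure m (ball x s) \<le> CA * s powr Q" if "0 < s" "s < 2" for x s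
      using ah[of s x] that diam by simp
  qed (fact tr Kr prob sets rst assms(6) assms(9) diam c \<gamma>(1) Q)+
  have df: "df = Q" unfolding assms(3) by (simp add: hausdorff_dim_eq)
  obtain C0 where C0: "0 < C0" "\<forall>x. \<forall>s. 0 < s \<and> s \<le> 1 \<longrightarrow>
           (INF f \<in> {f \<in> sobolev_space E root K m Mst p. continuous_on UNIV f \<and> (\<forall>y\<in>ball x s. f y = 1) \<and>
                       closure {y. f y \<noteq> 0} \<subseteq> ball x (2 * s)}. epowr (sobolev_seminorm E root K m Mst p f) p)
             \<le> ennreal (C0 * s powr (Q - walk_dim E root K m Mst rst p))"
    using assms(10) unfolding df unfolding assms(1,2,4) by blast
  from characterization[OF cutoffs_from_capacities[OF C0]] show ?thesis
    unfolding assms(1,2,4,5) .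
qed

end
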